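(* Let $d\ge 3$, let $V\in RH_s$ with $s\ge d/2$, and let $\rho$ be the critical radius function of $V$. Let $0<\alpha<d$, $1<p<d/\alpha$, $1/q=1/p-\alpha/d$, $w\in A^{\rho,\infty}_{p,q}$ and $\kappa=p/q$. Then the $\mathcal L$-fractional integral operator $\mathcal I_\alpha=\mathcal L^{-\alpha/2}$ is bounded from $L^{p,\kappa}_{\rho,\infty}(w^p,w^q)$ into $\mathrm{BMO}_{\rho,\infty}(\mathbb R^d)$; that is, for every $\theta>0$ there exist $\vartheta>0$ and $C>0$ such that for all $f\in L^{p,\kappa}_{\rho,\theta}(w^p,w^q)$, $$\|\mathcal I_\alpha f\|_{\mathrm{BMO}_{\rho,\vartheta}}\le C\,\|f\|_{L^{p,\kappa}_{\rho,\theta}(w^p,w^q)}.$$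
   Context: Potential. $V:\mathbb R^d\to\mathbb R$ is nonnegative, locally integrable and not identically zero. $V\in RH_s$ ($1<s<\infty$) means there is $C>0$ with $\left(\frac1{|B|}\int_B V^s\right)^{1/s}\le C\,\frac1{|B|}\int_B V$ for every ball $B\subset\mathbb R^d$. The critical radius function is $\rho(x)=\sup\{r>0:\ r^{2-d}\int_{B(x,r)}V(y)\,dy\le 1\}$, where $B(x,r)$ is the open ball with center $x$ and radius $r$; if $d\ge 3$ and $V$ is nonnegative, locally integrable, not identically zero and belongs to $RH_s$ with $s\ge d/2$, one has $0<\rho(x)<\infty$ for all $x$. Operator. $\mathcal L=-\Delta+V$ is the Schrödinger operator on $\mathbb R^d$, $p_t(x,y)$ ($t>0$) is the integral kernel of the semigroup $e^{-t\mathcal L}$, $\mathcal K_\alpha(x,y)=\int_0^\infty p_t(x,y)\,t^{\alpha/2-1}\,dt$, and $\mathcal I_\alpha f(x)=\mathcal L^{-\alpha/2}f(x)=\int_0^\infty e^{-t\mathcal L}f(x)\,t^{\alpha/2-1}dt=\int_{\mathbb R^d}\mathcal K_\alpha(x,y)f(y)\,dy$ (this is the definition; no normalizing constant is used). BMO-type space. For $0<\theta<\infty$, $\mathrm{BMO}_{\rho,\theta}(\mathbb R^d)$ is the set of locally integrable $b$ with $$\|b\|_{\mathrm{BMO}_{\rho,\theta}}=\sup_{B=B(x_0,r)}\Big(1+\frac r{\rho(x_0)}\Big)^{-\theta}\frac1{|B|}\int_B|b(x)-b_B|\,dx<\infty,\qquad b_B=\frac1{|B|}\int_B b\,dy,$$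 and $\mathrm{BMO}_{\rho,\infty}(\mathbb R^d)=\bigcup_{\theta>0}\mathrm{BMO}_{\rho,\theta}(\mathbb R^d)$. Weights. A weight is a nonnegative locally integrable function on $\mathbb R^d$ (not a.e. zero); $w(E)=\int_E w\,dx$ and $w^\gamma(x)=w(x)^\gamma$, so $w^q(B)=\int_B w^q\,dx$. For $1<p<q<\infty$, $p'=p/(p-1)$, $0<\theta<\infty$: $w\in A^{\rho,\theta}_{p,q}$ if there is $C>0$ such that for every ball $B=B(x_0,r)$, $$\Big(\frac1{|B|}\int_B w^q\,dx\Big)^{1/q}\Big(\frac1{|B|}\int_B w^{-p'}\,dx\Big)^{1/p'}\le C\Big(1+\frac{r}{\rho(x_0)}\Big)^{\theta}.$$ $A^{\rho,\infty}_{p,q}=\bigcup_{\theta>0}A^{\rho,\theta}_{p,q}$. Morrey spaces. For $1\le p<\infty$, $0\le\kappa<1$, weights $\mu,\nu$ and $0<\theta<\infty$, $L^{p,\kappa}_{\rho,\theta}(\mu,\nu)$ is the set of all measurable $f$, with $|f|^p\mu$ locally integrable, such that $$\|f\|_{L^{p,\kappa}_{\rho,\theta}(\mu,\nu)}=\sup_{B=B(x_0,r)}\Big(1+\frac r{\rho(x_0)}\Big)^{-\theta}\Big(\frac1{\nu(B)^\kappa}\int_B|f|^p\mu\,dx\Big)^{1/p}<\infty,$$ the supremum being over all balls. $L^{p,\kappa}_{\rho,\infty}(\mu,\nu)=\bigcup_{\theta>0}L^{p,\kappa}_{\rho,\theta}(\mu,\nu)$. *)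

theory Defs
  imports "HOL-Analysis.Analysis"
begin

text \<open>
  Euclidean space is an arbitrary type of class \<open>euclidean_space\<close>, of dimension \<open>d = DIM('a)\<close>, with
  Lebesgue measure. Functions are real-valued and are treated as representatives of their
  almost-everywhere classes. Norms and averages that may be infinite live in \<^typ>\<open>ennreal\<close>,
  where \<open>1 / 0 = \<infinity>\<close>.
\<close>

section \<open>Preliminaries\<close>

text \<open>Real powers \<open>x\<^sup>a\<close>, \<open>a \<ge> 0\<close>, on \<open>[0, \<infinity>]\<close>. The case \<open>a = 0\<close> is separate because
  \<^term>\<open>0 powr 0\<close> is \<open>0\<close> for reals.\<close>

definition epowr :: "ennreal \<Rightarrow> real \<Rightarrow> ennreal" where
  "epowr x a = (if a = 0 then 1 else if x = \<infinity> then \<infinity> else ennreal (enn2real x powr a))"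

definition locally_integrable :: "('a::euclidean_space \<Rightarrow> real) \<Rightarrow> bool" where
  "locally_integrable f \<longleftrightarrow> (\<forall>K. compact K \<longrightarrow> f absolutely_integrable_on K)"

definition nonzero_density :: "('a::euclidean_space \<Rightarrow> real) \<Rightarrow> bool" where
  "nonzero_density w \<longleftrightarrow>
     (\<forall>x. 0 \<le> w x) \<and> locally_integrable w \<and> \<not> (AE x in lebesgue. w x = 0)"

definition eaverage :: "'a::euclidean_space set \<Rightarrow> ('a \<Rightarrow> ennreal) \<Rightarrow> ennreal" where
  "eaverage B g = (\<integral>\<^sup>+x\<in>B. g x \<partial>lebesgue) / emeasure lebesgue B"

definition average :: "'a::euclidean_space set \<Rightarrow> ('a \<Rightarrow> real) \<Rightarrow> real" where
  "average B b = (LINT x:B|lebesgue. b x) / measure lebesgue B"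


section \<open>Potentials and the critical radius\<close>

definition reverse_Hoelder :: "real \<Rightarrow> ('a::euclidean_space \<Rightarrow> real) \<Rightarrow> bool" where
  "reverse_Hoelder s V \<longleftrightarrow>
     (\<exists>C::real. 0 < C \<and> (\<forall>x r. 0 < r \<longrightarrow>
        epowr (eaverage (ball x r) (\<lambda>y. ennreal (V y powr s))) (1 / s)
          \<le> ennreal C * eaverage (ball x r) (\<lambda>y. ennreal (V y))))"

text \<open>The real supremum is meaningful only for a nonempty set that is bounded above; this is the case
  for nonzero potentials in \<open>RH\<^sub>s\<close> with \<open>d \<ge> 3\<close> and \<open>s \<ge> d / 2\<close>.\<close>

definition critical_radius :: "('a::euclidean_space \<Rightarrow> real) \<Rightarrow> 'a \<Rightarrow> real" where
  "critical_radius V x =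
     Sup {r. 0 < r \<and> r powr (2 - real DIM('a)) * (LINT y:ball x r|lebesgue. V y) \<le> 1}"


section \<open>The Schroedinger operator and its semigroup on \<open>L\<^sup>2\<close>\<close>

definition L2 :: "('a::euclidean_space \<Rightarrow> real) set" where
  "L2 = {u \<in> borel_measurable lebesgue. integrable lebesgue (\<lambda>x. (u x)\<^sup>2)}"

definition L2_norm :: "('a::euclidean_space \<Rightarrow> real) \<Rightarrow> real" where
  "L2_norm u = sqrt (LINT x|lebesgue. (u x)\<^sup>2)"

text \<open>Weak gradients, tested against compactly supported \<open>C\<^sup>1\<close> functions.\<close>

definition weak_gradient :: "('a::euclidean_space \<Rightarrow> real) \<Rightarrow> ('a \<Rightarrow> 'a) \<Rightarrow> bool" where
  "weak_gradient u g \<longleftrightarrow>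
     (\<forall>\<phi> \<phi>'. (\<forall>x. GDERIV \<phi> x :> \<phi>' x) \<and> continuous_on UNIV \<phi>' \<and>
             (\<exists>K. compact K \<and> (\<forall>x. x \<notin> K \<longrightarrow> \<phi> x = 0)) \<longrightarrow>
       (LINT x|lebesgue. u x *\<^sub>R \<phi>' x) = - (LINT x|lebesgue. \<phi> x *\<^sub>R g x))"

text \<open>\<open>u\<close> lies in the form domain \<open>{u \<in> H\<^sup>1. V\<^bsup>1/2\<^esup> u \<in> L\<^sup>2}\<close> and has weak gradient \<open>g\<close>.\<close>

definition form_domain :: "('a::euclidean_space \<Rightarrow> real) \<Rightarrow> ('a \<Rightarrow> real) \<Rightarrow> ('a \<Rightarrow> 'a) \<Rightarrow> bool" where
  "form_domain V u g \<longleftrightarrow>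
     u \<in> L2 \<and> g \<in> borel_measurable lebesgue \<and> integrable lebesgue (\<lambda>x. (norm (g x))\<^sup>2) \<and>
     weak_gradient u g \<and> integrable lebesgue (\<lambda>x. V x * (u x)\<^sup>2)"

text \<open>The graph of \<open>L = - \<Delta> + V\<close>, the self-adjoint operator on \<open>L\<^sup>2\<close> associated with the closed form
  \<open>(u, v) \<mapsto> \<integral> \<nabla>u \<bullet> \<nabla>v + \<integral> V u v\<close>: \<open>schroedinger_operator V u h\<close> means that \<open>u\<close> is in the domain
  of \<open>L\<close> and \<open>L u = h\<close>.\<close>

definition schroedinger_operator ::
    "('a::euclidean_space \<Rightarrow> real) \<Rightarrow> ('a \<Rightarrow> real) \<Rightarrow> ('a \<Rightarrow> real) \<Rightarrow> bool" where
  "schroedinger_operator V u h \<longleftrightarrow>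
     h \<in> L2 \<and>
     (\<exists>g. form_domain V u g \<and>
        (\<forall>v k. form_domain V v k \<longrightarrow>
           (LINT x|lebesgue. g x \<bullet> k x) + (LINT x|lebesgue. V x * u x * v x)
             = (LINT x|lebesgue. h x * v x)))"

text \<open>Strongly continuous semigroups of bounded linear operators on \<open>L\<^sup>2\<close>; all identities between
  functions hold almost everywhere.\<close>

definition C0_semigroup ::
    "(real \<Rightarrow> ('a::euclidean_space \<Rightarrow> real) \<Rightarrow> ('a \<Rightarrow> real)) \<Rightarrow> bool" where
  "C0_semigroup T \<longleftrightarrow>
     (\<forall>t\<ge>0. \<forall>f\<in>L2. T t f \<in> L2) \<and>
     (\<forall>t\<ge>0. \<forall>f\<in>L2. \<forall>g\<in>L2. \<forall>a b. AE x in lebesgue.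
        T t (\<lambda>y. a * f y + b * g y) x = a * T t f x + b * T t g x) \<and>
     (\<forall>t\<ge>0. \<exists>M. \<forall>f\<in>L2. L2_norm (T t f) \<le> M * L2_norm f) \<and>
     (\<forall>f\<in>L2. AE x in lebesgue. T 0 f x = f x) \<and>
     (\<forall>s\<ge>0. \<forall>t\<ge>0. \<forall>f\<in>L2. AE x in lebesgue. T (s + t) f x = T s (T t f) x) \<and>
     (\<forall>f\<in>L2. ((\<lambda>t. L2_norm (\<lambda>x. T t f x - f x)) \<longlongrightarrow> 0) (at_right 0))"

definition generator ::
    "(real \<Rightarrow> ('a::euclidean_space \<Rightarrow> real) \<Rightarrow> ('a \<Rightarrow> real)) \<Rightarrow> ('a \<Rightarrow> real) \<Rightarrow> ('a \<Rightarrow> real) \<Rightarrow> bool"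
  where
  "generator T u h \<longleftrightarrow>
     u \<in> L2 \<and> h \<in> L2 \<and>
     ((\<lambda>t. L2_norm (\<lambda>x. (T t u x - u x) / t - h x)) \<longlongrightarrow> 0) (at_right 0)"

text \<open>\<open>T t = e\<^bsup>-tL\<^esup>\<close> is the semigroup generated by \<open>- L\<close>; this determines \<open>T t\<close> for \<open>t \<ge> 0\<close> on \<open>L\<^sup>2\<close>,
  up to null sets.\<close>

definition schroedinger_semigroup ::
    "('a::euclidean_space \<Rightarrow> real) \<Rightarrow> (real \<Rightarrow> ('a \<Rightarrow> real) \<Rightarrow> ('a \<Rightarrow> real)) \<Rightarrow> bool" where
  "schroedinger_semigroup V T \<longleftrightarrow>
     C0_semigroup T \<and> (\<forall>u h. generator T u h \<longleftrightarrow> schroedinger_operator V u (\<lambda>x. - h x))"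

text \<open>\<open>p t x y\<close>, \<open>t > 0\<close>, is a jointly measurable integral kernel of \<open>T t\<close>. Joint measurability makes it
  unique up to null sets in \<open>(t, x, y)\<close>.\<close>

definition semigroup_kernel ::
    "(real \<Rightarrow> ('a::euclidean_space \<Rightarrow> real) \<Rightarrow> ('a \<Rightarrow> real)) \<Rightarrow> (real \<Rightarrow> 'a \<Rightarrow> 'a \<Rightarrow> real) \<Rightarrow> bool" where
  "semigroup_kernel T p \<longleftrightarrow>
     (\<lambda>(t, x, y). p t x y) \<in> borel_measurable (lebesgue_on ({0<..} \<times> UNIV)) \<and>
     (\<forall>t>0. \<forall>f\<in>L2. AE x in lebesgue.
        integrable lebesgue (\<lambda>y. p t x y * f y) \<and> T t f x = (LINT y|lebesgue. p t x y * f y))"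


section \<open>The fractional integral operator\<close>

definition fractional_kernel ::
    "(real \<Rightarrow> 'a::euclidean_space \<Rightarrow> 'a \<Rightarrow> real) \<Rightarrow> real \<Rightarrow> 'a \<Rightarrow> 'a \<Rightarrow> real" where
  "fractional_kernel p \<alpha> x y = (LINT t:{0<..}|lebesgue. p t x y * t powr (\<alpha> / 2 - 1))"

definition fractional_integral ::
    "(real \<Rightarrow> 'a::euclidean_space \<Rightarrow> 'a \<Rightarrow> real) \<Rightarrow> real \<Rightarrow> ('a \<Rightarrow> real) \<Rightarrow> 'a \<Rightarrow> real" where
  "fractional_integral p \<alpha> f x = (LINT y|lebesgue. fractional_kernel p \<alpha> x y * f y)"

text \<open>Since divergent Bochner integrals are \<open>0\<close> by convention, the existence of the fractional integral
  at almost every point is a separate statement. The condition below is absolute convergence of the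
  double integral over \<open>(t, y)\<close>, which by Fubini makes both iterated integrals (and the kernel,
  for almost every \<open>y\<close> with \<open>f y \<noteq> 0\<close>) well defined, and equal.\<close>

definition fractional_integral_exists ::
    "(real \<Rightarrow> 'a::euclidean_space \<Rightarrow> 'a \<Rightarrow> real) \<Rightarrow> real \<Rightarrow> ('a \<Rightarrow> real) \<Rightarrow> bool" where
  "fractional_integral_exists p \<alpha> f \<longleftrightarrow>
     (AE x in lebesgue. integrable (lebesgue_on ({0<..} \<times> UNIV))
        (\<lambda>(t, y). p t x y * f y * t powr (\<alpha> / 2 - 1)))"


section \<open>Function spaces and weights\<close>

definition bmo_norm ::
    "('a::euclidean_space \<Rightarrow> real) \<Rightarrow> real \<Rightarrow> ('a \<Rightarrow> real) \<Rightarrow> ennreal" where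
  "bmo_norm \<rho> \<theta> b =
     (SUP x. SUP r\<in>{0<..}.
        ennreal ((1 + r / \<rho> x) powr (- \<theta>)) *
        eaverage (ball x r) (\<lambda>y. ennreal \<bar>b y - average (ball x r) b\<bar>))"

definition BMO :: "('a::euclidean_space \<Rightarrow> real) \<Rightarrow> real \<Rightarrow> ('a \<Rightarrow> real) set" where
  "BMO \<rho> \<theta> = {b. locally_integrable b \<and> bmo_norm \<rho> \<theta> b < \<infinity>}"

text \<open>\<open>w\<^bsup>-p'\<^esup>\<close> is computed in \<^typ>\<open>ennreal\<close>, so that it is \<open>\<infinity>\<close> where \<open>w\<close> vanishes.\<close>

definition A_weight ::
    "('a::euclidean_space \<Rightarrow> real) \<Rightarrow> real \<Rightarrow> real \<Rightarrow> real \<Rightarrow> ('a \<Rightarrow> real) set" where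
  "A_weight \<rho> p q \<theta> =
     {w. nonzero_density w \<and>
        (let p' = p / (p - 1) in
         \<exists>C::real. 0 < C \<and> (\<forall>x r. 0 < r \<longrightarrow>
           epowr (eaverage (ball x r) (\<lambda>y. ennreal (w y powr q))) (1 / q) *
           epowr (eaverage (ball x r) (\<lambda>y. inverse (ennreal (w y powr p')))) (1 / p')
             \<le> ennreal (C * (1 + r / \<rho> x) powr \<theta>)))}"

definition A_weight_inf ::
    "('a::euclidean_space \<Rightarrow> real) \<Rightarrow> real \<Rightarrow> real \<Rightarrow> ('a \<Rightarrow> real) set" where
  "A_weight_inf \<rho> p q = (\<Union>\<theta>\<in>{0<..}. A_weight \<rho> p q \<theta>)"

definition morrey_norm ::
    "('a::euclidean_space \<Rightarrow> real) \<Rightarrow> real \<Rightarrow> real \<Rightarrow> real \<Rightarrow> ('a \<Rightarrow> real) \<Rightarrow> ('a \<Rightarrow> real) \<Rightarrow>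
     ('a \<Rightarrow> real) \<Rightarrow> ennreal" where
  "morrey_norm \<rho> p \<kappa> \<theta> \<mu> \<nu> f =
     (SUP x. SUP r\<in>{0<..}.
        ennreal ((1 + r / \<rho> x) powr (- \<theta>)) *
        epowr ((\<integral>\<^sup>+y\<in>ball x r. ennreal (\<bar>f y\<bar> powr p * \<mu> y) \<partial>lebesgue)
               / epowr (\<integral>\<^sup>+y\<in>ball x r. ennreal (\<nu> y) \<partial>lebesgue) \<kappa>) (1 / p))"

definition morrey_space ::
    "('a::euclidean_space \<Rightarrow> real) \<Rightarrow> real \<Rightarrow> real \<Rightarrow> real \<Rightarrow> ('a \<Rightarrow> real) \<Rightarrow> ('a \<Rightarrow> real) \<Rightarrow>
     ('a \<Rightarrow> real) set" where
  "morrey_space \<rho> p \<kappa> \<theta> \<mu> \<nu> =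
     {f \<in> borel_measurable lebesgue.
        locally_integrable (\<lambda>y. \<bar>f y\<bar> powr p * \<mu> y) \<and> morrey_norm \<rho> p \<kappa> \<theta> \<mu> \<nu> f < \<infinity>}"

end

(*
Everything rests on three properties of the semigroup that only use its quadratic form: the kernel is dominated by the
Gaussian, mass absorbed by V makes the kernel at time t smaller by any power of 1 + sqrt t / rho x, and Duhamel's formula
makes it Hoelder continuous in x. On B(x0, r), split the time integral at t = r^2. Up to r^2 the domination bounds
the average of the potential; beyond r^2 its oscillation is summed over dyadic annuli, where a geometric mean of the three
estimates decays in the distance, in t and in r. On a ball of radius R, the weight and Morrey conditions with kappa = p/q
and Hoelder's inequality bound the L^1 norm of f by R^(d - alpha) up to powers of 1 + R / rho, which makes the sums converge.
*)
theory Submission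
 imports Defs
begin

\<comment> \<open>The semigroup is known only through its generator on square-integrable functions,
  so no upper bound for the kernel itself is proved: every estimate is for \<open>S t f\<close> with
  \<open>f\<close> nonnegative, and it comes from differentiating the pairing of
  \<open>S s f\<close> with a Gaussian run backwards in time. For this the Gaussian must be
  admissible in the form, which is why weak gradients are identified with derivatives of
  translations. The delicate endpoint is \<open>s = d/2\<close>, where Hoelder's inequality alone
  gives no growth exponent for the normalised mass \<open>r^(2-d) * v x r\<close>; reverse doubling
  of the measure \<open>W^s dx\<close> supplies a positive one. A fixed fraction of mass is lost per
  time \<open>rho^2\<close>. To reach an arbitrary power, this is iterated only about
  \<open>sqrt t / rho\<close> times instead of \<open>t / rho^2\<close> times, so that the mass
  leaking out meanwhile is a tail of arbitrary polynomial order. One power of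
  \<open>1 + sqrt t / rho\<close> more than the growth of \<open>f\<close> demands is kept, because
  at \<open>kappa = p/q\<close> the integral over large times converges absolutely only through
  it.\<close>
text \<open>\<open>NN\<close>, \<open>LI\<close> and \<open>AL\<close> abbreviate the nonnegative integral, the Bochner integral and the almost-everywhere
 quantifier over Lebesgue-Borel measure, \<open>NL\<close> the nonnegative integral over Lebesgue measure, \<open><|x|>\<close> the absolute value.\<close>

syntax
 "_NN"::"pttrn => ennreal => ennreal" ("(NN _./ _)" [0, 10] 10)
 "_NNS"::"pttrn => 'a set => ennreal => ennreal" ("(NN _:_./ _)" [0, 51, 10] 10)
 "_NL"::"pttrn => ennreal => ennreal" ("(NL _./ _)" [0, 10] 10)
 "_NLS"::"pttrn => 'a set => ennreal => ennreal" ("(NL _:_./ _)" [0, 51, 10] 10)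
 "_LI"::"pttrn => 'b => 'b" ("(LI _./ _)" [0, 10] 10)
 "_AL"::"pttrn => bool => bool" ("(AL _./ _)" [0, 10] 10)

translations
 "NN x. f" => "CONST nn_integral (CONST lborel) (%x. f)"
 "NN x:A. f" => "CONST set_nn_integral (CONST lborel) A (%x. f)"
 "NL x. f" => "CONST nn_integral (CONST lebesgue) (%x. f)"
 "NL x:A. f" => "CONST set_nn_integral (CONST lebesgue) A (%x. f)"
 "LI x. f" => "CONST lebesgue_integral (CONST lborel) (%x. f)"
 "AL x. P" => "CONST almost_everywhere (CONST lborel) (%x. P)"

notation (input) LIMSEQ (infix "---->" 60) and tendsto (infixr "--->" 55) and scaleR (infixr "*." 75)
 and iff (infixr "<->" 25) and inner (infix ".*" 70) and abs ("<|_|>") and infinity ("oo")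

abbreviation (input) "BM \<equiv> borel_measurable borel"
abbreviation (input) "itg \<equiv> integrable lborel"
abbreviation (input) "ind \<equiv> indicator"
abbreviation (input) "en \<equiv> ennreal"
abbreviation (input) "lb2 \<equiv> lborel \<Otimes>\<^sub>M lborel"
lemmas mono_l = mult_left_mono and mono_r = mult_right_mono and ind_def = indicator_def

section \<open>The Hilbert space of square-integrable functions\<close>

definition sqi::"('a::euclidean_space => real) => bool" where
 "sqi f <-> f : BM & itg (%x. (f x)^2)"

lemma sqi_measurable [measurable_dest]: "sqi f ==> f : BM"
 by (simp add: sqi_def)

lemma sqi_mult_integrable:
 assumes "sqi f" "sqi g"
 shows "itg (%x. f x*g x)"
proof (rule Bochner_Integration.integrable_bound)
 show "itg (%x. (f x)^2 + (g x)^2)"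
  using assms by (auto simp: sqi_def)
 show "(%x. f x*g x) : borel_measurable lborel"
  using assms by (auto simp: sqi_def)
 have "<|a*b|> <= a^2 + b^2" for a b::real
 proof -
  have "2*<|a|>*<|b|> <= <|a|>^2 + <|b|>^2" using sum_squares_bound by blast
  moreover have "0 <= <|a|>*<|b|>" by simp
  ultimately have "<|a|>*<|b|> <= <|a|>^2 + <|b|>^2" by linarith
  thus ?thesis by (simp add: abs_mult)
 qed
 thus "AL x. norm (f x*g x) <= norm ((f x)^2 + (g x)^2)"
  by (intro AE_I2) simp
qed

lemma sqi_add:
 assumes "sqi f" "sqi g"
 shows "sqi (%x. f x + g x)"
proof -
 have "itg (%x. (f x)^2 + (g x)^2 + 2*(f x*g x))"
  using assms sqi_mult_integrable[OF assms] by (auto simp: sqi_def)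
 moreover have "(f x)^2 + (g x)^2 + 2*(f x*g x) = (f x + g x)^2" for x
  by (simp add: power2_sum)
 ultimately show ?thesis using assms by (auto simp: sqi_def)
qed

lemma sqi_scale: "sqi f ==> sqi (%x. c*f x)"
 by (auto simp: sqi_def power_mult_distrib)

lemma sqi_zero: "sqi (%x. 0)"
 by (auto simp: sqi_def)

lemma sqi_bound:
 assumes "sqi f" "g : BM" "AL x. <|g x|> <= <|f x|>"
 shows "sqi g"
 unfolding sqi_def
proof
 show "itg (%x. (g x)^2)"
 proof (rule Bochner_Integration.integrable_bound)
  show "itg (%x. (f x)^2)" using assms by (auto simp: sqi_def)
  show "AL x. norm ((g x)^2) <= norm ((f x)^2)"
  using assms(3) by eventually_elim (simp add: abs_le_square_iff)
 qed (use assms in auto)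
qed (rule assms)

lemma sqi_abs: "sqi f ==> sqi (%x. <|f x|>)"
 by (auto simp: sqi_def)

lemma sqi_nn_integral_iff:
 assumes "f : BM"
 shows "sqi f <-> (NN x. en ((f x)^2)) < oo"
 using assms by (auto simp: sqi_def integrable_iff_bounded)

\<comment> \<open>Square-integrable Borel functions modulo null sets become a type, so that limits,
  derivatives and integrals with values in a Banach space are available for them. The relation is
  partial: functions that are not square integrable represent nothing.\<close>
quotient_type (overloaded) 'a l2 = "'a::euclidean_space => real" /
 partial: "%f g. sqi f & sqi g & (AL x. f x = g x)"
 morphisms rep cls
proof (rule part_equivpI)
 show "? f::'a => real. sqi f & sqi f & (AL x. f x = f x)"
  using sqi_zero by auto
 show "symp (%f g::'a => real. sqi f & sqi g & (AL x. f x = g x))"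
  by (auto simp: symp_def elim: eventually_mono)
 show "transp (%f g::'a => real. sqi f & sqi g & (AL x. f x = g x))"
 proof (rule transpI)
  fix f g h::"'a => real"
  assume *: "sqi f & sqi g & (AL x. f x = g x)" "sqi g & sqi h & (AL x. g x = h x)"
  hence "AL x. f x = g x" "AL x. g x = h x" by auto
  hence "AL x. f x = h x" by eventually_elim simp
  with* show "sqi f & sqi h & (AL x. f x = h x)" by blast
 qed
qed

lemma sqi_rep [simp, intro]: "sqi (rep u)"
 using Quotient3_rep_reflp[OF Quotient3_l2, of u] by simp

lemma rep_measurable [measurable]: "rep u : BM"
 by (rule sqi_measurable) simp

lemma abs_rep [simp]: "cls (rep u) = u"
 by (rule Quotient3_abs_rep[OF Quotient3_l2])

lemma rep_abs: "sqi f ==> AL x. rep (cls f) x = f x"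
 using Quotient3_rep_abs[OF Quotient3_l2, of f] by simp

lemma cls_eqI: "sqi f ==> sqi g ==> AL x. f x = g x ==> cls f = cls g"
 using Quotient3_rel[OF Quotient3_l2, of f g] by simp

lemma l2_eqI: "AL x. rep u x = rep v x ==> u = v"
 using cls_eqI[of "rep u" "rep v"] by simp

instantiation l2::(euclidean_space) real_inner
begin

definition "0 = cls (%x. 0)"
definition "u + v = cls (%x. rep u x + rep v x)"
definition "c *. u = cls (%x. c*rep u x)" for c::real
definition "- u = cls (%x. (-1)*rep u x)"
definition "u - v = cls (%x. rep u x + (-1)*rep v x)"
definition "inner u v = (LI x. rep u x*rep v x)"
definition "norm u = sqrt (inner u u)" for u::"'a l2"
definition "sgn u = cls (%x. inverse (norm u)*rep u x)"
definition "dist u v = norm (u - v)" for u v::"'a l2"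
definition [code del]:
 "(uniformity::('a l2 \<times> 'a l2) filter) = (INF e\<in>{0 <..}. principal {(x, y). dist x y < e})"
definition [code del]:
 "open (U::'a l2 set) <-> (!x:U. eventually (%(x', y). x' = x --> y : U) uniformity)"

lemma rep_zero: "AL x. rep 0 x = 0"
 unfolding zero_l2_def by (rule rep_abs[OF sqi_zero])

lemma rep_plus: "AL x. rep (u + v) x = rep u x + rep v x"
 unfolding plus_l2_def by (rule rep_abs) (simp add: sqi_add)

lemma rep_scale: "AL x. rep (c *. u) x = c*rep u x"
 unfolding scaleR_l2_def by (rule rep_abs) (simp add: sqi_scale)

lemma rep_uminus: "AL x. rep (- u) x = - rep u x"
 unfolding uminus_l2_def using rep_abs[OF sqi_scale[OF sqi_rep, of "-1" u]] by simp

lemma rep_minus: "AL x. rep (u - v) x = rep u x - rep v x"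
 unfolding minus_l2_def using rep_abs[OF sqi_add[OF sqi_rep sqi_scale[OF sqi_rep, of "-1" v]], of u] by simp

instance
proof
 fix a b c::"'a l2" and r s::real
 show "a + b + c = a + (b + c)"
  by (rule l2_eqI, use rep_plus[of a b] rep_plus[of "a + b" c] rep_plus[of b c] rep_plus[of a "b + c"]
  in eventually_elim) simp
 show "a + b = b + a"
  by (rule l2_eqI, use rep_plus[of a b] rep_plus[of b a] in eventually_elim) simp
 show "0 + a = a"
  by (rule l2_eqI, use rep_plus[of 0 a] rep_zero in eventually_elim) simp
 show "- a + a = 0"
  by (rule l2_eqI, use rep_plus[of "-a" a] rep_uminus[of a] rep_zero in eventually_elim) simp
 show "a - b = a + - b"
  by (rule l2_eqI, use rep_minus[of a b] rep_plus[of a "- b"] rep_uminus[of b] in eventually_elim) simp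
 show "r *. (a + b) = r *. a + r *. b"
  by (rule l2_eqI, use rep_plus[of a b] rep_scale[of r "a+b"] rep_scale[of r a] rep_scale[of r b]
  rep_plus[of "r *. a" "r *. b"] in eventually_elim) (simp add: algebra_simps)
 show "(r + s) *. a = r *. a + s *. a"
  by (rule l2_eqI, use rep_scale[of "r+s" a] rep_scale[of r a] rep_scale[of s a]
  rep_plus[of "r *. a" "s *. a"] in eventually_elim) (simp add: algebra_simps)
 show "r *. s *. a = (r* s) *. a"
  by (rule l2_eqI, use rep_scale[of "r* s" a] rep_scale[of s a] rep_scale[of r "s *. a"]
  in eventually_elim) (simp add: algebra_simps)
 show "1 *. a = a"
  by (rule l2_eqI, use rep_scale[of 1 a] in eventually_elim) simp
 show "sgn a = inverse (norm a) *. a" by (simp add: sgn_l2_def scaleR_l2_def)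
 show "dist a b = norm (a - b)" by (rule dist_l2_def)
 show "(uniformity::('a l2 \<times> 'a l2) filter) = (INF e\<in>{0 <..}. principal {(x, y). dist x y < e})"
  by (rule uniformity_l2_def)
 show "open U <-> (!x:U. eventually (%(x', y). x' = x --> y : U) uniformity)" for U::"'a l2 set"
  by (rule open_l2_def)
 show "inner a b = inner b a" by (simp add: inner_l2_def mult.commute)
 have "inner (a + b) c = (LI x. rep a x*rep c x + rep b x*rep c x)"
  unfolding inner_l2_def
  by (rule integral_cong_AE, measurable, use rep_plus[of a b] in eventually_elim) (simp add: algebra_simps)
 also have "... = inner a c + inner b c"
  unfolding inner_l2_def by (rule Bochner_Integration.integral_add) (auto intro: sqi_mult_integrable)
 finally show "inner (a + b) c = inner a c + inner b c" .
 have "inner (r *. a) b = (LI x. r*(rep a x*rep b x))"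
  unfolding inner_l2_def
  by (rule integral_cong_AE, measurable, use rep_scale[of r a] in eventually_elim) simp
 thus "inner (r *. a) b = r*inner a b"
  by (simp add: inner_l2_def)
 show "0 <= inner a a" unfolding inner_l2_def by simp
 have int: "itg (%x. rep a x*rep a x)" by (simp add: sqi_mult_integrable)
 have "inner a a = 0 <-> (AL x. rep a x*rep a x = 0)"
  unfolding inner_l2_def by (rule integral_nonneg_eq_0_iff_AE[OF int]) simp
 also have "... <-> a = 0"
 proof
  assume *: "AL x. rep a x*rep a x = 0"
  show "a = 0"
  by (rule l2_eqI, use rep_zero*in eventually_elim) simp
 next
  assume "a = 0"
  thus "AL x. rep a x*rep a x = 0" using rep_zero by simp
 qed
 finally show "inner a a = 0 <-> a = 0" .
 show "norm a = sqrt (inner a a)" by (rule norm_l2_def)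
qed

end

lemma norm_l2_sq: "(norm u)^2 = (LI x. (rep u x)^2)"
 unfolding power2_norm_eq_inner inner_l2_def by (simp add: power2_eq_square)

lemma nn_norm_l2: "en ((norm u)^2) = (NN x. en ((rep u x)^2))"
proof -
 have "itg (%x. (rep u x)^2)" using sqi_rep[of u] by (simp add: sqi_def)
 thus ?thesis by (simp add: norm_l2_sq nn_integral_eq_integral)
qed

lemma inner_cls:
 assumes "sqi f"
 shows "inner u (cls f) = (LI x. rep u x*f x)"
 unfolding inner_l2_def
 by (rule integral_cong_AE, (use assms in measurable)[2], use rep_abs[OF assms] in eventually_elim) simp

lemma inner_abs_cls:
 assumes "sqi f" "sqi g"
 shows "inner (cls f) (cls g) = (LI x. f x*g x)"
 unfolding inner_cls[OF assms(2)]
 by (rule integral_cong_AE, (use assms in measurable)[2], use rep_abs[OF assms(1)] in eventually_elim) simp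

lemma nn_norm_cls:
 assumes "sqi f"
 shows "en ((norm (cls f))^2) = (NN x. en ((f x)^2))"
 unfolding nn_norm_l2
 by (rule nn_integral_cong_AE, use rep_abs[OF assms] in eventually_elim) simp

lemma norm_l2_le_iff_nn:
 assumes "0 <= c"
 shows "norm u <= c <-> (NN x. en ((rep u x)^2)) <= en (c^2)"
 using assms by (simp add: nn_norm_l2[symmetric] ennreal_le_iff power2_le_iff_abs_le abs_le_square_iff[symmetric])

lemma cls_add:
 assumes "sqi f" "sqi g"
 shows "cls (%x. f x + g x) = cls f + cls g"
 by (rule l2_eqI, use rep_abs[OF sqi_add[OF assms]] rep_plus[of "cls f" "cls g"]
  rep_abs[OF assms(1)] rep_abs[OF assms(2)]
  in eventually_elim) simp

lemma cls_scale:
 assumes "sqi f"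
 shows "cls (%x. c*f x) = c *. cls f"
 by (rule l2_eqI, use rep_abs[OF sqi_scale[OF assms, of c]] rep_scale[of c "cls f"] rep_abs[OF assms]
  in eventually_elim) simp

lemma sqi_diff: "sqi f ==> sqi g ==> sqi (%x. f x - g x)"
 using sqi_add[of f "%x. (-1)*g x"] sqi_scale[of g "-1"] by simp

lemma cls_diff:
 assumes "sqi f" "sqi g"
 shows "cls (%x. f x - g x) = cls f - cls g"
 by (rule l2_eqI, use rep_abs[OF sqi_diff[OF assms]] rep_minus[of "cls f" "cls g"]
  rep_abs[OF assms(1)] rep_abs[OF assms(2)]
  in eventually_elim) simp

lemma sqi_sum: "finite I ==> (!!i. i : I ==> sqi (f i)) ==> sqi (%x. \<Sum>i\<in>I. f i x)"
 by (induction I rule: finite_induct) (auto intro: sqi_add sqi_zero)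

lemma rep_sum: "finite I ==> AL x. rep (\<Sum>i\<in>I. f i) x = (\<Sum>i\<in>I. rep (f i) x)"
proof (induction I rule: finite_induct)
 case empty
 thus ?case using rep_zero by simp
next
 case (insert i I)
 from insert.IH rep_plus[of "f i" "\<Sum>i\<in>I. f i"] show ?case
  by eventually_elim (use insert.hyps in simp)
qed

text \<open>Fatou's lemma: a distance bound along a sequence that converges almost everywhere passes
  to the limit, and its finiteness makes the limit square integrable. Completeness and the
  extraction of convergent subsequences both rest on it.\<close>

lemma l2_limit_of_AE_limit:
 assumes AE: "AL x. (%n. rep (X n) x) ----> f x"
  and f [measurable]: "f : BM"
  and bound: "!!n. N <= n ==> norm (X n - u) <= e"
 shows "sqi f" "norm (cls f - u) <= e"
proof -
 have e: "0 <= e" using bound[of N] norm_ge_zero order_trans by blast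
 have "(NN x. en ((f x - rep u x)^2))
  = (NN x. liminf (%n. en ((rep (X n) x - rep u x)^2)))"
 proof (rule nn_integral_cong_AE, use AE in eventually_elim)
  fix x assume "(%n. rep (X n) x) ----> f x"
  hence "(%n. en ((rep (X n) x - rep u x)^2)) ----> en ((f x - rep u x)^2)"
  by (intro tendsto_ennrealI tendsto_intros)
  thus "en ((f x - rep u x)^2) = liminf (%n. en ((rep (X n) x - rep u x)^2))"
  by (rule lim_imp_Liminf[OF sequentially_bot, symmetric])
 qed
 also have "... <= liminf (%n. NN x. en ((rep (X n) x - rep u x)^2))"
  by (rule nn_integral_liminf) measurable
 also have "... = liminf (%n. en ((norm (X n - u))^2))"
 proof (intro arg_cong[where f=liminf] ext)
  show "(NN x. en ((rep (X n) x - rep u x)^2)) = en ((norm (X n - u))^2)" for n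
  unfolding nn_norm_l2 by (rule nn_integral_cong_AE, use rep_minus[of "X n" u] in eventually_elim) simp
 qed
 also have "... <= liminf (%n. en (e^2))"
 proof (rule Liminf_mono)
  show "\<forall>\<^sub>F n in sequentially. en ((norm (X n - u))^2) <= en (e^2)"
  using eventually_ge_at_top[of N] by eventually_elim (intro ennreal_leI power_mono bound, auto)
 qed
 also have "... = en (e^2)" by (simp add: Liminf_const)
 finally have le: "(NN x. en ((f x - rep u x)^2)) <= en (e^2)" .
 hence "sqi (%x. f x - rep u x)"
  by (subst sqi_nn_integral_iff) (auto simp: le_less_trans[OF _ ennreal_less_top])
 from sqi_add[OF this sqi_rep[of u]] show s: "sqi f" by simp
 have "(NN x. en ((rep (cls f - u) x)^2)) = (NN x. en ((f x - rep u x)^2))"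
  by (rule nn_integral_cong_AE, use rep_minus[of "cls f" u] rep_abs[OF s] in eventually_elim) simp
 with le show "norm (cls f - u) <= e" using e by (simp add: norm_l2_le_iff_nn)
qed

lemma norm_sum_cls:
 fixes n::nat
 shows "norm (cls (%x. \<Sum>i<n. <|rep (d i) x|>)) <= (\<Sum>i<n. norm (d i))"
proof (induction n)
 case 0
 thus ?case by (simp flip: zero_l2_def)
next
 case (Suc n)
 have s: "sqi (%x. <|rep (d i) x|>)" for i by (rule sqi_abs) simp
 have "norm (cls (%x. <|rep (d n) x|>)) = norm (d n)"
 proof -
  have "en ((norm (cls (%x. <|rep (d n) x|>)))^2) = en ((norm (d n))^2)"
  by (subst nn_norm_cls[OF s]) (simp add: nn_norm_l2)
  hence "(norm (cls (%x. <|rep (d n) x|>)))^2 = (norm (d n))^2" by simp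
  thus ?thesis by (rule power2_eq_imp_eq) auto
 qed
 moreover have "cls (%x. \<Sum>i<Suc n. <|rep (d i) x|>)
  = cls (%x. \<Sum>i<n. <|rep (d i) x|>) + cls (%x. <|rep (d n) x|>)"
  by (subst cls_add[symmetric]) (auto intro!: sqi_sum s)
 ultimately show ?case using Suc norm_triangle_ineq[of "cls (%x. \<Sum>i<n. <|rep (d i) x|>)" "cls (%x. <|rep (d n) x|>)"]
  by simp
qed

text \<open>The Riesz-Fischer argument: partial sums of absolute values increase, and monotone
  convergence bounds the integral of the square of their supremum, which is therefore finite almost
  everywhere.\<close>

lemma AE_summable_of_summable_norms:
 assumes b: "!!n::nat. (\<Sum>i<n. norm (d i)) <= b"
 shows "AL x. summable (%i. <|rep (d i) x|>)"
proof -
 define S where "S n x = (\<Sum>i<n. <|rep (d i) x|>)" for n x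
 have [measurable]: "S n : BM" for n unfolding S_def by measurable
 have sS: "sqi (S n)" for n unfolding S_def by (intro sqi_sum sqi_abs) auto
 have mono: "incseq (%n. en ((S n x)^2))" for x
  unfolding S_def by (intro incseq_SucI ennreal_leI power_mono sum_nonneg) auto
 have b0: "0 <= b" using b[of 0] by simp
 have "(NN x. (SUP n. en ((S n x)^2))) = (SUP n. NN x. en ((S n x)^2))"
  by (rule nn_integral_monotone_convergence_SUP) (use mono in "auto simp: incseq_def le_fun_def")
 also have "... <= en (b^2)"
 proof (rule SUP_least)
  fix n
  have "(norm (cls (S n)))^2 <= b^2"
  using norm_sum_cls[where n=n and d = d] b[of n] by (intro power_mono) (auto simp: S_def[abs_def])
  thus "(NN x. en ((S n x)^2)) <= en (b^2)"
  by (simp add: nn_norm_cls[OF sS, symmetric] ennreal_leI)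
 qed
 finally have "(NN x. (SUP n. en ((S n x)^2))) ~= oo"
  by (auto simp: top_unique)
 hence "AL x. (SUP n. en ((S n x)^2)) ~= oo"
  by (intro nn_integral_noteq_infinite) measurable
 thus ?thesis
 proof eventually_elim
  fix x assume "(SUP n. en ((S n x)^2)) ~= oo"
  then obtain c where c: "0 <= c" "(SUP n. en ((S n x)^2)) = en c"
  by (cases "SUP n. en ((S n x)^2)") auto
  have "S n x <= sqrt c" for n
  proof -
  have "en ((S n x)^2) <= en c" unfolding c(2)[symmetric] by (rule SUP_upper) simp
  hence "(S n x)^2 <= c" using c(1) by simp
  thus ?thesis by (rule real_le_rsqrt)
  qed
  hence "(\<Sum>i\<le>n. <|rep (d i) x|>) <= sqrt c" for n
  unfolding S_def lessThan_Suc_atMost[symmetric] .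
  thus "summable (%i. <|rep (d i) x|>)"
  by (intro bounded_imp_summable[of _ "sqrt c"]) auto
 qed
qed

lemma l2_fast_Cauchy_AE_convergent:
 assumes "!!n. norm (X (Suc n) - X n) <= (1/2)^n"
 shows "AL x. convergent (%n. rep (X n) x)"
proof -
 have "(\<Sum>i<n. norm (X (Suc i) - X i)) <= 2" for n
 proof -
  have "(\<Sum>i<n. norm (X (Suc i) - X i)) <= (\<Sum>i<n. (1/2)^i)" by (intro sum_mono assms)
  also have "... <= 2" by (simp add: geometric_sum)
  finally show ?thesis .
 qed
 from AE_summable_of_summable_norms[of "%i. X (Suc i) - X i", OF this]
 have 1: "AL x. summable (%i. <|rep (X (Suc i) - X i) x|>)" .
 have 2: "AL x. !i. rep (X (Suc i) - X i) x = rep (X (Suc i)) x - rep (X i) x"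
  by (subst AE_all_countable) (auto intro: rep_minus)
 from 1 2 show ?thesis
 proof eventually_elim
  case (elim x)
  hence "summable (%i. <|rep (X (Suc i)) x - rep (X i) x|>)"
  by (simp only:)
  hence "summable (%i. rep (X (Suc i)) x - rep (X i) x)"
  by (rule summable_rabs_cancel)
  hence "convergent (%n. \<Sum>i<n. rep (X (Suc i)) x - rep (X i) x)"
  by (rule summable_iff_convergent[THEN iffD1])
  hence "convergent (%n. rep (X n) x - rep (X 0) x)"
  by (simp only: sum_lessThan_telescope[of "%i. rep (X i) x"])
  thus ?case
  using convergent_add_const_iff[of "- rep (X 0) x" "%n. rep (X n) x"] by simp
 qed
qed

lemma fast_subsequence:
 fixes X::"nat => 'b::real_normed_vector"
 assumes "Cauchy X"
 obtains r where "strict_mono r" "!!n. norm (X (r (Suc n)) - X (r n)) <= (1/2)^n"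
proof -
 have "? N. ALL m>=N. ALL n>=N. norm (X m - X n) < (1/2)^k" for k::nat
  using assms[unfolded Cauchy_iff] by (auto dest: spec[of _ "(1/2)^k"])
 then obtain N where N: "!!k m n. N k <= m ==> N k <= n ==> norm (X m - X n) < (1/2)^k"
  by metis
 define r where "r=rec_nat (N 0) (%k a. max (Suc a) (N (Suc k)))"
 have r: "r 0 = N 0" "r (Suc k) = max (Suc (r k)) (N (Suc k))" for k
  by (auto simp: r_def)
 have "N k <= r k" for k by (cases k) (auto simp: r)
 moreover have sm: "strict_mono r" by (intro strict_mono_Suc_iff[THEN iffD2]) (simp add: r less_max_iff_disj)
 moreover have "r n <= r (Suc n)" for n using sm by (simp add: strict_mono_less_eq)
 ultimately have "norm (X (r (Suc n)) - X (r n)) <= (1/2)^n" for n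
  using N[of n "r (Suc n)" "r n"] by (meson less_imp_le order_trans)
 with sm show ?thesis by (rule that)
qed

instance l2::(euclidean_space) complete_space
proof
 fix X::"nat => 'a l2" assume C: "Cauchy X"
 obtain r where r: "strict_mono r" "!!n. norm (X (r (Suc n)) - X (r n)) <= (1/2)^n"
  using fast_subsequence[OF C] by blast
 define f where "f x = lim (%n. rep (X (r n)) x)" for x
 have [measurable]: "f : BM" unfolding f_def by measurable
 have AE: "AL x. (%n. rep (X (r n)) x) ----> f x"
  using l2_fast_Cauchy_AE_convergent[of "%n. X (r n)", OF r(2)]
  by eventually_elim (simp add: f_def convergent_LIMSEQ_iff)
 have "(%n. X n) ----> cls f"
 proof (rule LIMSEQ_I)
  fix e::real assume "0 < e"
  then obtain N where N: "!!m n. N <= m ==> N <= n ==> norm (X m - X n) < e/2"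
  using C[unfolded Cauchy_iff] by (metis half_gt_zero)
  have "norm (X n - cls f) < e" if "N <= n" for n
  proof -
  have "norm (cls f - X n) <= e/2"
  proof (rule l2_limit_of_AE_limit(2)[OF AE, of N])
  show "norm (X (r k) - X n) <= e/2" if "N <= k" for k
  using N[of "r k" n] `N <= n` that seq_suble[OF r(1), of k] by simp
  qed measurable
  thus ?thesis using `0 < e` by (simp add: norm_minus_commute)
  qed
  thus "? no. ALL n>=no. norm (X n - cls f) < e" by blast
 qed
 thus "convergent X" by (auto simp: convergent_def)
qed

instance l2::(euclidean_space) banach ..

lemma l2_tendsto_AE_subseq:
 assumes "X ----> u"
 obtains r where "strict_mono (r::nat => nat)" "AL x. (%n. rep (X (r n)) x) ----> rep u x"
proof -
 obtain r where r: "strict_mono r" "!!n. norm (X (r (Suc n)) - X (r n)) <= (1/2)^n"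
  using fast_subsequence[OF LIMSEQ_imp_Cauchy[OF assms]] by blast
 define f where "f x = lim (%n. rep (X (r n)) x)" for x
 have [measurable]: "f : BM" unfolding f_def by measurable
 have AE: "AL x. (%n. rep (X (r n)) x) ----> f x"
  using l2_fast_Cauchy_AE_convergent[of "%n. X (r n)", OF r(2)]
  by eventually_elim (simp add: f_def convergent_LIMSEQ_iff)
 have lim: "(%n. X (r n)) ----> u" using LIMSEQ_subseq_LIMSEQ[OF assms r(1)] by (simp add: o_def)
 have le: "sqi f & norm (cls f - u) <= e" if "0 < e" for e
 proof -
  obtain N where "!!n. N <= n ==> norm (X (r n) - u) < e"
  using LIMSEQ_D[OF lim `0 < e`] by blast
  thus ?thesis
  using l2_limit_of_AE_limit[OF AE, of N u e] by (auto intro: less_imp_le)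
 qed
 have "norm (cls f - u) <= 0" by (rule field_le_epsilon) (use le in simp)
 hence "cls f = u" by simp
 moreover have "sqi f" using le[of 1] by simp
 ultimately have "AL x. rep u x = f x" using rep_abs by blast
 with AE have "AL x. (%n. rep (X (r n)) x) ----> rep u x" by eventually_elim simp
 with r(1) show ?thesis by (rule that)
qed

section \<open>Strongly continuous semigroups\<close>

text \<open>Since \<open>T (x + z) - T (x - z)\<close> is twice \<open>T z\<close>, one of the two
  values has norm at least \<open>norm (T z)\<close>: around any centre \<open>x\<close>, a short
  step in a good direction with the right sign makes \<open>T\<close> large.\<close>

lemma bounded_linear_large_perturbation:
 assumes T: "bounded_linear T" and r: "0 < r" and y: "c*norm y < norm (T y)" "0 <= c"
 obtains z where "norm z <= r" "c*r <= norm (T (x + z))"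
proof -
 interpret bounded_linear T by (rule T)
 have y0: "norm y > 0" using y zero by force
 define z where "z=(r/norm y) *. y"
 have nz: "norm z = r" using y0 r by (simp add: z_def)
 have "c*r = c*norm y*(r/norm y)" using y0 by simp
 also have "... <= norm (T y)*(r/norm y)" using y y0 r by (intro mono_r) auto
 also have "... = norm (T z)" using y0 r by (simp add: z_def scaleR)
 finally have 1: "c*r <= norm (T z)" .
 have "T (x + z) - T (x - z) = 2 *. T z"
  by (simp add: add diff scaleR_2)
 hence "2*norm (T z) <= norm (T (x + z)) + norm (T (x - z))"
  by (metis abs_numeral norm_scaleR norm_triangle_ineq4)
 then consider "norm (T z) <= norm (T (x + z))" | "norm (T z) <= norm (T (x + - z))"
  by fastforce
 thus ?thesis
  by cases (use that[of z] that[of "- z"] nz 1 in auto)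
qed

text \<open>A gliding hump in place of Baire's theorem. Pick maps of norm above
  \<open>4 ^ Suc k\<close> and move by at most \<open>(1/3)^k\<close> so that the
  \<open>k\<close>-th one becomes large; the later steps total at most half of
  \<open>(1/3)^k\<close>, so at the limit point the values still grow like
  \<open>(4/3)^k\<close>.\<close>

lemma uniform_boundedness:
 fixes F::"nat => 'b::banach => 'c::real_normed_vector"
 assumes lin: "!!n. bounded_linear (F n)"
  and bd: "!!x. ? B. !n. norm (F n x) <= B"
 shows "? B. !n x. norm (F n x) <= B*norm x"
proof (rule ccontr)
 assume neg: "~ ?thesis"
 have "? n. 4 ^ Suc k < onorm (F n)" for k::nat
 proof (rule ccontr)
  assume "~ (? n. 4 ^ Suc k < onorm (F n))"
  hence "norm (F n x) <= 4 ^ Suc k*norm x" for n x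
  using onorm[OF lin[of n], of x] by (meson mono_r norm_ge_zero not_less order_trans)
  with neg show False by blast
 qed
 then obtain N where N: "!!k::nat. 4 ^ Suc k < onorm (F (N k))" by metis
 have "? z. norm z <= (1/3)^k & 3/4* onorm (F (N k))*(1/3)^k <= norm (F (N k) (x + z))" for k x
 proof -
  have pos: "0 < onorm (F (N k))" using N[of k] zero_less_power[of "4::real" "Suc k"] by linarith
  \<comment> \<open>Any factor below 1 is exceeded by some vector; \<open>3/4\<close> leaves a
    quarter of the norm once the tail \<open>1/2\<close> is subtracted.\<close>
  have "? y. 3/4* onorm (F (N k))*norm y < norm (F (N k) y)"
  proof (rule ccontr)
  assume "~ ?thesis"
  hence "onorm (F (N k)) <= 3/4* onorm (F (N k))"
  using pos by (intro onorm_bound) (auto simp: not_less)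
  with pos show False by simp
  qed
  then obtain y where "3/4* onorm (F (N k))*norm y < norm (F (N k) y)" ..
  from bounded_linear_large_perturbation[OF lin _ this, of "(1/3)^k" x] pos show ?thesis by auto
 qed
 then obtain z where z: "!!k x. norm (z k x) <= (1/3)^k"
  "!!k x. 3/4* onorm (F (N k))*(1/3)^k <= norm (F (N k) (x + z k x))"
  by metis
 define X where "X=rec_nat 0 (%k a. a + z k a)"
 have X: "X (Suc k) = X k + z k (X k)" for k by (simp add: X_def)
 have step: "norm (X (Suc k) - X k) <= (1/3)^k" for k using z(1)[of k "X k"] by (simp add: X)
 have "summable (%k. X (Suc k) - X k)"
  by (rule summable_comparison_test'[of "%k. (1/3)^k" 0]) (use step in "auto intro: summable_geometric")
 hence "convergent (%n. \<Sum>k<n. X (Suc k) - X k)" by (rule summable_iff_convergent[THEN iffD1])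
 hence "convergent (%n. X n - X 0)" by (simp only: sum_lessThan_telescope[of X])
 then obtain L where L: "X ----> L" by (auto simp: X_def convergent_def)
 have tail: "norm (X (m + k) - X k) <= 3/2*(1/3)^k*(1 - (1/3)^m)" for k m
 proof (induction m)
  case (Suc m)
  have "norm (X (Suc m + k) - X k) <= norm (X (Suc (m + k)) - X (m + k)) + norm (X (m + k) - X k)"
  using norm_triangle_ineq[of "X (Suc (m + k)) - X (m + k)" "X (m + k) - X k"] by simp
  also have "... <= (1/3)^(m + k) + 3/2*(1/3)^k*(1 - (1/3)^m)"
  by (intro add_mono step Suc)
  also have "... = 3/2*(1/3)^k*(1 - (1/3)^Suc m)" by (simp add: power_add field_simps)
  finally show ?case .
 qed simp
 have dist: "norm (L - X k) <= 3/2*(1/3)^k" for k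
 proof (rule LIMSEQ_le_const2)
  show "(%m. norm (X (m + k) - X k)) ----> norm (L - X k)"
  by (intro tendsto_intros LIMSEQ_ignore_initial_segment L)
  show "? n0. ALL m>=n0. norm (X (m + k) - X k) <= 3/2*(1/3)^k"
  proof (intro exI allI impI)
  fix m
  have "3/2*(1/3)^k*(1 - (1/3)^m) <= 3/2*(1/3::real)^k*1" by (intro mono_l) auto
  thus "norm (X (m + k) - X k) <= 3/2*(1/3)^k" using tail[of m k] by linarith
  qed
 qed
 show False
 proof -
  obtain B where B: "!!n. norm (F n L) <= B" using bd by blast
  have "(4/3::real)^k <= B" for k
  proof -
  let ?F = "F (N k)"
  have "norm (?F (X (Suc k))) <= norm (?F L) + norm (?F (L - X (Suc k)))"
  using norm_triangle_ineq4[of "?F L" "?F (L - X (Suc k))"] bounded_linear.linear[OF lin[of "N k"]]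
  by (simp add: linear_diff)
  also have "... <= B + onorm ?F*(3/2*(1/3)^Suc k)"
  by (intro add_mono B order_trans[OF onorm[OF lin]] mono_l dist onorm_pos_le lin)
  finally have "3/4* onorm ?F*(1/3)^k <= B + onorm ?F*(3/2*(1/3)^Suc k)"
  using z(2)[of k "X k"] by (simp add: X)
  hence "1/4* onorm ?F*(1/3)^k <= B" by (simp add: field_simps)
  moreover have "1/4*4 ^ Suc k*(1/3)^k <= 1/4* onorm ?F*(1/3)^k"
  using N[of k] by (intro mono_r mono_l) auto
  moreover have "1/4*4 ^ Suc k*(1/3::real)^k = (4/3)^k" by (simp add: power_divide)
  ultimately show ?thesis by linarith
  qed
  moreover obtain k where "B < (4/3::real)^k" using real_arch_pow[of "4/3" B] by auto
  ultimately show False by (meson not_less)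
 qed
qed

lemma has_vector_derivative_iff_quotient:
 "(f has_vector_derivative D) (at x within A) <-> ((%y. (f y - f x) /\<^sub>R (y - x)) ---> D) (at x within A)"
proof -
 have "(f has_vector_derivative D) (at x within A)
  <-> ((%y. norm (f y - f x - (y - x) *. D)/norm (y - x)) ---> 0) (at x within A)"
  unfolding has_vector_derivative_def has_derivative_iff_norm
  by (simp add: bounded_linear_scaleR_left)
 also have "... <-> ((%y. norm ((f y - f x) /\<^sub>R (y - x) - D)) ---> 0) (at x within A)"
 proof (rule filterlim_cong[OF refl refl])
  show "\<forall>\<^sub>F y in at x within A. norm (f y - f x - (y - x) *. D)/norm (y - x) = norm ((f y - f x) /\<^sub>R (y - x) - D)"
  unfolding eventually_at_filter
  proof (intro always_eventually allI impI)
  fix y assume "y ~= x"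
  hence "(f y - f x) /\<^sub>R (y - x) - D = (f y - f x - (y - x) *. D) /\<^sub>R (y - x)"
  by (simp add: scaleR_diff_right)
  thus "norm (f y - f x - (y - x) *. D)/norm (y - x) = norm ((f y - f x) /\<^sub>R (y - x) - D)"
  by (simp add: divide_inverse mult.commute)
  qed
 qed
 also have "... <-> ((%y. (f y - f x) /\<^sub>R (y - x)) ---> D) (at x within A)"
  by (simp add: tendsto_norm_zero_iff LIM_zero_iff)
 finally show ?thesis .
qed

text \<open>Semigroup orbits are differentiable at time 0 only from the right, hence derivatives
  within the interval.\<close>

lemma DERIV_within_nonpos_imp_le:
 fixes f::"real => real"
 assumes ab: "a <= b"
  and D: "!!s. a <= s ==> s <= b ==> (f has_real_derivative D s) (at s within {a..b})"
  and neg: "!!s. a < s ==> s < b ==> D s <= 0"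
 shows "f b <= f a"
proof (rule DERIV_nonpos_imp_decreasing_open[OF ab])
 show "continuous_on {a..b} f"
  using D by (auto simp: continuous_on_eq_continuous_within intro!: DERIV_continuous)
 fix x assume x: "a < x" "x < b"
 hence "DERIV f x :> D x" using D[of x] by (simp add: at_within_Icc_at)
 with neg[OF x] show "? y. DERIV f x :> y & y <= 0" by blast
qed

locale c0_semigroup =
 fixes S::"real => 'b::banach => 'b"
 assumes lin: "!!t. 0 <= t ==> bounded_linear (S t)"
  and S_0 [simp]: "!!x. S 0 x = x"
  and S_add: "!!s t x. 0 <= s ==> 0 <= t ==> S (s + t) x = S s (S t x)"
  and S_lim_0: "!!x. ((%t. S t x) ---> x) (at_right 0)"
begin

definition gen::"'b => 'b => bool" where
 "gen x y <-> ((%t. (S t x - x) /\<^sub>R t) ---> y) (at_right 0)"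

lemma S_linear: "0 <= t ==> linear (S t)"
 using lin by (rule bounded_linear.linear)

lemma S_near_0: "0 < e ==> EX d>0. !t. 0 <= t --> t < d --> norm (S t x - x) < e"
proof -
 assume "0 < e"
 hence "\<forall>\<^sub>F t in at_right 0. dist (S t x) x < e" using S_lim_0[of x] by (simp add: tendsto_iff)
 then obtain d where d: "0 < d" "!!t. 0 < t ==> t < d ==> dist (S t x) x < e"
  by (auto simp: eventually_at_right_field)
 have "norm (S t x - x) < e" if "0 <= t" "t < d" for t
  using d(2)[of t] that `0 < e` by (cases "t = 0") (auto simp: dist_norm)
 with d(1) show ?thesis by blast
qed

text \<open>No bound uniform in \<open>t\<close> is assumed. If none existed near 0, there would be
  times \<open>t n\<close> tending to 0 with operators of unbounded norm, although every sequence
  \<open>S (t n) y\<close> converges and is bounded; the uniform boundedness principle excludes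
  this.\<close>

lemma bounded_near_0: "EX d>0. ? M. !t x. 0 <= t --> t <= d --> norm (S t x) <= M*norm x"
proof (rule ccontr)
 assume neg: "~ ?thesis"
 have "? t x. 0 <= t & t <= 1/Suc n & real n*norm x < norm (S t x)" for n
  using neg by (meson not_le divide_pos_pos of_nat_0_less_iff zero_less_Suc zero_less_one)
 then obtain t x where t: "!!n. 0 <= t n" "!!n. t n <= 1/Suc n" and x: "!!n. real n*norm (x n) < norm (S (t n) (x n))"
  by metis
 have "? B. !n. norm (S (t n) y) <= B" for y
 proof -
  obtain d where d: "0 < d" "!!t. 0 <= t ==> t < d ==> norm (S t y - y) < 1"
  using S_near_0[of 1 y] by auto
  obtain N where N: "1/Suc N < d" using nat_approx_posE[OF d(1)] .
  have "norm (S (t n) y) <= Max (insert (norm y + 1) ((%n. norm (S (t n) y)) ` {..N}))" for n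
  proof (cases "n <= N")
  case False
  have "t n <= 1/Suc n" by (rule t)
  also have "... <= 1/Suc N" using False by (intro divide_left_mono) auto
  finally have "norm (S (t n) y - y) < 1" using d(2) t(1) N by fastforce
  hence "norm (S (t n) y) <= norm y + 1" using norm_triangle_sub[of "S (t n) y" y] by simp
  thus ?thesis by (simp add: Max_ge_iff)
  next
  case True
  thus ?thesis by (intro Max_ge) auto
  qed
  thus ?thesis by blast
 qed
 from uniform_boundedness[OF lin[OF t(1)] this]
 obtain B where B: "!!n y. norm (S (t n) y) <= B*norm y" by blast
 obtain n where n: "B < real n" using reals_Archimedean2 by blast
 have "real n*norm (x n) < B*norm (x n)" using x[of n] B[of n "x n"] by linarith
 moreover have "B*norm (x n) <= real n*norm (x n)" using n by (intro mono_r) auto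
 ultimately show False by simp
qed

lemma bounded_on: "EX M>=1. !t x. 0 <= t --> t <= K --> norm (S t x) <= M*norm x"
proof -
 obtain d M0 where d: "0 < d" and M0: "!!t x. 0 <= t ==> t <= d ==> norm (S t x) <= M0*norm x"
  using bounded_near_0 by blast
 define M where "M=max 1 M0"
 have M: "norm (S t x) <= M*norm x" if "0 <= t" "t <= d" for t x
  using M0[OF that, of x] mono_r[of M0 M "norm x"] by (simp add: M_def)
 have M1: "1 <= M" by (simp add: M_def)
 have *: "norm (S t x) <= M ^ Suc n*norm x" if "0 <= t" "t <= real (Suc n)*d" for n t x
  using that
 proof (induction n arbitrary: t)
  case 0
  thus ?case using M by simp
 next
  case (Suc n)
  show ?case
  proof (cases "t <= d")
  case True
  have "norm (S t x) <= M*norm x" using M Suc.prems True by blast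
  also have "... <= M ^ Suc (Suc n)*norm x"
  using M1 self_le_power[of M "Suc (Suc n)"] by (intro mono_r) auto
  finally show ?thesis .
  next
  case False
  have "norm (S t x) = norm (S d (S (t - d) x))"
  using False d S_add[of d "t - d" x] by simp
  also have "... <= M*norm (S (t - d) x)" using d by (intro M) auto
  also have "... <= M*(M ^ Suc n*norm x)"
  using Suc.prems False M1 by (intro mono_l Suc.IH) (auto simp: algebra_simps)
  finally show ?thesis by simp
  qed
 qed
 obtain n where n: "K/d < real n" using reals_Archimedean2 by blast
 have "K <= real (Suc n)*d" using n d by (simp add: field_simps)
 hence "!t x. 0 <= t --> t <= K --> norm (S t x) <= M ^ Suc n*norm x"
  using *[of _ n] by fastforce
 thus ?thesis using one_le_power[OF M1] by blast
qed

lemma continuous_S: "continuous_on {0..} (%t. S t x)"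
 unfolding continuous_on_iff
proof (intro ballI allI impI)
 fix t e::real assume t: "t : {0..}" and e: "0 < e"
 obtain M where M1: "1 <= M" and M: "!!s y. 0 <= s ==> s <= t + 1 ==> norm (S s y) <= M*norm y"
  using bounded_on[of "t + 1"] by blast
 obtain d where d: "0 < d" "!!h. 0 <= h ==> h < d ==> norm (S h x - x) < e/M"
  using S_near_0[of "e/M" x] e M1 by auto
 have *: "norm (S (a + h) x - S a x) < e" if "0 <= a" "a <= t + 1" "0 <= h" "h < d" for a h
 proof -
  have "norm (S (a + h) x - S a x) = norm (S a (S h x - x))"
  using that S_add[of a h x] by (simp add: linear_diff[OF S_linear])
  also have "... <= M*norm (S h x - x)" using that by (intro M) auto
  also have "... < M*(e/M)" using M1 d(2)[of h] that by (intro mult_strict_left_mono) auto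
  finally show ?thesis using M1 by simp
 qed
 show "EX d>0. !s:{0..}. dist s t < d --> dist (S s x) (S t x) < e"
 proof (intro exI[of _ "min d 1"] conjI ballI impI)
  fix s assume s: "s : {0..}" "dist s t < min d 1"
  show "dist (S s x) (S t x) < e"
  proof (cases "t <= s")
  case True
  thus ?thesis using *[of t "s - t"] s t by (simp add: dist_norm)
  next
  case False
  thus ?thesis using *[of s "t - s"] s t by (simp add: dist_norm norm_minus_commute)
  qed
 qed (use d in auto)
qed

lemma gen_S: "gen x y ==> 0 <= t ==> gen (S t x) (S t y)"
proof -
 assume g: "gen x y" and t: "0 <= t"
 have "((%h. S t ((S h x - x) /\<^sub>R h)) ---> S t y) (at_right 0)"
  using g unfolding gen_def by (rule bounded_linear.tendsto[OF lin[OF t]])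
 moreover have "\<forall>\<^sub>F h in at_right 0. S t ((S h x - x) /\<^sub>R h) = (S h (S t x) - S t x) /\<^sub>R h"
  using eventually_at_right_less[of 0]
 proof eventually_elim
  case (elim h)
  hence "S h (S t x) = S t (S h x)"
  using S_add[of h t x] S_add[of t h x] t by (simp add: add.commute)
  thus ?case using t by (simp add: linear_diff[OF S_linear] linear_scale[OF S_linear])
 qed
 ultimately show ?thesis unfolding gen_def by (rule Lim_transform_eventually)
qed

lemma has_derivative_S:
 assumes g: "gen x y" and t: "0 <= t"
 shows "((%t. S t x) has_vector_derivative S t y) (at t within {0..})"
 unfolding has_vector_derivative_def has_derivative_within_alt2
proof (intro conjI allI impI)
 show "bounded_linear (%h. h *. S t y)" by (rule bounded_linear_scaleR_left)
 fix e::real assume e: "0 < e"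
 obtain M where M1: "1 <= M" and M: "!!s y. 0 <= s ==> s <= t + 1 ==> norm (S s y) <= M*norm y"
  using bounded_on[of "t + 1"] by blast
 define e' where "e'=e/(2*M)"
 have e': "0 < e'" "M*e' = e/2" using e M1 by (auto simp: e'_def)
 have "\<forall>\<^sub>F h in at_right 0. dist ((S h x - x) /\<^sub>R h) y < e'"
  using g e' unfolding gen_def tendsto_iff by blast
 then obtain d1 where d1: "0 < d1" "!!h. 0 < h ==> h < d1 ==> dist ((S h x - x) /\<^sub>R h) y < e'"
  by (auto simp: eventually_at_right_field)
 obtain d2 where d2: "0 < d2" "!!s. 0 <= s ==> dist s t < d2 ==> dist (S s y) (S t y) < e/2"
  using continuous_S[of y, unfolded continuous_on_iff, rule_format, of t "e/2"] e t by auto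
 \<comment> \<open>A left difference quotient at \<open>t\<close> is a right one based at some
   \<open>s < t\<close>. The bound is uniform in the base point, and continuity of the orbit of
   \<open>y\<close> moves the derivative from \<open>s\<close> to \<open>t\<close>.\<close>
 have *: "norm (S (a + h) x - S a x - h *. S a y) <= e/2*h" if "0 <= a" "a <= t + 1" "0 <= h" "h < d1" for a h
 proof (cases "h = 0")
  case False
  hence h: "0 < h" using that by simp
  have "norm (S h x - x - h *. y) = norm (h *. ((S h x - x) /\<^sub>R h - y))"
  using h by (simp add: scaleR_diff_right)
  also have "... <= h*e'"
  using d1(2)[of h] h that by (simp add: dist_norm)
  finally have 1: "norm (S h x - x - h *. y) <= h*e'" .
  have "norm (S (a + h) x - S a x - h *. S a y) = norm (S a (S h x - x - h *. y))"
  using that S_add[of a h x] by (simp add: linear_diff[OF S_linear] linear_scale[OF S_linear])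
  also have "... <= M*norm (S h x - x - h *. y)" using that by (intro M) auto
  also have "... <= M*(h*e')" using M1 1 by (intro mono_l) auto
  also have "... = e/2*h" using e'(2) by (simp add: mult.commute mult.left_commute)
  finally show ?thesis .
 qed simp
 have "\<forall>\<^sub>F s in at t within {0..}. dist s t < Min {d1, d2, 1}"
  unfolding eventually_at using d1(1) d2(1) by (intro exI[of _ "Min {d1, d2, 1}"]) auto
 moreover have "\<forall>\<^sub>F s in at t within {0..}. s : {0..}" by (simp add: eventually_at_filter)
 ultimately show "\<forall>\<^sub>F s in at t within {0..}. norm (S s x - S t x - (s - t) *. S t y) <= e*norm (s - t)"
 proof eventually_elim
  case (elim s)
  show ?case
  proof (cases "t <= s")
  case True
  have "norm (S s x - S t x - (s - t) *. S t y) <= e/2*(s - t)"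
  using *[of t "s - t"] elim t True by (simp add: dist_norm)
  also have "... <= e*norm (s - t)" using e True by (intro mult_mono) auto
  finally show ?thesis .
  next
  case False
  have 1: "norm (S t x - S s x - (t - s) *. S s y) <= e/2*(t - s)"
  using *[of s "t - s"] elim t False by (simp add: dist_norm)
  have 2: "norm ((t - s) *. (S s y - S t y)) <= e/2*(t - s)"
  using d2(2)[of s] elim False by (simp add: dist_norm mult.commute mono_l)
  have "S s x - S t x - (s - t) *. S t y
  = - (S t x - S s x - (t - s) *. S s y) - (t - s) *. (S s y - S t y)"
  by (simp add: algebra_simps)
  hence "norm (S s x - S t x - (s - t) *. S t y) <= e/2*(t - s) + e/2*(t - s)"
  using norm_triangle_ineq4[of "- (S t x - S s x - (t - s) *. S s y)" "(t - s) *. (S s y - S t y)"] 1 2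
  by (simp only: norm_minus_cancel)
  thus ?thesis using False by simp
  qed
 qed
qed

text \<open>Time averages of an orbit lie in the domain of the generator and converge to its
  starting point; they are the only approximations used, since they also inherit signs and
  bounds.\<close>

definition avg::"real => 'b => 'b" where
 "avg h x = integral {0..h} (%s. S s x) /\<^sub>R h"

lemma integrable_S: "0 <= a ==> (%s. S s x) integrable_on {a..b}"
 by (intro integrable_continuous_real continuous_on_subset[OF continuous_S]) auto

lemma avg_tendsto: "((%h. avg h x) ---> x) (at_right 0)"
proof -
 have "((%u. integral {0..u} (%s. S s x)) has_vector_derivative S 0 x) (at 0 within {0..1})"
  by (rule integral_has_vector_derivative) (auto intro: continuous_on_subset[OF continuous_S])
 hence "((%h. (integral {0..h} (%s. S s x) - integral {0..0} (%s. S s x)) /\<^sub>R (h - 0)) ---> x) (at 0 within {0..1})"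
  by (simp only: has_vector_derivative_iff_quotient S_0)
 hence "((%h. avg h x) ---> x) (at 0 within {0..1})" by (simp add: avg_def[abs_def])
 thus ?thesis by (simp add: at_within_Icc_at_right)
qed

lemma avg_diff: "0 < h ==> avg h (x - y) = avg h x - avg h y"
proof -
 assume h: "0 < h"
 have "integral {0..h} (%s. S s (x - y)) = integral {0..h} (%s. S s x - S s y)"
  by (rule integral_cong) (simp add: linear_diff[OF S_linear])
 also have "... = integral {0..h} (%s. S s x) - integral {0..h} (%s. S s y)"
  by (rule Henstock_Kurzweil_Integration.integral_diff) (auto intro: integrable_S)
 finally show ?thesis by (simp add: avg_def scaleR_diff_right)
qed

lemma S_integral:
 assumes "0 <= k" "0 <= h" "0 <= a"
 shows "S k (integral {a..a + h} (%s. S s x)) = integral {a + k..a + k + h} (%s. S s x)"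
proof -
 have "S k (integral {a..a + h} (%s. S s x)) = integral {a..a + h} (%s. S k (S s x))"
  using integral_linear[OF integrable_S[OF assms(3), where x=x and b = "a + h"] lin[OF assms(1)]] by (simp add: o_def)
 also have "... = integral {a..a + h} (%s. S (s + k) x)"
  by (rule integral_cong) (use assms in "auto simp: S_add[symmetric] add.commute")
 also have "... = integral {a + k..a + k + h} (%s. S s x)"
  using integral_shift_Icc_real[of a "a + h" "%s. S s x" k] by (simp add: o_def algebra_simps)
 finally show ?thesis .
qed

text \<open>\<open>S k\<close> shifts the window of integration from \<open>[0, h]\<close> to
  \<open>[k, h + k]\<close>, so the difference quotient of the average involves only the two end
  pieces of length \<open>k\<close>.\<close>

lemma gen_avg:
 assumes h: "0 < h"
 shows "gen (avg h x) ((S h x - x) /\<^sub>R h)"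
proof -
 let ?I = "%a b. integral {a..b} (%s. S s x)"
 have "((%k. avg k (S h x - x) /\<^sub>R h) ---> (S h x - x) /\<^sub>R h) (at_right 0)"
  by (intro tendsto_intros avg_tendsto)
 moreover have "\<forall>\<^sub>F k in at_right 0. avg k (S h x - x) /\<^sub>R h = (S k (avg h x) - avg h x) /\<^sub>R k"
  using eventually_at_right_less[of 0] eventually_at_right_real[OF h]
 proof eventually_elim
  case (elim k)
  hence k: "0 < k" "k < h" by auto
  have 1: "S k (?I 0 h) = ?I k (h + k)" using S_integral[of k h 0 x] h k by (simp add: add.commute)
  have 2: "?I 0 k + ?I k (h + k) = ?I 0 (h + k)" "?I 0 h + ?I h (h + k) = ?I 0 (h + k)"
  using k h by (auto intro!: Henstock_Kurzweil_Integration.integral_combine integrable_S)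
  have 3: "integral {0..k} (%s. S s (S h x)) = ?I h (h + k)"
  proof -
  have "integral {0..k} (%s. S s (S h x)) = integral {0..k} (%s. S (s + h) x)"
  by (rule integral_cong) (use h in "simp add: S_add")
  also have "... = ?I h (h + k)"
  using integral_shift_Icc_real[of 0 k "%s. S s x" h] by (simp add: o_def algebra_simps)
  finally show ?thesis .
  qed
  have "S k (?I 0 h) - ?I 0 h = ?I h (h + k) - ?I 0 k"
  unfolding 1 using 2 by (simp add: algebra_simps)
  hence "S k (avg h x) - avg h x = (?I h (h + k) - ?I 0 k) /\<^sub>R h"
  using k by (simp add: avg_def linear_scale[OF S_linear] scaleR_diff_right[symmetric])
  moreover have "avg k (S h x - x) = (?I h (h + k) - ?I 0 k) /\<^sub>R k"
  unfolding avg_diff[OF k(1)] unfolding avg_def 3 by (simp add: scaleR_diff_right)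
  ultimately show ?case by (simp add: mult.commute)
 qed
 ultimately show ?thesis unfolding gen_def by (rule Lim_transform_eventually)
qed

end

lemma (in c0_semigroup) gen_dense:
 obtains X where "!!n::nat. ? y. gen (X n) y" "X ----> x"
proof -
 have "filterlim (%n. 1/real (Suc n)) (at_right 0) sequentially"
  unfolding filterlim_at using LIMSEQ_inverse_real_of_nat by (auto simp: inverse_eq_divide)
 from filterlim_compose[OF avg_tendsto this, of x]
 have "(%n. avg (1/real (Suc n)) x) ----> x" .
 with gen_avg[of "1/real (Suc _)" x] show ?thesis by (intro that) auto
qed

text \<open>Derivatives along orbits exist for starting points in the domain of the generator;
  density of the domain and continuity of \<open>f\<close> and \<open>S t\<close> give the
  rest.\<close>

lemma (in c0_semigroup) decreasing_along_S:
 fixes f::"'b => real"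
 assumes cont: "continuous_on UNIV f"
  and f: "!!x y t. gen x y ==> 0 <= t ==>
  ? D. ((%t. f (S t x)) has_real_derivative D) (at t within {0..}) & D <= 0"
  and t: "0 <= t"
 shows "f (S t x) <= f x"
proof -
 have gen: "f (S t z) <= f z" if g: "gen z y" for z y
 proof -
  obtain D where D: "!!s. 0 <= s ==> ((%t. f (S t z)) has_real_derivative D s) (at s within {0..})"
  "!!s. 0 <= s ==> D s <= 0"
  using f[OF g] by metis
  have "f (S t z) <= f (S 0 z)"
  by (rule DERIV_within_nonpos_imp_le[where D=D and a = 0 and b = t and f = "%s. f (S s z)"]) (use D t in \<open>auto intro: DERIV_subset[of _ _ _ "{0..}"]\<close>)
  thus ?thesis by simp
 qed
 obtain X where X: "!!n::nat. ? y. gen (X n) y" "X ----> x" using gen_dense[where x=x] by metis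
 have lim: "(%n. f (Y n)) ----> f y" if "Y ----> y" for Y::"nat => 'b" and y
  using continuous_on_tendsto_compose[OF cont that] by simp
 show ?thesis
 proof (rule LIMSEQ_le)
  show "(%n. f (S t (X n))) ----> f (S t x)"
  by (intro lim bounded_linear.tendsto[OF lin[OF t]] X)
  show "(%n. f (X n)) ----> f x" by (intro lim X)
  show "? N. ALL n>=N. f (S t (X n)) <= f (X n)" using X(1) gen by blast
 qed
qed

section \<open>Translations and Gaussian mollification\<close>

lemma nn_integral_shift:
 fixes c::"'a::euclidean_space"
 assumes [measurable]: "f : BM"
 shows "(NN x. f (x + c)) = (NN x. f x)"
proof -
 have "(NN x. f x) = (\<integral>\<^sup>+x. f x \<partial>distr lborel borel ((+) c))"
  by (simp only: lborel_distr_plus)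
 also have "... = (NN x. f (c + x))" by (subst nn_integral_distr) auto
 finally show ?thesis by (simp add: add.commute)
qed

lemma nn_integral_affine:
 fixes c::"'a::euclidean_space"
 assumes [measurable]: "f : BM" and r: "r ~= 0"
 shows "(NN x. f x) = en (<|r|> ^ DIM('a))*(NN x. f (c + r *. x))"
proof -
 have "(NN x. f x) = (\<integral>\<^sup>+x. f x \<partial>density (distr lborel borel (%x. c + r *. x)) (%_. <|r|>^DIM('a)))"
  using lborel_affine[OF r, of c] by simp
 also have "... = en (<|r|> ^ DIM('a))*(NN x. f (c + r *. x))"
  by (subst nn_integral_density, measurable, subst nn_integral_distr, measurable)
  (simp add: nn_integral_cmult ennreal_power)
 finally show ?thesis .
qed

lemma AE_shift:
 fixes c::"'a::euclidean_space"
 assumes "AL x. P x"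
 shows "AL x. P (x + c)"
proof -
 obtain N where N: "N : sets borel" "emeasure lborel N = 0" "{x. ~ P x} \<subseteq> N"
  using assms by (auto elim!: AE_E)
 have "AL x. x ~: N" using N by (intro AE_not_in) (auto simp: null_sets_def)
 have "emeasure lborel {x. x + c : N} = (NN x. ind N (x + c))"
 proof -
  have "{x. x + c : N} : sets borel" using N(1) by measurable
  moreover have "(%x. ind N (x + c)::ennreal) = ind {x. x + c : N}"
  by (auto simp: ind_def fun_eq_iff)
  ultimately show ?thesis by simp
 qed
 also have "... = 0" using N by (subst nn_integral_shift) auto
 finally have "{x. x + c : N} : null_sets lborel" using N(1) by (auto simp: null_sets_def)
 from AE_not_in[OF this] show ?thesis by eventually_elim (use N(3) in auto)
qed

lemma sqi_shift: "sqi f ==> sqi (%x. f (x + c))"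
proof -
 assume f: "sqi f"
 have [measurable]: "f : BM" using f by (rule sqi_measurable)
 show ?thesis
  using f nn_integral_shift[of "%x. en ((f x)^2)" c] by (simp add: sqi_nn_integral_iff)
qed

definition transl::"'a::euclidean_space => 'a l2 => 'a l2" where
 "transl y u = cls (%x. rep u (x + y))"

lemma rep_transl: "AL x. rep (transl y u) x = rep u (x + y)"
 unfolding transl_def by (rule rep_abs) (simp add: sqi_shift)

lemma transl_abs: "sqi f ==> transl y (cls f) = cls (%x. f (x + y))"
 unfolding transl_def
 by (rule cls_eqI) (auto intro: sqi_shift AE_shift rep_abs)

lemma norm_transl [simp]: "norm (transl y u) = norm u"
proof -
 have "en ((norm (transl y u))^2) = en ((norm u)^2)"
  unfolding transl_def by (subst nn_norm_cls) (auto simp: sqi_shift nn_norm_l2 nn_integral_shift[where f="%x. en ((rep u x)^2)"])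
 hence "(norm (transl y u))^2 = (norm u)^2" by simp
 thus ?thesis by (rule power2_eq_imp_eq) auto
qed

lemma transl_add: "transl y (u + v) = transl y u + transl y v"
 by (rule l2_eqI, use rep_transl[of y "u + v"] AE_shift[OF rep_plus[of u v], of y] rep_plus[of "transl y u" "transl y v"]
  rep_transl[of y u] rep_transl[of y v] in eventually_elim) simp

lemma transl_scale: "transl y (c *. u) = c *. transl y u"
 by (rule l2_eqI, use rep_transl[of y "c *. u"] AE_shift[OF rep_scale[of c u], of y] rep_scale[of c "transl y u"]
  rep_transl[of y u] in eventually_elim) simp

lemma bounded_linear_transl: "bounded_linear (transl y)"
 by (rule bounded_linear_intro[of _ 1]) (auto simp: transl_add transl_scale)

lemma transl_diff: "transl y (u - v) = transl y u - transl y v"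
 using linear_diff[OF bounded_linear.linear[OF bounded_linear_transl]] .

lemma transl_transl: "transl y (transl z u) = transl (y + z) u"
 by (rule l2_eqI, use rep_transl[of y "transl z u"] AE_shift[OF rep_transl[of z u], of y] rep_transl[of "y + z" u]
  in eventually_elim) (simp add: add.assoc)

lemma transl_0 [simp]: "transl 0 u = u"
 by (rule l2_eqI, use rep_transl[of 0 u] in eventually_elim) simp

lemma inner_transl: "inner (transl y u) (transl y v) = inner u v"
 by (simp add: dot_norm transl_add[symmetric])

lemma inner_transl_left: "inner (transl y u) v = inner u (transl (- y) v)"
 using inner_transl[of "- y" "transl y u" v] by (simp add: transl_transl)

lemma l2_dominated_convergence:
 assumes [measurable]: "!!n::nat. f n : BM" "g : BM"
  and h: "sqi h"
  and bound: "!!n. AL x. <|f n x|> <= h x"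
  and lim: "AL x. (%n. f n x) ----> g x"
 shows "!!n. sqi (f n)" "sqi g" "(%n. cls (f n)) ----> cls g"
proof -
 have [measurable]: "h : BM" using h by (rule sqi_measurable)
 have all: "AL x. !n. <|f n x|> <= h x" by (subst AE_all_countable) (use bound in auto)
 show sf: "sqi (f n)" for n
  by (rule sqi_bound[OF h], measurable, use bound[of n] in eventually_elim) auto
 have gb: "AL x. <|g x|> <= h x"
  using lim all
 proof eventually_elim
  fix x assume x: "(%n. f n x) ----> g x" "!n. <|f n x|> <= h x"
  show "<|g x|> <= h x"
  by (rule LIMSEQ_le_const2[OF tendsto_rabs[OF x(1)]]) (use x(2) in auto)
 qed
 show sg: "sqi g"
  by (rule sqi_bound[OF h], measurable, use gb in eventually_elim) auto
 have "(%n. LI x. (f n x - g x)^2) ----> (\<integral>x. 0 \<partial>(lborel::'a measure))"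
 proof (rule integral_dominated_convergence[where w="%x. 4*(h x)^2"])
  show "itg (%x. 4*(h x)^2)" using h by (simp add: sqi_def)
  show "AL x. (%n. (f n x - g x)^2) ----> 0"
  using lim by eventually_elim (auto intro!: tendsto_eq_intros)
  show "AL x. norm ((f n x - g x)^2) <= 4*(h x)^2" for n
  using bound[of n] gb
  proof eventually_elim
  case (elim x)
  hence "<|f n x - g x|> <= 2*h x" by linarith
  hence "<|f n x - g x|>^2 <= (2*h x)^2" by (intro power_mono) auto
  thus ?case by (simp add: power_mult_distrib)
  qed
 qed measurable
 moreover have "(LI x. (f n x - g x)^2) = (norm (cls (f n) - cls g))^2" for n
  unfolding cls_diff[OF sf sg, symmetric] power2_norm_eq_inner
  by (subst inner_abs_cls) (auto intro: sqi_diff sf sg simp: power2_eq_square)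
 ultimately have "(%n. (norm (cls (f n) - cls g))^2) ----> 0" by simp
 hence "(%n. sqrt ((norm (cls (f n) - cls g))^2)) ----> sqrt 0" by (rule tendsto_real_sqrt)
 thus "(%n. cls (f n)) ----> cls g"
  by (simp add: tendsto_norm_zero_iff LIM_zero_iff)
qed

definition transl_cont::"'a::euclidean_space l2 => bool" where
 "transl_cont u <-> ((%y. transl y u) ---> u) (at 0)"

lemma transl_cont_add: "transl_cont u ==> transl_cont v ==> transl_cont (u + v)"
 unfolding transl_cont_def transl_add by (rule tendsto_add)

lemma transl_cont_scale: "transl_cont u ==> transl_cont (c *. u)"
 unfolding transl_cont_def transl_scale by (intro tendsto_intros)

lemma transl_cont_approx:
 assumes "!!e. 0 < e ==> ? v. transl_cont v & norm (u - v) < e"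
 shows "transl_cont u"
 unfolding transl_cont_def tendsto_iff
proof (intro allI impI)
 fix e::real assume "0 < e"
 then obtain v where v: "transl_cont v" "norm (u - v) < e/3" using assms[of "e/3"] by auto
 have "\<forall>\<^sub>F y in at 0. dist (transl y v) v < e/3"
  using v(1) `0 < e` unfolding transl_cont_def tendsto_iff by (metis divide_pos_pos zero_less_numeral)
 thus "\<forall>\<^sub>F y in at 0. dist (transl y u) u < e"
 proof eventually_elim
  case (elim y)
  have "transl y u - u = transl y (u - v) + (transl y v - v) - (u - v)"
  by (simp add: transl_diff)
  from arg_cong[OF this, of norm] have "norm (transl y u - u) <= norm (transl y (u - v)) + norm (transl y v - v) + norm (u - v)"
  using norm_triangle_ineq4[of "transl y (u - v) + (transl y v - v)" "u - v"]
  norm_triangle_ineq[of "transl y (u - v)" "transl y v - v"] by linarith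
  thus ?case using elim v(2) by (simp add: dist_norm)
 qed
qed

lemma sqi_indicator: "A : sets borel ==> sqi (ind A) <-> emeasure lborel A < oo"
proof -
 assume A: "A : sets borel"
 have "(%x. en ((ind A x)^2)) = (%x. ind A x)" by (auto simp: fun_eq_iff ind_def)
 thus ?thesis using A by (simp add: sqi_nn_integral_iff)
qed

text \<open>For \<open>x\<close> in the open set, the indicator at \<open>x + X n\<close> is
  eventually 1; the other points are ignored by the inner product with the indicator itself. As
  translations are isometric, convergence of these inner products is convergence in norm.\<close>

lemma transl_cont_open:
 assumes U: "open U" "emeasure lborel U < oo"
 shows "transl_cont (cls (ind U))"
 unfolding transl_cont_def
 unfolding tendsto_at_iff_sequentially comp_def
proof (intro allI impI)
 fix X::"nat => 'a" assume X: "X ----> 0"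
 let ?ch = "ind U::'a => real"
 have [measurable]: "U : sets borel" using U by simp
 have s: "sqi ?ch" using U by (subst sqi_indicator) auto
 have int: "itg ?ch" using U by (simp add: integrable_indicator_iff)
 have "(%n. LI x. ?ch (x + X n)*?ch x) ----> (LI x. ?ch x*?ch x)"
 proof (rule integral_dominated_convergence[where w= ?ch])
  show "AL x. (%n. ?ch (x + X n)*?ch x) ----> ?ch x*?ch x"
  proof (rule AE_I2)
  fix x
  show "(%n. ?ch (x + X n)*?ch x) ----> ?ch x*?ch x"
  proof (cases "x : U")
  case True
  have "(%n. x + X n) ----> x" using tendsto_add[OF tendsto_const X, of x] by simp
  from topological_tendstoD[OF this U(1) True]
  have "\<forall>\<^sub>F n in sequentially. ?ch x*?ch x = ?ch (x + X n)*?ch x"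
  by eventually_elim (simp add: True)
  thus ?thesis by (rule Lim_transform_eventually[OF tendsto_const])
  qed simp
  qed
  show "AL x. norm (?ch (x + X n)*?ch x) <= ?ch x" for n
  by (auto simp: ind_def)
 qed (use int in measurable)
 hence lim: "(%n. inner (transl (X n) (cls ?ch)) (cls ?ch)) ----> inner (cls ?ch) (cls ?ch)"
  by (simp add: transl_abs[OF s] inner_abs_cls[OF s s] inner_abs_cls[OF sqi_shift[OF s] s])
 have "(norm (transl (X n) u - u))^2 = 2*(inner u u - inner (transl (X n) u) u)" for n and u::"'a l2"
  using inner_transl[of "X n" u u]
  by (simp add: power2_norm_eq_inner inner_diff_left inner_diff_right inner_commute[of u "transl (X n) u"])
 hence "(%n. (norm (transl (X n) (cls ?ch) - cls ?ch))^2) ----> 0"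
  using tendsto_mult[OF tendsto_const[of 2] tendsto_diff[OF tendsto_const[of "inner (cls ?ch) (cls ?ch)"] lim]]
  by simp
 hence "(%n. sqrt ((norm (transl (X n) (cls ?ch) - cls ?ch))^2)) ----> sqrt 0" by (rule tendsto_real_sqrt)
 thus "(%n. transl (X n) (cls ?ch)) ----> cls ?ch"
  by (simp add: tendsto_norm_zero_iff LIM_zero_iff)
qed

text \<open>Induction over nonnegative Borel functions: outer regularity passes from open sets to
  Borel sets of finite measure, dominated convergence to increasing limits.\<close>

lemma transl_cont_abs_nonneg:
 assumes f: "f : BM" "!!x. 0 <= f x"
 shows "sqi f ==> transl_cont (cls f)"
 using f
proof (induction rule: borel_measurable_induct_real)
 case (set A)
 have A: "A : sets borel" using set by simp
 have fin: "emeasure lborel A < oo" using set(2) A by (simp add: sqi_indicator)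
 show ?case
 proof (rule transl_cont_approx)
  fix e::real assume e: "0 < e"
  obtain U where U: "open U" "A \<subseteq> U" "emeasure lborel (U - A) < en (e^2)"
  using outer_regular_lborel[OF A, of "e^2"] e by auto
  have [measurable]: "U : sets borel" "A : sets borel" using U A by auto
  have "emeasure lborel U = emeasure lborel A + emeasure lborel (U - A)"
  using U(2) by (subst plus_emeasure) (auto intro: arg_cong[where f="emeasure lborel"])
  also have "... < oo" using fin U(3) by (auto simp: less_top[symmetric] ennreal_add_eq_top)
  finally have finU: "emeasure lborel U < oo" .
  have sA: "sqi (ind A)" and sU: "sqi (ind U)" using fin finU by (simp_all add: sqi_indicator)
  have "en ((norm (cls (ind A) - cls (ind U)))^2)
  = (NN x. en ((ind A x - ind U x)^2))"
  by (simp add: cls_diff[OF sA sU, symmetric] nn_norm_cls[OF sqi_diff[OF sA sU]])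
  also have "... = (NN x. ind (U - A) x)"
  using U(2) by (intro nn_integral_cong) (auto simp: ind_def)
  also have "... < en (e^2)" using U(3) by simp
  finally have "(norm (cls (ind A) - cls (ind U)))^2 < e^2"
  using e by (simp add: ennreal_less_iff)
  hence "norm (cls (ind A) - cls (ind U)) < e"
  using e by (intro power2_less_imp_less[of _ e]) auto
  with transl_cont_open[OF U(1) finU]
  show "? v. transl_cont v & norm (cls (ind A) - v) < e" by blast
 qed
next
 case (mult u c)
 show ?case
 proof (cases "c = 0")
  case True
  thus ?thesis by (simp add: transl_cont_def zero_l2_def[symmetric] transl_scale[of _ 0 0, simplified])
 next
  case False
  have "sqi u" using sqi_scale[OF mult.prems, of "1/c"] False by simp
  thus ?thesis using mult by (simp add: cls_scale transl_cont_scale)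
 qed
next
 case (add u v)
 have [measurable]: "u : BM" "v : BM" using add by auto
 have "sqi u" "sqi v"
  by (rule sqi_bound[OF add.prems]; use add in "auto intro!: AE_I2")+
 thus ?case using add by (simp add: cls_add transl_cont_add)
next
 case (seq U)
 have m: "U i : BM" "f : BM" for i using seq f by auto
 have le: "U i x <= f x" for i x
 proof (rule incseq_le)
  show "incseq (%i. U i x)" using `incseq U` by (auto simp: incseq_def le_fun_def)
  show "(%i. U i x) ----> f x" using seq by simp
 qed
 have "(%n. cls (U n)) ----> cls f"
  by (rule l2_dominated_convergence[OF m seq.prems]) (use le seq in auto)
 moreover have "sqi (U i)" for i
  by (rule sqi_bound[OF seq.prems m(1)]) (use le seq in "auto intro!: AE_I2 simp: f")
 hence "transl_cont (cls (U i))" for i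
  using seq by blast
 ultimately show ?case
  by (intro transl_cont_approx) (auto dest!: LIMSEQ_D simp: norm_minus_commute)
qed

lemma transl_tendsto_0: "((%y. transl y u) ---> u) (at 0)"
proof -
 define f where "f x = max (rep u x) 0" for x
 define g where "g x = max (- rep u x) 0" for x
 have [measurable]: "f : BM" "g : BM"
  unfolding f_def g_def by measurable
 have s: "sqi f" "sqi g"
  by (rule sqi_bound[OF sqi_rep[of u]]; auto simp: f_def g_def)+
 have "transl_cont (cls f + (-1) *. cls g)"
  by (intro transl_cont_add transl_cont_scale transl_cont_abs_nonneg s) (auto simp: f_def g_def)
 also have "cls f + (-1) *. cls g = cls (%x. f x - g x)"
  using s by (simp add: cls_diff)
 also have "(%x. f x - g x) = rep u" by (auto simp: f_def g_def fun_eq_iff)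
 finally show ?thesis by (simp add: transl_cont_def)
qed

lemma continuous_transl: "continuous_on UNIV (%y. transl y u)"
proof -
 have "((%y. transl y u) ---> transl z u) (at z)" for z
 proof -
  have "((%y. transl (z + y) u) ---> transl z u) (at 0)"
  using transl_tendsto_0[of "transl z u"] by (simp add: transl_transl add.commute)
  thus ?thesis by (subst LIM_offset_zero_iff) auto
 qed
 thus ?thesis by (simp add: continuous_on_def)
qed

section \<open>Polynomial weights, dyadic sums and the Gaussian kernel\<close>

lemma ball_in_borel [measurable]: "ball x r : sets borel"
 by simp

text \<open>A polynomial weight in place of exponentials: it absorbs unit shifts of its argument at
  the price of a factor (\<open>pk_half\<close>) and, for large \<open>K\<close>, is summable
  against every measure of polynomial growth.\<close>

definition pk::"nat => real => real" where "pk K s = 1/(1 + s) ^ K"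

lemma pk_pos: "0 <= s ==> 0 < pk K s"
 by (simp add: pk_def)

lemma pk_nonneg: "0 <= s ==> 0 <= pk K s"
 by (simp add: pk_def)

lemma pk_le_1: "0 <= s ==> pk K s <= 1"
 by (simp add: pk_def divide_le_eq)

lemma pk_antimono: "0 <= s ==> s <= t ==> pk K t <= pk K s"
 unfolding pk_def by (intro divide_left_mono power_mono mult_pos_pos zero_less_power) auto

lemma pk_add: "pk (K + L) s = pk K s*pk L s"
 by (simp add: pk_def power_add)

lemma pk_measurable [measurable]: "pk K : BM"
 unfolding pk_def by measurable

lemma pk_half: "0 <= s ==> t <= s + 1 ==> pk K s <= 2 ^ K*pk K t" if "0 <= t"
proof -
 assume s: "0 <= s" "t <= s + 1"
 have "(1 + t) ^ K <= (2*(1 + s)) ^ K" using s that by (intro power_mono) auto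
 thus "pk K s <= 2 ^ K*pk K t"
  using s that unfolding power_mult_distrib by (simp add: pk_def field_simps)
qed

text \<open>One term of the exponential series gives
  \<open>(1 + s) ^ K <= fact K * exp (1 + s)\<close>, and \<open>(s/2 - 1)^2 >= 0\<close> gives
  \<open>exp (- (s^2/4)) <= exp (1 - s)\<close>; the two exponentials multiply to
  \<open>exp 2\<close>.\<close>

lemma exp_quarter_le_pk: "0 <= s ==> exp (- (s^2/4)) <= fact K*exp 2*pk K s"
proof -
 assume s: "0 <= s"
 have "(1 + s) ^ K/fact K <= exp (1 + s)"
 proof -
  have "(1 + s) ^ K /\<^sub>R fact K <= (\<Sum>n. (1 + s) ^ n /\<^sub>R fact n)"
  using sum_le_suminf[OF summable_exp_generic, of "{K}" "1 + s"] s by simp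
  thus ?thesis by (simp add: exp_def divide_inverse mult.commute)
 qed
 hence 1: "(1 + s) ^ K <= fact K*exp (1 + s)" by (simp add: field_simps)
 have "0 <= (s/2 - 1)^2" by simp
 hence "- (s^2/4) <= 1 - s" by (simp add: power2_eq_square field_simps)
 hence "(1 + s) ^ K*exp (- (s^2/4)) <= (fact K*exp (1 + s))*exp (1 - s)"
  using 1 by (intro mult_mono) auto
 also have "... = fact K*exp 2" by (simp add: mult.assoc flip: exp_add)
 finally show ?thesis using s by (simp add: pk_def field_simps)
qed

text \<open>On the annulus between the radii \<open>2^(j-1) * R\<close> and \<open>2^j * R\<close>
  the weight is at most \<open>2^K / 2^(K*j)\<close>, against a mass of at most
  \<open>A * 2^(D*j)\<close>; as \<open>D < K\<close>, a geometric series of ratio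
  \<open>1/2\<close> dominates.\<close>

lemma nn_dyadic:
 fixes g::"'a::euclidean_space => ennreal" and x::'a
 assumes [measurable]: "g : BM" and R: "0 < R"
  and growth: "!!j::nat. (NN y:ball x (2 ^ j* R). g y) <= A*en (2 ^ (D*j))"
  and K: "D < K"
 shows "(NN y. g y*en (pk K (norm (y - x)/R))) <= en (2 ^ (K + 1))*A"
proof -
 have pw: "en (pk K (norm (y - x)/R)) <= (\<Sum>j. en (2 ^ K/2 ^ (K*j))*ind (ball x (2 ^ j* R)) y)" for y
 proof -
  obtain n where n: "norm (y - x)/R < 2 ^ n" using real_arch_pow[of 2 "norm (y - x)/R"] by auto
  define j where "j=(LEAST n. norm (y - x)/R < 2 ^ n)"
  have j: "norm (y - x)/R < 2 ^ j" unfolding j_def by (rule LeastI[of _ n]) (rule n)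
  have le: "pk K (norm (y - x)/R) <= 2 ^ K/2 ^ (K*j)"
  proof (cases j)
  case 0
  have "pk K (norm (y - x)/R) <= 1" using R by (intro pk_le_1) auto
  also have "1 <= (2::real) ^ K/2 ^ (K*j)" using 0 by simp
  finally show ?thesis .
  next
  case (Suc i)
  have "~ norm (y - x)/R < 2 ^ i" using Suc not_less_Least[of i "%n. norm (y - x)/R < 2 ^ n"] by (simp add: j_def)
  hence "pk K (norm (y - x)/R) <= pk K (2 ^ i)" by (intro pk_antimono) auto
  also have "... <= 1/(2 ^ i) ^ K" unfolding pk_def by (intro divide_left_mono power_mono mult_pos_pos zero_less_power) (auto intro: add_pos_pos)
  also have "... = 2 ^ K/2 ^ (K*j)" using Suc by (simp add: power_mult[symmetric] power_add mult.commute)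
  finally show ?thesis .
  qed
  have "en (pk K (norm (y - x)/R)) <= en (2 ^ K/2 ^ (K*j))*ind (ball x (2 ^ j* R)) y"
  using le j R by (auto simp: ind_def dist_norm norm_minus_commute field_simps intro!: ennreal_leI)
  also have "... <= (\<Sum>j. en (2 ^ K/2 ^ (K*j))*ind (ball x (2 ^ j* R)) y)"
  proof -
  have "f j <= suminf f" for f::"nat => ennreal" using sum_le_suminf[of f "{j}"] by simp
  thus ?thesis .
  qed
  finally show ?thesis .
 qed
 have "(NN y. g y*en (pk K (norm (y - x)/R)))
  <= (NN y. (\<Sum>j. en (2 ^ K/2 ^ (K*j))*(g y*ind (ball x (2 ^ j* R)) y)))"
 proof (rule nn_integral_mono)
  fix y
  have "g y*en (pk K (norm (y - x)/R)) <= g y*(\<Sum>j. en (2 ^ K/2 ^ (K*j))*ind (ball x (2 ^ j* R)) y)"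
  by (intro mono_l pw) auto
  thus "g y*en (pk K (norm (y - x)/R)) <= (\<Sum>j. en (2 ^ K/2 ^ (K*j))*(g y*ind (ball x (2 ^ j* R)) y))"
  by (simp add: ennreal_suminf_cmult[symmetric] mult.left_commute del: ennreal_suminf_cmult)
 qed
 also have "... = (\<Sum>j. en (2 ^ K/2 ^ (K*j))*(NN y:ball x (2 ^ j* R). g y))"
 proof (subst nn_integral_suminf)
  show "(\<Sum>j. NN y. en (2 ^ K/2 ^ (K*j))*(g y*ind (ball x (2 ^ j* R)) y))
  = (\<Sum>j. en (2 ^ K/2 ^ (K*j))*(NN y:ball x (2 ^ j* R). g y))"
  by (intro suminf_cong nn_integral_cmult) measurable
 qed measurable
 also have "... <= (\<Sum>j. en (2 ^ K)*A*en ((1/2) ^ j))"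
 proof (rule suminf_le)
  fix j
  have "en (2 ^ K/2 ^ (K*j))*(NN y:ball x (2 ^ j* R). g y)
  <= en (2 ^ K/2 ^ (K*j))*(A*en (2 ^ (D*j)))"
  by (intro mono_l growth) auto
  also have "... = A*en (2 ^ K/2 ^ (K*j)*2 ^ (D*j))"
  by (subst ennreal_mult) (auto simp: mult_ac)
  also have "... <= A*en (2 ^ K*(1/2) ^ j)"
  proof (intro mono_l ennreal_leI)
  have "2 ^ (D*j)*2 ^ j = (2::real) ^ (Suc D*j)" by (simp add: power_add mult.commute)
  also have "... <= 2 ^ (K*j)" using K by (intro power_increasing mono_r) auto
  finally show "2 ^ K/2 ^ (K*j)*2 ^ (D*j) <= 2 ^ K*(1/2::real) ^ j"
  by (simp add: field_simps power_one_over)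
  qed auto
  also have "... = en (2 ^ K)*A*en ((1/2) ^ j)" by (simp add: ennreal_mult mult_ac)
  finally show "en (2 ^ K/2 ^ (K*j))*(NN y:ball x (2 ^ j* R). g y) <= en (2 ^ K)*A*en ((1/2) ^ j)" .
 qed auto
 also have "... = en (2 ^ K)*A*(\<Sum>j. en ((1/2) ^ j))" by (rule ennreal_suminf_cmult)
 also have "(\<Sum>j. en ((1/2) ^ j)) = en 2"
  by (subst suminf_ennreal2) (auto simp: suminf_geometric summable_geometric)
 also have "en (2 ^ K)*A*en 2 = en (2 ^ (K + 1))*A"
  by (simp add: ennreal_mult mult_ac)
 finally show ?thesis .
qed

lemma nn_integral_pk:
 fixes x::"'a::euclidean_space"
 assumes R: "0 < R" and K: "DIM('a) < K"
 shows "(NN y. en (pk K (norm (y - x)/R))) <= en (2 ^ (K + 1)*unit_ball_vol DIM('a)* R ^ DIM('a))"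
proof -
 have "(NN y. 1*en (pk K (norm (y - x)/R)))
  <= en (2 ^ (K + 1))*en (unit_ball_vol DIM('a)* R ^ DIM('a))"
 proof (rule nn_dyadic[OF _ R _ K])
  fix j::nat
  have "(NN y:ball x (2 ^ j* R). 1) = en (unit_ball_vol DIM('a)*(2 ^ j* R) ^ DIM('a))"
  using R by (simp add: emeasure_ball)
  also have "... = en (unit_ball_vol DIM('a)* R ^ DIM('a))*en (2 ^ (DIM('a)*j))"
  using R by (subst ennreal_mult[symmetric])
  (auto simp: power_mult_distrib power_mult[symmetric] mult_ac intro!: arg_cong[where f=en])
  finally show "(NN y:ball x (2 ^ j* R). 1)
  <= en (unit_ball_vol DIM('a)* R ^ DIM('a))*en (2 ^ (DIM('a)*j))" by simp
 qed auto
 also have "... = en (2 ^ (K + 1)*unit_ball_vol DIM('a)* R ^ DIM('a))"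
  using R by (subst ennreal_mult[symmetric]) (auto simp: mult_ac)
 finally show ?thesis by simp
qed

text \<open>The value is \<open>(4 pi)^(d/2)\<close>. It stays implicit: positivity, and mass 1 of
  the normalised Gaussian, are what matters.\<close>

definition gconst::"'a::euclidean_space itself => real" where
 "gconst _ = enn2real (\<integral>\<^sup>+x. en (exp (- ((norm x)^2/4))) \<partial>(lborel::'a measure))"

abbreviation (input) hd::"'a::euclidean_space itself => real" where
 "hd _ \<equiv> real DIM('a)/2"

syntax
 "_HD" :: "type => real" ("HD'(_')")
 "_PHD" :: "real => type => real" ("_ ^-hd'(_')" [81, 0] 80)
translations
 "HD('a)" => "CONST hd TYPE('a)"
 "t ^-hd('a)" => "t powr (- CONST hd TYPE('a))"

definition gauss::"real => 'a::euclidean_space => real" where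
 "gauss t z = t ^-hd('a)*exp (- ((norm z)^2/(4*t)))/gconst TYPE('a)"

lemma gconst: "0 < gconst TYPE('a::euclidean_space)"
  "(\<integral>\<^sup>+x. en (exp (- ((norm x)^2/4))) \<partial>(lborel::'a measure)) = en (gconst TYPE('a))"
proof -
 let ?I = "\<integral>\<^sup>+x. en (exp (- ((norm x)^2/4))) \<partial>(lborel::'a measure)"
 let ?K = "DIM('a) + 1"
 have "?I <= (\<integral>\<^sup>+x. en (fact ?K*exp 2)*en (pk ?K (norm (x - 0)/1)) \<partial>(lborel::'a measure))"
  by (rule nn_integral_mono)
  (use exp_quarter_le_pk[where K= ?K] in "auto simp: ennreal_mult[symmetric] pk_pos less_imp_le intro!: ennreal_leI")
 also have "... = en (fact ?K*exp 2)*(\<integral>\<^sup>+x. en (pk ?K (norm (x - 0)/1)) \<partial>(lborel::'a measure))"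
  by (rule nn_integral_cmult) measurable
 also have "... < oo"
  using le_less_trans[OF nn_integral_pk[of 1 ?K "0::'a"] ennreal_less_top] by (simp add: ennreal_mult_less_top)
 finally have fin: "?I < oo" .
 thus eq: "?I = en (gconst TYPE('a))" by (simp add: gconst_def less_top)
 have "?I ~= 0"
 proof
  assume "?I = 0"
  hence "AE x in (lborel::'a measure). en (exp (- ((norm x)^2/4))) = 0" by (subst (asm) nn_integral_0_iff_AE) auto
  hence "AE x in (lborel::'a measure). False" by (rule eventually_mono) simp
  thus False by (simp add: eventually_False ae_filter_eq_bot_iff)
 qed
 with eq show "0 < gconst TYPE('a)" by (metis ennreal_eq_0_iff not_less)
qed

lemmas [simp] = gconst(1) gconst(1)[THEN less_imp_le] gconst(1)[THEN less_imp_neq, THEN not_sym]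

lemma gauss_nonneg: "0 <= gauss t (z::'a::euclidean_space)"
 by (simp add: gauss_def)

lemma gauss_minus [simp]: "gauss t (- z) = gauss t z"
 by (simp add: gauss_def)

lemma gauss_measurable [measurable]: "gauss t : BM"
 unfolding gauss_def by measurable

lemma gauss_measurable2 [measurable (raw)]:
 assumes [measurable]: "f : borel_measurable M" "g : borel_measurable M"
 shows "(%x. gauss (f x) (g x)) : borel_measurable M"
 unfolding gauss_def by measurable

lemma powr_half_dim: "0 < t ==> t powr (- hd TYPE('a::euclidean_space)) = 1/sqrt t ^ DIM('a)"
proof -
 assume t: "0 < t"
 have "sqrt t ^ DIM('a) = t powr HD('a)"
 proof -
  have "sqrt t ^ DIM('a) = sqrt t powr real DIM('a)" using t by (subst powr_realpow) auto
  also have "... = (t powr (1/2)) powr real DIM('a)" using t by (subst powr_half_sqrt) auto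
  also have "... = t powr HD('a)" by (subst powr_powr) simp
  finally show ?thesis .
 qed
 thus ?thesis by (simp only: powr_minus_divide)
qed

lemma gauss_scale: "0 < t ==> gauss t (sqrt t *. z) = t ^-hd('a)*gauss 1 (z::'a::euclidean_space)"
 by (simp add: gauss_def power_mult_distrib)

lemma nn_integral_gauss_scale:
 assumes t: "0 < t" and [measurable]: "F : BM"
 shows "(NN y. en (gauss t y)*F y)
  = (\<integral>\<^sup>+y. en (gauss 1 y)*F (sqrt t *. y) \<partial>(lborel::'a::euclidean_space measure))"
proof -
 have "(NN y. en (gauss t y)*F y)
  = en (<|sqrt t|> ^ DIM('a))*(NN y. en (gauss t (0 + sqrt t *. y))*F (0 + sqrt t *. y))"
  using t by (subst nn_integral_affine[of _ "sqrt t" 0]) auto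
 also have "... = (NN y. en (sqrt t ^ DIM('a))*(en (gauss t (sqrt t *. y))*F (sqrt t *. y)))"
  using t by (subst nn_integral_cmult) auto
 also have "... = (\<integral>\<^sup>+y. en (gauss 1 y)*F (sqrt t *. y) \<partial>(lborel::'a::euclidean_space measure))"
 proof (rule nn_integral_cong)
  fix y::'a
  have "en (sqrt t ^ DIM('a))*en (gauss t (sqrt t *. y)) = en (gauss 1 y)"
  using t by (subst ennreal_mult[symmetric]) (auto simp: gauss_nonneg gauss_scale powr_half_dim)
  thus "en (sqrt t ^ DIM('a))*(en (gauss t (sqrt t *. y))*F (sqrt t *. y)) = en (gauss 1 y)*F (sqrt t *. y)"
  by (simp add: mult.assoc[symmetric])
 qed
 finally show ?thesis .
qed

lemma nn_integral_gauss_0: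
 assumes t: "0 < t"
 shows "(\<integral>\<^sup>+y. en (gauss t y) \<partial>(lborel::'a::euclidean_space measure)) = 1"
proof -
 have "(\<integral>\<^sup>+y. en (gauss t y) \<partial>(lborel::'a measure)) = (\<integral>\<^sup>+y. en (gauss 1 y) \<partial>(lborel::'a measure))"
  using nn_integral_gauss_scale[OF t, of "%_. 1"] by simp
 also have "... = (\<integral>\<^sup>+y. en (1/gconst TYPE('a))*en (exp (- ((norm y)^2/4))) \<partial>(lborel::'a measure))"
  by (intro nn_integral_cong) (simp add: gauss_def ennreal_mult[symmetric])
 also have "... = en (1/gconst TYPE('a))*en (gconst TYPE('a))"
  by (subst nn_integral_cmult) (auto simp: gconst)
 also have "... = 1"
  by (subst ennreal_mult[symmetric]) auto
 finally show ?thesis .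
qed

lemma nn_integral_gauss:
 assumes t: "0 < t"
 shows "(NN y. en (gauss t (y - x))) = 1" "(NN y. en (gauss t (x - y))) = 1"
proof -
 show "(NN y. en (gauss t (y - x))) = 1"
  using nn_integral_shift[of "%y. en (gauss t y)" "- x"] nn_integral_gauss_0[OF t, where 'a='a] by simp
 thus "(NN y. en (gauss t (x - y))) = 1"
  by (metis (no_types, lifting) gauss_minus minus_diff_eq nn_integral_cong)
qed

lemma gauss_le_pk:
 "0 < t ==> gauss t z <= fact K*exp 2/gconst TYPE('a)*t ^-hd('a)*pk K (norm (z::'a::euclidean_space)/sqrt t)"
proof -
 assume t: "0 < t"
 have "exp (- ((norm z)^2/(4*t))) <= fact K*exp 2*pk K (norm z/sqrt t)"
  using exp_quarter_le_pk[of "norm z/sqrt t" K] t by (simp add: power_divide mult.commute)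
 thus ?thesis
  using mono_l[of _ _ "t ^-hd('a)"]
  unfolding gauss_def by (fastforce simp: divide_right_mono field_simps)
qed

lemma gauss_le: "0 < t ==> gauss t (z::'a::euclidean_space) <= t ^-hd('a)/gconst TYPE('a)"
 unfolding gauss_def by (intro divide_right_mono mult_left_le) auto

lemma sqi_bounded_integrable:
 assumes [measurable]: "f : BM" and bound: "!!x. <|f x|> <= B" and int: "(NN x. en <|f x|>) < oo"
 shows "sqi f"
proof -
 have "(NN x. en ((f x)^2)) <= (NN x. en B*en <|f x|>)"
 proof (rule nn_integral_mono)
  fix x
  have "(f x)^2 = <|f x|>*<|f x|>" by (simp add: power2_eq_square)
  also have "... <= B*<|f x|>" by (intro mono_r bound) auto
  finally show "en ((f x)^2) <= en B*en <|f x|>"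
  using order_trans[OF abs_ge_zero bound] by (simp add: ennreal_mult[symmetric] ennreal_leI)
 qed
 also have "... = en B*(NN x. en <|f x|>)" by (rule nn_integral_cmult) measurable
 also have "... < oo" using int by (simp add: ennreal_mult_less_top)
 finally show ?thesis by (simp add: sqi_nn_integral_iff)
qed

lemma sqi_gauss: "0 < t ==> sqi (%y. gauss t (y - x))"
 by (rule sqi_bounded_integrable[where B="t ^-hd('a)/gconst TYPE('a::euclidean_space)" for x::'a])
  (auto simp: gauss_nonneg gauss_le nn_integral_gauss)

text \<open>The Gaussian as an element of the Hilbert space, so that \<open>inner u (gk t x)\<close>
  is the free heat flow of \<open>u\<close> at time \<open>t\<close>, evaluated at the point
  \<open>x\<close>.\<close>

definition gk::"real => 'a::euclidean_space => 'a l2" where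
 "gk t x = cls (%y. gauss t (y - x))"

lemma rep_gk: "0 < t ==> AL y. rep (gk t x) y = gauss t (y - x)"
 unfolding gk_def by (rule rep_abs[OF sqi_gauss])

lemma transl_gk: "0 < t ==> transl y (gk t x) = gk t (x - y)"
 unfolding gk_def by (simp add: transl_abs[OF sqi_gauss] algebra_simps)

lemma inner_gk: "0 < t ==> inner u (gk t x) = (LI y. rep u y*gauss t (y - x))"
 unfolding gk_def by (rule inner_cls[OF sqi_gauss])

lemma integrable_gk: "0 < t ==> itg (%y. rep u y*gauss t (y - x))"
 by (rule sqi_mult_integrable[OF sqi_rep sqi_gauss])

lemma continuous_inner_gk: "0 < t ==> continuous_on UNIV (%x. inner u (gk t x))"
proof -
 assume t: "0 < t"
 have "continuous_on UNIV (%x. inner u (transl (- x) (gk t 0)))"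
  by (intro continuous_intros continuous_on_compose2[OF continuous_transl]) auto
 thus ?thesis using t by (simp add: transl_gk)
qed

lemma inner_gk_measurable [measurable]: "0 < t ==> (%x. inner u (gk t x)) : BM"
 by (intro borel_measurable_continuous_onI continuous_inner_gk)

lemma integral_shift:
 fixes f::"'a::euclidean_space => real"
 assumes [measurable]: "f : BM"
 shows "(LI x. f (x + c)) = (LI x. f x)"
  "itg (%x. f (x + c)) <-> itg f"
proof -
 have *: "(LI x. f x) = (LI x. f (c + x))"
 proof -
  have "(LI x. f x) = (\<integral>x. f x \<partial>distr lborel borel ((+) c))" by (simp only: lborel_distr_plus)
  also have "... = (LI x. f (c + x))" by (subst integral_distr) auto
  finally show ?thesis .
 qed
 thus "(LI x. f (x + c)) = (LI x. f x)" by (simp add: add.commute)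
 show "itg (%x. f (x + c)) <-> itg f"
  using nn_integral_shift[of "%x. en (norm (f x))" c] by (simp add: integrable_iff_bounded)
qed

text \<open>The variance of \<open>g\<close> about its mean under the probability density
  \<open>k\<close> is nonnegative.\<close>

lemma weighted_jensen_square:
 assumes [measurable]: "k : borel_measurable M" "g : borel_measurable M"
  and k: "!!x. 0 <= k x" "(\<integral>\<^sup>+x. en (k x) \<partial>M) = 1"
  and int: "integrable M (%x. k x*g x)"
 shows "en ((\<integral>x. k x*g x \<partial>M)^2) <= (\<integral>\<^sup>+x. en (k x*(g x)^2) \<partial>M)"
proof (cases "(\<integral>\<^sup>+x. en (k x*(g x)^2) \<partial>M) = oo")
 case False
 have ik: "integrable M k" using k by (simp add: integrable_iff_bounded)
 have i1: "(\<integral>x. k x \<partial>M) = 1" using k by (simp add: integral_eq_nn_integral)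
 have i2: "integrable M (%x. k x*(g x)^2)"
  using False k by (simp add: integrable_iff_bounded less_top)
 define m where "m=(\<integral>x. k x*g x \<partial>M)"
 have "0 <= (\<integral>x. k x*(g x - m)^2 \<partial>M)" using k by simp
 also have "(\<integral>x. k x*(g x - m)^2 \<partial>M) = (\<integral>x. (k x*(g x)^2 - (2*m)*(k x*g x)) + m^2*k x \<partial>M)"
  by (rule Bochner_Integration.integral_cong) (auto simp: power2_eq_square algebra_simps)
 also have "... = (\<integral>x. k x*(g x)^2 \<partial>M) - m^2"
  using ik i1 i2 int by (simp add: m_def[symmetric] power2_eq_square)
 finally have "m^2 <= (\<integral>x. k x*(g x)^2 \<partial>M)" by simp
 hence "en (m^2) <= en (\<integral>x. k x*(g x)^2 \<partial>M)" by (rule ennreal_leI)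
 also have "... = (\<integral>\<^sup>+x. en (k x*(g x)^2) \<partial>M)"
  using i2 k by (subst nn_integral_eq_integral) auto
 finally show ?thesis by (simp add: m_def)
qed simp

text \<open>Jensen's inequality at each \<open>x\<close>, followed by an exchange of the integrals
  over \<open>x\<close> and over the displacement \<open>y\<close>.\<close>

lemma mollify_error:
 fixes u::"'a::euclidean_space l2"
 assumes t: "0 < t"
 shows "(NN x. en ((inner u (gk t x) - rep u x)^2))
  <= (NN y. en (gauss t y)*en ((norm (transl y u - u))^2))"
proof -
 have "(NN x. en ((inner u (gk t x) - rep u x)^2))
  <= (NN x. (NN y. en (gauss t y*(rep u (x + y) - rep u x)^2)))"
 proof (rule nn_integral_mono)
  fix x::'a
  have g: "itg (gauss t::'a => real)" "(LI y. gauss t (y::'a)) = 1"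
  using nn_integral_gauss[OF t, of "0::'a"] by (auto simp: integrable_iff_bounded gauss_nonneg integral_eq_nn_integral)
  have i: "itg (%y. gauss t y*rep u (x + y))"
  using integral_shift(2)[of "%y. rep u y*gauss t (y - x)" x] integrable_gk[OF t, of u x]
  by (simp add: add.commute mult.commute)
  have "inner u (gk t x) = (LI y. gauss t y*rep u (x + y))"
  using integral_shift(1)[of "%y. rep u y*gauss t (y - x)" x] t
  by (simp add: inner_gk add.commute mult.commute)
  hence eq: "inner u (gk t x) - rep u x = (LI y. gauss t y*(rep u (x + y) - rep u x))"
  using i g by (simp add: right_diff_distrib)
  show "en ((inner u (gk t x) - rep u x)^2) <= (NN y. en (gauss t y*(rep u (x + y) - rep u x)^2))"
  unfolding eq
  by (rule weighted_jensen_square)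
  (use i g nn_integral_gauss[OF t, of "0::'a"] in "auto simp: gauss_nonneg right_diff_distrib")
 qed
 also have "... = (NN y. (NN x. en (gauss t y*(rep u (x + y) - rep u x)^2)))"
  by (rule lborel_pair.Fubini') measurable
 also have "... = (NN y. en (gauss t y)*en ((norm (transl y u - u))^2))"
 proof (rule nn_integral_cong)
  fix y::'a
  have "(NN x. en (gauss t y*(rep u (x + y) - rep u x)^2))
  = en (gauss t y)*(NN x. en ((rep u (x + y) - rep u x)^2))"
  by (subst nn_integral_cmult[symmetric]) (auto simp: ennreal_mult gauss_nonneg)
  also have "(NN x. en ((rep u (x + y) - rep u x)^2)) = en ((norm (transl y u - u))^2)"
  unfolding nn_norm_l2
  by (rule nn_integral_cong_AE, use rep_transl[of y u] rep_minus[of "transl y u" u] in eventually_elim) simp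
  finally show "(NN x. en (gauss t y*(rep u (x + y) - rep u x)^2))
  = en (gauss t y)*en ((norm (transl y u - u))^2)" .
 qed
 finally show ?thesis .
qed

lemma mollify_tendsto:
 fixes u::"'a::euclidean_space l2" and ep::"nat => real"
 assumes e: "!!n. 0 < ep n" "ep ----> 0"
 shows "!!n. sqi (%x. inner u (gk (ep n) x))" "(%n. cls (%x. inner u (gk (ep n) x))) ----> u"
proof -
 have [measurable]: "(%y. norm (transl y u - u)) : BM"
  by (intro borel_measurable_continuous_onI continuous_intros continuous_on_compose2[OF continuous_transl]) auto
 have [measurable]: "(%x. inner u (gk (ep n) x)) : BM" for n
  by (rule inner_gk_measurable[OF e(1)])
 define E where "E n = (\<integral>\<^sup>+y. en (gauss 1 y)*en ((norm (transl (sqrt (ep n) *. y) u - u))^2) \<partial>(lborel::'a measure))" for n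
 have le: "(NN x. en ((inner u (gk (ep n) x) - rep u x)^2)) <= E n" for n
  using mollify_error[OF e(1), of u n] nn_integral_gauss_scale[OF e(1)[of n], of "%y. en ((norm (transl y u - u))^2)"]
  by (simp add: E_def)
 have bd: "(norm (transl y u - u))^2 <= 4*(norm u)^2" for y
 proof -
  have "norm (transl y u - u) <= 2*norm u" using norm_triangle_ineq4[of "transl y u" u] by simp
  hence "(norm (transl y u - u))^2 <= (2*norm u)^2" by (intro power_mono) auto
  thus ?thesis by (simp add: power_mult_distrib)
 qed
 have wfin: "(\<integral>\<^sup>+y. en (gauss 1 y)*en (4*(norm u)^2) \<partial>(lborel::'a measure)) < oo"
  using nn_integral_gauss[of 1 "0::'a"] by (subst nn_integral_multc) auto
 have Elim: "E ----> (\<integral>\<^sup>+y. 0 \<partial>(lborel::'a measure))"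
  unfolding E_def
 proof (rule nn_integral_dominated_convergence[OF _ _ _ _ wfin])
  show "AL y. (%n. en (gauss 1 y)*en ((norm (transl (sqrt (ep n) *. y) u - u))^2)) ----> 0"
  proof (rule AE_I2)
  fix y::'a
  have "(%n. sqrt (ep n) *. y) ----> sqrt 0 *. y" by (intro tendsto_intros e)
  from continuous_on_tendsto_compose[OF continuous_transl this, of u]
  have "(%n. transl (sqrt (ep n) *. y) u) ----> u" by simp
  hence "(%n. gauss 1 y*(norm (transl (sqrt (ep n) *. y) u - u))^2) ----> gauss 1 y*(norm (u - u))^2"
  by (intro tendsto_intros)
  thus "(%n. en (gauss 1 y)*en ((norm (transl (sqrt (ep n) *. y) u - u))^2)) ----> 0"
  by (simp add: ennreal_mult[symmetric] gauss_nonneg tendsto_ennrealI[of _ 0, simplified])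
  qed
  show "AL y. en (gauss 1 y)*en ((norm (transl (sqrt (ep n) *. y) u - u))^2) <= en (gauss 1 y)*en (4*(norm u)^2)" for n
  by (intro AE_I2 mono_l ennreal_leI bd) auto
 qed measurable
 hence Elim0: "E ----> 0" by simp
 have Efin: "E n < oo" for n
 proof -
  have "E n <= (\<integral>\<^sup>+y. en (gauss 1 y)*en (4*(norm u)^2) \<partial>(lborel::'a measure))"
  unfolding E_def by (intro nn_integral_mono mono_l ennreal_leI bd) auto
  thus ?thesis using wfin by (rule le_less_trans)
 qed
 have d: "sqi (%x. inner u (gk (ep n) x) - rep u x)" for n
  using le_less_trans[OF le Efin, of n] by (simp add: sqi_nn_integral_iff)
 show s: "sqi (%x. inner u (gk (ep n) x))" for n using sqi_add[OF d[of n] sqi_rep[of u]] by simp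
 have "en ((norm (cls (%x. inner u (gk (ep n) x)) - u))^2) <= E n" for n
 proof -
  have "cls (%x. inner u (gk (ep n) x)) - u = cls (%x. inner u (gk (ep n) x) - rep u x)"
  by (simp add: cls_diff[OF s sqi_rep])
  thus ?thesis using le[of n] by (simp add: nn_norm_cls[OF d])
 qed
 hence "(%n. en ((norm (cls (%x. inner u (gk (ep n) x)) - u))^2)) ----> 0"
  by (intro tendsto_sandwich[OF _ _ tendsto_const Elim0]) auto
 hence "(%n. (norm (cls (%x. inner u (gk (ep n) x)) - u))^2) ----> 0"
  by (subst (asm) ennreal_0[symmetric], subst (asm) tendsto_ennreal_iff) auto
 hence "(%n. sqrt ((norm (cls (%x. inner u (gk (ep n) x)) - u))^2)) ----> sqrt 0" by (rule tendsto_real_sqrt)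
 thus "(%n. cls (%x. inner u (gk (ep n) x))) ----> u"
  by (simp add: tendsto_norm_zero_iff LIM_zero_iff)
qed

text \<open>Inequalities are proved for inner products with narrow Gaussians, which make sense at
  every point; along such a sequence they become inequalities for representatives almost
  everywhere.\<close>

lemma mollify_AE:
 fixes u::"'a::euclidean_space l2"
 obtains ep::"nat => real" where "!!n. 0 < ep n" "ep ----> 0"
  "AL x. (%n. inner u (gk (ep n) x)) ----> rep u x"
proof -
 define e where "e n = inverse (real (Suc n))" for n
 have e: "0 < e n" "e ----> 0" for n unfolding e_def using LIMSEQ_inverse_real_of_nat by auto
 note m = mollify_tendsto[of e u, OF e]
 obtain r where r: "strict_mono r"
  "AL x. (%n. rep (cls (%x. inner u (gk (e (r n)) x))) x) ----> rep u x"
  using l2_tendsto_AE_subseq[OF m(2)] by blast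
 have "AL x. !n. rep (cls (%x. inner u (gk (e (r n)) x))) x = inner u (gk (e (r n)) x)"
  by (subst AE_all_countable) (auto intro: rep_abs m)
 with r(2) have "AL x. (%n. inner u (gk (e (r n)) x)) ----> rep u x"
  by eventually_elim simp
 moreover have "(%n. e (r n)) ----> 0" using LIMSEQ_subseq_LIMSEQ[OF e(2) r(1)] by (simp add: o_def)
 ultimately show ?thesis using e(1) by (intro that[of "%n. e (r n)"]) auto
qed

lemma gk_total:
 assumes "!!t x. 0 < t ==> inner u (gk t x) = 0"
 shows "u = 0"
proof -
 obtain ep::"nat => real" where e: "!!n. 0 < ep n" "ep ----> 0"
  "AL x. (%n. inner u (gk (ep n) x)) ----> rep u x" using mollify_AE by blast
 from e(3) have *: "AL x. rep u x = 0"
  by eventually_elim (simp add: assms e LIMSEQ_const_iff)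
 show ?thesis by (rule l2_eqI, use rep_zero*in eventually_elim) simp
qed

section \<open>Differentiation in the space of square-integrable functions\<close>

text \<open>By the mean value theorem \<open>K\<close> bounds the difference quotients for all
  parameters near \<open>s0\<close>, so their pointwise limits are limits in norm by dominated
  convergence.\<close>

lemma l2_has_vector_derivative:
 fixes k k'::"real => 'a::euclidean_space => real"
 assumes d: "0 < d"
  and k: "!!s y. <|s - s0|> < d ==> ((%s. k s y) has_real_derivative k' s y) (at s)"
  and sk: "!!s. <|s - s0|> < d ==> sqi (k s)"
  and K: "!!s y. <|s - s0|> < d ==> <|k' s y|> <= K y" "sqi K"
  and [measurable]: "k' s0 : BM"
 shows "((%s. cls (k s)) has_vector_derivative cls (k' s0)) (at s0)" "sqi (k' s0)"
proof -
 show "sqi (k' s0)"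
  by (rule sqi_bound[OF K(2)]) (use K(1)[of s0] d in "auto intro!: AE_I2 order_trans[OF _ abs_ge_self]")
 show "((%s. cls (k s)) has_vector_derivative cls (k' s0)) (at s0)"
  unfolding has_vector_derivative_iff_quotient tendsto_at_iff_sequentially comp_def
 proof (intro allI impI)
  fix X assume X: "!i. X i : UNIV - {s0}" "X ----> s0"
  obtain N where N: "!!n. N <= n ==> <|X n - s0|> < d"
  using LIMSEQ_D[OF X(2) d] by auto
  define Y where "Y n = X (n + N)" for n
  have Y: "Y n ~= s0" "<|Y n - s0|> < d" "Y ----> s0" for n
  using X N LIMSEQ_ignore_initial_segment[OF X(2), of N] by (auto simp: Y_def[abs_def])
  define q where "q n y = (1/(Y n - s0))*(k (Y n) y - k s0 y)" for n y
  have s0: "sqi (k s0)" using sk d by simp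
  have sqd: "sqi (%y. k (Y n) y - k s0 y)" for n by (intro sqi_diff sk Y s0)
  have [measurable]: "q n : BM" for n
  unfolding q_def using sqi_measurable[OF sqd] by measurable
  have "(%n. cls (q n)) ----> cls (k' s0)"
  proof (rule l2_dominated_convergence(3)[OF _ _ K(2)])
  show "AL y. <|q n y|> <= K y" for n
  proof (rule AE_I2)
  fix y
  have seg: "<|z - s0|> < d" if "z : closed_segment s0 (Y n)" for z
  using that Y(2)[of n] by (auto simp: closed_segment_eq_real_ivl split: if_splits)
  have "norm (k (Y n) y - k s0 y) <= K y*norm (Y n - s0)"
  proof (rule differentiable_bound[of "closed_segment s0 (Y n)" "%s. k s y" "%s h. k' s y*h"])
  fix z assume z: "z : closed_segment s0 (Y n)"
  show "((%s. k s y) has_derivative (%h. k' z y*h)) (at z within closed_segment s0 (Y n))"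
  using k[OF seg[OF z], of y] has_derivative_at_withinI by (auto simp: has_field_derivative_def)
  show "onorm (%h. k' z y*h) <= K y"
  using K(1)[OF seg[OF z], of y] by (intro onorm_bound) (auto simp: abs_mult mono_r intro: order_trans[OF abs_ge_zero])
  qed auto
  thus "<|q n y|> <= K y" using Y(1)[of n] by (simp add: q_def abs_mult field_simps)
  qed
  show "AL y. (%n. q n y) ----> k' s0 y"
  proof (rule AE_I2)
  fix y
  have "((%s. (k s y - k s0 y)/(s - s0)) ---> k' s0 y) (at s0)"
  using k[of s0 y] d by (simp add: has_field_derivative_iff)
  hence "(%n. (k (Y n) y - k s0 y)/(Y n - s0)) ----> k' s0 y"
  using Y unfolding tendsto_at_iff_sequentially comp_def by blast
  thus "(%n. q n y) ----> k' s0 y" by (simp add: q_def)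
  qed
  qed measurable
  moreover have "cls (q n) = (cls (k (Y n)) - cls (k s0)) /\<^sub>R (Y n - s0)" for n
  unfolding q_def cls_scale[OF sqd] by (simp add: cls_diff[OF sk[OF Y(2)] s0] inverse_eq_divide)
  ultimately have "(%n. (cls (k (X (n + N))) - cls (k s0)) /\<^sub>R (X (n + N) - s0)) ----> cls (k' s0)"
  by (simp add: Y_def)
  thus "(%n. (cls (k (X n)) - cls (k s0)) /\<^sub>R (X n - s0)) ----> cls (k' s0)"
  by (rule LIMSEQ_offset)
 qed
qed

text \<open>The directional derivative as the generator of translations. Being a limit in norm, it
  allows products and compositions to be handled through difference quotients, which a weak gradient
  does not.\<close>

definition tderiv::"'a::euclidean_space => 'a l2 => 'a l2 => bool" where
 "tderiv e u v <-> ((%s. transl (s *. e) u) has_vector_derivative v) (at 0)"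

lemma tderiv_quotient: "tderiv e u v <-> ((%s. (transl (s *. e) u - u) /\<^sub>R s) ---> v) (at 0)"
 by (simp add: tderiv_def has_vector_derivative_iff_quotient)

text \<open>The adjoint of a translation is the opposite translation; the sign comes from the
  reversed difference quotient.\<close>

lemma tderiv_ibp:
 assumes "tderiv e u u'" "tderiv e v v'"
 shows "inner u' v = - inner u v'"
proof -
 have 1: "((%s. inner ((transl (s *. e) u - u) /\<^sub>R s) v) ---> inner u' v) (at 0)"
  using assms(1) unfolding tderiv_quotient by (intro tendsto_intros)
 have "filterlim uminus (at 0) (at (0::real))"
  unfolding filterlim_at by (auto intro!: tendsto_eq_intros simp: eventually_at_filter)
 with assms(2) have "((%s. (transl (- s *. e) v - v) /\<^sub>R (- s)) ---> v') (at 0)"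
  unfolding tderiv_quotient by (rule filterlim_compose)
 hence "((%s. - inner u ((transl (- s *. e) v - v) /\<^sub>R (- s))) ---> - inner u v') (at 0)"
  by (intro tendsto_intros)
 moreover have "inner ((transl (s *. e) u - u) /\<^sub>R s) v = - inner u ((transl (- s *. e) v - v) /\<^sub>R (- s))" for s
 proof -
  have "inner (transl (s *. e) u - u) v = inner u (transl (- s *. e) v - v)"
  by (simp add: inner_diff_left inner_diff_right inner_transl_left)
  thus ?thesis by simp
 qed
 ultimately have "((%s. inner ((transl (s *. e) u - u) /\<^sub>R s) v) ---> - inner u v') (at 0)" by (simp only:)
 from tendsto_unique[OF _ 1 this] show ?thesis by simp
qed

lemma gauss_moment_bound:
 fixes z::"'a::euclidean_space"
 assumes "0 < t" "j <= L"
 shows "gauss t z*(norm z/sqrt t) ^ j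
  <= fact (K + L)*exp 2/gconst TYPE('a)*t ^-hd('a)*pk K (norm z/sqrt t)"
proof -
 define s where "s=norm z/sqrt t"
 have s: "0 <= s" using assms by (simp add: s_def)
 define C where "C=fact (K + L)*exp 2/gconst TYPE('a)*t ^-hd('a)"
 have C: "0 <= C" by (simp add: C_def)
 have "gauss t z* s ^ j <= C*pk (K + L) s* s ^ j"
  using gauss_le_pk[OF assms(1), of z "K + L"] s by (intro mono_r) (auto simp: C_def s_def)
 also have "... = C*pk K s*(pk L s* s ^ j)" by (simp add: pk_add)
 also have "... <= C*pk K s*1"
 proof (intro mono_l)
  have "s ^ j <= (1 + s) ^ j" using s by (intro power_mono) auto
  also have "... <= (1 + s) ^ L" using s assms by (intro power_increasing) auto
  finally show "pk L s* s ^ j <= 1" using s by (simp add: pk_def)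
 qed (use C s pk_pos[of s K] in auto)
 finally show ?thesis by (simp add: C_def s_def)
qed

lemma sqi_pk:
 assumes "0 < R" "DIM('a) < K"
 shows "sqi (%y::'a::euclidean_space. c*pk K (norm (y - x)/R))"
proof (rule sqi_scale, rule sqi_bounded_integrable[where B=1])
 show "<|pk K (norm (y - x)/R)|> <= 1" for y
  using assms pk_le_1[of "norm (y - x)/R" K] pk_pos[of "norm (y - x)/R" K] by auto
 have "(NN y. en <|pk K (norm (y - x)/R)|>) = (NN y. en (pk K (norm (y - x)/R)))"
  using assms pk_pos[of "norm (_ - x)/R" K] by (intro nn_integral_cong arg_cong[where f=en] abs_of_nonneg) (auto intro: less_imp_le)
 also have "... < oo" using le_less_trans[OF nn_integral_pk[OF assms] ennreal_less_top] by simp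
 finally show "(NN y. en <|pk K (norm (y - x)/R)|>) < oo" .
qed measurable

lemma gauss_translate_deriv:
 fixes z e::"'a::euclidean_space"
 assumes "0 < t"
 shows "((%s. gauss t (z - s *. e)) has_real_derivative gauss t (z - s *. e)*(((z - s *. e) .* e)/(2*t))) (at s)"
proof -
 have 1: "((%s. (norm (z - s *. e))^2) has_real_derivative - (2*((z - s *. e) .* e))) (at s)"
 proof -
  have "(%s. (norm (z - s *. e))^2) = (%s. z .* z - 2* s*(z .* e) + s^2*(e .* e))"
  unfolding power2_norm_eq_inner
  by (simp add: fun_eq_iff inner_diff_left inner_diff_right inner_commute power2_eq_square algebra_simps)
  moreover have "((%s. z .* z - 2* s*(z .* e) + s^2*(e .* e)) has_real_derivative - (2*((z - s *. e) .* e))) (at s)"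
  by (auto intro!: derivative_eq_intros simp: inner_diff_left)
  ultimately show ?thesis by simp
 qed
 have 2: "((%s. - ((norm (z - s *. e))^2/(4*t))) has_real_derivative ((z - s *. e) .* e)/(2*t)) (at s)"
  by (rule DERIV_cong[OF DERIV_minus[OF DERIV_cdivide[OF 1]]]) (use assms in simp)
 show ?thesis
  unfolding gauss_def
  by (rule DERIV_cong[OF DERIV_cdivide[OF DERIV_cmult[OF DERIV_chain2[OF DERIV_exp 2]]]]) (simp add: mult_ac)
qed

lemma gauss_translate_deriv2:
 fixes z e::"'a::euclidean_space"
 assumes t: "0 < t" and e: "norm e = 1"
 shows "((%s. gauss t (z - s *. e)*(((z - s *. e) .* e)/(2*t))) has_real_derivative
  gauss t (z - s *. e)*(((z - s *. e) .* e)^2/(4*t^2) - 1/(2*t))) (at s)"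
proof -
 have 1: "((%s. ((z - s *. e) .* e)/(2*t)) has_real_derivative - (1/(2*t))) (at s)"
  using e t by (auto intro!: derivative_eq_intros simp: inner_diff_left norm_eq_1)
 show ?thesis
  by (rule DERIV_cong[OF DERIV_mult[OF gauss_translate_deriv[OF t] 1]])
  (use t in "simp add: field_simps power2_eq_square")
qed

lemma gauss_time_deriv:
 fixes z::"'a::euclidean_space"
 assumes t: "0 < t"
 shows "((%t. gauss t z) has_real_derivative gauss t z*((norm z)^2/(4*t^2) - HD('a)/t)) (at t)"
proof -
 have 1: "((%t. - ((norm z)^2/(4*t))) has_real_derivative ((norm z)^2)/(4*t^2)) (at t)"
  using t by (auto intro!: derivative_eq_intros simp: field_simps power2_eq_square)
 have 2: "((%t. t ^-hd('a)) has_real_derivative - HD('a)/t*t ^-hd('a)) (at t)"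
 proof -
  have "((%t. t ^-hd('a)) has_real_derivative - HD('a)*t powr (- HD('a) - 1)) (at t)"
  by (rule has_real_derivative_powr[OF t])
  moreover have "t powr (- HD('a) - 1) = t ^-hd('a)/t"
  using t by (subst powr_diff) simp
  ultimately show ?thesis by (simp add: field_simps)
 qed
 show ?thesis
  unfolding gauss_def
  by (rule DERIV_cong[OF DERIV_cdivide[OF DERIV_mult[OF 2 DERIV_chain2[OF DERIV_exp 1]]]])
  (use gconst(1)[where 'a='a] t in "simp add: field_simps")
qed

definition gcon::"'a::euclidean_space itself => real => real" where
 "gcon _ t = fact (DIM('a) + 1 + 2)*exp 2/gconst TYPE('a)*t ^-hd('a)"

text \<open>Up to powers of \<open>t\<close>, all derivatives are dominated by one integrable
  weight, since each factor \<open>norm z / sqrt t\<close> is absorbed by spare powers in the moment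
  bound.\<close>

lemma gauss_deriv_bounds:
 fixes z e::"'a::euclidean_space"
 assumes t: "0 < t" and e: "norm e = 1"
 defines "P \<equiv> gcon TYPE('a) t*pk (DIM('a) + 1) (norm z/sqrt t)"
 shows "gauss t z <= P"
  "<|gauss t z*((z .* e)/(2*t))|> <= P/sqrt t"
  "<|gauss t z*((z .* e)^2/(4*t^2) - 1/(2*t))|> <= P/t"
  "<|gauss t z*((norm z)^2/(4*t^2) - HD('a)/t)|> <= (1 + real DIM('a))*P/t"
proof -
 have m: "gauss t z*(norm z/sqrt t) ^ j <= P" if "j <= 2" for j
  using gauss_moment_bound[OF t that, of z "DIM('a) + 1"] by (simp add: P_def gcon_def)
 have m0: "gauss t z <= P" using m[of 0] by simp
 have m1: "gauss t z*(norm z/sqrt t) <= P" using m[of 1] by simp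
 have m2: "gauss t z*((norm z)^2/t) <= P" using m[of 2] t by (simp add: power_divide)
 have P: "0 <= P" using m0 gauss_nonneg[of t z] by linarith
 have ze: "<|z .* e|> <= norm z" using Cauchy_Schwarz_ineq2[of z e] e by simp
 have ze2: "(z .* e)^2 <= (norm z)^2" using power_mono[OF ze, of 2] by simp
 show "gauss t z <= P" by (rule m0)
 have "<|gauss t z*((z .* e)/(2*t))|> = gauss t z*(<|z .* e|>/(2*t))"
  using t by (simp add: abs_mult gauss_nonneg)
 also have "... <= gauss t z*(norm z/t)"
  using t ze by (intro mono_l frac_le) (auto simp: gauss_nonneg)
 also have "... = gauss t z*(norm z/sqrt t)/sqrt t" using t by (simp add: field_simps)
 also have "... <= P/sqrt t" using t m1 by (intro divide_right_mono) auto
 finally show "<|gauss t z*((z .* e)/(2*t))|> <= P/sqrt t" .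
 have "<|(z .* e)^2/(4*t^2) - 1/(2*t)|> <= (norm z)^2/(4*t^2) + 1/(2*t)"
  using ze2 t by (intro order_trans[OF abs_triangle_ineq4] add_mono) (auto intro: divide_right_mono)
 hence "<|gauss t z*((z .* e)^2/(4*t^2) - 1/(2*t))|> <= gauss t z*((norm z)^2/(4*t^2) + 1/(2*t))"
  by (simp add: abs_mult gauss_nonneg mono_l)
 also have "... = (gauss t z*((norm z)^2/t)/4 + gauss t z/2)/t"
  using t by (simp add: field_simps power2_eq_square)
 also have "... <= P/t" using m0 m2 t P by (intro divide_right_mono) auto
 finally show "<|gauss t z*((z .* e)^2/(4*t^2) - 1/(2*t))|> <= P/t" .
 have "<|(norm z)^2/(4*t^2) - HD('a)/t|> <= (norm z)^2/(4*t^2) + HD('a)/t"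
  using t by (intro order_trans[OF abs_triangle_ineq4] add_mono) auto
 hence "<|gauss t z*((norm z)^2/(4*t^2) - HD('a)/t)|> <= gauss t z*((norm z)^2/(4*t^2) + HD('a)/t)"
  by (simp add: abs_mult gauss_nonneg mono_l)
 also have "... = (gauss t z*((norm z)^2/t)/4 + gauss t z*HD('a))/t"
  using t by (simp add: field_simps power2_eq_square)
 also have "... <= (P + P*real DIM('a))/t"
  using m0 m2 t P mult_mono[OF m0, of "HD('a)" "real DIM('a)"]
  by (intro divide_right_mono add_mono) auto
 also have "... = (1 + real DIM('a))*P/t" by (simp add: algebra_simps)
 finally show "<|gauss t z*((norm z)^2/(4*t^2) - HD('a)/t)|> <= (1 + real DIM('a))*P/t" .
qed

lemma gcon_nonneg: "0 <= gcon TYPE('a::euclidean_space) t"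
 by (simp add: gcon_def)

text \<open>\<open>gk1\<close> and \<open>gk2\<close> are the first and second derivative in the
  centre \<open>x\<close> along \<open>e\<close>; a derivative by translation is minus a derivative
  in the centre.\<close>

definition gk1::"real => 'a => 'a => 'a::euclidean_space l2" where
 "gk1 t e x = cls (%y. gauss t (y - x)*(((y - x) .* e)/(2*t)))"

definition gk2::"real => 'a => 'a => 'a::euclidean_space l2" where
 "gk2 t e x = cls (%y. gauss t (y - x)*(((y - x) .* e)^2/(4*t^2) - 1/(2*t)))"

lemma pk_near:
 fixes y::"'a::euclidean_space"
 assumes t: "0 < t" and e: "norm e = 1" and s: "<|s|> < sqrt t"
 shows "pk K (norm (y - s *. e)/sqrt t) <= 2 ^ K*pk K (norm y/sqrt t)"
proof (rule pk_half)
 have "norm y <= norm (y - s *. e) + <|s|>"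
  using norm_triangle_sub[of y "s *. e"] norm_triangle_ineq[of "y - s *. e" "s *. e"] e by simp
 thus "norm y/sqrt t <= norm (y - s *. e)/sqrt t + 1"
  using t s by (simp add: field_simps)
qed (use t in auto)

lemma gk1_props:
 fixes x e::"'a::euclidean_space"
 assumes t: "0 < t" and e: "norm e = 1"
 shows "sqi (%y. gauss t (y - x)*(((y - x) .* e)/(2*t)))"
  "((%s. gk t (x + s *. e)) has_vector_derivative gk1 t e x) (at 0)"
proof -
 let ?K = "DIM('a) + 1"
 define K where "K y = gcon TYPE('a) t*2 ^ ?K/sqrt t*pk ?K (norm (y - x)/sqrt t)" for y
 have sK: "sqi K" unfolding K_def by (rule sqi_pk) (use t in auto)
 have p2: "sqi (%y. gauss t (y - x - s *. e))" for s using sqi_gauss[OF t, of "x + s *. e"] by (simp add: algebra_simps)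
 have p3: "<|gauss t (y - x - s *. e)*((y - x - s *. e) .* e/(2*t))|> <= K y" if s: "<|s - 0|> < sqrt t" for s y
 proof -
  have "<|gauss t (y - x - s *. e)*((y - x - s *. e) .* e/(2*t))|>
  <= gcon TYPE('a) t*pk ?K (norm (y - x - s *. e)/sqrt t)/sqrt t"
  by (rule gauss_deriv_bounds[OF t e])
  also have "... <= gcon TYPE('a) t*(2 ^ ?K*pk ?K (norm (y - x)/sqrt t))/sqrt t"
  using t s pk_near[OF t e, of s ?K "y - x"] by (intro divide_right_mono mono_l gcon_nonneg) auto
  also have "... = K y" by (simp add: K_def)
  finally show ?thesis .
 qed
 note D = l2_has_vector_derivative[where d="sqrt t" and K = K and ?s0.0 = 0
  and k = "%s y. gauss t ((y - x) - s *. e)" and k' = "%s y. gauss t ((y - x) - s *. e)*((((y - x) - s *. e) .* e)/(2*t))", OF _ gauss_translate_deriv[OF t] p2 p3 sK]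
 show "sqi (%y. gauss t (y - x)*(((y - x) .* e)/(2*t)))"
  "((%s. gk t (x + s *. e)) has_vector_derivative gk1 t e x) (at 0)"
  using D t by (simp_all add: gk_def gk1_def diff_diff_eq)
qed

lemma gk2_props:
 fixes x e::"'a::euclidean_space"
 assumes t: "0 < t" and e: "norm e = 1"
 shows "sqi (%y. gauss t (y - x)*(((y - x) .* e)^2/(4*t^2) - 1/(2*t)))"
  "((%s. gk1 t e (x + s *. e)) has_vector_derivative gk2 t e x) (at 0)"
proof -
 let ?K = "DIM('a) + 1"
 define K where "K y = gcon TYPE('a) t*2 ^ ?K/t*pk ?K (norm (y - x)/sqrt t)" for y
 have sK: "sqi K" unfolding K_def by (rule sqi_pk) (use t in auto)
 have p2: "sqi (%y. gauss t (y - x - s *. e)*((y - x - s *. e) .* e/(2*t)))" for s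
  using gk1_props(1)[OF t e, of "x + s *. e"] by (simp add: algebra_simps)
 have p3: "<|gauss t (y - x - s *. e)*(((y - x - s *. e) .* e)^2/(4*t^2) - 1/(2*t))|> <= K y" if s: "<|s - 0|> < sqrt t" for s y
 proof -
  have "<|gauss t (y - x - s *. e)*(((y - x - s *. e) .* e)^2/(4*t^2) - 1/(2*t))|>
  <= gcon TYPE('a) t*pk ?K (norm (y - x - s *. e)/sqrt t)/t"
  by (rule gauss_deriv_bounds[OF t e])
  also have "... <= gcon TYPE('a) t*(2 ^ ?K*pk ?K (norm (y - x)/sqrt t))/t"
  using t s pk_near[OF t e, of s ?K "y - x"] by (intro divide_right_mono mono_l gcon_nonneg) auto
  also have "... = K y" by (simp add: K_def)
  finally show ?thesis .
 qed
 note D = l2_has_vector_derivative[where d="sqrt t" and K = K and ?s0.0 = 0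
  and k = "%s y. gauss t ((y - x) - s *. e)*((((y - x) - s *. e) .* e)/(2*t))" and k' = "%s y. gauss t ((y - x) - s *. e)*((((y - x) - s *. e) .* e)^2/(4*t^2) - 1/(2*t))", OF _ gauss_translate_deriv2[OF t e] p2 p3 sK]
 show "sqi (%y. gauss t (y - x)*(((y - x) .* e)^2/(4*t^2) - 1/(2*t)))"
  "((%s. gk1 t e (x + s *. e)) has_vector_derivative gk2 t e x) (at 0)"
  using D t by (simp_all add: gk1_def gk2_def diff_diff_eq)
qed

text \<open>The heat equation as a derivative in norm: the squared coordinates of
  \<open>y - x\<close> add up to its squared norm, and the constants \<open>1/(2*t)\<close> to
  \<open>d/(2*t)\<close>.\<close>

lemma gk_time_derivative:
 fixes x::"'a::euclidean_space"
 assumes t: "0 < t"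
 shows "((%t. gk t x) has_vector_derivative (\<Sum>e\<in>Basis. gk2 t e x)) (at t)"
proof -
 let ?K = "DIM('a) + 1"
 define c where "c=(1 + real DIM('a))*gcon TYPE('a) (t/2)*(2/t)"
 have [simp]: "0 <= c" using t gcon_nonneg[where 'a='a, of "t/2"] by (simp add: c_def)
 define K where "K y = c*pk ?K (norm (y - x)/sqrt (2*t))" for y
 have sK: "sqi K" unfolding K_def by (rule sqi_pk) (use t in auto)
 let ?k' = "%t y. gauss t (y - x)*((norm (y - x))^2/(4*t^2) - HD('a)/t)"
 have "((%s. cls (%y. gauss s (y - x))) has_vector_derivative cls (?k' t)) (at t)"
 proof (rule l2_has_vector_derivative(1)[where d="t/2" and K = K and k = "%s y. gauss s (y - x)" and k' = ?k'])
  fix s y assume s: "<|s - t|> < t/2"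
  hence s': "t/2 < s" "s < 2*t" "0 < s" using t by (auto simp: abs_if split: if_splits)
  show "((%s. gauss s (y - x)) has_real_derivative ?k' s y) (at s)" by (rule gauss_time_deriv[OF s'(3)])
  show "sqi (%y. gauss s (y - x))" by (rule sqi_gauss[OF s'(3)])
  obtain e::'a where e: "e : Basis" using nonempty_Basis by blast
  have "<|?k' s y|> <= (1 + real DIM('a))*(gcon TYPE('a) s*pk ?K (norm (y - x)/sqrt s))/s"
  by (rule gauss_deriv_bounds(4)[OF s'(3), of e]) (use e in simp)
  also have "... <= (1 + real DIM('a))*(gcon TYPE('a) (t/2)*pk ?K (norm (y - x)/sqrt (2*t)))/(t/2)"
  proof (intro frac_le mono_l mult_mono)
  show "gcon TYPE('a) s <= gcon TYPE('a) (t/2)"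
  unfolding gcon_def using s' t gconst(1)[where 'a='a] by (intro mono_l powr_mono2') auto
  show "pk ?K (norm (y - x)/sqrt s) <= pk ?K (norm (y - x)/sqrt (2*t))"
  using s' t by (intro pk_antimono divide_left_mono) auto
  show "0 <= pk ?K (norm (y - x)/sqrt s)" using s' by (intro pk_nonneg) auto
  show "0 <= (1 + real DIM('a))*(gcon TYPE('a) (t/2)*pk ?K (norm (y - x)/sqrt (2*t)))"
  using t by (intro mult_nonneg_nonneg gcon_nonneg pk_nonneg) auto
  qed (use s' t gcon_nonneg in auto)
  also have "... = K y" by (simp add: K_def c_def)
  finally show "<|?k' s y|> <= K y" .
 qed (use t sK in auto)
 moreover have "cls (?k' t) = (\<Sum>e\<in>Basis. gk2 t e x)"
 proof (rule l2_eqI)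
  have 1: "AL y. !e:Basis. rep (gk2 t e x) y = gauss t (y - x)*(((y - x) .* e)^2/(4*t^2) - 1/(2*t))"
  unfolding gk2_def by (intro AE_finite_allI rep_abs gk2_props(1) t) auto
  have sum: "?k' t y = (\<Sum>e\<in>Basis. gauss t (y - x)*(((y - x) .* e)^2/(4*t^2) - 1/(2*t)))" for y
  proof -
  have "(norm (y - x))^2 = (\<Sum>e\<in>Basis. ((y - x) .* e)^2)"
  unfolding power2_norm_eq_inner by (subst euclidean_inner) (simp add: power2_eq_square)
  thus ?thesis by (simp add: sum_distrib_left[symmetric] sum_subtractf sum_divide_distrib)
  qed
  have "sqi (?k' t)" unfolding sum by (intro sqi_sum gk2_props(1) t) auto
  from rep_abs[OF this] rep_sum[OF finite_Basis, of "%e. gk2 t e x"] 1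
  show "AL y. rep (cls (?k' t)) y = rep (\<Sum>e\<in>Basis. gk2 t e x) y"
  by eventually_elim (simp only: sum cong: sum.cong)
 qed
 ultimately show ?thesis by (simp add: gk_def)
qed

lemma has_vector_derivative_reflect:
 assumes "(f has_vector_derivative D) (at (0::real))"
 shows "((%s. f (- s)) has_vector_derivative - D) (at 0)"
proof -
 have "((f \<circ> uminus) has_vector_derivative (-1) *. D) (at 0)"
  by (rule vector_diff_chain_at) (use assms in "auto intro!: derivative_eq_intros")
 thus ?thesis by (simp add: o_def)
qed

lemma transl_gk1:
 assumes "0 < t" "norm e = 1"
 shows "transl y (gk1 t e x) = gk1 t e (x - y)"
 unfolding gk1_def transl_abs[OF gk1_props(1)[OF assms]] by (simp add: diff_diff_eq2)

lemma tderiv_gk: "0 < t ==> norm e = 1 ==> tderiv e (gk t x) (- gk1 t e x)"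
 unfolding tderiv_def using has_vector_derivative_reflect[OF gk1_props(2)[of t e x]] by (simp add: transl_gk)

lemma tderiv_gk1: "0 < t ==> norm e = 1 ==> tderiv e (gk1 t e x) (- gk2 t e x)"
 unfolding tderiv_def using has_vector_derivative_reflect[OF gk2_props(2)[of t e x]] by (simp add: transl_gk1)

section \<open>Lebesgue measurable representatives\<close>

text \<open>The notions of the theorem live over the completed measure, whereas product measures and
  Fubini's theorem are applied to Borel functions; \<open>bor\<close> chooses a Borel
  version.\<close>

definition bor::"('a::euclidean_space => real) => 'a => real" where
 "bor f = (SOME g. g : BM & (AL x. f x = g x))"

lemma bor:
 assumes "f : borel_measurable lebesgue"
 shows "bor f : BM" "AL x. f x = bor f x"
proof -
 have "? g. g : BM & (AL x. f x = g x)"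
  using completion_ex_borel_measurable_real[OF assms] by auto
 from someI_ex[OF this] show "bor f : BM" "AL x. f x = bor f x"
  by (auto simp: bor_def)
qed

lemma lebesgue_lborel_integral:
 fixes f g::"'a::euclidean_space => real"
 assumes f: "f : borel_measurable lebesgue" and g: "g : BM" and eq: "AL x. f x = g x"
 shows "(\<integral>x. f x \<partial>lebesgue) = (LI x. g x)" "integrable lebesgue f <-> itg g"
proof -
 have g': "g : borel_measurable lebesgue" using g by (simp add: measurable_completion)
 have eq': "AE x in lebesgue. f x = g x" using eq by (rule AE_completion)
 show "(\<integral>x. f x \<partial>lebesgue) = (LI x. g x)"
  using integral_cong_AE[OF f g' eq'] g by (simp add: integral_completion)
 show "integrable lebesgue f <-> itg g"
  using integrable_cong_AE[OF f g' eq'] g by (simp add: integrable_completion)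
qed

lemma L2_iff: "f : L2 <-> f : borel_measurable lebesgue & sqi (bor f)"
proof (cases "f : borel_measurable lebesgue")
 case True
 note b = bor[OF True]
 have "integrable lebesgue (%x. (f x)^2) <-> itg (%x. (bor f x)^2)"
  by (rule lebesgue_lborel_integral) (use True b in "auto elim: eventually_mono")
 thus ?thesis using True b by (simp add: L2_def sqi_def)
qed (simp add: L2_def)

definition elt::"('a::euclidean_space => real) => 'a l2" where
 "elt f = cls (bor f)"

lemma L2_measurable: "f : L2 ==> f : borel_measurable lebesgue"
 by (simp add: L2_def)

lemma rep_elt: "f : L2 ==> AL x. rep (elt f) x = f x"
proof -
 assume f: "f : L2"
 hence "AL x. rep (elt f) x = bor f x" unfolding elt_def by (intro rep_abs) (simp add: L2_iff)
 with bor(2)[OF L2_measurable[OF f]] show ?thesis by eventually_elim simp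
qed

lemma elt_eqI: "f : L2 ==> AL x. rep u x = f x ==> elt f = u"
proof -
 assume f: "f : L2" and eq: "AL x. rep u x = f x"
 show "elt f = u" by (rule l2_eqI, use rep_elt[OF f] eq in eventually_elim) simp
qed

lemma sqi_L2: "sqi f ==> f : L2"
 unfolding L2_def by (auto simp: sqi_def measurable_completion integrable_completion)

lemma rep_L2 [simp]: "rep u : L2"
 by (rule sqi_L2) simp

lemma elt_rep [simp]: "elt (rep u) = u"
 by (rule elt_eqI) auto

lemma elt_sqi: "sqi f ==> elt f = cls f"
 by (rule elt_eqI[OF sqi_L2]) (auto intro: rep_abs)

lemma inner_elt:
 assumes "f : L2" "g : L2"
 shows "inner (elt f) (elt g) = (\<integral>x. f x*g x \<partial>lebesgue)"
 unfolding inner_l2_def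
 by (rule lebesgue_lborel_integral(1)[symmetric])
  (use L2_measurable[OF assms(1)] L2_measurable[OF assms(2)] in "measurable",
  use rep_elt[OF assms(1)] rep_elt[OF assms(2)] in eventually_elim, simp)

lemma norm_elt: "f : L2 ==> norm (elt f) = L2_norm f"
 by (simp add: norm_eq_sqrt_inner inner_elt L2_norm_def power2_eq_square)

lemma lin_L2:
 assumes "f : L2" "g : L2"
 shows "(%x. a*f x + b*g x) : L2" "elt (%x. a*f x + b*g x) = a *. elt f + b *. elt g"
proof -
 have m: "(%x. a*f x + b*g x) : borel_measurable lebesgue"
  using L2_measurable[OF assms(1)] L2_measurable[OF assms(2)] by measurable
 have ae: "AL x. rep (a *. elt f + b *. elt g) x = a*f x + b*g x"
  using rep_plus[of "a *. elt f" "b *. elt g"] rep_scale[of a "elt f"] rep_scale[of b "elt g"]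
  rep_elt[OF assms(1)] rep_elt[OF assms(2)] by eventually_elim simp
 have "integrable lebesgue (%x. (a*f x + b*g x)^2) <-> itg (%x. (rep (a *. elt f + b *. elt g) x)^2)"
  by (rule lebesgue_lborel_integral) (use m ae in "auto elim: eventually_mono")
 thus L: "(%x. a*f x + b*g x) : L2"
  using m sqi_rep[of "a *. elt f + b *. elt g"] by (simp add: L2_def sqi_def)
 show "elt (%x. a*f x + b*g x) = a *. elt f + b *. elt g"
  by (rule elt_eqI[OF L ae])
qed

section \<open>Weak gradients and translations\<close>

lemma integrable_componentwiseI:
 fixes f::"'b => 'a::euclidean_space"
 assumes "!!e. e : Basis ==> integrable M (%x. f x .* e)"
 shows "integrable M f"
proof -
 have "integrable M (%x. \<Sum>e\<in>Basis. (f x .* e) *. e)"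
  by (intro Bochner_Integration.integrable_sum integrable_scaleR_left assms)
 thus ?thesis by (simp add: euclidean_representation)
qed

lemma emeasure_ball_less_top [simp]: "emeasure lborel (ball (x::'a::euclidean_space) r) < top"
 using emeasure_lborel_ball_finite[of x r] by simp

definition C1c::"('a::euclidean_space => real) => ('a => 'a) => bool" where
 "C1c ph ph' <-> (!x. GDERIV ph x :> ph' x) & continuous_on UNIV ph' &
  (? K. compact K & (!x. x ~: K --> ph x = 0))"

lemma C1c_bounds:
 assumes "C1c ph ph'"
 obtains B R where "!!x. <|ph x|> <= B" "!!x. norm (ph' x) <= B" "0 < R"
  "!!x. R <= norm x ==> ph x = 0" "!!x. R <= norm x ==> ph' x = 0"
proof -
 obtain K where K: "compact K" "!!x. x ~: K ==> ph x = 0" and D: "!!x. GDERIV ph x :> ph' x" and c: "continuous_on UNIV ph'"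
  using assms by (auto simp: C1c_def)
 obtain R0 where R0: "!!x. x : K ==> norm x <= R0" using compact_imp_bounded[OF K(1)] by (auto simp: bounded_iff)
 define R where "R=max R0 0 + 1"
 have out: "x ~: K" if "R <= norm x" for x using R0[of x] that by (auto simp: R_def)
 have D0: "ph' x = 0" if "x ~: K" for x
 proof -
  have "open (- K)" using compact_imp_closed[OF K(1)] by (simp add: open_Compl)
  hence "(ph has_derivative (%h. 0)) (at x)"
  by (intro has_derivative_transform_within_open[OF has_derivative_const, of "- K" _ 0 ph]) (use that K in auto)
  moreover have "(ph has_derivative (%h. inner h (ph' x))) (at x)" using D by (simp add: gderiv_def)
  ultimately have "(%h. inner h (ph' x)) = (%h. 0)" using has_derivative_unique by blast
  hence "inner (ph' x) (ph' x) = 0" by metis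
  thus ?thesis by simp
 qed
 have cph: "continuous_on UNIV ph"
  using D by (auto simp: gderiv_def continuous_on_eq_continuous_within intro: has_derivative_continuous)
 have "bounded (ph ` cball 0 R)" "bounded (ph' ` cball 0 R)"
  by (intro compact_imp_bounded compact_continuous_image continuous_on_subset[OF c] continuous_on_subset[OF cph] compact_cball; simp)+
 then obtain B1 B2 where B: "!!x. x : cball 0 R ==> norm (ph x) <= B1" "!!x. x : cball 0 R ==> norm (ph' x) <= B2"
  unfolding bounded_iff by (metis imageI)
 show ?thesis
 proof (rule that[of "max 0 (max B1 B2)" R])
  show "<|ph x|> <= max 0 (max B1 B2)" for x
  using B(1)[of x] K(2)[OF out, of x] by (cases "norm x <= R") auto
  show "norm (ph' x) <= max 0 (max B1 B2)" for x
  using B(2)[of x] D0[OF out, of x] by (cases "norm x <= R") auto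
 qed (use out K D0 in "auto simp: R_def")
qed

lemma sqi_bounded_support:
 assumes "f : BM" "!!x. <|f x|> <= B" "!!x. R <= norm x ==> f x = 0"
 shows "sqi f"
proof (rule sqi_bound)
 show "sqi (%x. B*ind (ball 0 R) x)"
  by (intro sqi_scale, subst sqi_indicator) auto
 show "AL x. <|f x|> <= <|B*ind (ball 0 R) x|>"
  using assms(2,3) by (intro AE_I2) (auto simp: ind_def not_less intro: order_trans[OF _ abs_ge_self])
qed fact

lemma C1c_measurable:
 assumes "C1c ph ph'"
 shows "ph : BM" "ph' : BM"
proof -
 have "continuous_on UNIV ph" "continuous_on UNIV ph'"
  using assms by (auto simp: C1c_def gderiv_def continuous_on_eq_continuous_within intro: has_derivative_continuous)
 thus "ph : BM" "ph' : BM" by (auto intro: borel_measurable_continuous_onI)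
qed

lemma C1c_sqi:
 assumes "C1c ph ph'"
 shows "sqi ph" "sqi (%x. ph' x .* e)"
proof -
 obtain B R where B: "!!x. <|ph x|> <= B" "!!x. norm (ph' x) <= B"
  "!!x. R <= norm x ==> ph x = 0" "!!x. R <= norm x ==> ph' x = 0"
  using C1c_bounds[OF assms] by metis
 note [measurable] = C1c_measurable[OF assms]
 show "sqi ph" by (rule sqi_bounded_support) (use B in auto)
 show "sqi (%x. ph' x .* e)"
 proof (rule sqi_bounded_support)
  show "<|ph' x .* e|> <= B*norm e" for x
  using Cauchy_Schwarz_ineq2[of "ph' x" e] mono_r[OF B(2)[of x], of "norm e"] by simp
  show "ph' x .* e = 0" if "R <= norm x" for x using B(4)[OF that] by simp
 qed measurable
qed

lemma tderiv_C1c: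
 assumes C: "C1c ph ph'" and e: "norm e = 1"
 shows "tderiv e (cls ph) (cls (%x. ph' x .* e))"
proof -
 obtain B R where B: "!!x. <|ph x|> <= B" "!!x. norm (ph' x) <= B"
  "!!x. R <= norm x ==> ph x = 0" "!!x. R <= norm x ==> ph' x = 0"
  using C1c_bounds[OF C] by metis
 note [measurable] = C1c_measurable[OF C]
 have p1: "((%s. ph (y + s *. e)) has_real_derivative ph' (y + s *. e) .* e) (at s)" for s y
 proof -
  have "(ph has_derivative (%h. h .* ph' (y + s *. e))) (at (y + s *. e))" using C by (simp add: C1c_def gderiv_def)
  moreover have "((%s. y + s *. e) has_derivative (%h. h *. e)) (at s)" by (auto intro!: derivative_eq_intros)
  ultimately have "(ph \<circ> (%s. y + s *. e) has_derivative (%h. h .* ph' (y + s *. e)) \<circ> (%h. h *. e)) (at s)"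
  by (intro diff_chain_at)
  thus ?thesis by (simp add: has_field_derivative_def o_def inner_commute mult_commute_abs)
 qed
 have p2: "sqi (%y. ph (y + s *. e))" for s by (rule sqi_shift[OF C1c_sqi(1)[OF C]])
 have p3: "<|ph' (y + s *. e) .* e|> <= B*ind (ball 0 (R + 1)) y" if s: "<|s - 0|> < 1" for s y
 proof (cases "norm y < R + 1")
  case True
  thus ?thesis using Cauchy_Schwarz_ineq2[of "ph' (y + s *. e)" e] B(2)[of "y + s *. e"] e by simp
 next
  case False
  have "norm y <= norm (y + s *. e) + <|s|>"
  using norm_triangle_ineq4[of "y + s *. e" "s *. e"] e by simp
  hence "ph' (y + s *. e) = 0" using False s by (intro B) auto
  thus ?thesis using False by simp
 qed
 have "sqi (%y. B*ind (ball 0 (R + 1)) y)"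
  by (intro sqi_scale, subst sqi_indicator) auto
 from l2_has_vector_derivative(1)[where d=1 and ?s0.0 = 0 and k = "%s y. ph (y + s *. e)" and k' = "%s y. ph' (y + s *. e) .* e",
  OF _ p1 p2 p3 this]
 show ?thesis unfolding tderiv_def transl_abs[OF C1c_sqi(1)[OF C]] by simp
qed

lemma weak_gradient_inner:
 assumes w: "weak_gradient u g" and u: "u : L2" and g: "g : borel_measurable lebesgue" "integrable lebesgue (%x. (norm (g x))^2)"
  and C: "C1c ph ph'"
 shows "(%x. g x .* e) : L2" "inner (elt u) (cls (%x. ph' x .* e)) = - inner (cls ph) (elt (%x. g x .* e))"
proof -
 have gL: "(%x. g x .* e) : L2" for e
 proof -
  have [measurable]: "g : borel_measurable lebesgue" by fact
  have "integrable lebesgue (%x. (g x .* e)^2)"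
  proof (rule Bochner_Integration.integrable_bound)
  show "integrable lebesgue (%x. (norm (g x))^2*(norm e)^2)" using g by simp
  show "AE x in lebesgue. norm ((g x .* e)^2) <= norm ((norm (g x))^2*(norm e)^2)"
  using Cauchy_Schwarz_ineq[of "g _" e] by (intro AE_I2) (simp add: power2_norm_eq_inner)
  qed measurable
  thus ?thesis by (simp add: L2_def)
 qed
 thus "(%x. g x .* e) : L2" .
 obtain B R where B: "!!x. <|ph x|> <= B" "!!x. norm (ph' x) <= B"
  "!!x. R <= norm x ==> ph x = 0" "!!x. R <= norm x ==> ph' x = 0"
  using C1c_bounds[OF C] by metis
 have m: "ph : borel_measurable lebesgue" "ph' : borel_measurable lebesgue" "u : borel_measurable lebesgue"
  using C1c_measurable[OF C] L2_measurable[OF u] by (auto simp: measurable_completion)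
 have sL: "sqi f ==> h : L2 ==> integrable lebesgue (%x. h x*f x)" for f h::"'a => real"
 proof -
  assume f: "sqi f" and h: "h : L2"
  have "integrable lebesgue (%x. h x*f x) <-> itg (%x. rep (elt h) x*f x)"
  by (rule lebesgue_lborel_integral)
  (use L2_measurable[OF h] measurable_completion[of f lborel borel] sqi_measurable[OF f] rep_elt[OF h]
  in "auto intro: borel_measurable_times elim: eventually_mono")
  thus ?thesis using f by (simp add: sqi_mult_integrable)
 qed
 have i1: "integrable lebesgue (%x. u x *. ph' x)"
  by (rule integrable_componentwiseI) (auto intro!: sL u C1c_sqi[OF C])
 have i2: "integrable lebesgue (%x. ph x *. g x)"
  by (rule integrable_componentwiseI) (auto intro!: sL[OF C1c_sqi(1)[OF C] gL, simplified mult.commute])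
 have "(LINT x|lebesgue. u x *. ph' x) .* e = - (LINT x|lebesgue. ph x *. g x) .* e"
 proof -
  have "(LINT x|lebesgue. u x *. ph' x) = - (LINT x|lebesgue. ph x *. g x)"
  using w C unfolding weak_gradient_def C1c_def by blast
  thus ?thesis by simp
 qed
 hence "(LINT x|lebesgue. u x*(ph' x .* e)) = - (LINT x|lebesgue. ph x*(g x .* e))"
  using integral_inner_left[of e lebesgue "%x. u x *. ph' x"] integral_inner_left[of e lebesgue "%x. ph x *. g x"] i1 i2
  by simp
 thus "inner (elt u) (cls (%x. ph' x .* e)) = - inner (cls ph) (elt (%x. g x .* e))"
  unfolding elt_sqi[OF C1c_sqi(1)[OF C], symmetric] elt_sqi[OF C1c_sqi(2)[OF C], symmetric]
  inner_elt[OF u sqi_L2[OF C1c_sqi(2)[OF C]]] inner_elt[OF sqi_L2[OF C1c_sqi(1)[OF C]] gL] .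
qed

lemma weak_gradientI:
 fixes k::"'a::euclidean_space => 'a l2"
 assumes v: "sqi v"
  and k: "!!ph ph' e. C1c ph ph' ==> e : Basis ==> inner (cls v) (cls (%x. ph' x .* e)) = - inner (cls ph) (k e)"
 shows "weak_gradient v (%x. \<Sum>e\<in>Basis. rep (k e) x *. e)"
 unfolding weak_gradient_def
proof (intro allI impI)
 fix ph and ph'::"'a => 'a"
 assume "(!x. GDERIV ph x :> ph' x) & continuous_on UNIV ph' & (? K. compact K & (!x. x ~: K --> ph x = 0))"
 hence C: "C1c ph ph'" by (simp add: C1c_def)
 let ?g = "%x. \<Sum>e\<in>Basis. rep (k e) x *. e"
 have [measurable]: "v : BM" "ph : BM" "ph' : BM"
  using v C1c_measurable[OF C] by (auto dest: sqi_measurable)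
 have ge: "?g x .* e = rep (k e) x" if "e : Basis" for x e using that by simp
 have i1: "itg (%x. v x *. ph' x)"
  by (rule integrable_componentwiseI) (auto intro!: sqi_mult_integrable v C1c_sqi[OF C])
 have i2: "itg (%x. ph x *. ?g x)"
  by (rule integrable_componentwiseI) (auto simp: ge intro!: sqi_mult_integrable C1c_sqi[OF C])
 have "(LI x. v x *. ph' x) = - (LI x. ph x *. ?g x)"
 proof (rule euclidean_eqI)
  fix e::'a assume e: "e : Basis"
  have "(LI x. v x *. ph' x) .* e = (LI x. v x*(ph' x .* e))"
  using integral_inner_left[of e lborel "%x. v x *. ph' x"] i1 by simp
  also have "... = - inner (cls ph) (k e)"
  using k[OF C e] by (simp add: inner_abs_cls v C1c_sqi[OF C])
  also have "inner (cls ph) (k e) = (LI x. ph x*rep (k e) x)"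
  using inner_abs_cls[OF C1c_sqi(1)[OF C] sqi_rep[of "k e"]] by simp
  also have "... = (LI x. (ph x *. ?g x) .* e)"
  using e by (intro Bochner_Integration.integral_cong) (simp_all add: ge)
  also have "... = (LI x. ph x *. ?g x) .* e" using i2 by (intro integral_inner_left)
  finally show "(LI x. v x *. ph' x) .* e = - (LI x. ph x *. ?g x) .* e" by simp
 qed
 thus "(LINT x|lebesgue. v x *. ph' x) = - (LINT x|lebesgue. ph x *. ?g x)"
  by (subst (1 2) integral_completion) measurable
qed

text \<open>Squaring removes the kink of the positive part, so that a cut-off by positive parts
  remains continuously differentiable.\<close>

lemma DERIV_pos_part_sq: "((%v. (max 0 v)^2) has_real_derivative 2*max 0 v) (at (v::real))"
proof -
 consider "v > 0" | "v < 0" | "v = 0" by linarith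
 thus ?thesis
 proof cases
  case 1
  have "((%v. v^2) has_real_derivative 2*max 0 v) (at v)"
  using 1 by (auto intro!: derivative_eq_intros)
  thus ?thesis
  by (rule has_field_derivative_transform_within_open[of _ _ _ "{0<..}"]) (use 1 in auto)
 next
  case 2
  have "((%v. 0) has_real_derivative 2*max 0 v) (at v)" using 2 by simp
  thus ?thesis
  by (rule has_field_derivative_transform_within_open[of _ _ _ "{..<0}"]) (use 2 in auto)
 next
  case 3
  have "((%y::real. (max 0 y)^2/y) ---> 0) (at 0)"
  proof (rule Lim_null_comparison[of _ "%y. <|y|>"])
  have "norm ((max 0 y)^2/y) <= <|y|>" for y::real
  by (auto simp: max_def power2_eq_square)
  thus "\<forall>\<^sub>F y in at 0. norm ((max 0 y)^2/y) <= <|y|>" by (intro always_eventually) blast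
  qed (auto intro!: tendsto_eq_intros)
  thus ?thesis using 3 by (simp add: has_field_derivative_iff)
 qed
qed

lemma GDERIV_dist_sq: "GDERIV (%y. (y - x) .* (y - x)) y :> 2 *. (y - x)"
 unfolding gderiv_def
 by (auto intro!: derivative_eq_intros simp: fun_eq_iff inner_commute)

text \<open>The Gaussian is \<open>c * E^2\<close> with \<open>E\<close> again Gaussian. Lowering
  \<open>E\<close> by \<open>d n\<close> and taking the positive part gives compact support,
  squaring keeps the function C1, and both it and its derivatives stay dominated by those of the
  Gaussian.\<close>

lemma gauss_cutoff:
 fixes x::"'a::euclidean_space"
 assumes t: "0 < t"
 obtains ph::"nat => 'a => real" and ph' where
  "!!n. C1c (ph n) (ph' n)"
  "!!n y. <|ph n y|> <= gauss t (y - x)"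
  "!!y. (%n. ph n y) ----> gauss t (y - x)"
  "!!n y e. <|ph' n y .* e|> <= <|gauss t (y - x)*(((y - x) .* e)/(2*t))|>"
  "!!y e. (%n. ph' n y .* e) ----> - (gauss t (y - x)*(((y - x) .* e)/(2*t)))"
proof -
 define c where "c=t ^-hd('a)/gconst TYPE('a)"
 have c: "0 <= c" by (simp add: c_def)
 define E where "E y = exp (- (((y - x) .* (y - x))/(8*t)))" for y
 have Epos: "0 < E y" for y by (simp add: E_def)
 have gE: "gauss t (y - x) = c*(E y)^2" for y
 proof -
  have "(E y)^2 = exp (- ((norm (y - x))^2/(4*t)))"
  unfolding E_def power2_norm_eq_inner using t by (simp add: exp_double[symmetric] field_simps)
  thus ?thesis by (simp add: gauss_def c_def)
 qed
 define d where "d n = inverse (real (Suc n))" for n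
 have d: "0 < d n" "d ----> 0" for n unfolding d_def using LIMSEQ_inverse_real_of_nat by auto
 define ph where "ph n y = c*(max 0 (E y - d n))^2" for n y
 define ph' where "ph' n y = (c*(2*max 0 (E y - d n)*(- (E y/(8*t))))) *. (2 *. (y - x))" for n y
 have lim: "(%n. max 0 (E y - d n)) ----> E y" for y
 proof -
  have "(%n. max 0 (E y - d n)) ----> max 0 (E y - 0)" by (intro tendsto_intros d)
  thus ?thesis using Epos[of y] by (simp add: max_def)
 qed
 have le: "max 0 (E y - d n) <= E y" "0 <= max 0 (E y - d n)" for y n using Epos[of y] d(1)[of n] by auto
 have cont: "continuous_on UNIV E" unfolding E_def by (intro continuous_intros) (use t in auto)
 show ?thesis
 proof (rule that[of ph ph'])
  fix n
  show "C1c (ph n) (ph' n)"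
  unfolding C1c_def
  proof (intro conjI allI)
  fix y
  have 1: "DERIV (%s. exp (- (s/(8*t)))) ((y - x) .* (y - x)) :> - (E y/(8*t))"
  unfolding E_def by (rule DERIV_cong[OF DERIV_chain2[OF DERIV_exp DERIV_minus[OF DERIV_cdivide[OF DERIV_ident]]]]) simp
  have 2: "DERIV (%s. c*(max 0 (exp (- (s/(8*t))) - d n))^2) ((y - x) .* (y - x)) :> c*(2*max 0 (E y - d n)*(- (E y/(8*t))))"
  using DERIV_cmult[OF DERIV_chain2[OF DERIV_pos_part_sq DERIV_diff[OF 1 DERIV_const[of "d n"]]], of c]
  by (simp add: E_def)
  show "GDERIV (ph n) y :> ph' n y"
  using GDERIV_DERIV_compose[OF GDERIV_dist_sq 2] unfolding ph_def ph'_def E_def .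
  next
  show "continuous_on UNIV (ph' n)" unfolding ph'_def using t by (intro continuous_intros cont) auto
  show "? K. compact K & (!y. y ~: K --> ph n y = 0)"
  proof (intro exI conjI allI impI)
  \<comment> \<open>Beyond this radius \<open>exp u >= 1 + u\<close> already forces \<open>E\<close>
    below \<open>d n\<close>.\<close>
  show "compact (cball x (sqrt (8*t/d n)))" by simp
  fix y assume "y ~: cball x (sqrt (8*t/d n))"
  hence "sqrt (8*t/d n) < norm (y - x)" by (simp add: dist_norm norm_minus_commute)
  hence "8*t/d n < (norm (y - x))^2"
  using d(1)[of n] t by (metis real_sqrt_less_iff real_sqrt_power real_sqrt_abs abs_norm_cancel)
  hence a: "1/d n < ((y - x) .* (y - x))/(8*t)"
  using t by (simp add: power2_norm_eq_inner field_simps)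
  have "1/d n <= exp (((y - x) .* (y - x))/(8*t))"
  using a exp_ge_add_one_self[of "((y - x) .* (y - x))/(8*t)"] by linarith
  hence "E y <= d n" using d(1)[of n] by (simp add: E_def exp_minus field_simps)
  thus "ph n y = 0" by (simp add: ph_def max_def)
  qed
  qed
  fix y e
  have "(max 0 (E y - d n))^2 <= (E y)^2" by (intro power_mono le)
  thus "<|ph n y|> <= gauss t (y - x)" using c by (simp add: ph_def gE abs_mult mono_l)
  have "<|ph' n y .* e|> = c*(max 0 (E y - d n)*E y)*(<|(y - x) .* e|>/(2*t))"
  using c t Epos[of y] le[of y n] by (simp add: ph'_def abs_mult)
  also have "... <= c*(E y*E y)*(<|(y - x) .* e|>/(2*t))"
  using c t Epos[of y] le[of y n] by (intro mono_r mono_l) auto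
  also have "... = <|gauss t (y - x)*(((y - x) .* e)/(2*t))|>"
  using c t by (simp add: gE abs_mult power2_eq_square)
  finally show "<|ph' n y .* e|> <= <|gauss t (y - x)*(((y - x) .* e)/(2*t))|>" .
 next
  fix y::'a and e::'a
  show "(%n. ph n y) ----> gauss t (y - x)"
  unfolding ph_def gE by (intro tendsto_intros lim)
  have "(%n. c*(2*max 0 (E y - d n)*(- (E y/(8*t))))*(2*((y - x) .* e)))
  ----> c*(2*E y*(- (E y/(8*t))))*(2*((y - x) .* e))"
  by (intro tendsto_intros lim)
  thus "(%n. ph' n y .* e) ----> - (gauss t (y - x)*(((y - x) .* e)/(2*t)))"
  by (simp add: ph'_def gE power2_eq_square mult_ac)
 qed
qed

lemma C1c_ibp_gk:
 fixes U G::"'a::euclidean_space l2"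
 assumes C: "!!ph ph'. C1c ph ph' ==> inner U (cls (%x. ph' x .* e)) = - inner (cls ph) G"
  and t: "0 < t" and e: "norm e = 1"
 shows "inner U (gk1 t e x) = inner (gk t x) G"
proof -
 obtain ph::"nat => 'a => real" and ph' where ph: "!!n. C1c (ph n) (ph' n)"
  "!!n y. <|ph n y|> <= gauss t (y - x)"
  "!!y. (%n. ph n y) ----> gauss t (y - x)"
  "!!n y e. <|ph' n y .* e|> <= <|gauss t (y - x)*(((y - x) .* e)/(2*t))|>"
  "!!y e. (%n. ph' n y .* e) ----> - (gauss t (y - x)*(((y - x) .* e)/(2*t)))"
  using gauss_cutoff[OF t, of x] by blast
 note [measurable] = C1c_measurable[OF ph(1)]
 have 1: "(%n. cls (ph n)) ----> gk t x"
  unfolding gk_def by (rule l2_dominated_convergence(3)[OF _ _ sqi_gauss[OF t, of x]]) (use ph in auto)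
 have 2: "(%n. cls (%y. ph' n y .* e)) ----> cls (%y. - (gauss t (y - x)*(((y - x) .* e)/(2*t))))"
  by (rule l2_dominated_convergence(3)[OF _ _ sqi_abs[OF gk1_props(1)[OF t e, of x]]]) (use ph in auto)
 have "cls (%y. - (gauss t (y - x)*(((y - x) .* e)/(2*t)))) = - gk1 t e x"
  unfolding gk1_def using cls_scale[OF gk1_props(1)[OF t e, of x], of "-1"] by simp
 with 2 have 2: "(%n. cls (%y. ph' n y .* e)) ----> - gk1 t e x" by simp
 have "(%n. inner U (cls (%y. ph' n y .* e))) ----> inner U (- gk1 t e x)" by (intro tendsto_intros 2)
 moreover have "(%n. - inner (cls (ph n)) G) ----> - inner (gk t x) G" by (intro tendsto_intros 1)
 ultimately have "inner U (- gk1 t e x) = - inner (gk t x) G"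
  unfolding C[OF ph(1)] by (rule LIMSEQ_unique)
 thus ?thesis by simp
qed

text \<open>Against any Gaussian, \<open>transl (b *. e) u - u\<close> equals the integral of the
  translates of \<open>g\<close>, by the scalar fundamental theorem of calculus. Gaussians separate
  points, so the identity holds in the space, and the derivative at 0 of that integral of a
  continuous path is \<open>g\<close>.\<close>

lemma tderiv_from_gk_right:
 fixes u g::"'a::euclidean_space l2"
 assumes e: "norm e = 1" and eq: "!!t x. 0 < t ==> inner u (gk1 t e x) = inner (gk t x) g"
 shows "((%s. (transl (s *. e) u - u) /\<^sub>R s) ---> g) (at_right 0)"
proof -
 have cont: "continuous_on A (%s. transl (s *. e) g)" for A
  by (rule continuous_on_compose2[OF continuous_transl]) (auto intro!: continuous_intros)
 have ftc: "transl (b *. e) u - u = integral {0..b} (%s. transl (s *. e) g)" if b: "0 <= b" for b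
 proof -
  have int: "(%s. transl (s *. e) g) integrable_on {0..b}" by (rule integrable_continuous_real[OF cont])
  have "inner (transl (b *. e) u - u - integral {0..b} (%s. transl (s *. e) g)) (gk t x) = 0" if t: "0 < t" for t x
  proof -
  define f where "f s = inner u (gk t (x + s *. e))" for s
  have D: "(f has_real_derivative inner (transl (s *. e) g) (gk t x)) (at s)" for s
  proof -
  have "((%h. inner u (gk t ((x + s *. e) + h *. e))) has_vector_derivative inner u (gk1 t e (x + s *. e))) (at 0)"
  by (rule bounded_linear.has_vector_derivative[OF bounded_linear_inner_right gk1_props(2)[OF t e]])
  hence "((%h. f (h + s)) has_real_derivative inner u (gk1 t e (x + s *. e))) (at 0)"
  by (simp add: f_def has_real_derivative_iff_has_vector_derivative algebra_simps)
  hence "(f has_real_derivative inner u (gk1 t e (x + s *. e))) (at s)"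
  using DERIV_shift[of f _ 0 s] by simp
  also have "inner u (gk1 t e (x + s *. e)) = inner (transl (s *. e) g) (gk t x)"
  using eq[OF t, of "x + s *. e"] inner_transl_left[of "s *. e" g "gk t x"] transl_gk[OF t, of "- (s *. e)" x]
  by (simp add: inner_commute[of "gk t (x + s *. e)" g])
  finally show ?thesis .
  qed
  have "((%s. inner (transl (s *. e) g) (gk t x)) has_integral (f b - f 0)) {0..b}"
  by (rule fundamental_theorem_of_calculus[OF b])
  (use D in "auto simp: has_real_derivative_iff_has_vector_derivative[symmetric] intro: has_field_derivative_at_within")
  moreover have "((%s. inner (transl (s *. e) g) (gk t x)) has_integral inner (integral {0..b} (%s. transl (s *. e) g)) (gk t x)) {0..b}"
  using has_integral_linear[OF integrable_integral[OF int] bounded_linear_inner_left] by (simp add: o_def)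
  ultimately have "f b - f 0 = inner (integral {0..b} (%s. transl (s *. e) g)) (gk t x)"
  by (rule has_integral_unique)
  thus ?thesis using t by (simp add: f_def inner_diff_left inner_transl_left transl_gk)
  qed
  from gk_total[OF this] show ?thesis by simp
 qed
 have "((%b. integral {0..b} (%s. transl (s *. e) g)) has_vector_derivative transl (0 *. e) g) (at 0 within {0..1})"
  by (rule integral_has_vector_derivative[OF cont]) auto
 hence "((%b. (integral {0..b} (%s. transl (s *. e) g) - integral {0..0} (%s. transl (s *. e) g)) /\<^sub>R (b - 0)) ---> g) (at 0 within {0..1})"
  by (simp only: has_vector_derivative_iff_quotient transl_0 scaleR_zero_left)
 hence 1: "((%b. (integral {0..b} (%s. transl (s *. e) g)) /\<^sub>R b) ---> g) (at_right 0)"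
  by (simp add: at_within_Icc_at_right)
 have "\<forall>\<^sub>F b in at_right 0. (integral {0..b} (%s. transl (s *. e) g)) /\<^sub>R b = (transl (b *. e) u - u) /\<^sub>R b"
  using eventually_at_right_less[of 0] by eventually_elim (simp add: ftc)
 from Lim_transform_eventually[OF 1 this] show ?thesis .
qed

text \<open>The left limit in direction \<open>e\<close> is the right limit in direction
  \<open>- e\<close>.\<close>

lemma tderiv_from_gk:
 fixes u g::"'a::euclidean_space l2"
 assumes e: "norm e = 1" and eq: "!!t x. 0 < t ==> inner u (gk1 t e x) = inner (gk t x) g"
 shows "tderiv e u g"
proof -
 have r: "((%s. (transl (s *. e) u - u) /\<^sub>R s) ---> g) (at_right 0)"
  by (rule tderiv_from_gk_right[OF e eq])
 have "gk1 t (- e) x = - gk1 t e x" if "0 < t" for t x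
  unfolding gk1_def using cls_scale[OF gk1_props(1)[OF that e, of x], of "-1"] by simp
 hence "((%s. (transl (s *. (- e)) u - u) /\<^sub>R s) ---> - g) (at_right 0)"
  using e eq by (intro tderiv_from_gk_right) auto
 hence "((%s. - ((transl (s *. (- e)) u - u) /\<^sub>R s)) ---> - (- g)) (at_right 0)" by (rule tendsto_minus)
 hence "((%s. (transl (- s *. e) u - u) /\<^sub>R (- s)) ---> g) (at_right 0)" by simp
 hence "((%s. (transl (s *. e) u - u) /\<^sub>R s) ---> g) (at_left 0)"
  by (simp add: filterlim_at_left_to_right)
 with r show ?thesis unfolding tderiv_quotient by (simp add: filterlim_at_split)
qed

lemma mvt_between:
 fixes G::"real => real"
 assumes "!!v. (G has_real_derivative G' v) (at v)"
 obtains xi where "<|xi - a|> <= <|b|>" "G (a + b) - G a = b*G' xi"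
proof -
 consider "b = 0" | "0 < b" | "b < 0" by linarith
 thus ?thesis
 proof cases
  case 1
  thus ?thesis using that[of a] by simp
 next
  case 2
  then obtain z where "a < z" "z < a + b" "G (a + b) - G a = (a + b - a)*G' z"
  using MVT2[of a "a + b" G G'] assms by auto
  thus ?thesis by (intro that[of z]) auto
 next
  case 3
  then obtain z where "a + b < z" "z < a" "G a - G (a + b) = (a - (a + b))*G' z"
  using MVT2[of "a + b" a G G'] assms by auto
  thus ?thesis by (intro that[of z]) auto
 qed
qed

lemma taylor_quadratic:
 fixes G::"real => real"
 assumes "!!v. (G has_real_derivative G' v) (at v)" "!!v w. <|G' v - G' w|> <= L*<|v - w|>"
 shows "<|G (a + b) - G a - G' a*b|> <= L*b^2"
proof -
 obtain xi where xi: "<|xi - a|> <= <|b|>" "G (a + b) - G a = b*G' xi" using mvt_between[OF assms(1)] .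
 have L0: "0 <= L" using assms(2)[of 1 0] by (simp add: order_trans[OF abs_ge_zero])
 have "<|G (a + b) - G a - G' a*b|> = <|b|>*<|G' xi - G' a|>"
  unfolding xi(2) by (simp add: abs_mult[symmetric] algebra_simps)
 also have "... <= <|b|>*(L*<|b|>)"
  using xi(1) L0 by (intro mono_l order_trans[OF assms(2)]) auto
 also have "... = L*b^2" by (simp add: power2_eq_square mult_ac)
 finally show ?thesis .
qed

lemma lipschitz_1:
 fixes G::"real => real"
 assumes "!!v. (G has_real_derivative G' v) (at v)" "!!v. <|G' v|> <= 1" "G 0 = 0"
 shows "<|G v|> <= <|v|>"
proof -
 obtain xi where "G (0 + v) - G 0 = v *G' xi" using mvt_between[OF assms(1)] .
 thus ?thesis using assms(2)[of xi] assms(3) by (simp add: abs_mult mult_left_le)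
qed

lemma continuous_of_Lipschitz:
 fixes G'::"real => real"
 assumes "!!v w. <|G' v - G' w|> <= L*<|v - w|>"
 shows "continuous_on UNIV G'"
 by (rule lipschitz_on_continuous_on[of L], rule lipschitz_onI)
  (use assms assms[of 1 0] in "auto simp: dist_real_def intro: order_trans[OF abs_ge_zero]")

text \<open>The Taylor remainder of \<open>G\<close> is quadratic in the difference quotient, hence
  controlled in L1 only. Paired with a bounded \<open>ph\<close> it is \<open>O(s)\<close>, which is
  why the chain rule has this weak form.\<close>

lemma l2_chain_rule:
 fixes u g::"'a::euclidean_space l2" and G G'::"real => real"
 assumes e: "tderiv e u g"
  and G: "!!v. (G has_real_derivative G' v) (at v)" "!!v. <|G' v|> <= 1" "!!v w. <|G' v - G' w|> <= L*<|v - w|>" "G 0 = 0"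
  and ph: "sqi ph" "!!x. <|ph x|> <= B" and phe: "tderiv e (cls ph) ph'"
 shows "inner (cls (%x. G (rep u x))) ph' = - inner (cls ph) (cls (%x. G' (rep u x)*rep g x))"
proof -
 have L0: "0 <= L" using G(3)[of 1 0] by (simp add: order_trans[OF abs_ge_zero])
 have B0: "0 <= B" using ph(2)[of undefined] abs_ge_zero order_trans by blast
 have Gm [measurable]: "G : BM"
  using G(1) by (intro borel_measurable_continuous_onI continuous_at_imp_continuous_on ballI DERIV_isCont)
 have G'm [measurable]: "G' : BM"
  by (rule borel_measurable_continuous_onI[OF continuous_of_Lipschitz[OF G(3)]])
 have [measurable]: "ph : BM" using ph by (auto dest: sqi_measurable)
 have sGu: "sqi (%x. G (rep u x))"
  by (rule sqi_bound[OF sqi_rep[of u]]) (use lipschitz_1[OF G(1,2,4)] in auto)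
 have sG'ph: "sqi (%x. G' (rep u x)*ph x)"
  by (rule sqi_bound[OF ph(1)]) (use mono_r[OF G(2), of "<|ph _|>"] in "auto simp: abs_mult")
 have sG'g: "sqi (%x. G' (rep u x)*rep g x)"
  by (rule sqi_bound[OF sqi_rep[of g]]) (use mono_r[OF G(2), of "<|rep g _|>"] in "auto simp: abs_mult")
 define Gu where "Gu=cls (%x. G (rep u x))"
 define f where "f=cls ph"
 define p where "p=cls (%x. G' (rep u x)*ph x)"
 define D where "D s = (transl (s *. e) u - u) /\<^sub>R s" for s
 define R where "R s = inner ((transl (s *. e) Gu - Gu) /\<^sub>R s) f" for s
 have D: "(D ---> g) (at 0)" using e by (simp add: tderiv_quotient D_def[abs_def])
 have bound: "<|R s - inner (D s) p|> <= B*L*<|s|>*(norm (D s))^2" if s: "s ~= 0" for s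
 proof -
  let ?q = "(transl (s *. e) Gu - Gu) /\<^sub>R s"
  let ?h = "%x. rep ?q x*ph x - rep (D s) x*(G' (rep u x)*ph x)"
  have i: "itg (%x. rep ?q x*ph x)" "itg (%x. rep (D s) x*(G' (rep u x)*ph x))"
  by (auto intro: sqi_mult_integrable ph sG'ph)
  have i3: "itg (%x. B*L*<|s|>*(rep (D s) x)^2)" using sqi_rep[of "D s"] by (simp add: sqi_def)
  have "R s - inner (D s) p = (LI x. ?h x)"
  unfolding R_def p_def f_def inner_cls[OF ph(1)] inner_cls[OF sG'ph] using i by simp
  also have "<|...|> <= (LI x. <|?h x|>)" by (rule integral_abs_bound)
  also have "... <= (LI x. B*L*<|s|>*(rep (D s) x)^2)"
  proof (rule integral_mono_AE[OF _ i3])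
  show "itg (%x. <|?h x|>)" using i by simp
  have G1: "AL x. rep Gu x = G (rep u x)" unfolding Gu_def by (rule rep_abs[OF sGu])
  have G2: "AL x. rep (transl (s *. e) Gu) x = G (rep u (x + s *. e))"
  using rep_transl[of "s *. e" Gu] AE_shift[OF G1, of "s *. e"] by eventually_elim simp
  have G3: "AL x. rep ?q x = inverse s*(rep (transl (s *. e) Gu) x - rep Gu x)"
  using rep_scale[of "inverse s" "transl (s *. e) Gu - Gu"] rep_minus[of "transl (s *. e) Gu" Gu]
  by eventually_elim simp
  have D3: "AL x. rep (D s) x = inverse s*(rep (transl (s *. e) u) x - rep u x)"
  unfolding D_def using rep_scale[of "inverse s" "transl (s *. e) u - u"] rep_minus[of "transl (s *. e) u" u]
  by eventually_elim simp
  show "AL x. <|?h x|> <= B*L*<|s|>*(rep (D s) x)^2"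
  using G1 G2 G3 D3 rep_transl[of "s *. e" u]
  proof eventually_elim
  case (elim x)
  define a where "a=rep u x"
  define b where "b=rep (D s) x"
  have ab: "rep u (x + s *. e) = a + s*b" using s elim by (simp add: a_def b_def field_simps)
  have "?h x = (inverse s*(G (a + s*b) - G a - G' a*(s*b)))*ph x"
  proof -
  define q where "q=rep ?q x"
  have q: "q = inverse s*(G (a + s*b) - G a)" using elim ab unfolding q_def a_def by simp
  have "q*ph x - b*(G' a*ph x) = (inverse s*(G (a + s*b) - G a - G' a*(s*b)))*ph x"
  unfolding q using s by (simp add: field_simps)
  thus ?thesis by (simp add: q_def a_def b_def)
  qed
  hence "<|?h x|> = <|G (a + s*b) - G a - G' a*(s*b)|>/<|s|>*<|ph x|>"
  by (simp add: abs_mult divide_inverse mult_ac)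
  also have "... <= (L*(s*b)^2)/<|s|>*B"
  using taylor_quadratic[of G G' L a "s*b", OF G(1,3)] ph(2)[of x] L0
  by (intro mult_mono divide_right_mono) auto
  also have "... = B*L*<|s|>*b^2"
  using s by (simp add: power2_eq_square field_simps abs_if)
  finally show ?case by (simp add: b_def)
  qed
  qed
  also have "... = B*L*<|s|>*(norm (D s))^2" by (simp add: norm_l2_sq)
  finally show ?thesis .
 qed
 have "((%s. R s - inner (D s) p) ---> 0) (at 0)"
 proof (rule Lim_null_comparison)
  show "\<forall>\<^sub>F s in at 0. norm (R s - inner (D s) p) <= B*L*<|s|>*(norm (D s))^2"
  using bound by (auto simp: eventually_at_filter)
  have "((%s. B*L*<|s|>*(norm (D s))^2) ---> B*L*<|0|>*(norm g)^2) (at 0)"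
  by (intro tendsto_intros D)
  thus "((%s. B*L*<|s|>*(norm (D s))^2) ---> 0) (at 0)" by simp
 qed
 moreover have "((%s. inner (D s) p) ---> inner g p) (at 0)" by (intro tendsto_intros D)
 ultimately have R1: "(R ---> inner g p) (at 0)" using tendsto_add by fastforce
 have "filterlim uminus (at 0) (at (0::real))"
  unfolding filterlim_at by (auto intro!: tendsto_eq_intros simp: eventually_at_filter)
 with phe have "((%s. (transl (- s *. e) f - f) /\<^sub>R (- s)) ---> ph') (at 0)"
  unfolding tderiv_quotient f_def by (rule filterlim_compose)
 hence "((%s. - inner Gu ((transl (- s *. e) f - f) /\<^sub>R (- s))) ---> - inner Gu ph') (at 0)"
  by (intro tendsto_intros)
 moreover have "R s = - inner Gu ((transl (- s *. e) f - f) /\<^sub>R (- s))" for s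
 proof -
  have "inner (transl (s *. e) Gu - Gu) f = inner Gu (transl (- s *. e) f - f)"
  by (simp add: inner_diff_left inner_diff_right inner_transl_left)
  thus ?thesis by (simp add: R_def)
 qed
 ultimately have "((%s. R s) ---> - inner Gu ph') (at 0)" by (simp only:)
 with R1 have "inner g p = - inner Gu ph'" using tendsto_unique[of "at (0::real)" R] by (simp add: eta_contract_eq)
 moreover have "inner g p = inner f (cls (%x. G' (rep u x)*rep g x))"
  unfolding p_def f_def inner_cls[OF sG'ph] inner_abs_cls[OF ph(1) sG'g] by (simp add: mult_ac)
 ultimately show ?thesis by (simp add: Gu_def f_def)
qed

section \<open>Positivity and the Duhamel inequality\<close>

definition hasgrad::"'a::euclidean_space l2 => ('a => 'a l2) => bool" where
 "hasgrad v k <-> (!e:Basis. !ph ph'. C1c ph ph' --> inner v (cls (%x. ph' x .* e)) = - inner (cls ph) (k e))"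

text \<open>In one direction cut-offs extend the test functions to Gaussians, which determine the
  derivative; the other is integration by parts for translations.\<close>

lemma hasgrad_iff_tderiv: "hasgrad v k <-> (!e:Basis. tderiv e v (k e))"
proof
 assume "hasgrad v k"
 thus "!e:Basis. tderiv e v (k e)"
  unfolding hasgrad_def by (intro ballI tderiv_from_gk C1c_ibp_gk) auto
next
 assume t: "!e:Basis. tderiv e v (k e)"
 show "hasgrad v k"
  unfolding hasgrad_def
 proof (intro ballI allI impI)
  fix e::'a and ph::"'a => real" and ph' assume e: "e : Basis" and C: "C1c ph ph'"
  have "tderiv e (cls ph) (cls (%x. ph' x .* e))" using e by (intro tderiv_C1c[OF C]) simp
  from tderiv_ibp[OF this, of v "k e"] t e
  show "inner v (cls (%x. ph' x .* e)) = - inner (cls ph) (k e)" by (simp add: inner_commute)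
 qed
qed

definition nn_l2::"'a::euclidean_space l2 => bool" where
 "nn_l2 u <-> (AL x. 0 <= rep u x)"

lemma nn_l2_abs: "sqi f ==> (!!x. 0 <= f x) ==> nn_l2 (cls f)"
 unfolding nn_l2_def using rep_abs[of f] by (auto elim: eventually_mono)

lemma nn_l2_gk: "0 < t ==> nn_l2 (gk t x)"
 unfolding gk_def by (rule nn_l2_abs[OF sqi_gauss]) (auto simp: gauss_nonneg)

lemma nn_l2_inner: "nn_l2 u ==> nn_l2 v ==> 0 <= inner u v"
 unfolding nn_l2_def inner_l2_def
 by (intro integral_nonneg_AE) (auto elim: eventually_elim2)

text \<open>Tested with the negative part of \<open>u\<close>.\<close>

lemma nn_l2_dual:
 assumes "!!v. nn_l2 v ==> 0 <= inner u v"
 shows "nn_l2 u"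
proof -
 define f where "f x = max 0 (- rep u x)" for x
 have [measurable]: "f : BM" unfolding f_def by measurable
 have f: "sqi f" by (rule sqi_bound[OF sqi_rep[of u]]) (auto simp: f_def)
 have "0 <= inner u (cls f)" by (intro assms nn_l2_abs f) (simp add: f_def)
 also have "inner u (cls f) = (LI x. - ((f x)^2))"
  unfolding inner_cls[OF f] by (rule Bochner_Integration.integral_cong) (auto simp: f_def max_def power2_eq_square)
 finally have "(LI x. (f x)^2) <= 0" by simp
 moreover have "0 <= (LI x. (f x)^2)" by simp
 ultimately have "(LI x. (f x)^2) = 0" by simp
 hence "AL x. (f x)^2 = 0"
  using f by (subst (asm) integral_nonneg_eq_0_iff_AE) (auto simp: sqi_def)
 thus ?thesis unfolding nn_l2_def by eventually_elim (auto simp: f_def max_def split: if_splits)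
qed

text \<open>\<open>Phi\<close> is a convex stand-in for half the square of the negative part. The
  derivative of the square has a kink at 0; the logarithmic correction makes \<open>Phi2\<close>
  Lipschitz, as the chain rule for \<open>Phi1\<close> requires, and \<open>Phi\<close> still
  vanishes exactly for \<open>v >= 0\<close>.\<close>

definition negp::"real => real" where "negp v = max 0 (- v)"
definition Phi::"real => real" where "Phi v = (negp v)^2/2 - negp v + ln (1 + negp v)"
definition Phi1::"real => real" where "Phi1 v = - ((negp v)^2/(1 + negp v))"
definition Phi2::"real => real" where "Phi2 v = 1 - 1/(1 + negp v)^2"

lemma negp_nonneg: "0 <= negp v" by (simp add: negp_def)

lemma DERIV_zero_of_quadratic:
 fixes f::"real => real"
 assumes "!!y. <|f y|> <= C*y^2"
 shows "(f has_real_derivative 0) (at 0)"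
proof -
 have f0: "f 0 = 0" using assms[of 0] by simp
 have "((%y. f y/y) ---> 0) (at 0)"
 proof (rule Lim_null_comparison[of _ "%y. C*<|y|>"])
  have "norm (f y/y) <= C*<|y|>" for y
  proof (cases "y = 0")
  case False
  have "norm (f y/y) = <|f y|>/<|y|>" by simp
  also have "... <= C*y^2/<|y|>" using assms[of y] by (intro divide_right_mono) auto
  also have "... = C*<|y|>" using False by (cases "0 < y") (auto simp: power2_eq_square)
  finally show ?thesis .
  qed simp
  thus "\<forall>\<^sub>F y in at 0. norm (f y/y) <= C*<|y|>" by (intro always_eventually) blast
 qed (auto intro!: tendsto_eq_intros)
 thus ?thesis by (simp add: has_field_derivative_iff f0)
qed

text \<open>Away from 0 this is the ordinary chain rule; at the kink the quadratic bound makes the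
  derivative 0 on both sides.\<close>

lemma DERIV_negp_compose:
 fixes f f'::"real => real"
 assumes D: "!!w. 0 < w ==> (f has_real_derivative f' w) (at w)" and f'0: "f' 0 = 0"
  and q: "!!w. 0 <= w ==> <|f w|> <= C*w^2"
 shows "((%v. f (negp v)) has_real_derivative - f' (negp v)) (at v)"
proof -
 have f0: "f 0 = 0" using q[of 0] by simp
 consider "v > 0" | "v < 0" | "v = 0" by linarith
 thus ?thesis
 proof cases
  case 1
  have "((%v. 0) has_real_derivative - f' (negp v)) (at v)" using 1 by (simp add: negp_def f'0)
  thus ?thesis
  by (rule has_field_derivative_transform_within_open[of _ _ _ "{0<..}"]) (use 1 f0 in "auto simp: negp_def")
 next
  case 2
  have "((%v. f (- v)) has_real_derivative - f' (negp v)) (at v)"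
  using 2 by (intro DERIV_cong[OF DERIV_chain2[OF D DERIV_minus[OF DERIV_ident]]]) (auto simp: negp_def)
  thus ?thesis
  by (rule has_field_derivative_transform_within_open[of _ _ _ "{..<0}"]) (use 2 in "auto simp: negp_def")
 next
  case 3
  have C: "0 <= C" using q[of 1] by (simp add: order_trans[OF abs_ge_zero])
  have "<|f (negp y)|> <= C*y^2" for y
  by (rule order_trans[OF q[OF negp_nonneg]]) (use C in "auto simp: negp_def max_def intro!: mono_l")
  from DERIV_zero_of_quadratic[of "%y. f (negp y)" C, OF this]
  show ?thesis using 3 by (simp add: negp_def f'0)
 qed
qed

lemma Phi_deriv: "(Phi has_real_derivative Phi1 v) (at v)"
proof -
 have "((%v. (%w. w^2/2 - w + ln (1 + w)) (negp v)) has_real_derivative - ((%w. w^2/(1 + w)) (negp v))) (at v)"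
 proof (rule DERIV_negp_compose[where C=1])
  fix w::real assume w: "0 < w"
  show "((%w. w^2/2 - w + ln (1 + w)) has_real_derivative (w^2)/(1 + w)) (at w)"
  using w by (auto intro!: derivative_eq_intros simp: field_simps power2_eq_square)
 next
  fix w::real assume w: "0 <= w"
  have "ln (1 + w) <= w" using w by (rule ln_add_one_self_le_self)
  moreover have "w - w^2 <= ln (1 + w)"
  proof (cases "w <= 1")
  case True
  thus ?thesis using ln_one_plus_pos_lower_bound[of w] w by simp
  next
  case False
  hence "w - w^2 <= 0" by (simp add: power2_eq_square)
  also have "0 <= ln (1 + w)" using w by simp
  finally show ?thesis .
  qed
  ultimately show "<|w^2/2 - w + ln (1 + w)|> <= 1*w^2" using zero_le_power2[of w] by linarith
 qed simp
 thus ?thesis by (simp add: Phi_def[abs_def] Phi1_def)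
qed

lemma Phi1_deriv: "(Phi1 has_real_derivative Phi2 v) (at v)"
proof -
 have "((%v. (%w. - (w^2/(1 + w))) (negp v)) has_real_derivative - ((%w. - (1 - 1/(1 + w)^2)) (negp v))) (at v)"
 proof (rule DERIV_negp_compose[where C=1])
  fix w::real assume w: "0 < w"
  show "((%w. - (w^2/(1 + w))) has_real_derivative - (1 - 1/(1 + w)^2)) (at w)"
  proof (rule DERIV_cong[OF DERIV_minus[OF DERIV_divide[OF DERIV_power[OF DERIV_ident] DERIV_add[OF DERIV_const DERIV_ident]]]])
  have "(2*w*(1 + w) - w^2) = (1 + w)^2 - 1" by (simp add: power2_eq_square algebra_simps)
  hence "(2*w*(1 + w) - w^2)/(1 + w)^2 = 1 - 1/(1 + w)^2" using w by (simp add: diff_divide_distrib)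
  thus "- ((real 2*(1*w ^ (2 - Suc 0))*(1 + w) - w^2*(0 + 1))/((1 + w)*(1 + w))) = - (1 - 1/(1 + w)^2)"
  by (simp add: power2_eq_square)
  qed (use w in auto)
 next
  fix w::real assume w: "0 <= w"
  thus "<|- (w^2/(1 + w))|> <= 1*w^2" by (simp add: divide_le_eq mult_le_cancel_left1)
 qed simp
 thus ?thesis by (simp add: Phi1_def[abs_def] Phi2_def)
qed

lemma Phi2_bounds: "0 <= Phi2 v" "Phi2 v <= 1"
 using negp_nonneg[of v] one_le_power[of "1 + negp v" 2] by (auto simp: Phi2_def)

lemma negp_diff: "<|negp v - negp w|> <= <|v - w|>"
 by (auto simp: negp_def max_def)

lemma Phi2_Lipschitz: "<|Phi2 v - Phi2 w|> <= 2*<|v - w|>"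
proof -
 define a where "a=1/(1 + negp v)"
 define b where "b=1/(1 + negp w)"
 have ab: "0 <= a" "a <= 1" "0 <= b" "b <= 1" using negp_nonneg[of v] negp_nonneg[of w] by (auto simp: a_def b_def)
 have "Phi2 v - Phi2 w = (b - a)*(b + a)" by (simp add: Phi2_def a_def b_def power_one_over power2_eq_square algebra_simps)
 hence "<|Phi2 v - Phi2 w|> = <|b - a|>*(b + a)" using ab by (simp add: abs_mult)
 also have "... <= <|b - a|>*2" using ab by (intro mono_l) auto
 also have "b - a = (negp v - negp w)*(a*b)"
  using negp_nonneg[of v] negp_nonneg[of w] by (simp add: a_def b_def field_simps)
 also have "<|(negp v - negp w)*(a*b)|> <= <|negp v - negp w|>*1"
  unfolding abs_mult using ab by (intro mono_l) (auto intro: mult_le_one)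
 also have "... <= <|v - w|>" using negp_diff by simp
 finally show ?thesis by simp
qed

lemma Phi1_Lipschitz: "<|Phi1 v - Phi1 w|> <= 1*<|v - w|>"
proof -
 obtain xi where "Phi1 (w + (v - w)) - Phi1 w = (v - w)*Phi2 xi"
  using mvt_between[OF Phi1_deriv, of w "v - w"] by blast
 thus ?thesis using Phi2_bounds[of xi] by (simp add: abs_mult mult_left_le)
qed

lemma Phi_zero [simp]: "0 <= v ==> Phi v = 0" "Phi1 0 = 0"
 by (simp_all add: Phi_def Phi1_def negp_def)

lemma Phi_pos: "v < 0 ==> 0 < Phi v"
proof -
 assume v: "v < 0"
 obtain z where z: "v < z" "z < 0" "Phi 0 - Phi v = (0 - v)*Phi1 z"
  using MVT2[OF v, of Phi Phi1] Phi_deriv by blast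
 have "Phi1 z < 0" using z by (simp add: Phi1_def negp_def)
 hence "(0 - v)*Phi1 z < 0" using v by (intro mult_pos_neg) auto
 thus ?thesis using z(3) by simp
qed

lemma Phi_nonneg: "0 <= Phi v"
 using Phi_pos[of v] by (cases "v < 0") auto

lemma Phi1_sign: "0 <= v *Phi1 v"
proof (cases "0 <= v")
 case True
 thus ?thesis by (simp add: Phi1_def negp_def)
next
 case False
 have "Phi1 v <= 0" using negp_nonneg[of v] by (simp add: Phi1_def)
 with False show ?thesis by (intro mult_nonpos_nonpos) auto
qed

lemma Phi_le: "<|Phi v|> <= 1* v^2"
 using taylor_quadratic[OF Phi_deriv Phi1_Lipschitz, of 0 v] by simp

lemma Phi_measurable [measurable]: "Phi : BM" "Phi1 : BM" "Phi2 : BM"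
 unfolding Phi_def Phi1_def Phi2_def negp_def by measurable

lemma sqi_Phi1: "sqi (%x. Phi1 (rep u x))"
 by (rule sqi_bound[OF sqi_rep[of u]])
  (use lipschitz_1[OF Phi1_deriv] Phi2_bounds in "auto intro!: AE_I2")

definition PhiI::"'a::euclidean_space l2 => real" where
 "PhiI u = (LI x. Phi (rep u x))"

lemma integrable_Phi: "itg (%x. Phi (rep u x))"
proof (rule Bochner_Integration.integrable_bound)
 show "itg (%x. (rep u x)^2)" using sqi_rep[of u] by (simp add: sqi_def)
qed (use Phi_le in auto)

text \<open>The integrated Taylor expansion, from which both the derivative along curves and the
  continuity of \<open>PhiI\<close> follow.\<close>

lemma PhiI_quadratic: "<|PhiI (u + k) - PhiI u - inner k (cls (%x. Phi1 (rep u x)))|> <= (norm k)^2"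
proof -
 let ?h = "%x. Phi (rep (u + k) x) - Phi (rep u x) - rep k x*Phi1 (rep u x)"
 have i: "itg (%x. rep k x*Phi1 (rep u x))" by (intro sqi_mult_integrable sqi_Phi1) simp
 have i3: "itg (%x. (rep k x)^2)" using sqi_rep[of k] by (simp add: sqi_def)
 have "PhiI (u + k) - PhiI u - inner k (cls (%x. Phi1 (rep u x))) = (LI x. ?h x)"
  unfolding PhiI_def inner_cls[OF sqi_Phi1] using i integrable_Phi[of u] integrable_Phi[of "u + k"]
  by (simp add: Bochner_Integration.integral_diff)
 also have "<|...|> <= (LI x. <|?h x|>)" by (rule integral_abs_bound)
 also have "... <= (LI x. (rep k x)^2)"
 proof (rule integral_mono_AE[OF _ i3])
  show "itg (%x. <|?h x|>)" using i integrable_Phi[of u] integrable_Phi[of "u + k"] by simp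
  show "AL x. <|?h x|> <= (rep k x)^2"
  using rep_plus[of u k]
  by eventually_elim (use taylor_quadratic[OF Phi_deriv Phi1_Lipschitz] in "simp add: mult.commute")
 qed
 finally show ?thesis by (simp add: norm_l2_sq)
qed

lemma PhiI_has_derivative:
 assumes f: "(f has_vector_derivative D) (at s within A)"
 shows "((%s. PhiI (f s)) has_real_derivative inner D (cls (%x. Phi1 (rep (f s) x)))) (at s within A)"
proof -
 let ?g = "cls (%x. Phi1 (rep (f s) x))"
 have q: "((%y. (f y - f s) /\<^sub>R (y - s)) ---> D) (at s within A)"
  using f by (simp add: has_vector_derivative_iff_quotient)
 have "((%y. (PhiI (f y) - PhiI (f s))/(y - s) - inner ((f y - f s) /\<^sub>R (y - s)) ?g) ---> 0) (at s within A)"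
 proof (rule Lim_null_comparison)
  show "\<forall>\<^sub>F y in at s within A. norm ((PhiI (f y) - PhiI (f s))/(y - s) - inner ((f y - f s) /\<^sub>R (y - s)) ?g)
  <= (norm ((f y - f s) /\<^sub>R (y - s)))^2*<|y - s|>"
  unfolding eventually_at_filter
  proof (intro always_eventually allI impI)
  fix y assume y: "y ~= s"
  have "norm ((PhiI (f y) - PhiI (f s))/(y - s) - inner ((f y - f s) /\<^sub>R (y - s)) ?g)
  = <|PhiI (f s + (f y - f s)) - PhiI (f s) - inner (f y - f s) ?g|>/<|y - s|>"
  using y by (simp add: inverse_eq_divide diff_divide_distrib[symmetric] abs_divide)
  also have "... <= (norm (f y - f s))^2/<|y - s|>"
  by (intro divide_right_mono PhiI_quadratic) auto
  also have "... = (norm ((f y - f s) /\<^sub>R (y - s)))^2*<|y - s|>"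
  proof -
  have "norm ((f y - f s) /\<^sub>R (y - s)) = norm (f y - f s)/<|y - s|>" by (simp add: divide_inverse mult.commute)
  moreover have "N^2/d = (N/d)^2*d" if "d ~= 0" for N d::real
  using that by (simp add: power2_eq_square)
  ultimately show ?thesis using y by (simp only:)
  qed
  finally show "norm ((PhiI (f y) - PhiI (f s))/(y - s) - inner ((f y - f s) /\<^sub>R (y - s)) ?g)
  <= (norm ((f y - f s) /\<^sub>R (y - s)))^2*<|y - s|>" .
  qed
  have "((%y. (norm ((f y - f s) /\<^sub>R (y - s)))^2*<|y - s|>) ---> (norm D)^2*<|s - s|>) (at s within A)"
  by (intro tendsto_intros q)
  thus "((%y. (norm ((f y - f s) /\<^sub>R (y - s)))^2*<|y - s|>) ---> 0) (at s within A)" by simp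
 qed
 moreover have "((%y. inner ((f y - f s) /\<^sub>R (y - s)) ?g) ---> inner D ?g) (at s within A)"
  by (intro tendsto_intros q)
 ultimately have "((%y. (PhiI (f y) - PhiI (f s))/(y - s)) ---> inner D ?g) (at s within A)"
  using tendsto_add by fastforce
 thus ?thesis by (simp add: has_field_derivative_iff)
qed

lemma PhiI_continuous: "continuous_on UNIV PhiI"
proof -
 have "(PhiI ---> PhiI u) (at u)" for u::"'a l2"
 proof -
  let ?g = "cls (%x. Phi1 (rep u x))"
  have "((%v. PhiI v - PhiI u) ---> 0) (at u)"
  proof (rule Lim_null_comparison)
  show "\<forall>\<^sub>F v in at u. norm (PhiI v - PhiI u) <= (norm (v - u))^2 + <|inner (v - u) ?g|>"
  proof (intro always_eventually allI)
  fix v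
  have "<|PhiI (u + (v - u)) - PhiI u - inner (v - u) ?g|> <= (norm (v - u))^2" by (rule PhiI_quadratic)
  hence "<|PhiI v - PhiI u - inner (v - u) ?g|> <= (norm (v - u))^2" by simp
  thus "norm (PhiI v - PhiI u) <= (norm (v - u))^2 + <|inner (v - u) ?g|>"
  unfolding real_norm_def by linarith
  qed
  have "((%v. (norm (v - u))^2 + <|inner (v - u) ?g|>) ---> (norm (u - u))^2 + <|inner (u - u) ?g|>) (at u)"
  by (intro tendsto_intros)
  thus "((%v. (norm (v - u))^2 + <|inner (v - u) ?g|>) ---> 0) (at u)" by simp
  qed
  thus ?thesis by (simp add: LIM_zero_iff)
 qed
 thus ?thesis by (simp add: continuous_on_def)
qed

lemma PhiI_eq_0_iff: "PhiI u <= 0 <-> nn_l2 u"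
proof -
 have "0 <= PhiI u" unfolding PhiI_def by (simp add: Phi_nonneg)
 hence "PhiI u <= 0 <-> PhiI u = 0" by linarith
 also have "... <-> (AL x. Phi (rep u x) = 0)"
  unfolding PhiI_def by (rule integral_nonneg_eq_0_iff_AE[OF integrable_Phi]) (simp add: Phi_nonneg)
 also have "... <-> nn_l2 u"
  unfolding nn_l2_def by (intro AE_cong) (metis Phi_pos Phi_zero(1) less_irrefl not_le)
 finally show ?thesis .
qed

subsection \<open>Semigroups generated by Schroedinger forms\<close>

text \<open>\<open>form\<close> is the weak equation on the domain of the generator, tested with all
  elements of finite energy; \<open>W_gauss\<close> says that Gaussians have finite potential energy
  and so are among them.\<close>

locale schroedinger_l2 = c0_semigroup S for S::"real => 'a::euclidean_space l2 => 'a l2" +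
 fixes W::"'a => real"
 assumes W_measurable [measurable]: "W : BM" and W_nonneg: "!!x. 0 <= W x"
  and W_gauss: "!!t x. 0 < t ==> itg (%y. W y*(gauss t (y - x))^2)"
  and form: "!!u h. gen u h ==> ? g. hasgrad u g & itg (%x. W x*(rep u x)^2) &
  (!v k. hasgrad v k --> itg (%x. W x*(rep v x)^2) -->
  (\<Sum>e\<in>Basis. inner (g e) (k e)) + (LI x. W x*(rep u x*rep v x)) = - inner h v)"
begin

text \<open>The equation of \<open>u\<close> is tested with \<open>Phi1\<close> of \<open>u\<close>:
  the gradient term is the integral of \<open>Phi2\<close> times the squared gradient, the potential
  term contains \<open>v * Phi1 v\<close> at the values \<open>v\<close> of \<open>u\<close>, and
  both are nonnegative.\<close>

lemma gen_Phi1: "gen u h ==> inner h (cls (%x. Phi1 (rep u x))) <= 0"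
proof -
 assume "gen u h"
 then obtain g where g: "hasgrad u g" and i: "itg (%x. W x*(rep u x)^2)"
  and eq: "!!v k. hasgrad v k ==> itg (%x. W x*(rep v x)^2) ==>
  (\<Sum>e\<in>Basis. inner (g e) (k e)) + (LI x. W x*(rep u x*rep v x)) = - inner h v"
  using form by blast
 let ?v = "cls (%x. Phi1 (rep u x))"
 let ?k = "%e. cls (%x. Phi2 (rep u x)*rep (g e) x)"
 have v: "AL x. rep ?v x = Phi1 (rep u x)" by (rule rep_abs[OF sqi_Phi1])
 have sk: "sqi (%x. Phi2 (rep u x)*rep (g e) x)" for e
  by (rule sqi_bound[OF sqi_rep[of "g e"]])
  (use Phi2_bounds in "auto simp: abs_mult mult_left_le_one_le")
 have "hasgrad ?v ?k"
  unfolding hasgrad_def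
 proof (intro ballI allI impI)
  fix e::'a and ph::"'a => real" and ph' assume e: "e : Basis" and C: "C1c ph ph'"
  obtain B R where B: "!!x. <|ph x|> <= B" using C1c_bounds[OF C] by metis
  show "inner ?v (cls (%x. ph' x .* e)) = - inner (cls ph) (?k e)"
  proof (rule l2_chain_rule[OF _ Phi1_deriv _ Phi2_Lipschitz _ C1c_sqi(1)[OF C] B])
  show "tderiv e u (g e)" using g e by (simp add: hasgrad_iff_tderiv)
  show "tderiv e (cls ph) (cls (%x. ph' x .* e))" using e by (intro tderiv_C1c[OF C]) simp
  show "<|Phi2 v|> <= 1" for v using Phi2_bounds[of v] by simp
  qed simp
 qed
 moreover have "itg (%x. W x*(rep ?v x)^2)"
 proof (rule Bochner_Integration.integrable_bound[OF i])
  show "AL x. norm (W x*(rep ?v x)^2) <= norm (W x*(rep u x)^2)"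
  using v
  proof eventually_elim
  case (elim x)
  have "<|Phi1 (rep u x)|> <= <|rep u x|>"
  using lipschitz_1[OF Phi1_deriv] Phi2_bounds by simp
  hence "(Phi1 (rep u x))^2 <= (rep u x)^2" by (simp add: abs_le_square_iff)
  thus ?case using elim W_nonneg[of x] by (simp add: abs_mult mono_l)
  qed
 qed measurable
 ultimately have "(\<Sum>e\<in>Basis. inner (g e) (?k e)) + (LI x. W x*(rep u x*rep ?v x)) = - inner h ?v"
  by (rule eq)
 moreover have "0 <= inner (g e) (?k e)" for e
  unfolding inner_cls[OF sk] using mult_nonneg_nonneg[OF Phi2_bounds(1) zero_le_square]
  by (intro Bochner_Integration.integral_nonneg) (metis mult.left_commute mult.commute)
 moreover have "0 <= (LI x. W x*(rep u x*rep ?v x))"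
  by (intro integral_nonneg_AE, use v in eventually_elim) (simp add: W_nonneg Phi1_sign)
 ultimately show ?thesis using sum_nonneg[of Basis "%e. inner (g e) (?k e)"] by simp
qed

text \<open>\<open>PhiI\<close> decreases along the semigroup and is at most 0 exactly on
  nonnegative elements.\<close>

lemma nn_S:
 assumes u: "nn_l2 u" and t: "0 <= t"
 shows "nn_l2 (S t u)"
proof -
 have "PhiI (S t u) <= PhiI u"
 proof (rule decreasing_along_S[OF PhiI_continuous _ t])
  fix x y and s::real assume g: "gen x y" and s: "0 <= s"
  show "? D. ((%t. PhiI (S t x)) has_real_derivative D) (at s within {0..}) & D <= 0"
  using PhiI_has_derivative[OF has_derivative_S[OF g s]] gen_Phi1[OF gen_S[OF g s]] by blast
 qed
 thus ?thesis using u PhiI_eq_0_iff by (metis order_trans)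
qed

text \<open>The equation of \<open>S s f\<close> is tested with the Gaussian. Another integration by
  parts turns the gradient term into the Laplacian of the Gaussian, which the time derivative of
  \<open>gk (r - s) x\<close> cancels; only the potential term survives.\<close>

lemma duhamel_deriv:
 assumes f: "gen f h" and s: "0 <= s" "s < r"
 shows "((%s. inner (S s f) (gk (r - s) x)) has_real_derivative
  - (LI y. W y*(rep (S s f) y*gauss (r - s) (y - x)))) (at s within {0..})"
  "itg (%y. W y*(rep (S s f) y*gauss (r - s) (y - x)))"
proof -
 define t where "t=r - s"
 have t: "0 < t" using s by (simp add: t_def)
 let ?u = "S s f"
 obtain g where g: "hasgrad ?u g" and i: "itg (%x. W x*(rep ?u x)^2)"
  and eq: "!!v k. hasgrad v k ==> itg (%x. W x*(rep v x)^2) ==>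
  (\<Sum>e\<in>Basis. inner (g e) (k e)) + (LI x. W x*(rep ?u x*rep v x)) = - inner (S s h) v"
  using form[OF gen_S[OF f s(1)]] by blast
 have tg: "tderiv e ?u (g e)" if "e : Basis" for e using g that by (simp add: hasgrad_iff_tderiv)
 have hg: "hasgrad (gk t x) (%e. - gk1 t e x)" unfolding hasgrad_iff_tderiv using t by (auto intro: tderiv_gk)
 have rg: "AL y. rep (gk t x) y = gauss t (y - x)" by (rule rep_gk[OF t])
 have ig: "itg (%y. W y*(rep (gk t x) y)^2)"
  by (rule integrable_cong_AE_imp[OF W_gauss[OF t, of x]], measurable, use rg in eventually_elim) simp
 have e1: "(\<Sum>e\<in>Basis. inner (g e) (- gk1 t e x)) + (LI y. W y*(rep ?u y*rep (gk t x) y)) = - inner (S s h) (gk t x)"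
  by (rule eq[OF hg ig])
 have e2: "(LI y. W y*(rep ?u y*rep (gk t x) y)) = (LI y. W y*(rep ?u y*gauss t (y - x)))"
  by (rule integral_cong_AE, measurable, use rg in eventually_elim) simp
 have e3: "inner (g e) (- gk1 t e x) = - inner ?u (gk2 t e x)" if "e : Basis" for e
  using tderiv_ibp[OF tg[OF that] tderiv_gk1[OF t, of e x]] that by simp
 have e4: "inner (S s h) (gk t x) - inner ?u (\<Sum>e\<in>Basis. gk2 t e x) = - (LI y. W y*(rep ?u y*gauss t (y - x)))"
  using e1 e2 e3 by (simp add: inner_sum_right sum_negf)
 have d1: "((%s. S s f) has_vector_derivative S s h) (at s within {0..})" by (rule has_derivative_S[OF f s(1)])
 have d2: "((%s. gk (r - s) x) has_vector_derivative - (\<Sum>e\<in>Basis. gk2 t e x)) (at s within {0..})"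
 proof -
  have "((%t. gk t x) \<circ> (%s. r - s) has_vector_derivative (-1) *. (\<Sum>e\<in>Basis. gk2 t e x)) (at s)"
  by (rule vector_diff_chain_at) (use gk_time_derivative[OF t] in "auto intro!: derivative_eq_intros simp: t_def")
  thus ?thesis by (simp add: o_def has_vector_derivative_at_within)
 qed
 have "((%s. inner (S s f) (gk (r - s) x)) has_vector_derivative
  inner ?u (- (\<Sum>e\<in>Basis. gk2 t e x)) + inner (S s h) (gk (r - s) x)) (at s within {0..})"
  by (rule bounded_bilinear.has_vector_derivative[OF bounded_bilinear_inner d1 d2])
 also have "inner ?u (- (\<Sum>e\<in>Basis. gk2 t e x)) + inner (S s h) (gk (r - s) x)
  = - (LI y. W y*(rep ?u y*gauss t (y - x)))"
  using e4 by (simp add: t_def)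
 finally show "((%s. inner (S s f) (gk (r - s) x)) has_real_derivative
  - (LI y. W y*(rep (S s f) y*gauss (r - s) (y - x)))) (at s within {0..})"
  by (simp add: has_real_derivative_iff_has_vector_derivative t_def)
 show "itg (%y. W y*(rep (S s f) y*gauss (r - s) (y - x)))"
 proof (rule Bochner_Integration.integrable_bound)
  show "itg (%y. W y*(rep ?u y)^2 + W y*(gauss t (y - x))^2)"
  by (intro Bochner_Integration.integrable_add i W_gauss t)
  have "<|a*b|> <= a^2 + b^2" for a b::real
  proof -
  have "2*<|a|>*<|b|> <= <|a|>^2 + <|b|>^2" using sum_squares_bound by blast
  moreover have "0 <= <|a|>*<|b|>" by simp
  ultimately have "<|a|>*<|b|> <= <|a|>^2 + <|b|>^2" by linarith
  thus ?thesis by (simp add: abs_mult)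
  qed
  hence "<|W y|>*<|a*b|> <= W y*(a^2 + b^2)" for y a b
  using W_nonneg[of y] by (simp add: mono_l)
  thus "AL y. norm (W y*(rep (S s f) y*gauss (r - s) (y - x))) <= norm (W y*(rep ?u y)^2 + W y*(gauss t (y - x))^2)"
  using W_nonneg by (intro AE_I2) (simp add: abs_mult distrib_left t_def)
 qed measurable
qed

lemma nn_avg:
 assumes u: "nn_l2 u" and h: "0 < h"
 shows "nn_l2 (avg h u)"
proof (rule nn_l2_dual)
 fix v::"'a l2" assume v: "nn_l2 v"
 have "inner (integral {0..h} (%s. S s u)) v = integral {0..h} (%s. inner (S s u) v)"
  using integral_linear[OF integrable_S[where x=u and a = 0 and b = h] bounded_linear_inner_left[of v]] by (simp add: o_def)
 also have "0 <= ..."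
  by (rule Henstock_Kurzweil_Integration.integral_nonneg)
  (use integrable_linear[OF integrable_S[where x=u and a = 0 and b = h] bounded_linear_inner_left[of v]] u v
  in "auto simp: o_def intro!: nn_l2_inner nn_S")
 finally show "0 <= inner (avg h u) v" using h by (simp add: avg_def)
qed

lemma nn_approx:
 assumes "nn_l2 f"
 obtains F where "!!n::nat. nn_l2 (F n)" "!!n. ? h. gen (F n) h" "F ----> f"
proof -
 have "filterlim (%n. 1/real (Suc n)) (at_right 0) sequentially"
  unfolding filterlim_at using LIMSEQ_inverse_real_of_nat by (auto simp: inverse_eq_divide)
 from filterlim_compose[OF avg_tendsto this, of f]
 have "(%n. avg (1/real (Suc n)) f) ----> f" .
 thus ?thesis
  using gen_avg[of "1/real (Suc _)" f] nn_avg[OF assms] by (intro that[of "%n. avg (1/real (Suc n)) f"]) auto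
qed

text \<open>For nonnegative \<open>f\<close> in the domain the derivative in Duhamel's formula is at
  most 0; nonnegative time averages extend the inequality to all nonnegative
  \<open>f\<close>.\<close>

lemma duhamel_inner_le:
 assumes f: "nn_l2 f" and t: "0 <= t" and e: "0 < e"
 shows "inner (S t f) (gk e x) <= inner f (gk (t + e) x)"
proof -
 have 1: "inner (S t f) (gk e x) <= inner f (gk (t + e) x)" if f: "nn_l2 f" and g: "gen f h" for f h
 proof -
  let ?D = "%s. - (LI y. W y*(rep (S s f) y*gauss (t + e - s) (y - x)))"
  have "inner (S t f) (gk (t + e - t) x) <= inner (S 0 f) (gk (t + e - 0) x)"
  proof (rule DERIV_within_nonpos_imp_le[where D= ?D and f = "%s. inner (S s f) (gk (t + e - s) x)"])
  fix s assume s: "0 <= s" "s <= t"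
  show "((%s. inner (S s f) (gk (t + e - s) x)) has_real_derivative ?D s) (at s within {0..t})"
  using duhamel_deriv(1)[OF g s(1), of "t + e" x] s e by (auto intro: DERIV_subset[of _ _ _ "{0..}"])
  next
  fix s assume s: "0 < s" "s < t"
  have "nn_l2 (S s f)" using nn_S[OF f] s by simp
  hence "0 <= (LI y. W y*(rep (S s f) y*gauss (t + e - s) (y - x)))"
  unfolding nn_l2_def
  by (intro integral_nonneg_AE) (auto simp: W_nonneg gauss_nonneg elim!: eventually_mono)
  thus "?D s <= 0" by simp
  qed (use t in auto)
  thus ?thesis by simp
 qed
 obtain F where F: "!!n::nat. nn_l2 (F n)" "!!n. ? h. gen (F n) h" "F ----> f" using nn_approx[OF f] by metis
 show ?thesis
 proof (rule LIMSEQ_le)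
  show "(%n. inner (S t (F n)) (gk e x)) ----> inner (S t f) (gk e x)"
  by (intro tendsto_intros bounded_linear.tendsto[OF lin[OF t]] F)
  show "(%n. inner (F n) (gk (t + e) x)) ----> inner f (gk (t + e) x)" by (intro tendsto_intros F)
  show "? N. ALL n>=N. inner (S t (F n)) (gk e x) <= inner (F n) (gk (t + e) x)" using 1 F by blast
 qed
qed

text \<open>The mollifying Gaussian on the left is removed by letting its width tend to 0, while on
  the right \<open>gk\<close> is continuous in time.\<close>

lemma domination:
 assumes f: "nn_l2 f" and t: "0 < t"
 shows "AL x. rep (S t f) x <= inner f (gk t x)"
proof -
 obtain ep::"nat => real" where e: "!!n. 0 < ep n" "ep ----> 0"
  "AL x. (%n. inner (S t f) (gk (ep n) x)) ----> rep (S t f) x"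
  using mollify_AE by blast
 from e(3) show ?thesis
 proof eventually_elim
  case (elim x)
  have "isCont (%t. gk t x) t"
  using has_vector_derivative_continuous[OF gk_time_derivative[OF t, of x]] by simp
  moreover have "(%n. t + ep n) ----> t" using tendsto_add[OF tendsto_const e(2), of t] by simp
  ultimately have "(%n. gk (t + ep n) x) ----> gk t x" by (rule isCont_tendsto_compose)
  hence "(%n. inner f (gk (t + ep n) x)) ----> inner f (gk t x)" by (intro tendsto_intros)
  from LIMSEQ_le[OF elim this] show ?case
  using duhamel_inner_le[OF f _ e(1)] t by auto
 qed
qed

end

section \<open>Reverse Hoelder potentials\<close>

text \<open>\<open>RH\<close> is the reverse Hoelder inequality raised to the power \<open>s\<close>
  and multiplied by the volume of the ball. It is stated for reals, hence the separate finiteness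
  conditions.\<close>

locale potential =
 fixes W::"'a::euclidean_space => real" and s K::real
 assumes W_measurable [measurable]: "W : BM" and W_nonneg: "!!x. 0 <= W x"
  and W_finite: "!!x r. (NN y:ball x r. en (W y)) < oo"
  and Ws_finite: "!!x r. (NN y:ball x r. en (W y powr s)) < oo"
  and W_nonzero: "~ (AL x. W x = 0)"
  and s: "1 < s" "real DIM('a)/2 <= s" and dim: "3 <= DIM('a)" and K: "0 < K"
  and RH: "!!x r. 0 < r ==> enn2real (NN y:ball x r. en (W y powr s))
  <= K*measure lborel (ball x r)*(enn2real (NN y:ball x r. en (W y))/measure lborel (ball x r)) powr s"
begin

definition nu::"'a measure" where "nu=density lborel (%y. en (W y))"
definition om::"'a measure" where "om=density lborel (%y. en (W y powr s))"
definition v::"'a => real => real" where "v x r = measure nu (ball x r)"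
definition w::"'a => real => real" where "w x r = measure om (ball x r)"
definition b::"real => real" where "b r = unit_ball_vol (real DIM('a))*r ^ DIM('a)"

lemma sets_nu [simp]: "sets nu = sets borel" "sets om = sets borel"
 by (simp_all add: nu_def om_def)

lemma emeasure_nu: "A : sets borel ==> emeasure nu A = (NN y:A. en (W y))"
 by (simp add: nu_def emeasure_density)

lemma emeasure_om: "A : sets borel ==> emeasure om A = (NN y:A. en (W y powr s))"
 by (simp add: om_def emeasure_density)

lemma fm [simp]: "ball x r : fmeasurable nu" "ball x r : fmeasurable om"
 using W_finite[of x r] Ws_finite[of x r] by (auto simp: fmeasurable_def emeasure_nu emeasure_om)

lemma v_eq: "v x r = enn2real (NN y:ball x r. en (W y))"
 by (simp add: v_def measure_def emeasure_nu)

lemma w_eq: "w x r = enn2real (NN y:ball x r. en (W y powr s))"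
 by (simp add: w_def measure_def emeasure_om)

lemma ennreal_v: "en (v x r) = (NN y:ball x r. en (W y))"
 using W_finite[of x r] by (simp add: v_eq less_top)

lemma ennreal_w: "en (w x r) = (NN y:ball x r. en (W y powr s))"
 using Ws_finite[of x r] by (simp add: w_def measure_def emeasure_om less_top)

lemma b_pos: "0 < r ==> 0 < b r"
 by (simp add: b_def unit_ball_vol_pos)

lemma b_measure: "0 <= r ==> measure lborel (ball (x::'a) r) = b r"
 by (simp add: b_def content_ball)

lemma RH': "0 < r ==> w x r <= K*b r*(v x r/b r) powr s"
 using RH[of r x] b_measure[of r x] by (simp add: v_eq w_eq)

lemma v_nonneg: "0 <= v x r" and w_nonneg: "0 <= w x r"
 by (simp_all add: v_def w_def)

lemma v_mono: "ball x r \<subseteq> ball y R ==> v x r <= v y R" and w_mono: "ball x r \<subseteq> ball y R ==> w x r <= w y R"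
 unfolding v_def w_def by (auto intro!: measure_mono_fmeasurable)

text \<open>This elementary splitting at height \<open>l\<close> replaces Hoelder's inequality.\<close>

lemma level_split:
 assumes l: "0 < l" and a: "0 <= a"
 shows "a <= l + l powr (1 - s)*a powr s"
proof (cases "a <= l")
 case True
 thus ?thesis using l by (simp add: add_increasing2)
next
 case False
 hence "a = a powr (1 - s)*a powr s" using l by (simp add: powr_add[symmetric])
 also have "... <= l powr (1 - s)*a powr s"
  using False l s by (intro mono_r powr_mono2') auto
 finally show ?thesis using l by simp
qed

text \<open>The splitting at height \<open>l\<close> is integrated over \<open>E\<close>;
  \<open>l\<close> stays free so that later uses can balance the two terms.\<close>

lemma level_split_measure:
 assumes E: "E : sets borel" "E \<subseteq> ball x r" and l: "0 < l"
 shows "measure nu E <= l*measure lborel E + l powr (1 - s)*w x r"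
proof -
 have fE: "emeasure lborel E < oo" using emeasure_mono[OF E(2), of lborel] emeasure_ball_less_top[of x r] by (auto intro: le_less_trans)
 have "emeasure nu E <= (NN y. en l*ind E y + en (l powr (1 - s))*(en (W y powr s)*ind (ball x r) y))"
  unfolding emeasure_nu[OF E(1)]
 proof (rule nn_integral_mono)
  fix y
  have "en (W y) <= en l + en (l powr (1 - s))*en (W y powr s)"
  proof -
  have "en (W y) <= en (l + l powr (1 - s)*W y powr s)"
  by (intro ennreal_leI level_split l W_nonneg)
  thus ?thesis using l by (simp add: ennreal_plus ennreal_mult)
  qed
  thus "en (W y)*ind E y <= en l*ind E y + en (l powr (1 - s))*(en (W y powr s)*ind (ball x r) y)"
  using E(2) by (auto simp: ind_def)
 qed
 also have "... = en l*emeasure lborel E + en (l powr (1 - s))*en (w x r)"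
  using E(1) by (simp add: nn_integral_add nn_integral_cmult ennreal_w)
 also have "... = en (l*measure lborel E + l powr (1 - s)*w x r)"
  using l fE w_nonneg by (simp add: emeasure_eq_ennreal_measure less_top ennreal_mult ennreal_plus)
 finally show ?thesis
  using l w_nonneg by (auto simp: measure_def intro!: enn2real_leI)
qed

text \<open>The Jensen half of the comparison, with a loss of a factor 2: at height
  \<open>l\<close>, half the mean of \<open>W\<close>, the low term accounts for only half of the
  mass.\<close>

lemma v_le_w:
 assumes r: "0 < r"
 shows "b r*(v x r/(2*b r)) powr s <= w x r"
proof (cases "v x r = 0")
 case True
 thus ?thesis using w_nonneg s by simp
next
 case False
 define l where "l=v x r/(2*b r)"
 have l: "0 < l" using False v_nonneg[of x r] b_pos[OF r] by (simp add: l_def)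
 have "v x r <= l*b r + l powr (1 - s)*w x r"
  using level_split_measure[OF _ order_refl l, of x r] r by (simp add: v_def b_measure)
 moreover have "l*b r = v x r/2" using b_pos[OF r] by (simp add: l_def)
 ultimately have "l*b r <= l powr (1 - s)*w x r" by linarith
 hence "l powr (s - 1)*(l*b r) <= l powr (s - 1)*(l powr (1 - s)*w x r)"
  by (intro mono_l) auto
 also have "... = w x r" using l by (simp add: mult.assoc[symmetric] powr_add[symmetric])
 also have "l powr (s - 1)*(l*b r) = b r*l powr s" using l by (simp add: powr_diff)
 finally show ?thesis by (simp add: l_def)
qed

text \<open>A shell of relative volume \<open>1/(4*L)\<close> carries at most half of the mass of
  its ball: at height \<open>L\<close> times the mean, the low term is a quarter by volume, and the
  high term at most a quarter by the reverse Hoelder inequality.\<close>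

lemma v_shrink: "? th. 0 < th & th < 1 & (!x r. 0 < r --> v x r <= 2* v x (th*r))"
proof -
 \<comment> \<open>Large enough for \<open>K * L powr (1 - s) <= 1/4\<close>; the added 1 ensures
   \<open>L >= 1\<close>.\<close>
 define L where "L=(4*K) powr (1/(s - 1)) + 1"
 have L: "1 <= L" by (simp add: L_def)
 have KL: "K*L powr (1 - s) <= 1/4"
 proof -
  have "4*K = ((4*K) powr (1/(s - 1))) powr (s - 1)" using K s by (simp add: powr_powr)
  also have "... <= L powr (s - 1)" using s by (intro powr_mono2) (auto simp: L_def)
  finally have "4*K <= L powr (s - 1)" .
  hence "K*L powr (1 - s) <= L powr (s - 1)/4*L powr (1 - s)" by (intro mono_r) auto
  also have "... = 1/4" using L by (simp add: powr_add[symmetric])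
  finally show ?thesis .
 qed
 define q where "q=1 - 1/(4*L)"
 define th where "th=root DIM('a) q"
 have q: "0 < q" "q < 1" using L by (auto simp: q_def divide_less_eq)
 have th: "0 < th" "th < 1" "th ^ DIM('a) = q" using q dim by (auto simp: th_def)
 have "v x r <= 2* v x (th*r)" if r: "0 < r" for x r
 proof (cases "v x r = 0")
  case True
  thus ?thesis using v_nonneg by simp
 next
  case False
  define l where "l=L*(v x r/b r)"
  have vp: "0 < v x r" using False v_nonneg[of x r] by simp
  have l: "0 < l" using vp b_pos[OF r] L by (simp add: l_def)
  let ?E = "ball x r - ball x (th*r)"
  have sub: "ball x (th*r) \<subseteq> ball x r" using th r by (intro subset_ball) (simp add: mult_le_cancel_right1)
  have "measure nu ?E <= l*measure lborel ?E + l powr (1 - s)*w x r"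
  by (rule level_split_measure[OF _ _ l]) auto
  also have "measure lborel ?E = b r - b (th*r)"
  proof -
  have "emeasure lborel (ball x r) ~= oo" using emeasure_ball_less_top[of x r] by (metis infinity_ennreal_def less_irrefl)
  thus ?thesis using sub r th by (subst measure_Diff) (auto simp: b_measure)
  qed
  also have "b r - b (th*r) = b r/(4*L)" by (simp add: b_def power_mult_distrib th(3) q_def algebra_simps)
  also have "l powr (1 - s)*w x r <= l powr (1 - s)*(K*b r*(v x r/b r) powr s)"
  by (intro mono_l RH' r) auto
  also have "... = K*L powr (1 - s)* v x r"
  proof -
  have lp: "l powr (1 - s) = L powr (1 - s)*(v x r/b r) powr (1 - s)"
  unfolding l_def by (rule powr_mult)
  have vb: "(v x r/b r) powr (1 - s)*(v x r/b r) powr s = v x r/b r"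
  using vp b_pos[OF r] by (simp add: powr_add[symmetric])
  have "l powr (1 - s)*(K*b r*(v x r/b r) powr s)
  = L powr (1 - s)*K*b r*((v x r/b r) powr (1 - s)*(v x r/b r) powr s)"
  unfolding lp by (simp only: mult_ac)
  hence "l powr (1 - s)*(K*b r*(v x r/b r) powr s) = L powr (1 - s)*K*b r*(v x r/b r)"
  unfolding vb .
  thus ?thesis using b_pos[OF r] by simp
  qed
  also have "... <= 1/4* v x r" using KL vp by (intro mono_r) auto
  finally have "measure nu ?E <= l*(b r/(4*L)) + 1/4* v x r" by simp
  also have "l*(b r/(4*L)) = v x r/4" using b_pos[OF r] L by (simp add: l_def)
  finally have "measure nu ?E <= v x r/2" by simp
  moreover have "measure nu ?E = v x r - v x (th*r)"
  unfolding v_def using sub fm(1)[of x r] by (subst measure_Diff) (auto simp: fmeasurable_def)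
  ultimately show ?thesis by simp
 qed
 with th show ?thesis by blast
qed

lemma v_doubling: "? n::nat. !x r. 0 < r --> v x (2*r) <= 2 ^ n* v x r"
proof -
 obtain th where th: "0 < th" "th < 1" "!!x r. 0 < r ==> v x r <= 2* v x (th*r)" using v_shrink by blast
 have it: "v x r <= 2 ^ n* v x (th ^ n*r)" if "0 < r" for x r n
 proof (induction n)
  case (Suc n)
  have "v x (th ^ n*r) <= 2* v x (th*(th ^ n*r))" using that th by (intro th(3)) auto
  hence "2 ^ n* v x (th ^ n*r) <= 2 ^ n*(2* v x (th*(th ^ n*r)))" by (intro mono_l) auto
  from order_trans[OF Suc this] show ?case by (simp add: mult_ac)
 qed simp
 obtain n where n: "th ^ n < 1/2" using real_arch_pow_inv[of "1/2" th] th by auto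
 have "v x (2*r) <= 2 ^ n* v x r" if r: "0 < r" for x r
 proof -
  have "th ^ n*(2*r) <= 1/2*(2*r)" using n r by (intro mono_r) auto
  hence "v x (th ^ n*(2*r)) <= v x r" by (intro v_mono subset_ball) simp
  thus ?thesis using it[of "2*r" x n] r by (meson mono_l order_trans zero_le_numeral zero_le_power mult_pos_pos zero_less_numeral)
 qed
 thus ?thesis by blast
qed

text \<open>Binary logarithm of a doubling constant, and thus the exponent in every polynomial bound
  for a ratio of radii.\<close>

definition nd::nat where "nd=(SOME n. !x r. 0 < r --> v x (2*r) <= 2 ^ n* v x r)"

lemma doubling: "0 < r ==> v x (2*r) <= 2 ^ nd* v x r"
 using someI_ex[OF v_doubling] unfolding nd_def by blast

lemma doubling_iter: "0 < r ==> v x (2 ^ j*r) <= 2 ^ (nd*j)* v x r"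
proof (induction j)
 case (Suc j)
 have "v x (2 ^ Suc j*r) <= 2 ^ nd* v x (2 ^ j*r)"
  using doubling[of "2 ^ j*r" x] Suc.prems by (simp add: mult.assoc)
 also have "... <= 2 ^ nd*(2 ^ (nd*j)* v x r)" using Suc by (intro mono_l) auto
 finally show ?case by (simp add: power_add mult_ac)
qed simp

lemma doubling_ratio:
 assumes "0 < r" "r <= R"
 shows "v x R <= 2 ^ nd*(R/r) ^ nd* v x r"
proof -
 define j where "j=nat \<lceil>log 2 (R/r)\<rceil>"
 have Rr: "1 <= R/r" using assms by simp
 have 1: "R/r <= 2 ^ j"
 proof -
  have "log 2 (R/r) <= real j" unfolding j_def by linarith
  hence "R/r <= 2 powr real j" using Rr by (subst (asm) log_le_iff) auto
  thus ?thesis by (simp add: powr_realpow)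
 qed
 have 2: "2 ^ j <= 2*(R/r)"
 proof -
  have "real j <= log 2 (R/r) + 1" unfolding j_def using Rr by (simp add: zero_le_log_cancel_iff)
  hence "2 powr real j <= 2 powr (log 2 (R/r) + 1)" by simp
  also have "... = 2*(R/r)" using Rr by (simp add: powr_add)
  finally show ?thesis by (simp add: powr_realpow)
 qed
 have "v x R <= v x (2 ^ j*r)" using 1 assms by (intro v_mono subset_ball) (simp add: field_simps)
 also have "... <= 2 ^ (nd*j)* v x r" by (rule doubling_iter[OF assms(1)])
 also have "... = (2 ^ j) ^ nd* v x r" by (simp add: power_mult[symmetric] mult.commute)
 also have "... <= (2*(R/r)) ^ nd* v x r" using 2 by (intro mono_r power_mono v_nonneg) auto
 finally show ?thesis by (simp only: power_mult_distrib)
qed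

text \<open>A single null ball would by doubling make all balls with that centre null, and so
  \<open>W\<close> zero almost everywhere.\<close>

lemma v_pos: "0 < r ==> 0 < v x r"
proof (rule ccontr)
 assume r: "0 < r" and "~ 0 < v x r"
 hence 0: "v x r = 0" using v_nonneg[of x r] by simp
 have "emeasure nu (ball x (real n)) = 0" for n
 proof -
  have "v x (max r (real n)) <= 0" using doubling_ratio[OF r, of "max r (real n)" x] 0 by simp
  moreover have "v x (real n) <= v x (max r (real n))" by (intro v_mono subset_ball) simp
  ultimately have "v x (real n) = 0" using v_nonneg[of x "real n"] by simp
  thus ?thesis unfolding v_def using fm(1)[of x "real n"] by (simp add: measure_eq_emeasure_eq_ennreal fmeasurable_def emeasure_eq_ennreal_measure less_top)
 qed
 hence null: "(\<Union>n. ball x (real n)) : null_sets nu" by (intro null_sets_UN) (auto simp: null_sets_def)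
 have "(\<Union>n. ball x (real n)) = UNIV" by (auto intro: reals_Archimedean2)
 with null have "emeasure nu UNIV = 0" by (simp add: null_sets_def)
 hence "(NN y. en (W y)) = 0" by (simp add: emeasure_nu)
 hence "AL y. W y = 0"
  by (subst (asm) nn_integral_0_iff_AE) (auto simp: W_nonneg order_antisym elim: eventually_mono)
 with W_nonzero show False by blast
qed

text \<open>The reverse Hoelder inequality and its Jensen converse let the \<open>nu\<close>-mass
  and the \<open>om\<close>-mass of a ball determine each other up to constants, so doubling carries
  over.\<close>

lemma w_doubling: "EX C>=1. !x r. 0 < r --> w x (2*r) <= C*w x r"
proof -
 define C where "C=max 1 (K*2 ^ DIM('a)*(2 ^ (nd + 1)) powr s)"
 have "w x (2*r) <= C*w x r" if r: "0 < r" for x r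
 proof -
  have b2: "b (2*r) = 2 ^ DIM('a)*b r" by (simp add: b_def power_mult_distrib)
  have br: "0 < b r" using r by (rule b_pos)
  have "w x (2*r) <= K*b (2*r)*(v x (2*r)/b (2*r)) powr s" using r by (intro RH') simp
  also have "... <= K*b (2*r)*(2 ^ (nd + 1)*(v x r/(2*b r))) powr s"
  proof (intro mono_l powr_mono2)
  have "v x (2*r)/b (2*r) <= 2 ^ nd* v x r/b r"
  using doubling[OF r, of x] v_nonneg br b2 mono_r[of 1 "2 ^ DIM('a)" "b r"] by (intro frac_le) auto
  thus "v x (2*r)/b (2*r) <= 2 ^ (nd + 1)*(v x r/(2*b r))" by simp
  qed (use s K br b2 v_nonneg r in "auto simp: b_pos less_imp_le")
  also have "... = K*2 ^ DIM('a)*(2 ^ (nd + 1)) powr s*(b r*(v x r/(2*b r)) powr s)"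
  using v_nonneg br by (subst powr_mult) (auto simp: b2)
  also have "... <= K*2 ^ DIM('a)*(2 ^ (nd + 1)) powr s*w x r"
  using K by (intro mono_l v_le_w[OF r]) auto
  also have "... <= C*w x r" by (intro mono_r w_nonneg) (simp add: C_def)
  finally show ?thesis .
 qed
 moreover have "1 <= C" by (simp add: C_def)
 ultimately show ?thesis by blast
qed

text \<open>The shell between the radii \<open>r\<close> and \<open>2*r\<close> contains a ball of
  radius \<open>r/2\<close> whose dilation by 8 covers \<open>ball x (2*r)\<close>; three doublings
  give the shell a fixed share of the mass.\<close>

lemma w_reverse_doubling: "? g. 0 < g & g < 1 & (!x r. 0 < r --> w x r <= g*w x (2*r))"
proof -
 obtain C where C: "1 <= C" "!!x r. 0 < r ==> w x (2*r) <= C*w x r" using w_doubling by blast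
 have C3: "1 <= C ^ 3" using C by simp
 have C6: "2 <= 2*C ^ 3" using mono_l[OF C3, of 2] by simp
 hence C6': "1 < 2*C ^ 3" "0 < 2*C ^ 3" by linarith+
 define g where "g=1 - 1/(2*C ^ 3)"
 have g: "0 < g" "g < 1" unfolding g_def using C6' by (simp_all add: divide_less_eq)
 have "w x r <= g*w x (2*r)" if r: "0 < r" for x r
 proof -
  obtain e::'a where e: "e : Basis" using nonempty_Basis by blast
  define z where "z=x + (3/2*r) *. e"
  have xz: "dist x z = 3/2*r" using e r by (simp add: z_def dist_norm)
  have d: "ball z (r/2) \<subseteq> ball x (2*r) - ball x r"
  proof
  fix y assume "y : ball z (r/2)"
  hence "dist z y < r/2" by simp
  thus "y : ball x (2*r) - ball x r"
  using xz dist_triangle[of x y z] dist_triangle[of x z y] by (auto simp: dist_commute)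
  qed
  have c: "ball x (2*r) \<subseteq> ball z (2*(2*(2*(r/2))))"
  proof
  fix y assume "y : ball x (2*r)"
  thus "y : ball z (2*(2*(2*(r/2))))"
  using xz dist_triangle[of z y x] r by (auto simp: dist_commute)
  qed
  have "w x (2*r) <= w z (2*(2*(2*(r/2))))" by (rule w_mono[OF c])
  also have "... <= C*(C*(C*w z (r/2)))"
  using r C(1) by (intro order_trans[OF C(2)] mono_l) auto
  also have "w z (r/2) <= measure om (ball x (2*r) - ball x r)"
  unfolding w_def using d by (intro measure_mono_fmeasurable fmeasurable_Diff) auto
  also have "... = w x (2*r) - w x r"
  unfolding w_def using fm(2)[of x "2*r"] r by (subst measure_Diff) (auto simp: fmeasurable_def subset_ball)
  finally have "w x (2*r) <= C ^ 3*(w x (2*r) - w x r)"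
  using C(1) by (simp add: power3_eq_cube mult_ac mono_l)
  hence "w x (2*r)/C ^ 3 <= w x (2*r) - w x r" using C6' by (simp add: pos_divide_le_eq mult.commute)
  moreover have "w x (2*r)/(2*C ^ 3) <= w x (2*r)/C ^ 3"
  using C6' w_nonneg[of x "2*r"] by (intro divide_left_mono) auto
  ultimately show ?thesis by (simp add: g_def left_diff_distrib)
 qed
 with g show ?thesis by blast
qed

text \<open>The scale-invariant mass of the potential; the critical radius is the supremum of the
  radii at which it is at most 1.\<close>

definition ps::"'a => real => real" where
 "ps x r = r powr (2 - real DIM('a))* v x r"

lemma ps_nonneg: "0 <= ps x r"
 by (simp add: ps_def v_nonneg)

lemma ps_pos: "0 < r ==> 0 < ps x r"
 by (simp add: ps_def v_pos)

text \<open>The Jensen and reverse Hoelder bounds compare \<open>ps\<close> at the radii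
  \<open>R/2^k\<close> and \<open>R\<close> up to a constant as soon as \<open>s >= d/2\<close>. The
  strict gain \<open>g ^ k\<close>, present even at equality, is the reverse doubling of
  \<open>om\<close> raised to the power \<open>1/s\<close>.\<close>

lemma ps_dyadic: "? C g. 0 < C & 0 < g & g < 1 & (!x R k. 0 < R --> ps x (R/2 ^ k) <= C*g ^ k*ps x R)"
proof -
 obtain h where h: "0 < h" "h < 1" "!!x r. 0 < r ==> w x r <= h*w x (2*r)" using w_reverse_doubling by blast
 have wk: "w x (R/2 ^ k) <= h ^ k*w x R" if R: "0 < R" for x R k
 proof (induction k)
  case (Suc k)
  have "w x (R/2 ^ Suc k) <= h*w x (R/2 ^ k)" using h(3)[of "R/2 ^ Suc k" x] R by simp
  also have "... <= h*(h ^ k*w x R)" using h Suc by (intro mono_l) auto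
  finally show ?case by (simp add: mult_ac)
 qed simp
 define g where "g=h powr (1/s)"
 define C where "C=2*K powr (1/s)"
 have s0: "s ~= 0" "0 < s" using s by auto
 have g: "0 < g" "g < 1" using h s powr_less_mono2[of "1/s" h 1] by (auto simp: g_def)
 have "ps x (R/2 ^ k) <= C*g ^ k*ps x R" if R: "0 < R" for x R k
 proof -
  define r where "r=R/2 ^ k"
  have r: "0 < r" using R by (simp add: r_def)
  define q where "q=(2::real) ^ k"
  have q: "0 < q" "1 <= q" "R = q*r" by (auto simp: q_def r_def)
  have br: "0 < b r" and bR: "0 < b R" using r R b_pos by auto
  have bq: "b R = q ^ DIM('a)*b r" by (simp add: b_def q(3) power_mult_distrib)
  have "b r*(v x r/(2*b r)) powr s <= w x r" by (rule v_le_w[OF r])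
  also have "... <= h ^ k*w x R" using wk[OF R, of x k] by (simp add: r_def)
  also have "... <= h ^ k*(K*b R*(v x R/b R) powr s)" using h by (intro mono_l RH' R) auto
  finally have "(v x r/(2*b r)) powr s <= h ^ k*K*q ^ DIM('a)*(v x R/b R) powr s"
  using br by (simp add: bq mult_ac)
  hence "((v x r/(2*b r)) powr s) powr (1/s) <= (h ^ k*K*q ^ DIM('a)*(v x R/b R) powr s) powr (1/s)"
  using s0 by (intro powr_mono2) auto
  moreover have "((v x r/(2*b r)) powr s) powr (1/s) = v x r/(2*b r)"
  using s0 v_nonneg[of x r] br by (simp add: powr_powr)
  moreover have "(h ^ k*K*q ^ DIM('a)*(v x R/b R) powr s) powr (1/s)
  = (h ^ k) powr (1/s)*K powr (1/s)*(q ^ DIM('a)) powr (1/s)*(v x R/b R)"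
  using s0 h K q v_nonneg[of x R] bR by (simp add: powr_mult powr_powr)
  moreover have "(h ^ k) powr (1/s) = g ^ k"
  using h by (simp add: g_def powr_realpow[symmetric] powr_powr mult.commute)
  moreover have "(q ^ DIM('a)) powr (1/s) = q powr (real DIM('a)/s)"
  using q by (simp add: powr_realpow[symmetric] powr_powr)
  ultimately have "v x r/(2*b r) <= g ^ k*K powr (1/s)*q powr (real DIM('a)/s)*(v x R/b R)" by simp
  hence "v x r <= (2*b r)*(g ^ k*K powr (1/s)*q powr (real DIM('a)/s)*(v x R/b R))"
  using br by (simp add: divide_le_eq mult.commute)
  also have "... = C*g ^ k*(q powr (real DIM('a)/s)/q ^ DIM('a))* v x R"
  unfolding bq using br q(1) by (simp add: C_def field_simps)
  also have "... <= C*g ^ k*q powr (2 - real DIM('a))* v x R"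
  proof (intro mono_r mono_l v_nonneg)
  have "q powr (real DIM('a)/s)/q ^ DIM('a) = q powr (real DIM('a)/s - real DIM('a))"
  using q by (simp add: powr_diff powr_realpow)
  \<comment> \<open>Here \<open>s >= d/2\<close> enters, in the form
    \<open>d/s <= 2\<close>.\<close>
  also have "... <= q powr (2 - real DIM('a))"
  using q s s0 by (intro powr_mono) (auto simp: field_simps)
  finally show "q powr (real DIM('a)/s)/q ^ DIM('a) <= q powr (2 - real DIM('a))" .
  qed (use g in "auto simp: C_def")
  finally have "v x r <= C*g ^ k*q powr (2 - real DIM('a))* v x R" .
  hence "r powr (2 - real DIM('a))* v x r <= r powr (2 - real DIM('a))*(C*g ^ k*q powr (2 - real DIM('a))* v x R)"
  by (intro mono_l) auto
  also have "... = C*g ^ k*ps x R" using q r by (simp add: ps_def powr_mult mult_ac)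
  finally show ?thesis by (simp add: ps_def r_def)
 qed
 moreover have "0 < C" using K by (simp add: C_def)
 ultimately show ?thesis using g by blast
qed

lemma dyadic_le:
 fixes r R::real
 assumes "0 < r" "r <= R"
 obtains k::nat where "r <= R/2 ^ k" "R/2 ^ k < 2*r"
proof -
 obtain n where n: "R/2 ^ n < 2*r"
 proof -
  obtain n where "R/(2*r) < 2 ^ n" using real_arch_pow[of 2 "R/(2*r)"] by auto
  thus ?thesis using assms by (intro that[of n]) (simp add: field_simps)
 qed
 define k where "k=(LEAST n. R/2 ^ n < 2*r)"
 have 1: "R/2 ^ k < 2*r" unfolding k_def by (rule LeastI[of _ n]) (rule n)
 have "r <= R/2 ^ k"
 proof (cases k)
  case (Suc i)
  hence "~ R/2 ^ i < 2*r" using not_less_Least[of i "%n. R/2 ^ n < 2*r"] by (simp add: k_def)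
  thus ?thesis using Suc by simp
 qed (use assms in simp)
 with 1 show ?thesis by (intro that)
qed

lemma ps_growth: "? C de. 1 <= C & 0 < de & de <= 1 & (!x r R. 0 < r --> r <= R --> ps x r <= C*(r/R) powr de*ps x R)"
proof -
 obtain C0 g where C0: "0 < C0" and g: "0 < g" "g < 1"
  and d: "!!x R k. 0 < R ==> ps x (R/2 ^ k) <= C0*g ^ k*ps x R" using ps_dyadic by blast
 \<comment> \<open>The exponent corresponding to the gain \<open>g\<close> per halving, capped at 1
   so that it can serve as a Hoelder exponent.\<close>
 define de where "de=min 1 (- log 2 g)"
 have lg: "log 2 g < 0" using g by simp
 have de: "0 < de" "de <= 1" using lg by (auto simp: de_def)
 define C where "C=max 1 (2 ^ DIM('a)*C0*2)"
 have "ps x r <= C*(r/R) powr de*ps x R" if r: "0 < r" "r <= R" for x r R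
 proof -
  obtain k::nat where k: "r <= R/2 ^ k" "R/2 ^ k < 2*r" using dyadic_le[OF r] by blast
  define t where "t=R/2 ^ k"
  have t: "0 < t" "r <= t" "t < 2*r" using k r by (auto simp: t_def)
  have "ps x r <= r powr (2 - real DIM('a))* v x t"
  unfolding ps_def using t by (intro mono_l v_mono subset_ball) auto
  also have "... <= (2 ^ DIM('a)*t powr (2 - real DIM('a)))* v x t"
  proof (intro mono_r v_nonneg)
  have "r powr (2 - real DIM('a)) <= (t/2) powr (2 - real DIM('a))"
  using t dim by (intro powr_mono2') auto
  also have "... = t powr (2 - real DIM('a))*2 powr (real DIM('a) - 2)"
  using t by (simp add: powr_divide powr_diff[of 2] field_simps)
  also have "... <= t powr (2 - real DIM('a))*2 powr real DIM('a)" by (intro mono_l powr_mono) auto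
  finally show "r powr (2 - real DIM('a)) <= 2 ^ DIM('a)*t powr (2 - real DIM('a))" by (simp add: powr_realpow mult.commute)
  qed
  also have "... = 2 ^ DIM('a)*ps x t" by (simp add: ps_def)
  also have "... <= 2 ^ DIM('a)*(C0*g ^ k*ps x R)"
  unfolding t_def using r by (intro mono_l d) auto
  also have "... <= 2 ^ DIM('a)*(C0*(2*(r/R) powr de)*ps x R)"
  proof (intro mono_l mono_r ps_nonneg)
  have "g ^ k = 2 powr (log 2 g*real k)"
  using g by (simp add: powr_powr[symmetric] powr_realpow)
  also have "... <= 2 powr (- de*real k)" by (intro powr_mono mono_r) (auto simp: de_def)
  also have "... = (1/2 ^ k) powr de"
  proof -
  have "1/2 ^ k = (2::real) powr (- real k)" by (simp only: powr_minus_divide powr_realpow[OF zero_less_numeral])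
  thus ?thesis by (simp only: powr_powr) (simp add: mult.commute)
  qed
  also have "... <= (2*(r/R)) powr de" using k r de by (intro powr_mono2) (auto simp: field_simps)
  also have "... = 2 powr de*(r/R) powr de" by (rule powr_mult)
  also have "... <= 2 powr 1*(r/R) powr de" using de by (intro mono_r powr_mono) auto
  finally show "g ^ k <= 2*(r/R) powr de" by simp
  qed (use C0 in auto)
  also have "2 ^ DIM('a)*(C0*(2*(r/R) powr de)*ps x R) = (2 ^ DIM('a)*C0*2)*((r/R) powr de*ps x R)" by simp
  also have "... <= C*((r/R) powr de*ps x R)" by (intro mono_r mult_nonneg_nonneg ps_nonneg) (auto simp: C_def)
  finally show ?thesis by (simp add: mult_ac)
 qed
 moreover have "1 <= C" by (simp add: C_def)
 ultimately show ?thesis using de by blast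
qed

end

context potential
begin

text \<open>The growth exponent is chosen first and its constant \<open>cg\<close> afterwards, which
  fixes both for the rest of the proof.\<close>

definition dl::real where
 "dl = (SOME de. ? C. 1 <= C & 0 < de & de <= 1 & (!x r R. 0 < r --> r <= R --> ps x r <= C*(r/R) powr de*ps x R))"

definition cg::real where
 "cg = (SOME C. 1 <= C & 0 < dl & dl <= 1 & (!x r R. 0 < r --> r <= R --> ps x r <= C*(r/R) powr dl*ps x R))"

lemma cg_dl: "1 <= cg & 0 < dl & dl <= 1 & (!x r R. 0 < r --> r <= R --> ps x r <= cg*(r/R) powr dl*ps x R)"
proof -
 have "? de C. 1 <= C & 0 < de & de <= 1 & (!x r R. 0 < r --> r <= R --> ps x r <= C*(r/R) powr de*ps x R)"
  using ps_growth by blast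
 from someI_ex[OF this] show ?thesis unfolding cg_def dl_def[symmetric] by (rule someI_ex)
qed

lemmas cg = cg_dl[THEN conjunct1] and dl = cg_dl[THEN conjunct2, THEN conjunct1] cg_dl[THEN conjunct2, THEN conjunct2, THEN conjunct1]

lemma growth: "0 < r ==> r <= R ==> ps x r <= cg*(r/R) powr dl*ps x R"
 using cg_dl by blast

lemma ps_upper:
 assumes "0 < r" "r <= R"
 shows "ps x R <= 2 ^ nd*(R/r) ^ nd*ps x r"
proof -
 have "ps x R <= r powr (2 - real DIM('a))*(2 ^ nd*(R/r) ^ nd* v x r)"
  unfolding ps_def using assms dim by (intro mult_mono doubling_ratio powr_mono2' v_nonneg) auto
 thus ?thesis by (simp add: ps_def mult_ac)
qed

definition rho::"'a => real" where
 "rho x = Sup {r. 0 < r & r powr (2 - real DIM('a))* v x r <= 1}"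

lemma rho_bdd: "bdd_above {r. 0 < r & r powr (2 - real DIM('a))* v x r <= 1}"
proof (rule bdd_aboveI)
 fix r assume "r : {r. 0 < r & r powr (2 - real DIM('a))* v x r <= 1}"
 hence r: "0 < r" "ps x r <= 1" by (auto simp: ps_def)
 show "r <= max 1 ((cg/ps x 1) powr (1/dl))"
 proof (cases "r <= 1")
  case False
  have p: "0 < ps x 1" by (rule ps_pos) simp
  have "ps x 1 <= cg*(1/r) powr dl*ps x r" using False by (intro growth) auto
  also have "... <= cg*(1/r) powr dl*1" using r cg by (intro mono_l) auto
  also have "(1/r) powr dl = 1/r powr dl" using r by (simp add: powr_divide)
  finally have "r powr dl <= cg/ps x 1" using r p by (simp add: field_simps)
  hence "(r powr dl) powr (1/dl) <= (cg/ps x 1) powr (1/dl)" using dl by (intro powr_mono2) auto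
  hence "r <= (cg/ps x 1) powr (1/dl)" using r dl by (simp add: powr_powr)
  thus ?thesis by simp
 qed simp
qed

lemma rho_nonempty: "? r. 0 < r & ps x r <= 1"
proof -
 have p: "0 < cg*ps x 1" using ps_pos[of 1 x] cg by simp
 define r where "r=min 1 ((1/(cg*ps x 1)) powr (1/dl))"
 have r: "0 < r" "r <= 1" using p by (auto simp: r_def)
 have "r powr dl <= ((1/(cg*ps x 1)) powr (1/dl)) powr dl" using r dl by (intro powr_mono2) (auto simp: r_def)
 also have "... = 1/(cg*ps x 1)" using p dl by (simp add: powr_powr)
 finally have "r powr dl*(cg*ps x 1) <= 1" using p by (simp add: pos_le_divide_eq)
 moreover have "ps x r <= cg*(r/1) powr dl*ps x 1" using r by (intro growth) auto
 ultimately have "ps x r <= 1" by (simp add: mult_ac)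
 with r show ?thesis by blast
qed

lemma rho_upper: "0 < r ==> ps x r <= 1 ==> r <= rho x"
 unfolding rho_def by (rule cSup_upper[OF _ rho_bdd]) (simp add: ps_def)

lemma rho_pos: "0 < rho x"
 using rho_nonempty[of x] rho_upper by (meson less_le_trans)

definition c4::real where "c4=4 ^ nd"

lemma c4: "1 <= c4" by (simp add: c4_def)

text \<open>Instead of continuity in the radius: some radius above \<open>rho x / 2\<close> has
  \<open>ps\<close> at most 1 and the radius \<open>2 * rho x\<close> has it above 1; doubling moves
  both facts to \<open>rho x\<close>.\<close>

lemma ps_rho: "ps x (rho x) <= c4" "1/c4 <= ps x (rho x)"
proof -
 have "rho x/2 < rho x" using rho_pos[of x] by simp
 then obtain r where r: "0 < r" "ps x r <= 1" "rho x/2 < r"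
  unfolding rho_def using rho_nonempty[of x] by (subst (asm) less_cSup_iff[OF _ rho_bdd]) (auto simp: ps_def)
 have le: "r <= rho x" by (rule rho_upper[OF r(1,2)])
 have "ps x (rho x) <= 2 ^ nd*(rho x/r) ^ nd*ps x r" by (rule ps_upper[OF r(1) le])
 also have "... <= 2 ^ nd*2 ^ nd*1"
  using r rho_pos[of x] by (intro mult_mono power_mono) (auto simp: ps_nonneg field_simps)
 also have "... = c4" by (simp add: c4_def power_mult_distrib[symmetric])
 finally show "ps x (rho x) <= c4" .
 have "~ ps x (2*rho x) <= 1" using rho_upper[of "2*rho x" x] rho_pos[of x] by auto
 moreover have "ps x (2*rho x) <= 2 ^ nd*(2*rho x/rho x) ^ nd*ps x (rho x)"
  using rho_pos[of x] by (intro ps_upper) auto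
 moreover have "2 ^ nd*(2*rho x/rho x) ^ nd = c4" using rho_pos[of x] by (simp add: c4_def power_mult_distrib[symmetric])
 ultimately have "1 <= c4*ps x (rho x)" by simp
 thus "1/c4 <= ps x (rho x)" using c4 by (simp add: divide_le_eq mult.commute)
qed

lemma ps_lower: "rho x <= R ==> (R/rho x) powr dl <= cg*c4*ps x R"
proof -
 assume R: "rho x <= R"
 have R0: "0 < R" using R rho_pos[of x] by linarith
 have "1/c4 <= cg*(rho x/R) powr dl*ps x R"
  using ps_rho(2)[of x] growth[OF rho_pos R] by (rule order_trans)
 also have "(rho x/R) powr dl = 1/(R/rho x) powr dl" using R0 rho_pos[of x] by (simp add: powr_divide)
 finally show ?thesis using c4 R0 rho_pos[of x] by (simp add: field_simps)
qed

text \<open>Above the critical radius by doubling from \<open>rho x\<close>, below it by the growth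
  estimate up to \<open>rho x\<close>.\<close>

lemma ps_poly: "0 < R ==> ps x R <= 2 ^ nd*c4*cg*(1 + R/rho x) ^ nd"
proof -
 assume R: "0 < R"
 note rp = rho_pos[of x]
 show ?thesis
 proof (cases "rho x <= R")
  case True
  have "ps x R <= 2 ^ nd*(R/rho x) ^ nd*ps x (rho x)" by (rule ps_upper[OF rp True])
  also have "... <= 2 ^ nd*(1 + R/rho x) ^ nd*c4"
  using R rp ps_rho by (intro mult_mono mono_l power_mono) (auto simp: ps_nonneg)
  also have "... <= 2 ^ nd*(1 + R/rho x) ^ nd*(c4*cg)"
  using c4 cg R rp mono_l[OF cg, of c4] by (intro mono_l) auto
  finally show ?thesis by (simp add: mult_ac)
 next
  case False
  have "ps x R <= cg*(R/rho x) powr dl*ps x (rho x)" using False R by (intro growth) auto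
  also have "... <= cg*1*c4"
  using False R rp cg dl ps_rho by (intro mult_mono powr_le1) (auto simp: ps_nonneg)
  also have "... <= (2 ^ nd*c4*cg)*1" using cg c4 mono_r[of 1 "2 ^ nd" "c4*cg"] by (simp add: mult_ac)
  also have "... <= 2 ^ nd*c4*cg*(1 + R/rho x) ^ nd"
  using cg c4 R rp by (intro mono_l one_le_power) auto
  finally show ?thesis .
 qed
qed

lemma ps_move:
 assumes R: "0 < R" and xy: "dist x y <= R"
 shows "ps x R <= 2 ^ nd*ps y R"
proof -
 have "ball x R \<subseteq> ball y (2* R)"
 proof
  fix z assume "z : ball x R"
  thus "z : ball y (2* R)" using xy dist_triangle[of y z x] by (simp add: dist_commute)
 qed
 hence "v x R <= 2 ^ nd* v y R" using v_mono doubling[OF R] order_trans by blast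
 hence "R powr (2 - real DIM('a))* v x R <= R powr (2 - real DIM('a))*(2 ^ nd* v y R)" by (intro mono_l) auto
 thus ?thesis by (simp add: ps_def mult_ac)
qed

text \<open>Comparing the growth exponent \<open>dl\<close> at \<open>x\<close> with the doubling
  exponent \<open>nd\<close> at \<open>y\<close> suggests \<open>dl/nd\<close>; the denominator
  \<open>nd + 1\<close> is positive in any case and keeps the quotient at most 1.\<close>

definition kk::real where "kk=dl/(nd + 1)"

lemma kk: "0 < kk" "kk <= 1"
 using dl by (auto simp: kk_def divide_le_eq)

text \<open>The two entries are the constants of the two cases in \<open>rho_slow\<close>.\<close>

definition cr::real where
 "cr = max (2 ^ nd*c4*(2 ^ nd*cg*c4)) ((2 ^ nd*cg*c4*c4) powr (1/dl))"

lemma cr: "1 <= cr"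
proof -
 have 1: "1 <= 2 ^ nd*c4" using mult_mono[of 1 "2 ^ nd" 1 c4] c4 by simp
 have 2: "1 <= 2 ^ nd*cg" using mult_mono[of 1 "2 ^ nd" 1 cg] cg by simp
 have 3: "1 <= 2 ^ nd*cg*c4" using mult_mono[of 1 "2 ^ nd*cg" 1 c4] 2 c4 by simp
 have "1 <= 2 ^ nd*c4*(2 ^ nd*cg*c4)" using mult_mono[OF 1 3] 1 by simp
 thus ?thesis by (simp add: cr_def)
qed

text \<open>Points at distance at most \<open>R\<close> see comparable potential masses at radius
  \<open>R\<close>. This mass is large when \<open>R\<close> is large compared with
  \<open>rho x\<close>, and at \<open>y\<close> that is possible only if \<open>rho y\<close> is
  small compared with \<open>R\<close>.\<close>

lemma rho_slow:
 assumes xy: "dist x y <= R" and R: "rho x <= R"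
 shows "rho y <= cr* R*(rho x/R) powr kk"
proof -
 note px = rho_pos[of x] and py = rho_pos[of y]
 have R0: "0 < R" using R px by linarith
 define C1 where "C1=2 ^ nd*cg*c4"
 have low: "(T/rho x) powr dl <= C1*ps y T" if "R <= T" for T
 proof -
  have "(T/rho x) powr dl <= cg*c4*ps x T" using R that by (intro ps_lower) auto
  also have "... <= cg*c4*(2 ^ nd*ps y T)" using xy that R0 cg c4 by (intro mono_l ps_move) auto
  finally show ?thesis by (simp add: C1_def mult_ac)
 qed
 have C1: "0 < C1" using cg c4 by (simp add: C1_def)
 show ?thesis
 proof (cases "rho y <= R")
  case True
  define C2 where "C2=2 ^ nd*c4*C1"
  have "(R/rho x) powr dl <= C1*ps y R" by (rule low) simp
  also have "... <= C1*(2 ^ nd*(R/rho y) ^ nd*c4)"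
  using C1 py True by (intro mono_l order_trans[OF ps_upper[OF py True]] ps_rho) auto
  also have "... = C2*(R/rho y) ^ nd" by (simp add: C2_def mult_ac)
  also have "... <= C2*(R/rho y) ^ (nd + 1)"
  using True py C1 c4 by (intro mono_l power_increasing) (auto simp: C2_def)
  finally have 1: "(R/rho x) powr dl <= C2*(R/rho y) ^ (nd + 1)" .
  have C2cr: "C2 <= cr" by (simp add: C2_def C1_def cr_def)
  have "(R/rho x) powr dl <= cr ^ (nd + 1)*(R/rho y) ^ (nd + 1)"
  proof (rule order_trans[OF 1 mono_r])
  have "C2 <= cr ^ 1" using C2cr by simp
  also have "... <= cr ^ (nd + 1)" using cr by (intro power_increasing) auto
  finally show "C2 <= cr ^ (nd + 1)" .
  qed (use R0 py in auto)
  hence "(R/rho x) powr dl <= (cr*(R/rho y)) ^ (nd + 1)" by (simp only: power_mult_distrib)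
  hence "(R/rho x) powr dl <= (cr*(R/rho y)) powr real (nd + 1)"
  using cr R0 py by (subst powr_realpow) auto
  hence "((R/rho x) powr dl) powr (1/real (nd + 1)) <= ((cr*(R/rho y)) powr real (nd + 1)) powr (1/real (nd + 1))"
  by (intro powr_mono2) auto
  hence "(R/rho x) powr kk <= cr*(R/rho y)"
  using cr R0 py by (simp add: powr_powr kk_def add.commute)
  hence "rho y*(R/rho x) powr kk <= cr* R" using py by (simp add: pos_le_divide_eq mult.commute)
  moreover have "0 < (R/rho x) powr kk" using R0 px by simp
  ultimately have "rho y <= cr* R/(R/rho x) powr kk" by (simp add: pos_le_divide_eq)
  moreover have "(rho x/R) powr kk = 1/(R/rho x) powr kk" using R0 px by (simp add: powr_divide)
  ultimately show ?thesis by simp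
 next
  \<comment> \<open>At the radius \<open>rho y > R\<close> the mass \<open>ps\<close> around
    \<open>y\<close> is of order 1, which bounds \<open>rho y\<close> by a multiple of
    \<open>rho x\<close>.\<close>
  case False
  have "(rho y/rho x) powr dl <= C1*ps y (rho y)" using False by (intro low) auto
  also have "... <= C1*c4" using C1 ps_rho by (intro mono_l) auto
  finally have "((rho y/rho x) powr dl) powr (1/dl) <= (C1*c4) powr (1/dl)" using dl by (intro powr_mono2) auto
  hence "rho y/rho x <= (C1*c4) powr (1/dl)" using dl px py by (simp add: powr_powr)
  also have "... <= cr" by (simp add: cr_def C1_def)
  finally have "rho y <= cr*rho x" using px by (simp add: divide_le_eq)
  also have "... = cr* R*(rho x/R) powr 1" using R0 px by simp
  also have "... <= cr* R*(rho x/R) powr kk"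
  using cr R0 R px kk by (intro mono_l powr_mono') auto
  finally show ?thesis .
 qed
qed

lemma nn_W_pk:
 assumes R: "0 < R" and k: "nd < k"
 shows "(NN y. en (W y)*en (pk k (norm (y - x)/R))) <= en (2 ^ (k + 1)* v x R)"
proof -
 have "(NN y. en (W y)*en (pk k (norm (y - x)/R))) <= en (2 ^ (k + 1))*en (v x R)"
 proof (rule nn_dyadic[OF _ R _ k])
  fix j::nat
  have "(NN y:ball x (2 ^ j* R). en (W y)) = en (v x (2 ^ j* R))" by (simp add: ennreal_v)
  also have "... <= en (v x R*2 ^ (nd*j))" using doubling_iter[OF R, of x j] by (intro ennreal_leI) (simp add: mult.commute)
  finally show "(NN y:ball x (2 ^ j* R). en (W y)) <= en (v x R)*en (2 ^ (nd*j))"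
  by (simp add: ennreal_mult v_nonneg)
 qed measurable
 thus ?thesis by (simp add: ennreal_mult v_nonneg)
qed

lemma integrable_W_pk:
 assumes R: "0 < R" and k: "nd < k"
 shows "itg (%y. W y*pk k (norm (y - x)/R))"
  "(LI y. W y*pk k (norm (y - x)/R)) <= 2 ^ (k + 1)* v x R"
proof -
 have nn: "0 <= W y*pk k (norm (y - x)/R)" for y using R by (intro mult_nonneg_nonneg W_nonneg pk_nonneg) auto
 have le: "(NN y. en (W y*pk k (norm (y - x)/R))) <= en (2 ^ (k + 1)* v x R)"
  using nn_W_pk[OF assms, of x] R by (simp add: ennreal_mult W_nonneg pk_nonneg)
 show i: "itg (%y. W y*pk k (norm (y - x)/R))"
  using le_less_trans[OF le ennreal_less_top] nn by (simp add: integrable_iff_bounded)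
 thus "(LI y. W y*pk k (norm (y - x)/R)) <= 2 ^ (k + 1)* v x R"
  using le nn v_nonneg by (simp add: nn_integral_eq_integral)
qed

text \<open>One Gaussian factor is bounded, the other decays faster than the doubling measure
  \<open>nu\<close> grows; this admits Gaussians as test elements.\<close>

lemma integrable_W_gauss_sq:
 assumes t: "0 < t"
 shows "itg (%y. W y*(gauss t (y - x))^2)"
proof (rule Bochner_Integration.integrable_bound)
 let ?k = "nd + 1"
 let ?C = "fact ?k*exp 2/gconst TYPE('a)*t ^-hd('a)"
 let ?B = "t ^-hd('a)/gconst TYPE('a)"
 show "itg (%y. (?B*?C)*(W y*pk ?k (norm (y - x)/sqrt t)))"
  using t by (intro integrable_mult_right integrable_W_pk) auto
 have "(gauss t (y - x))^2 <= (?B*?C)*pk ?k (norm (y - x)/sqrt t)" for y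
 proof -
  have "gauss t (y - x)*gauss t (y - x) <= ?B*(?C*pk ?k (norm (y - x)/sqrt t))"
  by (intro mult_mono gauss_le[OF t] gauss_le_pk[OF t] gauss_nonneg) (use gconst(1)[where 'a='a] in auto)
  thus ?thesis by (simp add: power2_eq_square mult_ac)
 qed
 hence le: "W y*(gauss t (y - x))^2 <= (?B*?C)*(W y*pk ?k (norm (y - x)/sqrt t))" for y
  using mono_l[OF _ W_nonneg[of y]] by (metis mult.left_commute)
 show "AL y. norm (W y*(gauss t (y - x))^2) <= norm ((?B*?C)*(W y*pk ?k (norm (y - x)/sqrt t)))"
 proof (intro AE_I2)
  fix y
  have "norm (W y*(gauss t (y - x))^2) = W y*(gauss t (y - x))^2" using W_nonneg[of y] by simp
  also note le[of y]
  finally show "norm (W y*(gauss t (y - x))^2) <= norm ((?B*?C)*(W y*pk ?k (norm (y - x)/sqrt t)))"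
  unfolding real_norm_def by (rule order_trans[OF _ abs_ge_self])
 qed
qed measurable

end

section \<open>Heat kernel estimates\<close>

text \<open>The L1 norm of a nonnegative element, with value infinity outside L1.\<close>

definition mass::"'a::euclidean_space l2 => ennreal" where
 "mass u = (NN x. en (rep u x))"

definition le_l2::"'a::euclidean_space l2 => real => bool" where
 "le_l2 u B <-> (AL x. rep u x <= B)"

lemma inner_gk_le:
 assumes t: "0 < t" and B: "le_l2 u B"
 shows "inner u (gk t x) <= B"
proof -
 have g: "itg (%y. gauss t (y - x))" "(LI y. gauss t (y - x)) = 1"
  using nn_integral_gauss[OF t, of x] by (auto simp: integrable_iff_bounded gauss_nonneg integral_eq_nn_integral)
 have "inner u (gk t x) = (LI y. rep u y*gauss t (y - x))" by (rule inner_gk[OF t])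
 also have "... <= (LI y. B*gauss t (y - x))"
  by (rule integral_mono_AE[OF integrable_gk[OF t]])
  (use g B in "auto simp: le_l2_def gauss_nonneg elim!: eventually_mono intro: mono_r")
 also have "... = B" using g by simp
 finally show ?thesis .
qed

lemma ennreal_inner_gk:
 assumes t: "0 < t" and u: "nn_l2 u"
 shows "en (inner u (gk t x)) = (NN y. en (rep u y)*en (gauss t (y - x)))"
proof -
 have nn: "AL y. 0 <= rep u y*gauss t (y - x)"
  using u unfolding nn_l2_def by eventually_elim (simp add: gauss_nonneg)
 have "en (inner u (gk t x)) = (NN y. en (rep u y*gauss t (y - x)))"
  unfolding inner_gk[OF t] by (rule nn_integral_eq_integral[symmetric, OF integrable_gk[OF t] nn])
 also have "... = (NN y. en (rep u y)*en (gauss t (y - x)))"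
  by (rule nn_integral_cong_AE, use u[unfolded nn_l2_def] in eventually_elim) (simp add: ennreal_mult gauss_nonneg)
 finally show ?thesis .
qed

lemma gauss_symm: "gauss t (x - y) = gauss t (y - x)"
 by (metis gauss_minus minus_diff_eq)

lemma mass_heat_on:
 fixes u::"'a::euclidean_space l2"
 assumes t: "0 < t" and u: "nn_l2 u" and [measurable]: "A : sets borel"
 shows "(NN x:A. en (inner u (gk t x)))
  = (NN y. en (rep u y)*(NN x:A. en (gauss t (x - y))))"
proof -
 have "(NN x:A. en (inner u (gk t x)))
  = (NN x. (NN y. en (rep u y)*(en (gauss t (x - y))*ind A x)))"
  by (intro nn_integral_cong, subst ennreal_inner_gk[OF t u], subst nn_integral_multc[symmetric])
  (auto simp: mult_ac gauss_symm intro!: nn_integral_cong)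
 also have "... = (NN y. (NN x. en (rep u y)*(en (gauss t (x - y))*ind A x)))"
  by (rule lborel_pair.Fubini') measurable
 also have "... = (NN y. en (rep u y)*(NN x:A. en (gauss t (x - y))))"
  by (intro nn_integral_cong nn_integral_cmult) measurable
 finally show ?thesis .
qed

lemma mass_heat:
 fixes u::"'a::euclidean_space l2"
 assumes t: "0 < t" and u: "nn_l2 u"
 shows "(NN x. en (inner u (gk t x))) = mass u"
 using mass_heat_on[OF t u, of UNIV] nn_integral_gauss[OF t, where 'a='a] by (simp add: mass_def)

text \<open>Tested with the indicator of the set where the bound fails, cut to a ball to be square
  integrable.\<close>

lemma le_l2_dual:
 assumes "!!A. A : sets borel ==> emeasure lborel A < oo ==> inner u (cls (ind A)) <= B*measure lborel A"
 shows "le_l2 u B"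
proof -
 have "AL x. x : ball 0 (real n) --> rep u x <= B" for n
 proof -
  define A where "A={x. B < rep u x} \<inter> ball 0 (real n)"
  have A [measurable]: "A : sets borel" unfolding A_def by measurable
  have fin: "emeasure lborel A < oo"
  using emeasure_mono[of A "ball 0 (real n)" lborel] emeasure_ball_less_top[of 0 "real n"] by (auto simp: A_def intro: le_less_trans)
  have sA: "sqi (ind A)" using fin A by (simp add: sqi_indicator)
  have i1: "itg (%x. rep u x*ind A x)" by (rule sqi_mult_integrable[OF sqi_rep sA])
  have i2: "itg (%x. B*ind A x)" using fin A by (simp add: integrable_indicator_iff)
  have "(LI x. rep u x*ind A x - B*ind A x) <= 0"
  using assms[OF A fin] i1 i2 by (simp add: inner_cls[OF sA] Bochner_Integration.integral_diff)
  moreover have nn: "0 <= rep u x*ind A x - B*ind A x" for x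
  by (auto simp: A_def ind_def)
  ultimately have "(LI x. rep u x*ind A x - B*ind A x) = 0"
  by (intro antisym Bochner_Integration.integral_nonneg)
  hence "AL x. rep u x*ind A x - B*ind A x = 0"
  using i1 i2 nn by (subst (asm) integral_nonneg_eq_0_iff_AE) auto
  thus ?thesis by eventually_elim (auto simp: A_def ind_def split: if_splits)
 qed
 hence "AL x. !n. x : ball 0 (real n) --> rep u x <= B" by (subst AE_all_countable) blast
 thus ?thesis unfolding le_l2_def
 proof eventually_elim
  case (elim x)
  obtain n where "norm x < real n" using reals_Archimedean2 by blast
  thus ?case using elim by auto
 qed
qed

lemma le_l2_inner_indicator:
 assumes "le_l2 u B" "A : sets borel" "emeasure lborel A < oo"
 shows "inner u (cls (ind A)) <= B*measure lborel A"
proof -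
 have sA: "sqi (ind A)" using assms by (simp add: sqi_indicator)
 have "(LI x. rep u x*ind A x) <= (LI x. B*ind A x)"
 proof (rule integral_mono_AE[OF sqi_mult_integrable[OF sqi_rep sA]])
  show "itg (%x. B*ind A x)" using assms by (simp add: integrable_indicator_iff)
  show "AL x. rep u x*ind A x <= B*ind A x"
  using assms(1) unfolding le_l2_def by eventually_elim (simp add: ind_def)
 qed
 thus ?thesis using assms by (simp add: inner_cls[OF sA])
qed

lemma inner_indicator_mass:
 assumes "nn_l2 u" "A : sets borel" "emeasure lborel A < oo"
 shows "en (inner u (cls (ind A))) = (NN x:A. en (rep u x))"
proof -
 have sA: "sqi (ind A)" using assms by (simp add: sqi_indicator)
 have "en (inner u (cls (ind A))) = (NN x. en (rep u x*ind A x))"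
  unfolding inner_cls[OF sA]
  by (rule nn_integral_eq_integral[symmetric, OF sqi_mult_integrable[OF sqi_rep sA]])
  (use assms(1) in "auto simp: nn_l2_def ind_def elim!: eventually_mono")
 also have "... = (NN x:A. en (rep u x))"
  by (intro nn_integral_cong) (auto simp: ind_def)
 finally show ?thesis .
qed

lemma mass_eq_SUP: "mass u = (SUP n. NN x:ball 0 (real n). en (rep u x))"
proof -
 have "mass u = (NN x. (SUP n. en (rep u x)*ind (ball 0 (real n)) x))"
  unfolding mass_def
 proof (rule nn_integral_cong)
  fix x::'a
  obtain m where m: "norm x < real m" using reals_Archimedean2 by blast
  show "en (rep u x) = (SUP n. en (rep u x)*ind (ball 0 (real n)) x)"
  by (rule antisym[OF SUP_upper2[of m] SUP_least]) (use m in "auto simp: ind_def")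
 qed
 also have "... = (SUP n. NN x:ball 0 (real n). en (rep u x))"
  by (rule nn_integral_monotone_convergence_SUP) (auto simp: incseq_def le_fun_def ind_def)
 finally show ?thesis .
qed

context schroedinger_l2
begin

text \<open>Domination by the free flow, whose kernel has mass 1; \<open>mass_S\<close> holds for
  the same reason, with the mass taken in the other variable.\<close>

lemma le_S:
 assumes u: "nn_l2 u" "le_l2 u B" and t: "0 <= t"
 shows "le_l2 (S t u) B"
proof (cases "t = 0")
 case False
 thus ?thesis unfolding le_l2_def using domination[OF u(1), of t] t inner_gk_le[OF _ u(2)]
  by (auto elim!: eventually_mono intro: order_trans)
qed (use u in simp)

lemma mass_S:
 assumes u: "nn_l2 u" and t: "0 <= t"
 shows "mass (S t u) <= mass u"
proof (cases "t = 0")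
 case False
 hence "mass (S t u) <= (NN x. en (inner u (gk t x)))"
  unfolding mass_def using domination[OF u, of t] t by (intro nn_integral_mono_AE) (auto elim!: eventually_mono intro: ennreal_leI)
 thus ?thesis using mass_heat[OF _ u, of t] False t by simp
qed simp

lemma inner_avg:
 assumes h: "0 < h"
 shows "inner (avg h u) z = integral {0..h} (%s. inner (S s u) z)/h"
 using integral_linear[OF integrable_S[where x=u and a = 0 and b = h] bounded_linear_inner_left[of z]] h
 by (simp add: o_def avg_def divide_inverse mult.commute)

lemma inner_avg_le:
 assumes h: "0 < h" and c: "!!s. 0 <= s ==> inner (S s u) z <= c"
 shows "inner (avg h u) z <= c"
proof -
 have "integral {0..h} (%s. inner (S s u) z) <= integral {0..h} (%s. c)"
  by (rule integral_le) (use integrable_linear[OF integrable_S[where x=u and a = 0 and b = h] bounded_linear_inner_left[of z]] c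
  in "auto simp: o_def")
 thus ?thesis using h by (simp add: inner_avg divide_le_eq mult.commute)
qed

text \<open>Time averages keep sign, upper bound and mass, because each of these is tested by inner
  products, which pass under the time integral.\<close>

lemma nn_approx2:
 assumes f: "nn_l2 f"
 obtains F where "!!n::nat. nn_l2 (F n)" "!!n. ? h. gen (F n) h" "F ----> f"
  "!!n B. le_l2 f B ==> le_l2 (F n) B" "!!n. mass (F n) <= mass f"
proof -
 define F where "F n = avg (1/real (Suc n)) f" for n
 have "filterlim (%n. 1/real (Suc n)) (at_right 0) sequentially"
  unfolding filterlim_at using LIMSEQ_inverse_real_of_nat by (auto simp: inverse_eq_divide)
 from filterlim_compose[OF avg_tendsto this, of f] have lim: "F ----> f" by (simp add: F_def[abs_def])
 have nF: "nn_l2 (F n)" for n unfolding F_def by (rule nn_avg[OF f]) simp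
 show ?thesis
 proof (rule that[of F])
  show "nn_l2 (F n)" "F ----> f" for n by (fact nF lim)+
  show "? h. gen (F n) h" for n unfolding F_def using gen_avg[of "1/real (Suc n)" f] by auto
  show "le_l2 (F n) B" if B: "le_l2 f B" for n B
  proof (rule le_l2_dual)
  fix A::"'a set" assume A: "A : sets borel" "emeasure lborel A < oo"
  show "inner (F n) (cls (ind A)) <= B*measure lborel A"
  unfolding F_def by (intro inner_avg_le le_l2_inner_indicator le_S f B A) auto
  qed
  show "mass (F n) <= mass f" for n
  proof (cases "mass f = oo")
  case False
  then obtain m where m: "mass f = en m" "0 <= m" by (cases "mass f") auto
  have "(NN x:ball 0 (real k). en (rep (F n) x)) <= mass f" for k
  proof -
  have "inner (F n) (cls (ind (ball 0 (real k)))) <= m"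
  unfolding F_def
  proof (rule inner_avg_le)
  fix s::real assume s: "0 <= s"
  have "en (inner (S s f) (cls (ind (ball 0 (real k))))) <= mass (S s f)"
  unfolding inner_indicator_mass[OF nn_S[OF f s] ball_in_borel emeasure_ball_less_top[folded infinity_ennreal_def]] mass_def
  by (intro nn_integral_mono) (auto simp: ind_def)
  also have "... <= en m" using mass_S[OF f s] m by simp
  finally show "inner (S s f) (cls (ind (ball 0 (real k)))) <= m" using m by simp
  qed simp
  hence "en (inner (F n) (cls (ind (ball 0 (real k))))) <= mass f"
  unfolding m by (rule ennreal_leI)
  thus ?thesis
  unfolding inner_indicator_mass[OF nF ball_in_borel emeasure_ball_less_top[folded infinity_ennreal_def]] .
  qed
  thus ?thesis unfolding mass_eq_SUP[of "F n"] by (rule SUP_least)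
  qed simp
 qed
qed

end

text \<open>At distances of at least \<open>sqrt t\<close> the two Gaussians are estimated
  separately, below it the mean value theorem applies; since \<open>0 < a <= 1\<close>, the power
  \<open>a\<close> of \<open>dist x z / sqrt t\<close> serves in both cases.\<close>

lemma gauss_difference:
 fixes x z y::"'a::euclidean_space"
 assumes t: "0 < t" and a: "0 < a" "a <= 1"
 shows "<|gauss t (y - x) - gauss t (y - z)|>
  <= 2 ^ k*(fact (k + 1)*exp 2/gconst TYPE('a))*(dist x z/sqrt t) powr a*t ^-hd('a)*(pk k (norm (y - x)/sqrt t) + pk k (norm (y - z)/sqrt t))"
proof -
 define C where "C=2 ^ k*(fact (k + 1)*exp 2/gconst TYPE('a))"
 define P where "P x = pk k (norm (y - x)/sqrt t)" for x
 have P: "0 <= P x" for x using t by (simp add: P_def pk_nonneg)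
 define T where "T=t ^-hd('a)"
 have T: "0 <= T" by (simp add: T_def)
 define C0 where "C0=fact (k + 1)*exp 2/gconst TYPE('a)"
 have C0: "0 <= C0" by (simp add: C0_def)
 have C1: "C = 2 ^ k*C0" by (simp add: C_def C0_def)
 have C: "C = 2 ^ k*C0" "C0 <= C" using C1 mono_r[of 1 "2 ^ k" C0] C0 by auto
 have m: "gauss t z*(norm z/sqrt t) ^ j <= C0*T*pk k (norm z/sqrt t)" if "j <= 1" for j and z::'a
  using gauss_moment_bound[OF t that, of z k] by (simp add: C0_def T_def)
 show ?thesis
 proof (cases "sqrt t <= dist x z")
  case True
  have "<|gauss t (y - x) - gauss t (y - z)|> <= gauss t (y - x) + gauss t (y - z)"
  using gauss_nonneg[of t "y - x"] gauss_nonneg[of t "y - z"] by linarith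
  also have "... <= C0*T*P x + C0*T*P z"
  using m[of 0 "y - x"] m[of 0 "y - z"] by (intro add_mono) (auto simp: P_def)
  also have "... = (C0*1)*(T*(P x + P z))" by (simp add: algebra_simps)
  also have "... <= (C*(dist x z/sqrt t) powr a)*(T*(P x + P z))"
  using True t a C C0 P T by (intro mono_r mult_mono ge_one_powr_ge_zero) auto
  finally show ?thesis by (simp add: P_def T_def C_def mult_ac)
 next
  case False
  show ?thesis
  proof (cases "x = z")
  case xz: False
  define D where "D=dist x z"
  have D: "0 < D" "D < sqrt t" using xz False by (auto simp: D_def)
  define e where "e=(z - x) /\<^sub>R D"
  have e: "norm e = 1" "D *. e = z - x" using D by (auto simp: e_def D_def dist_norm norm_minus_commute)
  obtain xi where xi: "0 < xi" "xi < D" and eq: "gauss t (y - x - D *. e) - gauss t (y - x - 0 *. e)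
  = (D - 0)*(gauss t (y - x - xi *. e)*(((y - x - xi *. e) .* e)/(2*t)))"
  using MVT2[OF D(1), of "%s. gauss t (y - x - s *. e)" "%s. gauss t (y - x - s *. e)*(((y - x - s *. e) .* e)/(2*t))"]
  gauss_translate_deriv[OF t] by blast
  define q where "q=y - x - xi *. e"
  have "<|gauss t (y - x) - gauss t (y - z)|> = D*(gauss t q*(<|q .* e|>/(2*t)))"
  using eq D t e by (simp add: q_def abs_minus_commute[of "gauss t (y - x)"] abs_mult gauss_nonneg)
  also have "... <= D*(gauss t q*(norm q/t))"
  using D t Cauchy_Schwarz_ineq2[of q e] e by (intro mono_l frac_le) (auto simp: gauss_nonneg)
  also have "... = D/sqrt t*(gauss t q*(norm q/sqrt t) ^ 1)" using t by (simp add: field_simps)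
  also have "... <= D/sqrt t*(C0*T*pk k (norm q/sqrt t))"
  using D t m[of 1 q] by (intro mono_l) auto
  also have "... <= D/sqrt t*(C0*T*(2 ^ k*P x))"
  using D t xi C0 T pk_near[OF t e(1), of xi k "y - x"] by (intro mono_l) (auto simp: q_def P_def)
  also have "... = D/sqrt t*(C*T*P x)" by (simp add: C mult_ac)
  also have "... <= (D/sqrt t) powr a*(C*T*(P x + P z))"
  proof (intro mult_mono mono_l)
  have "(D/sqrt t) powr 1 <= (D/sqrt t) powr a" using D t a by (intro powr_mono') auto
  thus "D/sqrt t <= (D/sqrt t) powr a" using D t by simp
  qed (use P C C0 T in auto)
  finally show ?thesis by (simp add: P_def T_def D_def C_def mult_ac)
  qed simp
 qed
qed

lemma integral_abs_gauss_difference: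
 fixes x z::"'a::euclidean_space"
 assumes t: "0 < t" and a: "0 < a" "a <= 1"
 shows "itg (%y. <|gauss t (y - x) - gauss t (y - z)|>)"
  "(LI y. <|gauss t (y - x) - gauss t (y - z)|>)
  <= 2 ^ (DIM('a) + 1)*(fact (DIM('a) + 2)*exp 2/gconst TYPE('a))*2 ^ (DIM('a) + 3)*unit_ball_vol DIM('a)*(dist x z/sqrt t) powr a"
proof -
 let ?k = "DIM('a) + 1"
 have ig: "itg (%y. gauss t (y - x))" for x::'a
  using nn_integral_gauss[OF t, of x] by (auto simp: integrable_iff_bounded gauss_nonneg)
 show i: "itg (%y. <|gauss t (y - x) - gauss t (y - z)|>)" by (intro integrable_abs Bochner_Integration.integrable_diff ig)
 have ip: "itg (%y. pk ?k (norm (y - x)/sqrt t))"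
  "(LI y. pk ?k (norm (y - x)/sqrt t)) <= 2 ^ (?k + 1)*unit_ball_vol DIM('a)* sqrt t ^ DIM('a)" for x::'a
 proof -
  have le: "(NN y. en (pk ?k (norm (y - x)/sqrt t))) <= en (2 ^ (?k + 1)*unit_ball_vol DIM('a)* sqrt t ^ DIM('a))"
  using t by (intro nn_integral_pk) auto
  show j: "itg (%y. pk ?k (norm (y - x)/sqrt t))"
  using le_less_trans[OF le ennreal_less_top] t by (simp add: integrable_iff_bounded pk_nonneg)
  show "(LI y. pk ?k (norm (y - x)/sqrt t)) <= 2 ^ (?k + 1)*unit_ball_vol DIM('a)* sqrt t ^ DIM('a)"
  using le j t by (subst (asm) nn_integral_eq_integral) (auto simp: pk_nonneg)
 qed
 define C where "C=2 ^ ?k*(fact (?k + 1)*exp 2/gconst TYPE('a))"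
 have C: "0 <= C" by (simp add: C_def)
 define c where "c=C*(dist x z/sqrt t) powr a*t ^-hd('a)"
 have c: "0 <= c" using C by (simp add: c_def)
 have "(LI y. <|gauss t (y - x) - gauss t (y - z)|>)
  <= (LI y. c*(pk ?k (norm (y - x)/sqrt t) + pk ?k (norm (y - z)/sqrt t)))"
  by (rule integral_mono[OF i]) (use ip gauss_difference[OF t a, of _ x z ?k] in "auto simp: c_def C_def")
 also have "... = c*((LI y. pk ?k (norm (y - x)/sqrt t)) + (LI y. pk ?k (norm (y - z)/sqrt t)))"
  using ip by (simp add: Bochner_Integration.integral_add)
 also have "... <= c*(2 ^ (?k + 1)*unit_ball_vol DIM('a)* sqrt t ^ DIM('a) + 2 ^ (?k + 1)*unit_ball_vol DIM('a)* sqrt t ^ DIM('a))"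
  using c ip by (intro mono_l add_mono) auto
 also have "... = C*(dist x z/sqrt t) powr a*(t ^-hd('a)* sqrt t ^ DIM('a))*(2 ^ (?k + 2)*unit_ball_vol DIM('a))"
  by (simp add: c_def algebra_simps)
 also have "t ^-hd('a)* sqrt t ^ DIM('a) = 1" using t by (simp add: powr_half_dim)
 finally show "(LI y. <|gauss t (y - x) - gauss t (y - z)|>)
  <= 2 ^ (DIM('a) + 1)*(fact (DIM('a) + 2)*exp 2/gconst TYPE('a))*2 ^ (DIM('a) + 3)*unit_ball_vol DIM('a)*(dist x z/sqrt t) powr a"
  by (simp add: C_def mult_ac numeral_3_eq_3)
qed

lemma sqrt_powr: "0 < q ==> sqrt q powr k = q powr (k/2)"
proof -
 assume q: "0 < q"
 have "sqrt q powr k = (q powr (1/2)) powr k" using q by (simp only: powr_half_sqrt)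
 also have "... = q powr (1/2*k)" by (rule powr_powr)
 finally show ?thesis by simp
qed

lemma div_sqrt_powr: "0 < q ==> 0 <= r ==> (r/sqrt q) powr k = r powr k*q powr (- (k/2))"
proof -
 assume q: "0 < q" and r: "0 <= r"
 have "(r/sqrt q) powr k = r powr k/sqrt q powr k" by (rule powr_divide)
 also have "... = r powr k*q powr (- (k/2))" unfolding sqrt_powr[OF q] powr_minus_divide[of q "k/2"] by simp
 finally show ?thesis .
qed

section \<open>Hoelder continuity from Duhamel's formula\<close>

locale schr = schroedinger_l2 S W + potential W s K
 for S::"real => 'a::euclidean_space l2 => 'a l2" and W s K
begin

text \<open>\<open>CE\<close> and \<open>CH\<close> are the constants of the potential term and of
  the free term in Duhamel's formula.\<close>

definition CE::real where
 "CE = 2 ^ (nd + 1)*(fact (nd + 2)*exp 2/gconst TYPE('a))*2 ^ (nd + 2)"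

definition CH::real where
 "CH = 2 ^ (DIM('a) + 1)*(fact (DIM('a) + 2)*exp 2/gconst TYPE('a))*2 ^ (DIM('a) + 3)*unit_ball_vol DIM('a)"

lemma CE: "0 < CE" and CH: "0 < CH"
 by (auto simp: CE_def CH_def unit_ball_vol_pos)

text \<open>This is the potential mass seen by a Gaussian of time \<open>sg\<close>; the growth of
  \<open>ps\<close> then makes the singularity \<open>1/sg\<close> at \<open>sg = 0\<close>
  integrable.\<close>

lemma powr_half_v: "0 < sg ==> sg ^-hd('a)* v x (sqrt sg) = ps x (sqrt sg)/sg"
proof -
 assume t: "0 < sg"
 have "sqrt sg powr (2 - real DIM('a)) = sg powr (1 + - HD('a))"
  unfolding sqrt_powr[OF t] by (simp add: diff_divide_distrib)
 also have "... = sg* sg ^-hd('a)" using t by (simp only: powr_add powr_one)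
 finally show ?thesis using t by (simp add: ps_def)
qed

lemma W_difference_bound:
 assumes u: "nn_l2 u" "le_l2 u B" and B: "0 <= B" and sg: "0 < sg"
  and i: "itg (%y. W y*(rep u y*gauss sg (y - x)))" "itg (%y. W y*(rep u y*gauss sg (y - z)))"
  and a: "0 < a" "a <= 1"
 shows "<|(LI y. W y*(rep u y*gauss sg (y - x))) - (LI y. W y*(rep u y*gauss sg (y - z)))|>
  <= B*CE*(dist x z/sqrt sg) powr a*((ps x (sqrt sg) + ps z (sqrt sg))/sg)"
proof -
 let ?k = "nd + 1"
 define c where "c=2 ^ ?k*(fact (?k + 1)*exp 2/gconst TYPE('a))*(dist x z/sqrt sg) powr a* sg ^-hd('a)"
 have c: "0 <= c" by (simp add: c_def)
 have ip: "itg (%y. W y*pk ?k (norm (y - q)/sqrt sg))" "(LI y. W y*pk ?k (norm (y - q)/sqrt sg)) <= 2 ^ (?k + 1)* v q (sqrt sg)" for q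
  using sg by (intro integrable_W_pk; simp)+
 have "<|(LI y. W y*(rep u y*gauss sg (y - x))) - (LI y. W y*(rep u y*gauss sg (y - z)))|>
  = <|(LI y. W y*(rep u y*gauss sg (y - x)) - W y*(rep u y*gauss sg (y - z)))|>"
  using i by simp
 also have "... <= (LI y. <|W y*(rep u y*gauss sg (y - x)) - W y*(rep u y*gauss sg (y - z))|>)"
  by (rule integral_abs_bound)
 also have "... <= (LI y. (B*c)*(W y*pk ?k (norm (y - x)/sqrt sg) + W y*pk ?k (norm (y - z)/sqrt sg)))"
 proof (rule integral_mono_AE)
  show "itg (%y. <|W y*(rep u y*gauss sg (y - x)) - W y*(rep u y*gauss sg (y - z))|>)"
  using i by (intro integrable_abs Bochner_Integration.integrable_diff)
  show "itg (%y. (B*c)*(W y*pk ?k (norm (y - x)/sqrt sg) + W y*pk ?k (norm (y - z)/sqrt sg)))"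
  using ip by (intro integrable_mult_right Bochner_Integration.integrable_add)
  show "AL y. <|W y*(rep u y*gauss sg (y - x)) - W y*(rep u y*gauss sg (y - z))|>
  <= (B*c)*(W y*pk ?k (norm (y - x)/sqrt sg) + W y*pk ?k (norm (y - z)/sqrt sg))"
  using u unfolding nn_l2_def le_l2_def
  proof eventually_elim
  case (elim y)
  have "<|W y*(rep u y*gauss sg (y - x)) - W y*(rep u y*gauss sg (y - z))|> = W y*rep u y*<|gauss sg (y - x) - gauss sg (y - z)|>"
  using elim W_nonneg[of y] by (simp add: right_diff_distrib[symmetric] mult.assoc[symmetric] abs_mult)
  also have "... <= W y*B*(c*(pk ?k (norm (y - x)/sqrt sg) + pk ?k (norm (y - z)/sqrt sg)))"
  using elim W_nonneg[of y] B gauss_difference[OF sg a, of y x z ?k] by (intro mult_mono) (auto simp: c_def)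
  finally show ?case by (simp add: algebra_simps)
  qed
 qed
 also have "... = (B*c)*((LI y. W y*pk ?k (norm (y - x)/sqrt sg)) + (LI y. W y*pk ?k (norm (y - z)/sqrt sg)))"
  using ip by (simp add: Bochner_Integration.integral_add)
 also have "... <= (B*c)*(2 ^ (?k + 1)* v x (sqrt sg) + 2 ^ (?k + 1)* v z (sqrt sg))"
  using B c ip by (intro mono_l add_mono) auto
 also have "... = B*CE*(dist x z/sqrt sg) powr a*(sg ^-hd('a)* v x (sqrt sg) + sg ^-hd('a)* v z (sqrt sg))"
  by (simp add: c_def CE_def algebra_simps)
 also have "... = B*CE*(dist x z/sqrt sg) powr a*((ps x (sqrt sg) + ps z (sqrt sg))/sg)"
  by (simp only: powr_half_v[OF sg] add_divide_distrib)
 finally show ?thesis .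
qed

definition CR::real where "CR=CH + CE*cg*4/dl"

text \<open>Duhamel's formula for the difference at two centres. With \<open>sg = T - s\<close>, the
  Hoelder quotient of exponent \<open>dl/2\<close> costs \<open>sg powr (- (dl/4))\<close> and the
  growth of \<open>ps\<close> gains \<open>sg powr (dl/2)\<close>; the resulting
  \<open>sg powr (dl/4 - 1)\<close> is integrable down to \<open>sg = 0\<close>, so the bound is
  uniform as \<open>e\<close> tends to 0.\<close>

lemma regularity_gen:
 assumes f: "nn_l2 f" "le_l2 f B" and B: "0 <= B" and g: "gen f h" and t: "0 <= t" and e: "0 < e"
 shows "<|inner (S t f) (gk e x) - inner (S t f) (gk e z)|>
  <= B*CR*(dist x z/sqrt (t + e)) powr (dl/2)*(1 + ps x (sqrt (t + e)) + ps z (sqrt (t + e)))"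
proof -
 define T where "T=t + e"
 have T: "0 < T" "T - t = e" using t e by (auto simp: T_def)
 define Ps where "Ps=ps x (sqrt T) + ps z (sqrt T)"
 have Ps: "0 <= Ps" by (simp add: Ps_def ps_nonneg)
 define r where "r=dist x z"
 have r: "0 <= r" by (simp add: r_def)
 define p where "p=dl/4"
 have p: "0 < p" using dl by (simp add: p_def)
 define F where "F s = inner (S s f) (gk (T - s) x) - inner (S s f) (gk (T - s) z)" for s
 define D where "D s = - (LI y. W y*(rep (S s f) y*gauss (T - s) (y - x))) - - (LI y. W y*(rep (S s f) y*gauss (T - s) (y - z)))" for s
 define c where "c=B*CE*cg*Ps*r powr (dl/2)*T powr (- (dl/2))"
 define be where "be s = c*(T - s) powr (p - 1)" for s
 \<comment> \<open>A primitive of the bound \<open>be\<close>. Monotonicity of \<open>F - G\<close>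
   and of \<open>- F - G\<close> takes the place of integrating the derivative of
   \<open>F\<close>.\<close>
 define G where "G s = - (c/p)*(T - s) powr p" for s
 have DF: "(F has_real_derivative D s) (at s within {0..t})" if "0 <= s" "s <= t" for s
 proof -
  have "s < T" using that T e by (simp add: T_def)
  thus ?thesis unfolding F_def D_def
  using duhamel_deriv(1)[OF g that(1), of T] by (intro DERIV_diff) (auto intro: DERIV_subset[of _ _ _ "{0..}"])
 qed
 have DG: "(G has_real_derivative be s) (at s within {0..t})" if "0 <= s" "s <= t" for s
 proof -
  have sT: "0 < T - s" using that e by (simp add: T_def)
  have "((%s. (T - s) powr p) has_real_derivative p*(T - s) powr (p - 1)*(0 - 1)) (at s)"
  by (rule DERIV_chain2[OF has_real_derivative_powr[OF sT] DERIV_diff[OF DERIV_const DERIV_ident]])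
  from DERIV_cmult[OF this, of "- (c/p)"] have "(G has_real_derivative be s) (at s)"
  using p by (simp add: G_def[abs_def] be_def)
  thus ?thesis by (rule has_field_derivative_at_within)
 qed
 have Dbe: "<|D s|> <= be s" if "0 <= s" "s <= t" for s
 proof -
  define sg where "sg=T - s"
  have sg: "0 < sg" "sg <= T" using that e by (auto simp: T_def sg_def)
  have sT: "s < T" using sg by (simp add: sg_def)
  have "<|D s|> = <|(LI y. W y*(rep (S s f) y*gauss sg (y - x))) - (LI y. W y*(rep (S s f) y*gauss sg (y - z)))|>"
  by (simp add: D_def sg_def abs_minus_commute)
  also have "... <= B*CE*(dist x z/sqrt sg) powr (dl/2)*((ps x (sqrt sg) + ps z (sqrt sg))/sg)"
  using duhamel_deriv(2)[OF g that(1) sT] dl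
  by (intro W_difference_bound nn_S le_S f B that sg) (auto simp: sg_def)
  also have "... <= B*CE*(dist x z/sqrt sg) powr (dl/2)*((cg*(sqrt sg/sqrt T) powr dl*Ps)/sg)"
  proof (intro mono_l divide_right_mono)
  show "ps x (sqrt sg) + ps z (sqrt sg) <= cg*(sqrt sg/sqrt T) powr dl*Ps"
  using sg growth[of "sqrt sg" "sqrt T" x] growth[of "sqrt sg" "sqrt T" z] by (simp add: Ps_def distrib_left)
  qed (use B CE sg in auto)
  also have "... = B*CE*cg*Ps*((r/sqrt sg) powr (dl/2)*(sqrt sg/sqrt T) powr dl/sg)"
  by (simp add: r_def)
  also have "(r/sqrt sg) powr (dl/2)*(sqrt sg/sqrt T) powr dl/sg = r powr (dl/2)*T powr (- (dl/2))* sg powr (p - 1)"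
  proof -
  have q1: "(r/sqrt sg) powr (dl/2) = r powr (dl/2)* sg powr (- (dl/4))"
  using div_sqrt_powr[OF sg(1) r, of "dl/2"] by simp
  have q2: "(sqrt sg/sqrt T) powr dl = sg powr (dl/2)*T powr (- (dl/2))"
  using sg T div_sqrt_powr[of T "sqrt sg" dl] sqrt_powr[of sg dl] by simp
  have q3: "sg powr (- (dl/4))* sg powr (dl/2)/sg = sg powr (p - 1)"
  proof -
  have "sg powr (- (dl/4))* sg powr (dl/2) = sg powr p" by (simp add: powr_add[symmetric] p_def)
  thus ?thesis using sg by (simp add: powr_diff)
  qed
  show ?thesis unfolding q1 q2 q3[symmetric] by (simp add: mult_ac)
  qed
  finally show ?thesis by (simp add: be_def c_def sg_def mult_ac)
 qed
 have up: "F t - G t <= F 0 - G 0"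
  by (rule DERIV_within_nonpos_imp_le[OF t DERIV_diff[OF DF DG]]) (use Dbe in "auto simp: abs_le_iff")
 have low: "- F t - G t <= - F 0 - G 0"
  by (rule DERIV_within_nonpos_imp_le[OF t DERIV_diff[OF DERIV_minus[OF DF] DG]]) (use Dbe in "fastforce simp: abs_le_iff")+
 have c0: "0 <= c" using B CE cg Ps by (simp add: c_def)
 have "G t - G 0 <= (c/p)*T powr p"
  using c0 p by (simp add: G_def)
 with up low have "<|F t|> <= <|F 0|> + (c/p)*T powr p" by linarith
 also have "(c/p)*T powr p = B*(CE*cg*4/dl)*Ps*(r/sqrt T) powr (dl/2)"
 proof -
  have "(r/sqrt T) powr (dl/2) = r powr (dl/2)*T powr (- (dl/4))"
  using div_sqrt_powr[OF T(1) r, of "dl/2"] by simp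
  moreover have "T powr (- (dl/2))*T powr p = T powr (- (dl/4))" by (simp add: powr_add[symmetric] p_def)
  ultimately show ?thesis by (simp add: c_def p_def mult_ac)
 qed
 also have "<|F 0|> <= B*CH*(r/sqrt T) powr (dl/2)"
 proof -
  have i: "itg (%y. rep f y*gauss T (y - q))" for q by (rule integrable_gk[OF T(1)])
  have "F 0 = (LI y. rep f y*gauss T (y - x) - rep f y*gauss T (y - z))"
  using i T by (simp add: F_def inner_gk)
  also have "<|...|> <= (LI y. <|rep f y*gauss T (y - x) - rep f y*gauss T (y - z)|>)" by (rule integral_abs_bound)
  also have "... <= (LI y. B*<|gauss T (y - x) - gauss T (y - z)|>)"
  proof (rule integral_mono_AE)
  show "AL y. <|rep f y*gauss T (y - x) - rep f y*gauss T (y - z)|> <= B*<|gauss T (y - x) - gauss T (y - z)|>"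
  using f unfolding nn_l2_def le_l2_def
  by eventually_elim (auto simp: right_diff_distrib[symmetric] abs_mult intro: mono_r)
  qed (use i integral_abs_gauss_difference(1)[OF T(1), of 1] in auto)
  also have "... <= B*(CH*(dist x z/sqrt T) powr (dl/2))"
  proof -
  have "0 < dl/2" "dl/2 <= 1" using dl by auto
  from integral_abs_gauss_difference(2)[OF T(1) this, of x z]
  have "(LI y. <|gauss T (y - x) - gauss T (y - z)|>) <= CH*(dist x z/sqrt T) powr (dl/2)"
  by (simp only: CH_def)
  thus ?thesis using B by (simp only: integral_mult_right_zero mono_l)
  qed
  finally show ?thesis by (simp add: r_def mult_ac)
 qed
 finally have "<|F t|> <= B*(r/sqrt T) powr (dl/2)*(CH + CE*cg*4/dl*Ps)" by (simp add: algebra_simps)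
 also have "... <= B*(r/sqrt T) powr (dl/2)*(CR*(1 + Ps))"
 proof (intro mono_l)
  have q: "0 <= CE*cg*4/dl" using CE cg dl by simp
  have "0 <= CH*Ps" using CH Ps by simp
  moreover have "CR*(1 + Ps) = (CH + CE*cg*4/dl*Ps) + CH*Ps + CE*cg*4/dl" unfolding CR_def by algebra
  ultimately show "CH + CE*cg*4/dl*Ps <= CR*(1 + Ps)" using q by linarith
 qed (use B in auto)
 finally show ?thesis by (simp add: F_def T r_def Ps_def mult_ac add.assoc) (simp add: T_def mult_ac add.assoc)
qed

lemma CR: "0 < CR"
 using CH CE cg dl by (simp add: CR_def add_pos_nonneg)

text \<open>Passage from the domain to all nonnegative bounded \<open>f\<close>, and from mollified
  values to representatives. The constant \<open>c4\<close> pays for replacing \<open>t + e\<close>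
  by \<open>t\<close> inside \<open>ps\<close>, where \<open>e <= t\<close>.\<close>

lemma regularity:
 assumes f: "nn_l2 f" "le_l2 f B" and B: "0 <= B" and t: "0 < t"
 shows "AL x. AL z. <|rep (S t f) x - rep (S t f) z|>
  <= B*(CR*c4)*(dist x z/sqrt t) powr (dl/2)*(1 + ps x (sqrt t) + ps z (sqrt t))"
proof -
 obtain F where F: "!!n::nat. nn_l2 (F n)" "!!n. ? h. gen (F n) h" "F ----> f" "!!n B. le_l2 f B ==> le_l2 (F n) B"
  using nn_approx2[OF f(1)] by metis
 have all: "<|inner (S t f) (gk e x) - inner (S t f) (gk e z)|>
  <= B*(CR*c4)*(dist x z/sqrt t) powr (dl/2)*(1 + ps x (sqrt t) + ps z (sqrt t))" if e: "0 < e" "e <= t" for e x z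
 proof -
  define R where "R=B*CR*(dist x z/sqrt (t + e)) powr (dl/2)*(1 + ps x (sqrt (t + e)) + ps z (sqrt (t + e)))"
  have "<|inner (S t (F n)) (gk e x) - inner (S t (F n)) (gk e z)|> <= R" for n
  unfolding R_def using F f B t e by (metis less_imp_le regularity_gen)
  moreover have "(%n. <|inner (S t (F n)) (gk e x) - inner (S t (F n)) (gk e z)|>) ----> <|inner (S t f) (gk e x) - inner (S t f) (gk e z)|>"
  using t by (intro tendsto_intros bounded_linear.tendsto[OF lin] F) auto
  ultimately have "<|inner (S t f) (gk e x) - inner (S t f) (gk e z)|> <= R" by (intro LIMSEQ_le_const2) auto
  also have "R <= B*CR*(dist x z/sqrt t) powr (dl/2)*(c4*(1 + ps x (sqrt t) + ps z (sqrt t)))"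
  unfolding R_def
  proof (intro mult_mono mono_l powr_mono2 divide_left_mono)
  have up: "ps q (sqrt (t + e)) <= c4*ps q (sqrt t)" for q
  proof -
  have "sqrt (t + e) <= sqrt (4*t)" using e by (intro real_sqrt_le_mono) auto
  hence st: "sqrt (t + e) <= 2* sqrt t" using t by (simp add: real_sqrt_mult)
  have "ps q (sqrt (t + e)) <= 2 ^ nd*(sqrt (t + e)/sqrt t) ^ nd*ps q (sqrt t)"
  using t e by (intro ps_upper) auto
  also have "... <= 2 ^ nd*2 ^ nd*ps q (sqrt t)"
  using t e st by (intro mono_r mono_l power_mono ps_nonneg) (auto simp: divide_le_eq)
  finally show ?thesis by (simp add: c4_def power_mult_distrib[symmetric])
  qed
  show "1 + ps x (sqrt (t + e)) + ps z (sqrt (t + e)) <= c4*(1 + ps x (sqrt t) + ps z (sqrt t))"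
  using up[of x] up[of z] c4 by (simp add: distrib_left)
  qed (use B CR e t dl ps_nonneg in "auto intro!: add_nonneg_nonneg mult_nonneg_nonneg")
  finally show ?thesis by (simp add: mult_ac)
 qed
 obtain ep::"nat => real" where e: "!!n. 0 < ep n" "ep ----> 0"
  "AL x. (%n. inner (S t f) (gk (ep n) x)) ----> rep (S t f) x"
  using mollify_AE by blast
 obtain N where N: "!!n. N <= n ==> ep n <= t"
  using order_tendstoD(2)[OF e(2) t] unfolding eventually_sequentially by (meson less_imp_le)
 show ?thesis using e(3)
 proof eventually_elim
  case (elim x)
  note x = elim
  show ?case using e(3)
  proof eventually_elim
  case (elim z)
  have "(%n. <|inner (S t f) (gk (ep n) x) - inner (S t f) (gk (ep n) z)|>) ----> <|rep (S t f) x - rep (S t f) z|>"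
  by (intro tendsto_intros x elim)
  thus ?case using all[OF e(1) N] by (intro LIMSEQ_le_const2) auto
  qed
 qed
qed

end

section \<open>Loss of mass at the critical scale\<close>

context schr
begin

abbreviation (input) one_on::"'a set => 'a l2" where "one_on A \<equiv> cls (ind A)"

lemma inner_one_on:
 "A : sets borel ==> emeasure lborel A < oo ==> inner u (one_on A) = (LI x. rep u x*ind A x)"
 by (rule inner_cls) (simp add: sqi_indicator)

lemma mass_le_ballsI:
 assumes u: "nn_l2 u" and c: "!!r. 0 < r ==> inner u (one_on (ball y r)) <= c"
 shows "mass u <= en c"
 unfolding mass_eq_SUP[of u]
proof (rule SUP_least)
 fix n::nat
 let ?r = "real n + norm y + 1"
 have "(NN x:ball 0 (real n). en (rep u x)) <= (NN x:ball y ?r. en (rep u x))"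
 proof (intro nn_integral_mono mono_l)
  fix x::'a
  show "(ind (ball 0 (real n)) x::ennreal) <= ind (ball y ?r) x"
  using norm_triangle_ineq4[of y x] by (auto simp: ind_def dist_norm)
 qed auto
 also have "... = en (inner u (one_on (ball y ?r)))" using u by (simp add: inner_indicator_mass)
 also have "... <= en c" by (intro ennreal_leI c add_nonneg_pos) auto
 finally show "(NN x:ball 0 (real n). en (rep u x)) <= en c" .
qed

definition La::real where "La=(4*K) powr (1/(s - 1)) + 4"

lemma La: "0 < La" "4 <= La" by (simp_all add: La_def add_nonneg_pos)

text \<open>Quantitative absolute continuity of \<open>nu\<close>: at height \<open>La\<close> times
  the mean, the low and the high term of the splitting are at most a quarter of the mass
  each.\<close>

lemma small_set:
 assumes E: "E : sets borel" "E \<subseteq> ball x r" and r: "0 < r" and small: "measure lborel E <= b r/(4*La)"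
 shows "measure nu E <= v x r/2"
proof -
 note br = b_pos[OF r] and vp = v_pos[OF r, of x]
 define l where "l=La*(v x r/b r)"
 have l: "0 < l" using br vp La by (simp add: l_def)
 have "La powr (1 - s)*K <= 1/4"
 proof -
  have "4*K = ((4*K) powr (1/(s - 1))) powr (s - 1)" using s K by (simp add: powr_powr)
  also have "... <= La powr (s - 1)" using s by (intro powr_mono2) (auto simp: La_def)
  finally have "4*K <= La powr (s - 1)" .
  moreover have "La powr (1 - s)*La powr (s - 1) = 1" using La by (simp add: powr_add[symmetric])
  ultimately have "La powr (1 - s)*(4*K) <= 1" by (metis mono_l powr_ge_zero)
  thus ?thesis by simp
 qed
 moreover have "l powr (1 - s)*w x r <= La powr (1 - s)*K* v x r"
 proof -
  have "l powr (1 - s)*w x r <= l powr (1 - s)*(K*b r*(v x r/b r) powr s)"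
  by (intro mono_l RH' r) auto
  also have hl: "l powr (1 - s) = La powr (1 - s)*(v x r/b r) powr (1 - s)" unfolding l_def by (rule powr_mult)
  also have "La powr (1 - s)*(v x r/b r) powr (1 - s)*(K*b r*(v x r/b r) powr s)
  = La powr (1 - s)*K*(b r*((v x r/b r) powr (1 - s)*(v x r/b r) powr s))" by (simp only: mult_ac)
  also have "(v x r/b r) powr (1 - s)*(v x r/b r) powr s = v x r/b r"
  using br vp by (simp add: powr_add[symmetric])
  finally show ?thesis using br by (simp add: hl)
 qed
 ultimately have "l powr (1 - s)*w x r <= 1/4* v x r"
  using vp by (meson mono_r less_imp_le order_trans)
 moreover have "l*measure lborel E <= l*(b r/(4*La))" using l small by (intro mono_l) auto
 moreover have "l*(b r/(4*La)) = v x r/4" using br La by (simp add: l_def)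
 ultimately show ?thesis using level_split_measure[OF E l] by linarith
qed

text \<open>\<open>kap / R^d\<close> bounds Gaussians of times between \<open>R^2/2\<close> and
  \<open>R^2\<close> from below at distances under \<open>2*R\<close>; \<open>et0\<close> makes the
  set where the solution falls far below the free flow small enough for \<open>small_set\<close>;
  \<open>c6\<close> is the resulting absorption rate in units of \<open>1/R^2\<close>.\<close>

definition kap::real where "kap=exp (- 9/4)/gconst TYPE('a)"
definition et0::real where "et0=min (1/2) (kap*unit_ball_vol DIM('a)/(16*La))"
definition c6::real where "c6=kap/(4*c4)"

lemma kap: "0 < kap" by (simp add: kap_def)
lemma et0: "0 < et0" "et0 < 1" using kap La by (simp_all add: et0_def unit_ball_vol_pos)
lemma c6: "0 < c6" using kap c4 by (simp add: c6_def)

text \<open>While little mass has been lost, the solution is close to the free heat flow on most of the ball, and the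
 potential removes mass at a definite rate.\<close>

lemma absorption:
 assumes F: "nn_l2 F" and R: "R = rho y" and m: "0 < m" "mass F <= en m"
  and B: "3/4*m <= inner F (one_on (ball y R))"
  and sg: "R^2/2 <= sg" "sg <= R^2" and big: "en ((1 - et0)*m) <= mass (S sg F)"
  and h: "0 <= c" "!!z. z : ball y R ==> c <= h z" "h : BM" "!!z. 0 <= h z"
  and i: "itg (%z. W z*(rep (S sg F) z*h z))"
 shows "c*(c6*m/R^2) <= (LI z. W z*(rep (S sg F) z*h z))"
proof -
 have R0: "0 < R" using rho_pos R by simp
 have sg0: "0 < sg" using sg R0 by (meson less_le_trans half_gt_zero zero_less_power)
 have nn: "nn_l2 (S sg F)" using nn_S[OF F] sg0 by simp
 define q where "q=kap*m/R ^ DIM('a)"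
 have q: "0 < q" using kap m R0 by (simp add: q_def)
 have low: "3/4*q <= inner F (gk sg x)" if x: "x : ball y R" for x
 proof -
  have "3/4*q <= (kap/R ^ DIM('a))*inner F (one_on (ball y R))"
  using B kap R0 mono_l[OF B, of "kap/R ^ DIM('a)"] by (simp add: q_def mult_ac)
  also have "... = (LI z. (kap/R ^ DIM('a))*(rep F z*ind (ball y R) z))"
  by (simp add: inner_one_on)
  also have "... <= (LI z. rep F z*gauss sg (z - x))"
  proof (rule integral_mono_AE)
  show "itg (%z. (kap/R ^ DIM('a))*(rep F z*ind (ball y R) z))"
  by (intro integrable_mult_right sqi_mult_integrable sqi_rep) (simp add: sqi_indicator)
  show "itg (%z. rep F z*gauss sg (z - x))" by (rule integrable_gk[OF sg0])
  show "AL z. (kap/R ^ DIM('a))*(rep F z*ind (ball y R) z) <= rep F z*gauss sg (z - x)"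
  using F unfolding nn_l2_def
  proof eventually_elim
  case (elim z)
  have "kap/R ^ DIM('a) <= gauss sg (z - x)" if z: "z : ball y R"
  proof -
  have "norm (z - x) < 2* R" using x z by (auto simp: dist_norm[symmetric]) (metis dist_commute dist_triangle_less_add mult_2)
  hence "(norm (z - x))^2 <= (2* R)^2" by (intro power_mono) auto
  also have "... <= 9* sg" using sg by (simp add: power_mult_distrib)
  finally have "(norm (z - x))^2/(4* sg) <= 9/4" using sg0 by (simp add: divide_le_eq)
  hence e: "exp (- 9/4) <= exp (- ((norm (z - x))^2/(4* sg)))" by simp
  have "(R^2) ^-hd('a) <= sg ^-hd('a)" using sg sg0 by (intro powr_mono2') auto
  moreover have "(R^2) ^-hd('a) = 1/R ^ DIM('a)"
  using powr_half_dim[of "R^2", where 'a='a] R0 by simp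
  ultimately have "1/R ^ DIM('a) <= sg ^-hd('a)" by simp
  from mult_mono[OF this e]
  have "1/R ^ DIM('a)*exp (- 9/4) <= sg ^-hd('a)*exp (- ((norm (z - x))^2/(4* sg)))" by simp
  from divide_right_mono[OF this, of "gconst TYPE('a)"] show ?thesis
  by (simp add: gauss_def kap_def mult.commute)
  qed
  thus ?case using elim gauss_nonneg[of sg "z - x"]
  using mono_l[of "kap/R ^ DIM('a)" "gauss sg (z - x)" "rep F z"] by (auto simp: ind_def mult.commute)
  qed
  qed
  finally show ?thesis by (simp add: inner_gk[OF sg0])
 qed
 \<comment> \<open>On this set the free flow is at least \<open>3/4*q\<close> and the solution below
   \<open>q/2\<close>, so at least \<open>q/4\<close> has been lost at each point. The total loss is
   at most \<open>et0*m\<close>, which makes the set small.\<close>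
 define E where "E={x \<in> ball y R. rep (S sg F) x < q/2}"
 have E[measurable]: "E : sets borel" unfolding E_def by measurable
 have Efin: "emeasure lborel E < oo"
  by (rule le_less_trans[OF emeasure_mono[of E "ball y R" lborel]]) (auto simp: E_def)
 have mE: "measure lborel E <= b R/(4*La)"
 proof -
  have "en ((1 - et0)*m) + en (q/4)*emeasure lborel E
  <= (NN x. en (rep (S sg F) x)) + (NN x:E. en (q/4))"
  using big by (simp add: mass_def add_mono nn_integral_cmult_indicator)
  also have "... = (NN x. en (rep (S sg F) x) + en (q/4)*ind E x)"
  by (subst nn_integral_add) auto
  also have "... <= (NN x. en (inner F (gk sg x)))"
  proof (rule nn_integral_mono_AE)
  show "AL x. en (rep (S sg F) x) + en (q/4)*ind E x <= en (inner F (gk sg x))"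
  using domination[OF F sg0] nn[unfolded nn_l2_def]
  proof eventually_elim
  case (elim x)
  show ?case using elim low[of x] q
  by (cases "x : E") (auto simp: E_def ennreal_plus[symmetric] simp del: ennreal_plus intro!: ennreal_leI)
  qed
  qed
  also have "... <= en m" using m mass_heat[OF sg0 F] by simp
  finally have "en ((1 - et0)*m + q/4*measure lborel E) <= en m"
  using Efin q et0 m by (simp add: emeasure_eq_ennreal_measure ennreal_mult''[symmetric] ennreal_plus[symmetric] del: ennreal_plus)
  hence "(1 - et0)*m + q/4*measure lborel E <= m" using m by (simp add: ennreal_le_iff)
  hence "q*measure lborel E <= 4*et0*m" by (simp add: algebra_simps)
  also have "... <= 4*(kap*unit_ball_vol DIM('a)/(16*La))*m" using m by (intro mono_r mono_l) (auto simp: et0_def)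
  also have "... = q*(b R/(4*La))" using R0 La by (simp add: q_def b_def)
  finally show ?thesis using q by (simp only: mult_le_cancel_left_pos)
 qed
 define G where "G=ball y R - E"
 have G[measurable]: "G : sets borel" by (simp add: G_def)
 have "measure nu E <= v y R/2" by (rule small_set[OF E _ R0 mE]) (auto simp: E_def)
 moreover have "measure nu G = v y R - measure nu E"
  unfolding G_def v_def by (intro measure_Diff) (auto simp: E_def fmeasurableD2)
 ultimately have nuG: "v y R/2 <= measure nu G" by simp
 have Gint: "(NN z. en (W z*ind G z)) = emeasure nu G"
  by (subst emeasure_nu) (auto intro!: nn_integral_cong simp: ind_def)
 have Gfin: "emeasure nu G < oo"
  using emeasure_mono[of G "ball y R" nu] fmeasurableD2[OF fm(1), of y R] by (auto simp: G_def less_top top_unique)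
 have iG: "itg (%z. W z*ind G z)" "(LI z. W z*ind G z) = measure nu G"
  using Gint Gfin W_nonneg by (auto intro!: integrableI_nonneg simp: integral_eq_nn_integral measure_def)
 \<comment> \<open>The choice of \<open>R\<close> as the critical radius enters through
   \<open>ps y R >= 1/c4\<close>.\<close>
 have vq: "v y R/R ^ DIM('a) >= 1/(c4* R^2)"
 proof -
  have "1/c4 <= R powr (2 - real DIM('a))* v y R" using ps_rho(2)[of y] R by (simp add: ps_def)
  also have "R powr (2 - real DIM('a)) = R^2/R ^ DIM('a)" using R0 by (simp add: powr_diff powr_realpow)
  finally have "(1/c4)/R^2 <= (R^2/R ^ DIM('a)* v y R)/R^2" by (rule divide_right_mono) simp
  thus ?thesis using R0 by simp
 qed
 have "c*(c6*m/R^2) = c*(kap*m/4)*(1/(c4* R^2))" by (simp add: c6_def)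
 also have "... <= c*(kap*m/4)*(v y R/R ^ DIM('a))" using vq h kap m by (intro mono_l) auto
 also have "... = c*(q/2)*(v y R/2)" by (simp add: q_def)
 also have "... <= c*(q/2)*measure nu G" using nuG h q by (intro mono_l) auto
 also have "... = (LI z. c*(q/2)*(W z*ind G z))" by (simp add: iG)
 also have "... <= (LI z. W z*(rep (S sg F) z*h z))"
 proof (rule integral_mono_AE)
  show "itg (%z. c*(q/2)*(W z*ind G z))" using iG by simp
  show "AL z. c*(q/2)*(W z*ind G z) <= W z*(rep (S sg F) z*h z)"
  using nn[unfolded nn_l2_def]
  proof eventually_elim
  case (elim z)
  show ?case
  proof (cases "z : G")
  case True
  hence "q/2 <= rep (S sg F) z" "c <= h z" using h by (auto simp: G_def E_def)
  hence "(q/2)*c <= rep (S sg F) z*h z" using q h by (intro mult_mono) auto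
  from mono_l[OF this W_nonneg[of z]] show ?thesis using True by (simp add: mult_ac)
  qed (use elim h W_nonneg in auto)
  qed
 qed (rule i)
 finally show ?thesis .
qed

text \<open>Either a fraction \<open>et0\<close> of the mass is gone by time \<open>R^2\<close>, or
  absorption acts throughout the second half \<open>[R^2/2, R^2]\<close> and removes the fraction
  \<open>c6/2\<close>. Constants are not square integrable, so the mass is tested by Gaussians of
  time \<open>e\<close> tending to infinity.\<close>

lemma mass_drop_dom:
 assumes F: "nn_l2 F" "gen F h" and R: "R = rho y" and m: "0 < m" "mass F <= en m"
  and B: "3/4*m <= inner F (one_on (ball y R))"
 shows "mass (S (R^2) F) <= en ((1 - min et0 (c6/2))*m)"
proof (cases "mass (S (R^2) F) <= en ((1 - et0)*m)")
 case True
 also have "en ((1 - et0)*m) <= en ((1 - min et0 (c6/2))*m)" using m by (intro ennreal_leI mono_r) auto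
 finally show ?thesis .
next
 case False
 have R0: "0 < R" using rho_pos R by simp
 define T where "T=R^2/2"
 have T: "0 < T" "T + T = R^2" using R0 by (simp_all add: T_def)
 define u where "u=S (T + T) F"
 have u: "nn_l2 u" using nn_S[OF F(1)] T by (simp add: u_def)
 define F' where "F'=S T F"
 have gF': "gen F' (S T h)" using gen_S[OF F(2)] T by (simp add: F'_def)
 have S': "S sg F' = S (sg + T) F" if "0 <= sg" for sg using S_add that T by (simp add: F'_def)
 \<comment> \<open>Duhamel's formula on the second half of the time, with a wide Gaussian: the free
   bound for mass \<open>m\<close>, less what was absorbed. The exponential tends to 1 as
   \<open>e\<close> grows.\<close>
 have step: "inner u (gk e y) <= (e + R^2) ^-hd('a)/gconst TYPE('a)*(m*(1 - c6/2*exp (- (R^2/(4*e)))))" if e: "0 < e" for e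
 proof -
  define c where "c=(e + R^2) ^-hd('a)/gconst TYPE('a)*exp (- (R^2/(4*e)))"
  have c: "0 <= c" by (simp add: c_def)
  let ?f = "%sg. inner (S sg F') (gk (T + e - sg) y) + c*(c6*m/R^2)* sg"
  have "?f T <= ?f 0"
  proof (rule DERIV_within_nonpos_imp_le[where f= ?f])
  fix sg assume "0 <= sg" "sg <= T"
  thus "(?f has_real_derivative (- (LI z. W z*(rep (S sg F') z*gauss (T + e - sg) (z - y)))) + c*(c6*m/R^2)*1) (at sg within {0..T})"
  using duhamel_deriv(1)[OF gF', of sg "T + e" y] e
  by (intro DERIV_add DERIV_cmult DERIV_ident) (auto intro: DERIV_subset[of _ _ _ "{0..}"])
  next
  fix sg assume sg: "0 < sg" "sg < T"
  have "c*(c6*m/R^2) <= (LI z. W z*(rep (S (sg + T) F) z*gauss (T + e - sg) (z - y)))"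
  proof (rule absorption[OF F(1) R m B])
  show "en ((1 - et0)*m) <= mass (S (sg + T) F)"
  proof -
  have "mass (S (R^2) F) = mass (S (T - sg) (S (sg + T) F))" using S_add[of "T - sg" "sg + T" F] sg T by simp
  also have "... <= mass (S (sg + T) F)" using sg by (intro mass_S nn_S F) auto
  finally show ?thesis using False by simp
  qed
  show "itg (%z. W z*(rep (S (sg + T) F) z*gauss (T + e - sg) (z - y)))"
  using duhamel_deriv(2)[OF gF', of sg "T + e" y] sg e S'[of sg] by simp
  show "c <= gauss (T + e - sg) (z - y)" if z: "z : ball y R" for z
  proof -
  have ta: "e <= T + e - sg" "T + e - sg <= e + R^2" using sg T by auto
  have "norm (z - y) <= R" using z by (simp add: dist_norm norm_minus_commute)
  hence "(norm (z - y))^2/(4*(T + e - sg)) <= R^2/(4*e)"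
  using e ta by (intro frac_le power_mono) auto
  moreover have "(e + R^2) ^-hd('a) <= (T + e - sg) ^-hd('a)"
  using ta e by (intro powr_mono2') auto
  ultimately have "(e + R^2) ^-hd('a)*exp (- (R^2/(4*e)))
  <= (T + e - sg) ^-hd('a)*exp (- ((norm (z - y))^2/(4*(T + e - sg))))"
  by (intro mult_mono) auto
  from divide_right_mono[OF this, of "gconst TYPE('a)"] show ?thesis
  by (simp add: gauss_def c_def)
  qed
  qed (use sg T c gauss_nonneg in "auto simp: T_def")
  thus "- (LI z. W z*(rep (S sg F') z*gauss (T + e - sg) (z - y))) + c*(c6*m/R^2)*1 <= 0"
  using S'[of sg] sg by simp
  qed (use T in auto)
  hence "inner u (gk e y) + c*(c6*m/R^2)*T <= inner F' (gk (T + e) y)"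
  using S'[of T] T by (simp add: u_def)
  also have "... <= inner F (gk (T + (T + e)) y)" unfolding F'_def using F T e by (intro duhamel_inner_le) auto
  also have "... <= (e + R^2) ^-hd('a)/gconst TYPE('a)*m"
  proof -
  let ?C = "(e + R^2) ^-hd('a)/gconst TYPE('a)"
  have q: "T + (T + e) = e + R^2" "0 < e + R^2" using T e R0 by (auto intro: add_pos_nonneg)
  have C: "0 <= ?C" by simp
  have "en (inner F (gk (e + R^2) y)) <= (NN z. en (rep F z)*en ?C)"
  unfolding ennreal_inner_gk[OF q(2) F(1)] by (intro nn_integral_mono mono_l ennreal_leI gauss_le q) auto
  also have "... = mass F*en ?C" unfolding mass_def by (rule nn_integral_multc) simp
  also have "... <= en m*en ?C" using m by (intro mono_r) auto
  also have "... = en (?C*m)" using m C by (simp add: ennreal_mult[symmetric] mult.commute)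
  finally have "en (inner F (gk (e + R^2) y)) <= en (?C*m)" .
  moreover have "0 <= ?C*m" using m by (intro mult_nonneg_nonneg C) simp
  ultimately show ?thesis unfolding q by (simp only: ennreal_le_iff)
  qed
  finally have "inner u (gk e y) <= (e + R^2) ^-hd('a)/gconst TYPE('a)*m - c*(c6*m/R^2)*T" by simp
  also have "c*(c6*m/R^2)*T = c*(c6/2)*m" using R0 by (simp add: T_def)
  finally show ?thesis by (simp add: c_def algebra_simps)
 qed
 have "mass u <= en ((1 - c6/2)*m)"
 proof (rule mass_le_ballsI[OF u, of y])
  fix r::real assume r: "0 < r"
  define I where "I=inner u (one_on (ball y r))"
  \<comment> \<open>On \<open>ball y r\<close> the wide Gaussian is at least
    \<open>exp (- (r^2/(4*e)))\<close> times its maximum, so it controls the mass of the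
    ball.\<close>
  have ub: "I <= exp (r^2/(4*e))*(m*(1 - c6/2*exp (- (R^2/(4*e)))))" if e: "0 < e" for e
  proof -
  let ?p = "e ^-hd('a)/gconst TYPE('a)"
  have p: "0 < ?p" using e by simp
  have "?p*exp (- (r^2/(4*e)))*I = (LI z. ?p*exp (- (r^2/(4*e)))*(rep u z*ind (ball y r) z))"
  by (simp add: I_def inner_one_on)
  also have "... <= (LI z. rep u z*gauss e (z - y))"
  proof (rule integral_mono_AE)
  show "itg (%z. ?p*exp (- (r^2/(4*e)))*(rep u z*ind (ball y r) z))"
  by (intro integrable_mult_right sqi_mult_integrable sqi_rep) (simp add: sqi_indicator)
  show "itg (%z. rep u z*gauss e (z - y))" by (rule integrable_gk[OF e])
  show "AL z. ?p*exp (- (r^2/(4*e)))*(rep u z*ind (ball y r) z) <= rep u z*gauss e (z - y)"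
  using u unfolding nn_l2_def
  proof eventually_elim
  case (elim z)
  have "?p*exp (- (r^2/(4*e))) <= gauss e (z - y)" if z: "z : ball y r"
  proof -
  have "norm (z - y) <= r" using z by (simp add: dist_norm norm_minus_commute)
  hence "(norm (z - y))^2/(4*e) <= r^2/(4*e)" using e by (intro divide_right_mono power_mono) auto
  hence "?p*exp (- (r^2/(4*e))) <= ?p*exp (- ((norm (z - y))^2/(4*e)))" using p by (intro mono_l) auto
  thus ?thesis by (simp add: gauss_def)
  qed
  thus ?case using elim gauss_nonneg[of e "z - y"]
  using mono_l[of "?p*exp (- (r^2/(4*e)))" "gauss e (z - y)" "rep u z"] by (auto simp: ind_def mult_ac)
  qed
  qed
  also have "... <= (e + R^2) ^-hd('a)/gconst TYPE('a)*(m*(1 - c6/2*exp (- (R^2/(4*e)))))"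
  using step[OF e] by (simp add: inner_gk[OF e])
  finally have A: "?p*exp (- (r^2/(4*e)))*I <= (e + R^2) ^-hd('a)/gconst TYPE('a)*(m*(1 - c6/2*exp (- (R^2/(4*e)))))" .
  have I0: "0 <= I" unfolding I_def by (intro nn_l2_inner u nn_l2_abs) (auto simp: sqi_indicator)
  have "0 <= (e + R^2) ^-hd('a)/gconst TYPE('a)*(m*(1 - c6/2*exp (- (R^2/(4*e)))))"
  by (rule order_trans[OF mult_nonneg_nonneg[OF mult_nonneg_nonneg[OF less_imp_le[OF p] exp_ge_zero] I0] A])
  hence N0: "0 <= m*(1 - c6/2*exp (- (R^2/(4*e))))"
  using gconst(1)[where 'a='a] add_pos_nonneg[OF e zero_le_power2[of R]] by (auto simp: zero_le_divide_iff zero_le_mult_iff)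
  note A
  also have "(e + R^2) ^-hd('a)/gconst TYPE('a)*(m*(1 - c6/2*exp (- (R^2/(4*e)))))
  <= ?p*(m*(1 - c6/2*exp (- (R^2/(4*e)))))"
  using e by (intro mono_r N0 divide_right_mono powr_mono2') auto
  finally have "exp (- (r^2/(4*e)))*I <= m*(1 - c6/2*exp (- (R^2/(4*e))))"
  using p by (simp only: mult.assoc mult_le_cancel_left_pos)
  hence "exp (r^2/(4*e))*(exp (- (r^2/(4*e)))*I) <= exp (r^2/(4*e))*(m*(1 - c6/2*exp (- (R^2/(4*e)))))"
  by (rule mono_l) simp
  thus ?thesis by (simp only: mult.assoc[symmetric, of "exp (r^2/(4*e))" "exp (- (r^2/(4*e)))" I] exp_minus_inverse mult_1_left)
  qed
  have lim0: "(%n. a/(4*real (Suc n))) ----> 0" for a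
  using tendsto_mult_left[OF LIMSEQ_inverse_real_of_nat, of "a/4"] by (simp only: divide_inverse inverse_mult_distrib mult.assoc mult_zero_right)
  have "(%n. exp (r^2/(4*real (Suc n)))*(m*(1 - c6/2*exp (- (R^2/(4*real (Suc n)))))))
  ----> exp 0*(m*(1 - c6/2*exp (- 0)))"
  by (intro tendsto_intros lim0)
  hence "I <= exp 0*(m*(1 - c6/2*exp (- 0)))"
  by (rule LIMSEQ_le_const) (intro exI[of _ 0] allI impI ub of_nat_0_less_iff[THEN iffD2] zero_less_Suc)
  thus "inner u (one_on (ball y r)) <= (1 - c6/2)*m" by (simp add: I_def mult.commute)
 qed
 also have "... <= en ((1 - min et0 (c6/2))*m)" using m by (intro ennreal_leI mono_r) auto
 finally show ?thesis by (simp add: u_def T)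
qed

definition et::real where "et=min et0 (c6/2)"

lemma et: "0 < et" "et < 1" using et0 c6 by (auto simp: et_def)

text \<open>Convergence in the L2 norm does not control the mass from below at infinity, but an
  upper bound passes to the limit: on each ball the mass is an inner product.\<close>

lemma mass_S_balls_limit:
 assumes F: "F ----> f" and t: "0 <= t" and f: "nn_l2 f" and nn: "!!n::nat. nn_l2 (F n)"
  and c: "eventually (%n. mass (S t (F n)) <= en c) sequentially" and c0: "0 <= c"
 shows "mass (S t f) <= en c"
proof (rule mass_le_ballsI[OF nn_S[OF f t], of 0])
 fix r::real
 have "(%n. inner (S t (F n)) (one_on (ball 0 r))) ----> inner (S t f) (one_on (ball 0 r))"
  using t by (intro tendsto_intros bounded_linear.tendsto[OF lin] F) auto
 moreover have "eventually (%n. inner (S t (F n)) (one_on (ball 0 r)) <= c) sequentially"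
  using c
 proof eventually_elim
  case (elim n)
  have "en (inner (S t (F n)) (one_on (ball 0 r))) <= mass (S t (F n))"
  using nn_S[OF nn t] unfolding mass_def
  by (subst inner_indicator_mass) (auto intro!: nn_integral_mono simp: ind_def)
  also note elim
  finally show ?case using c0 by simp
 qed
 ultimately show "inner (S t f) (one_on (ball 0 r)) <= c" by (rule tendsto_upperbound) simp
qed

text \<open>Approximants in the domain need not be supported in the ball. Convergence of the inner
  product with its indicator keeps more than \<open>3/4\<close> of the mass inside, which is what
  \<open>mass_drop_dom\<close> asks.\<close>

lemma mass_drop:
 assumes f: "nn_l2 f" and supp: "AL x. x ~: ball y (rho y) --> rep f x = 0"
 shows "mass (S ((rho y)^2) f) <= en (1 - et)*mass f"
proof -
 let ?B = "ball y (rho y)"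
 define m where "m=inner f (one_on ?B)"
 have m0: "0 <= m" unfolding m_def by (intro nn_l2_inner f nn_l2_abs) (auto simp: sqi_indicator)
 have m: "mass f = en m"
  unfolding m_def mass_def using supp by (subst inner_indicator_mass[OF f]) (auto intro!: nn_integral_cong_AE simp: ind_def)
 show ?thesis
 proof (cases "m = 0")
  case True
  thus ?thesis using mass_S[OF f, of "(rho y)^2"] m by simp
 next
  case False
  with m0 have mp: "0 < m" by simp
  obtain F where F: "!!n::nat. nn_l2 (F n)" "!!n. ? h. gen (F n) h" "F ----> f" "!!n. mass (F n) <= mass f"
  using nn_approx2[OF f] by metis
  have "(%n. inner (F n) (one_on ?B)) ----> m" unfolding m_def by (intro tendsto_intros F)
  hence "eventually (%n. 3/4*m < inner (F n) (one_on ?B)) sequentially" by (rule order_tendstoD) (use mp in simp)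
  hence "eventually (%n. mass (S ((rho y)^2) (F n)) <= en ((1 - et)*m)) sequentially"
  proof eventually_elim
  case (elim n)
  obtain h where "gen (F n) h" using F by blast
  from mass_drop_dom[OF F(1) this refl mp] elim F(4)[of n] m show ?case by (simp add: et_def)
  qed
  from mass_S_balls_limit[OF F(3) _ f F(1) this] have "mass (S ((rho y)^2) f) <= en ((1 - et)*m)" using mp et by simp
  thus ?thesis using m0 et by (simp add: m ennreal_mult)
 qed
qed

end

section \<open>Decay of arbitrary polynomial order in time\<close>

definition rst::"'a::euclidean_space set => 'a l2 => 'a l2" where
 "rst A u = cls (%x. rep u x*ind A x)"

lemma rep_rst: "A : sets borel ==> AL x. rep (rst A u) x = rep u x*ind A x"
 unfolding rst_def by (intro rep_abs sqi_bound[OF sqi_rep[of u]]) (auto simp: ind_def)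

lemma nn_rst: "A : sets borel ==> nn_l2 u ==> nn_l2 (rst A u)"
 using rep_rst[of A u] unfolding nn_l2_def by (auto simp: ind_def elim!: eventually_elim2)

lemma rst_split: "A : sets borel ==> rst A u + rst (- A) u = u"
proof (rule l2_eqI)
 assume A: "A : sets borel"
 show "AL x. rep (rst A u + rst (- A) u) x = rep u x"
  using rep_plus[of "rst A u" "rst (- A) u"] rep_rst[OF A, of u] rep_rst[of "- A" u] A
  by (auto simp: ind_def elim!: eventually_elim2 split: if_splits)
qed

lemma mass_rst: "A : sets borel ==> mass (rst A u) = (NN x:A. en (rep u x))"
 unfolding mass_def using rep_rst[of A u] by (intro nn_integral_cong_AE) (auto simp: ind_def elim!: eventually_mono)

lemma mass_plus: "nn_l2 u ==> nn_l2 v ==> mass (u + v) = mass u + mass v"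
proof -
 assume u: "nn_l2 u" "nn_l2 v"
 have "mass (u + v) = (NN x. en (rep u x) + en (rep v x))"
  unfolding mass_def using rep_plus[of u v] u[unfolded nn_l2_def]
  by (intro nn_integral_cong_AE) (auto elim!: eventually_elim2)
 thus ?thesis by (simp add: nn_integral_add mass_def)
qed

definition gT::"'a::euclidean_space itself => nat => real" where
 "gT _ M = fact (DIM('a) + 1 + M)*exp 2/gconst TYPE('a)*(2 ^ (DIM('a) + 2)*unit_ball_vol DIM('a))"

lemma gT: "0 <= gT TYPE('a::euclidean_space) M"
 by (simp add: gT_def)

text \<open>Of the polynomial decay of the Gaussian, \<open>M\<close> powers are spent on the
  distance \<open>L\<close> and the remaining ones on integrability.\<close>

lemma gauss_tail:
 fixes y::"'a::euclidean_space"
 assumes t: "0 < t" and L: "0 < L" and A: "A : sets borel" "!!x. x : A ==> L <= norm (x - y)"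
 shows "(NN x:A. en (gauss t (x - y))) <= en (gT TYPE('a) M*(sqrt t/L) ^ M)"
proof -
 let ?D = "DIM('a) + 1"
 define c where "c=fact (?D + M)*exp 2/gconst TYPE('a)*t ^-hd('a)*(sqrt t/L) ^ M"
 have c: "0 <= c" using t L by (simp add: c_def)
 have "(NN x:A. en (gauss t (x - y))) <= (NN x. en c*en (pk ?D (norm (x - y)/sqrt t)))"
 proof (rule nn_integral_mono)
  fix x::'a
  show "en (gauss t (x - y))*ind A x <= en c*en (pk ?D (norm (x - y)/sqrt t))"
  proof (cases "x : A")
  case True
  have q: "pk M (norm (x - y)/sqrt t) <= (sqrt t/L) ^ M"
  proof -
  have "0 < L/sqrt t" "L/sqrt t <= 1 + norm (x - y)/sqrt t" using t L A(2)[OF True] by (auto simp: field_simps intro: add_increasing)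
  hence "1/(1 + norm (x - y)/sqrt t) ^ M <= 1/(L/sqrt t) ^ M" by (intro divide_left_mono power_mono mult_pos_pos zero_less_power) auto
  thus ?thesis by (simp add: pk_def power_divide)
  qed
  have "gauss t (x - y) <= fact (?D + M)*exp 2/gconst TYPE('a)*t ^-hd('a)*pk (?D + M) (norm (x - y)/sqrt t)"
  by (rule gauss_le_pk[OF t])
  also have "... = fact (?D + M)*exp 2/gconst TYPE('a)*t ^-hd('a)*pk M (norm (x - y)/sqrt t)*pk ?D (norm (x - y)/sqrt t)"
  by (simp only: pk_add mult_ac)
  also have "... <= c*pk ?D (norm (x - y)/sqrt t)" unfolding c_def
  by (intro mono_r mono_l q) (use gconst(1)[where 'a='a] t in "auto intro!: pk_nonneg mult_nonneg_nonneg divide_nonneg_nonneg")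
  finally show ?thesis using True c t by (simp add: ennreal_mult[symmetric] pk_nonneg ennreal_leI)
  qed simp
 qed
 also have "... <= en c*en (2 ^ (?D + 1)*unit_ball_vol DIM('a)* sqrt t ^ DIM('a))"
  by (subst nn_integral_cmult, simp, intro mono_l nn_integral_pk) (use t in auto)
 also have "... = en (gT TYPE('a) M*(sqrt t/L) ^ M)"
  using c t by (subst ennreal_mult[symmetric]) (auto simp: c_def gT_def powr_half_dim mult_ac)
 finally show ?thesis .
qed

text \<open>\<open>q\<close> is split into \<open>N + 1\<close> equal factors \<open>z\<close>, and
  each power \<open>z ^ n\<close> absorbs one linear factor.\<close>

lemma geometric_le_power:
 fixes q::real
 assumes q: "0 < q" "q < 1"
 obtains C where "1 <= C" "!!n. q ^ n*(real n + 1) ^ N <= C"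
proof -
 define z where "z=q powr (1/real (Suc N))"
 have z: "0 < z" "z < 1" using q powr_less_mono2[of "1/real (Suc N)" q 1] by (auto simp: z_def)
 have zq: "z ^ Suc N = q" using q unfolding z_def powr_realpow[symmetric, OF z(1)[unfolded z_def]] by (simp add: powr_powr)
 have "(%n. real n*z ^ n) ----> 0" using powser_times_n_limit_0[of z] z by simp
 hence "Bseq (%n. real n*z ^ n)" by (rule convergent_imp_Bseq[OF convergentI])
 then obtain B where B: "!!n. <|real n*z ^ n|> <= B" by (auto simp: Bseq_def)
 have B1: "(real n + 1)*z ^ n <= B + 1" for n
  using B[of n] power_le_one[of z n] z by (simp add: algebra_simps)
 show ?thesis
 proof
  show "1 <= (B + 1) ^ Suc N" using B[of 0] by (intro one_le_power) simp
  fix n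
  have "q ^ n*(real n + 1) ^ N <= q ^ n*(real n + 1) ^ Suc N" using q by (intro mono_l power_increasing) auto
  also have "... = ((real n + 1)*z ^ n) ^ Suc N" unfolding zq[symmetric] by (simp only: power_mult_distrib power_mult[symmetric] mult.commute)
  also have "... <= (B + 1) ^ Suc N" using B1[of n] z by (intro power_mono) auto
  finally show "q ^ n*(real n + 1) ^ N <= (B + 1) ^ Suc N" .
 qed
qed

context schr
begin

lemma mass_S_diff: "nn_l2 f ==> 0 <= t ==> t <= t' ==> mass (S t' f) <= mass (S t f)"
 using S_add[of "t' - t" t f] mass_S[OF nn_S[of f t], of "t' - t"] by simp

text \<open>One ball is cut off at a time: the pieces stay nonnegative, their masses add up, and
  each has lost its fraction by time \<open>\<rho>b^2\<close>, which is at least its own critical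
  time.\<close>

lemma mass_drop_Union:
 assumes I: "finite I" and b: "!!y. y : I ==> rho y <= \<rho>b" and f: "nn_l2 f"
  and supp: "AL x. x ~: (\<Union>y\<in>I. ball y (rho y)) --> rep f x = 0"
 shows "mass (S (\<rho>b^2) f) <= en (1 - et)*mass f"
 using I b f supp
proof (induction I arbitrary: f rule: finite_induct)
 case empty
 hence "mass f = 0" by (auto simp: mass_def nn_integral_0_iff_AE)
 thus ?case using mass_S[OF empty(2), of "\<rho>b^2"] by simp
next
 case (insert y I)
 let ?A = "ball y (rho y)"
 let ?g = "rst ?A f" and ?h = "rst (- ?A) f"
 have nn: "nn_l2 ?g" "nn_l2 ?h" using insert.prems by (auto intro: nn_rst)
 have "mass (S (\<rho>b^2) ?h) <= en (1 - et)*mass ?h"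
 proof (rule insert.IH[OF _ nn(2)])
  show "AL x. x ~: (\<Union>y\<in>I. ball y (rho y)) --> rep ?h x = 0"
  using insert.prems(3) rep_rst[of "- ?A" f] by (auto simp: ind_def elim!: eventually_elim2)
 qed (use insert in auto)
 moreover have "mass (S (\<rho>b^2) ?g) <= en (1 - et)*mass ?g"
 proof -
  have "mass (S (\<rho>b^2) ?g) <= mass (S ((rho y)^2) ?g)"
  using insert.prems(1)[of y] rho_pos[of y] by (intro mass_S_diff nn) (auto intro!: power_mono)
  also have "... <= en (1 - et)*mass ?g"
  using rep_rst[of ?A f] by (intro mass_drop nn) (auto simp: ind_def elim!: eventually_mono)
  finally show ?thesis .
 qed
 moreover have "S (\<rho>b^2) f = S (\<rho>b^2) ?g + S (\<rho>b^2) ?h"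
  by (subst (1) rst_split[of ?A f, symmetric]) (auto simp: linear_simps(1)[OF lin])
 moreover have "mass f = mass ?g + mass ?h" by (subst (1) rst_split[of ?A f, symmetric]) (auto simp: mass_plus nn)
 ultimately show ?case by (simp add: mass_plus nn_S nn distrib_left add_mono)
qed

lemma mass_drop_ball:
 assumes b: "!!y. y : cball x0 L ==> rho y <= \<rho>b" and f: "nn_l2 f"
  and supp: "AL x. x ~: cball x0 L --> rep f x = 0"
 shows "mass (S (\<rho>b^2) f) <= en (1 - et)*mass f"
proof -
 have "cball x0 L \<subseteq> (\<Union>y\<in>cball x0 L. ball y (rho y))" using rho_pos by force
 then obtain I where I: "I \<subseteq> cball x0 L" "finite I" "cball x0 L \<subseteq> (\<Union>y\<in>I. ball y (rho y))"
  using compactE_image[OF compact_cball, of "cball x0 L" "%y. ball y (rho y)" x0 L] by (metis open_ball)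
 show ?thesis
 proof (rule mass_drop_Union[OF I(2) _ f])
  show "AL x. x ~: (\<Union>y\<in>I. ball y (rho y)) --> rep f x = 0"
  using supp I(3) by (auto elim!: eventually_mono)
 qed (use I b in auto)
qed

text \<open>In each step the part inside \<open>cball x0 (2*L)\<close> loses the fraction
  \<open>et\<close>, while the part outside is at most a Gaussian tail of relative size
  \<open>E\<close>; the tails accumulate to the geometric series \<open>E/et\<close>.\<close>

lemma decay_iterate:
 assumes \<rho>b: "0 < \<rho>b" and L: "0 < L" and b: "!!y. y : cball x0 (2*L) ==> rho y <= \<rho>b" and f: "nn_l2 f"
  and supp: "AL x. x ~: ball x0 L --> rep f x = 0" and k: "k <= n"
 shows "mass (S (real k*\<rho>b^2) f) <= en ((1 - et) ^ k + gT TYPE('a) M*(sqrt (real n*\<rho>b^2)/L) ^ M/et)*mass f"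
 using k
proof (induction k)
 case 0
 define E where "E=gT TYPE('a) M*(sqrt (real n*\<rho>b^2)/L) ^ M/et"
 have "0 <= E" unfolding E_def using gT[where 'a='a] et L by (intro divide_nonneg_nonneg mult_nonneg_nonneg zero_le_power) auto
 hence "1*mass f <= en (1 + E)*mass f" by (intro mono_r) auto
 thus ?case by (simp add: E_def)
next
 case (Suc k)
 define E where "E=gT TYPE('a) M*(sqrt (real n*\<rho>b^2)/L) ^ M"
 have E: "0 <= E" unfolding E_def using gT[where 'a='a] L by (intro mult_nonneg_nonneg zero_le_power) auto
 define u where "u=S (real k*\<rho>b^2) f"
 have u: "nn_l2 u" unfolding u_def by (intro nn_S f) auto
 let ?A = "cball x0 (2*L)"
 have IH: "mass u <= en ((1 - et) ^ k + E/et)*mass f" using Suc by (simp add: u_def E_def)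
 have tail: "mass (rst (- ?A) u) <= en E*mass f"
 proof (cases "k = 0")
  case True
  have "mass (rst (- ?A) u) = 0"
  unfolding mass_rst[of "- ?A" u, OF borel_comp[OF borel_closed[OF closed_cball]]] using True supp L unfolding u_def
  by (auto simp: nn_integral_0_iff_AE ind_def elim!: eventually_mono)
  thus ?thesis by simp
 next
  case False
  define sg where "sg=real k*\<rho>b^2"
  have sg: "0 < sg" "sg <= real n*\<rho>b^2" using False \<rho>b Suc.prems by (auto simp: sg_def intro: mono_r)
  have "mass (rst (- ?A) u) <= (NN x:- ?A. en (inner f (gk sg x)))"
  unfolding mass_rst[of "- ?A" u, OF borel_comp[OF borel_closed[OF closed_cball]]]
  using domination[OF f sg(1)] by (intro nn_integral_mono_AE) (auto simp: u_def sg_def ind_def ennreal_leI elim!: eventually_mono)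
  also have "... = (NN y. en (rep f y)*(NN x:- ?A. en (gauss sg (x - y))))"
  by (rule mass_heat_on[OF sg(1) f]) auto
  also have "... <= (NN y. en (rep f y)*en E)"
  proof (rule nn_integral_mono_AE)
  show "AL y. en (rep f y)*(NN x:- ?A. en (gauss sg (x - y))) <= en (rep f y)*en E"
  using supp
  proof eventually_elim
  case (elim y)
  show ?case
  proof (cases "y : ball x0 L")
  case True
  have "(NN x:- ?A. en (gauss sg (x - y))) <= en (gT TYPE('a) M*(sqrt sg/L) ^ M)"
  proof (rule gauss_tail[OF sg(1) L])
  fix x assume "x : - ?A"
  thus "L <= norm (x - y)" using True dist_triangle[of x0 x y] by (auto simp: dist_norm norm_minus_commute)
  qed auto
  also have "... <= en E" unfolding E_def using L sg gT[where 'a='a]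
  by (intro ennreal_leI mono_l power_mono divide_right_mono) auto
  finally show ?thesis by (intro mono_l) auto
  qed (use elim in auto)
  qed
  qed
  also have "... = en E*mass f" unfolding mass_def by (subst nn_integral_multc) (auto simp: mult.commute)
  finally show ?thesis .
 qed
 have nn: "nn_l2 (rst ?A u)" "nn_l2 (rst (- ?A) u)" by (auto intro!: nn_rst u)
 have "S (real (Suc k)*\<rho>b^2) f = S (\<rho>b^2) u"
  using S_add[of "\<rho>b^2" "real k*\<rho>b^2" f] by (simp add: u_def algebra_simps)
 also have "... = S (\<rho>b^2) (rst ?A u) + S (\<rho>b^2) (rst (- ?A) u)"
  by (subst (1) rst_split[of ?A u, symmetric]) (auto simp: linear_simps(1)[OF lin])
 finally have "mass (S (real (Suc k)*\<rho>b^2) f) = mass (S (\<rho>b^2) (rst ?A u)) + mass (S (\<rho>b^2) (rst (- ?A) u))"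
  by (simp add: mass_plus nn_S nn)
 also have "... <= en (1 - et)*mass (rst ?A u) + mass (rst (- ?A) u)"
 proof (intro add_mono mass_S nn)
  show "mass (S (\<rho>b^2) (rst ?A u)) <= en (1 - et)*mass (rst ?A u)"
  using rep_rst[of ?A u] by (intro mass_drop_ball[OF b] nn) (auto simp: ind_def elim!: eventually_mono)
 qed auto
 also have "... <= en (1 - et)*mass u + en E*mass f"
 proof (intro add_mono mono_l tail)
  show "mass (rst ?A u) <= mass u" by (subst mass_rst) (auto simp: mass_def ind_def intro!: nn_integral_mono)
 qed auto
 also have "... <= en (1 - et)*(en ((1 - et) ^ k + E/et)*mass f) + en E*mass f"
  by (intro add_mono mono_l IH) auto
 also have "... = en ((1 - et)*((1 - et) ^ k + E/et) + E)*mass f"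
  using et E by (simp add: ennreal_mult distrib_right mult.assoc ennreal_plus)
 also have "(1 - et)*((1 - et) ^ k + E/et) + E = (1 - et) ^ Suc k + E/et"
  using et by (simp add: field_simps)
 finally show ?case by (simp add: E_def)
qed

text \<open>With \<open>a = \<rho>b / sqrt t < 1\<close> only about \<open>1/a\<close> steps are
  made, although the time would allow about \<open>1/a^2\<close>. They already give
  \<open>(1 - et) ^ n <= C1 * a ^ N\<close>, and they take time at most \<open>a*t\<close>, so the
  tail is at most a multiple of \<open>(a*t/L^2) ^ N <= a ^ N\<close>.\<close>

lemma decay_mass:
 obtains C where "1 <= C"
  "!!t \<rho>b L x0 f. 0 < t ==> 0 < \<rho>b ==> sqrt t <= L ==> !y:cball x0 (2*L). rho y <= \<rho>b ==> nn_l2 f ==>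
  AL x. x ~: ball x0 L --> rep f x = 0 ==> mass (S t f) <= en (C*(\<rho>b/sqrt t) ^ N)*mass f"
proof -
 obtain C1 where C1: "1 <= C1" "!!n. (1 - et) ^ n*(real n + 1) ^ N <= C1"
  using geometric_le_power[of "1 - et" N] et by auto
 define C where "C=C1 + gT TYPE('a) (2*N)/et"
 have g0: "0 <= gT TYPE('a) (2*N)/et" using gT[where 'a='a] et by simp
 show ?thesis
 proof (rule that[of C])
  show C: "1 <= C" using C1 g0 by (simp add: C_def)
  fix t \<rho>b L x0 f
  assume t: "0 < t" and \<rho>b: "0 < \<rho>b" and L: "sqrt t <= L" and b: "!y:cball x0 (2*L). rho y <= \<rho>b"
  and f: "nn_l2 f" and supp: "AL x. x ~: ball x0 L --> rep f x = 0"
  have L0: "0 < L" using t L by (meson less_le_trans real_sqrt_gt_zero)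
  define a where "a=\<rho>b/sqrt t"
  have a: "0 < a" using \<rho>b t by (simp add: a_def)
  show "mass (S t f) <= en (C*(\<rho>b/sqrt t) ^ N)*mass f"
  proof (cases "1 <= a")
  case True
  have "mass (S t f) <= 1*mass f" using mass_S[OF f] t by simp
  also have "... <= en (C*a ^ N)*mass f"
  proof -
  have "1*1 <= C*a ^ N" using C True by (intro mult_mono one_le_power) auto
  thus ?thesis by (intro mono_r) auto
  qed
  finally show ?thesis by (simp add: a_def)
  next
  case False
  define n where "n=nat \<lfloor>1/a\<rfloor>"
  have n: "real n <= 1/a" "1/a < real n + 1" using a by (simp_all add: n_def)
  have n\<rho>: "real n*\<rho>b^2 <= a*t"
  proof -
  have "real n*\<rho>b^2 <= (1/a)*\<rho>b^2" using n by (intro mono_r) auto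
  also have "... = a*t" using t a by (simp add: a_def power2_eq_square field_simps)
  finally show ?thesis .
  qed
  also have "a*t <= t" using False t by simp
  finally have nt: "real n*\<rho>b^2 <= t" .
  have p1: "(1 - et) ^ n <= C1*a ^ N"
  proof -
  have "1 <= a*(real n + 1)" using n(2) a by (simp add: field_simps)
  hence "(1 - et) ^ n*1 <= (1 - et) ^ n*(a*(real n + 1)) ^ N" using et by (intro mono_l one_le_power) auto
  also have "... = ((1 - et) ^ n*(real n + 1) ^ N)*a ^ N" by (simp add: power_mult_distrib)
  also have "... <= C1*a ^ N" using C1 a by (intro mono_r) auto
  finally show ?thesis by simp
  qed
  have p2: "(sqrt (real n*\<rho>b^2)/L) ^ (2*N) <= a ^ N"
  proof -
  have "(sqrt (real n*\<rho>b^2)/L)^2 = (real n*\<rho>b^2)/L^2" by (simp add: power_divide)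
  also have "... <= (a*t)/(sqrt t)^2" using n\<rho> L t a by (intro frac_le power_mono) auto
  finally have "(sqrt (real n*\<rho>b^2)/L)^2 <= a" using t by simp
  thus ?thesis unfolding power_mult by (intro power_mono) auto
  qed
  have "mass (S t f) <= mass (S (real n*\<rho>b^2) f)" by (intro mass_S_diff f nt) auto
  also have "... <= en ((1 - et) ^ n + gT TYPE('a) (2*N)*(sqrt (real n*\<rho>b^2)/L) ^ (2*N)/et)*mass f"
  by (rule decay_iterate[OF \<rho>b L0 bspec[OF b] f supp order_refl])
  also have "... <= en (C*a ^ N)*mass f"
  proof (intro mono_r ennreal_leI)
  have "gT TYPE('a) (2*N)/et*(sqrt (real n*\<rho>b^2)/L) ^ (2*N) <= gT TYPE('a) (2*N)/et*a ^ N"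
  by (intro mono_l p2 g0)
  thus "(1 - et) ^ n + gT TYPE('a) (2*N)*(sqrt (real n*\<rho>b^2)/L) ^ (2*N)/et <= C*a ^ N"
  using p1 by (simp add: C_def distrib_right)
  qed auto
  finally show ?thesis by (simp add: a_def)
  qed
 qed
qed

end

context schr
begin

lemma half_powr: "0 < t ==> (t/2) ^-hd('a) = 2 powr HD('a)*t ^-hd('a)"
 by (simp add: powr_divide powr_minus_divide)

lemma inner_gk_le_mass:
 fixes f::"'a l2"
 assumes t: "0 < t" and f: "nn_l2 f" and m: "mass f <= en m" "0 <= m"
 shows "inner f (gk t x) <= t ^-hd('a)/gconst TYPE('a)*m"
proof -
 let ?C = "t ^-hd('a)/gconst TYPE('a)"
 have C: "0 <= ?C" by simp
 have "en (inner f (gk t x)) <= (NN z. en (rep f z)*en ?C)"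
  unfolding ennreal_inner_gk[OF t f] by (intro nn_integral_mono mono_l ennreal_leI gauss_le[OF t]) auto
 also have "... = mass f*en ?C" unfolding mass_def by (rule nn_integral_multc) simp
 also have "... <= en m*en ?C" using m by (intro mono_r) auto
 also have "... = en (?C*m)" using m C by (simp add: ennreal_mult[symmetric] mult.commute)
 finally have "en (inner f (gk t x)) <= en (?C*m)" .
 moreover have "0 <= ?C*m" using m by (intro mult_nonneg_nonneg C) simp
 ultimately show ?thesis by (simp only: ennreal_le_iff)
qed

lemma le_S_mass:
 assumes t: "0 < t" and f: "nn_l2 f" and m: "mass f <= en m" "0 <= m"
 shows "le_l2 (S t f) (t ^-hd('a)/gconst TYPE('a)*m)"
 unfolding le_l2_def using domination[OF f t] by eventually_elim (rule order_trans[OF _ inner_gk_le_mass[OF t f m]])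

text \<open>Half of the time is spent on losing mass, the other half on turning mass into an upper
  bound through the Gaussian. The slow variation of \<open>rho\<close> bounds all critical radii in
  the ball at once.\<close>

lemma decay:
 obtains C where "0 <= C"
  "!!t L x0 f m. 0 < t ==> sqrt t <= L ==> nn_l2 f ==> AL x. x ~: ball x0 L --> rep f x = 0 ==>
  mass f <= en m ==> 0 <= m ==>
  le_l2 (S t f) (C*t ^-hd('a)*(L/sqrt t*(1 + sqrt t/rho x0) powr (- kk)) ^ N*m)"
proof -
 obtain C1 where C1: "1 <= C1"
  "!!t \<rho>b L x0 f. 0 < t ==> 0 < \<rho>b ==> sqrt t <= L ==> !y:cball x0 (2*L). rho y <= \<rho>b ==> nn_l2 f ==>
  AL x. x ~: ball x0 L --> rep f x = 0 ==> mass (S t f) <= en (C1*(\<rho>b/sqrt t) ^ N)*mass f"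
  using decay_mass[of N] by blast
 define g where "g=2 powr HD('a)/gconst TYPE('a)"
 have g: "0 < g" by (simp add: g_def)
 define C where "C=g*C1*(8*cr) ^ N"
 have cr1: "1 <= cr" by (rule cr)
 show ?thesis
 proof (rule that[of C])
  show "0 <= C" using g C1 cr1 by (simp add: C_def)
  fix t L m::real and x0::'a and f::"'a l2"
  assume t: "0 < t" and L: "sqrt t <= L" and f: "nn_l2 f" and supp: "AL x. x ~: ball x0 L --> rep f x = 0"
  and m: "mass f <= en m" "0 <= m"
  define ta where "ta=t/2"
  have ta: "0 < ta" "ta + ta = t" using t by (auto simp: ta_def)
  have st: "0 < sqrt t" using t by simp
  have L0: "0 < L" using st L by linarith
  define X where "X=L/sqrt t*(1 + sqrt t/rho x0) powr (- kk)"
  have X0: "0 <= X" using L0 st by (simp add: X_def)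
  have Lt: "1 <= L/sqrt t" using L st by (simp add: le_divide_eq)
  have "mass (S ta f) <= en (C1*(8*cr*X) ^ N)*mass f"
  proof (cases "rho x0 <= sqrt t")
  \<comment> \<open>Below the critical scale there is no decay to prove, because
    \<open>8*cr*X >= 1\<close>.\<close>
  case False
  hence "sqrt t/rho x0 <= 1" using st rho_pos[of x0] by (simp add: divide_le_eq)
  hence "2 powr (- 1) <= (1 + sqrt t/rho x0) powr (- 1)" using rho_pos[of x0] st
  divide_nonneg_nonneg[OF less_imp_le[OF st] less_imp_le[OF rho_pos[of x0]]] by (intro powr_mono2') linarith+
  also have "... <= (1 + sqrt t/rho x0) powr (- kk)"
  using kk divide_nonneg_nonneg[OF less_imp_le[OF st] less_imp_le[OF rho_pos[of x0]]] by (intro powr_mono) linarith+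
  finally have "1/2 <= (1 + sqrt t/rho x0) powr (- kk)" by (simp add: powr_minus_divide)
  with Lt have "1*(1/2) <= X" unfolding X_def by (intro mult_mono) auto
  hence "1*1 <= (8*cr)*X" using cr1 mult_mono[of 2 "8*cr" "1/2" X] by simp
  hence "1*1 <= C1*(8*cr*X) ^ N" using C1 by (intro mult_mono one_le_power) auto
  hence "1*mass f <= en (C1*(8*cr*X) ^ N)*mass f" by (intro mono_r) auto
  with mass_S[OF f, of ta] ta show ?thesis by (metis less_imp_le mult_1 order_trans)
  next
  case True
  note rp = rho_pos[of x0]
  define \<rho>b where "\<rho>b=2*cr*L*(rho x0/sqrt t) powr kk"
  have \<rho>b: "0 < \<rho>b" using cr1 L0 rp st by (simp add: \<rho>b_def)
  have "mass (S ta f) <= en (C1*(\<rho>b/sqrt ta) ^ N)*mass f"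
  proof (rule C1(2)[OF ta(1) \<rho>b _ _ f supp])
  have "sqrt ta <= sqrt t" using t by (simp add: ta_def)
  thus "sqrt ta <= L" using L by linarith
  show "!y:cball x0 (2*L). rho y <= \<rho>b"
  proof
  fix y assume "y : cball x0 (2*L)"
  hence "rho y <= cr*(2*L)*(rho x0/(2*L)) powr kk"
  using True L L0 by (intro rho_slow) auto
  also have "... <= cr*(2*L)*(rho x0/sqrt t) powr kk"
  proof (intro mono_l powr_mono2)
  show "rho x0/(2*L) <= rho x0/sqrt t" using L L0 rp st by (intro divide_left_mono mult_pos_pos) linarith+
  show "0 <= rho x0/(2*L)" using L0 rp by (intro divide_nonneg_nonneg) linarith+
  show "0 <= cr*(2*L)" using cr1 L0 by (intro mult_nonneg_nonneg) linarith+
  qed (use kk in simp)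
  finally show "rho y <= \<rho>b" by (simp add: \<rho>b_def mult_ac)
  qed
  qed
  also have "... <= en (C1*(8*cr*X) ^ N)*mass f"
  proof (intro mono_r ennreal_leI mono_l power_mono)
  have s2: "sqrt t <= 2* sqrt ta"
  proof -
  have "sqrt t <= sqrt (4*ta)" using t by (intro real_sqrt_le_mono) (simp add: ta_def)
  thus ?thesis by (simp add: real_sqrt_mult)
  qed
  have a1: "(rho x0/sqrt t) powr kk <= 2*(1 + sqrt t/rho x0) powr (- kk)"
  proof -
  have "1 + sqrt t/rho x0 <= 2*(sqrt t/rho x0)" using True rp by (simp add: field_simps)
  hence "(1 + sqrt t/rho x0) powr kk <= (2*(sqrt t/rho x0)) powr kk"
  using kk rp st by (intro powr_mono2) (auto intro!: add_nonneg_nonneg)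
  also have "... = 2 powr kk*(sqrt t/rho x0) powr kk" by (rule powr_mult)
  also have "... <= 2*(sqrt t/rho x0) powr kk" using kk powr_mono[of kk 1 2] by (intro mono_r) auto
  finally have "1/(2*(sqrt t/rho x0) powr kk) <= 1/(1 + sqrt t/rho x0) powr kk"
  using rp st add_pos_pos[OF zero_less_one divide_pos_pos[OF st rp]] by (intro divide_left_mono mult_pos_pos) auto
  moreover have "(rho x0/sqrt t) powr kk = 1/(sqrt t/rho x0) powr kk" by (simp add: powr_divide)
  ultimately show ?thesis by (simp add: powr_minus_divide)
  qed
  have "\<rho>b/sqrt ta <= \<rho>b/(sqrt t/2)" using \<rho>b s2 st ta by (intro divide_left_mono) auto
  also have "... = 4*cr*(L/sqrt t)*(rho x0/sqrt t) powr kk" by (simp add: \<rho>b_def)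
  also have "... <= 4*cr*(L/sqrt t)*(2*(1 + sqrt t/rho x0) powr (- kk))"
  by (rule mono_l[OF a1 mult_nonneg_nonneg]) (use cr1 Lt in linarith)+
  finally show "\<rho>b/sqrt ta <= 8*cr*X" by (simp add: X_def)
  show "0 <= \<rho>b/sqrt ta" using \<rho>b ta by simp
  qed (use C1 in auto)
  finally show ?thesis .
  qed
  also have "... <= en (C1*(8*cr*X) ^ N)*en m" by (intro mono_l m) auto
  also have "... = en (C1*(8*cr*X) ^ N*m)" using m by (simp add: ennreal_mult'')
  finally have "mass (S ta f) <= en (C1*(8*cr*X) ^ N*m)" .
  moreover have "0 <= C1*(8*cr*X) ^ N*m" using C1 cr1 X0 m by simp
  ultimately have "le_l2 (S ta (S ta f)) (ta ^-hd('a)/gconst TYPE('a)*(C1*(8*cr*X) ^ N*m))"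
  using ta by (intro le_S_mass nn_S f) auto
  moreover have "ta ^-hd('a)/gconst TYPE('a)*(C1*(8*cr*X) ^ N*m) = C*t ^-hd('a)*X ^ N*m"
  unfolding ta_def half_powr[OF t] by (simp add: C_def g_def power_mult_distrib mult_ac)
  moreover have "S ta (S ta f) = S t f" using S_add[of ta ta f] ta by simp
  ultimately show "le_l2 (S t f) (C*t ^-hd('a)*(L/sqrt t*(1 + sqrt t/rho x0) powr (- kk)) ^ N*m)"
  by (simp add: X_def)
 qed
qed

text \<open>\<open>regularity\<close> is applied to \<open>S (t/2) f\<close>, which is bounded in
  terms of the mass. Moving \<open>ps\<close> from \<open>x\<close> and \<open>z\<close> to the
  centre \<open>x0\<close> produces the power \<open>nd\<close>, which the decay has to compensate
  later.\<close>

lemma regularity_mass: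
 obtains C where "0 <= C"
  "!!t r x0 f m. 0 < t ==> 0 < r ==> r <= sqrt t ==> nn_l2 f ==> mass f <= en m ==> 0 <= m ==>
  AL x. AL z. x : ball x0 r --> z : ball x0 r -->
  <|rep (S t f) x - rep (S t f) z|> <= C*t ^-hd('a)*(r/sqrt t) powr (dl/2)*(1 + sqrt t/rho x0) ^ nd*m"
proof -
 define g where "g=2 powr HD('a)/gconst TYPE('a)"
 have g: "0 < g" by (simp add: g_def)
 define P where "P=cg*(2 ^ nd*(2 ^ nd*c4*cg))"
 have P: "0 <= P" using cg c4 by (simp add: P_def)
 define C where "C=g*(CR*c4)*4 powr (dl/2)*(1 + 2*P)"
 show ?thesis
 proof (rule that[of C])
  show "0 <= C" using g CR c4 P by (simp add: C_def)
  fix t r m::real and x0::'a and f::"'a l2"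
  assume t: "0 < t" and r: "0 < r" "r <= sqrt t" and f: "nn_l2 f" and m: "mass f <= en m" "0 <= m"
  define ta where "ta=t/2"
  have ta: "0 < ta" "ta + ta = t" using t by (auto simp: ta_def)
  have st: "0 < sqrt t" using t by simp
  define B where "B=ta ^-hd('a)/gconst TYPE('a)*m"
  have B: "0 <= B" using m by (simp add: B_def)
  have S2: "S ta (S ta f) = S t f" using S_add[of ta ta f] ta by simp
  have s2: "sqrt ta <= sqrt t" "sqrt t <= 2* sqrt ta"
  proof -
  have "sqrt t <= sqrt (4*ta)" using t by (intro real_sqrt_le_mono) (simp add: ta_def)
  thus "sqrt t <= 2* sqrt ta" by (simp add: real_sqrt_mult)
  qed (use t in "simp add: ta_def")
  define Q where "Q=(1 + sqrt t/rho x0) ^ nd"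
  have Q: "1 <= Q" unfolding Q_def using st rho_pos[of x0] by (intro one_le_power) simp
  have psi: "ps x (sqrt ta) <= P*Q" if x: "x : ball x0 r" for x
  proof -
  have "ps x (sqrt ta) <= cg*(sqrt ta/sqrt t) powr dl*ps x (sqrt t)" using s2 ta by (intro growth) auto
  also have "... <= cg*1*ps x (sqrt t)"
  using s2 st ta dl cg by (intro mono_r mono_l powr_le1 ps_nonneg) auto
  also have "... <= cg*1*(2 ^ nd*ps x0 (sqrt t))"
  using x r st cg by (intro mono_l ps_move) (auto simp: dist_commute)
  also have "... <= cg*1*(2 ^ nd*(2 ^ nd*c4*cg*Q))"
  unfolding Q_def using cg st by (intro mono_l ps_poly) auto
  finally show ?thesis by (simp add: P_def mult_ac)
  qed
  show "AL x. AL z. x : ball x0 r --> z : ball x0 r -->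
  <|rep (S t f) x - rep (S t f) z|> <= C*t ^-hd('a)*(r/sqrt t) powr (dl/2)*(1 + sqrt t/rho x0) ^ nd*m"
  using regularity[OF nn_S[OF f less_imp_le[OF ta(1)]] le_S_mass[OF ta(1) f m, folded B_def] B ta(1)] unfolding S2
  proof (rule eventually_mono, elim eventually_mono, intro impI)
  fix x z assume xz: "x : ball x0 r" "z : ball x0 r"
  assume "<|rep (S t f) x - rep (S t f) z|> <= B*(CR*c4)*(dist x z/sqrt ta) powr (dl/2)*(1 + ps x (sqrt ta) + ps z (sqrt ta))"
  also have "... <= B*(CR*c4)*(4 powr (dl/2)*(r/sqrt t) powr (dl/2))*((1 + 2*P)*Q)"
  proof (intro mult_mono mono_l)
  have "dist x z <= 2*r" using xz dist_triangle[of x z x0] by (simp add: dist_commute)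
  hence "dist x z/sqrt ta <= (2*r)/(sqrt t/2)" using s2 st r by (intro frac_le) auto
  also have "... = 4*(r/sqrt t)" by simp
  finally have "(dist x z/sqrt ta) powr (dl/2) <= (4*(r/sqrt t)) powr (dl/2)" using ta dl by (intro powr_mono2) auto
  also have "... = 4 powr (dl/2)*(r/sqrt t) powr (dl/2)" by (rule powr_mult)
  finally show "(dist x z/sqrt ta) powr (dl/2) <= 4 powr (dl/2)*(r/sqrt t) powr (dl/2)" .
  have "(1 + 2*P)*Q = Q + P*Q + P*Q" by (simp add: algebra_simps)
  thus "1 + ps x (sqrt ta) + ps z (sqrt ta) <= (1 + 2*P)*Q" using psi[OF xz(1)] psi[OF xz(2)] Q by linarith
  qed (use B CR c4 ps_nonneg in "auto intro!: add_nonneg_nonneg")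
  also have "... = C*t ^-hd('a)*(r/sqrt t) powr (dl/2)*(1 + sqrt t/rho x0) ^ nd*m"
  unfolding B_def ta_def half_powr[OF t] C_def g_def Q_def by (simp add: mult_ac)
  finally show "<|rep (S t f) x - rep (S t f) z|> <= C*t ^-hd('a)*(r/sqrt t) powr (dl/2)*(1 + sqrt t/rho x0) ^ nd*m" .
  qed
 qed
qed

end

section \<open>From Lebesgue measurable functions and the given semigroup to the Hilbert
  space\<close>

lemma locally_integrable_measurable:
 fixes f::"'a::euclidean_space => real"
 assumes "locally_integrable f"
 shows "f : borel_measurable lebesgue"
proof (rule borel_measurable_LIMSEQ_real)
 fix x::'a
 obtain N::nat where N: "norm x <= real N" using real_arch_simple by blast
 have "eventually (%n. ind (cball 0 (real n)) x *. f x = f x) sequentially"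
  unfolding eventually_sequentially using N by (intro exI[of _ N]) (auto simp: ind_def)
 thus "(%n. ind (cball 0 (real n)) x *. f x) ----> f x" by (rule tendsto_eventually)
next
 fix n::nat
 have "f absolutely_integrable_on cball 0 (real n)" using assms by (simp add: locally_integrable_def)
 thus "(%x. ind (cball 0 (real n)) x *. f x) : borel_measurable lebesgue"
  unfolding set_integrable_def by (rule borel_measurable_integrable)
qed

lemma nn_integral_lborel_lebesgue:
 assumes g: "g : BM" and eq: "AL x. f x = g x"
 shows "(NL x. f x) = (NN x. g x)"
proof -
 have "(NL x. f x) = (NL x. g x)" using AE_completion[OF eq] by (rule nn_integral_cong_AE)
 also have "... = (NN x. g x)" by (rule nn_integral_completion)
 finally show ?thesis .
qed

lemma locally_integrable_nn_ball:
 fixes f::"'a::euclidean_space => real"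
 assumes "locally_integrable f"
 shows "(NL x:ball y r. en <|f x|>) < oo"
proof -
 have "f absolutely_integrable_on cball y r" using assms by (simp add: locally_integrable_def)
 hence "(NL x. en (norm (ind (cball y r) x *. f x))) < oo"
  unfolding set_integrable_def integrable_iff_bounded by simp
 moreover have "(NL x:ball y r. en <|f x|>) <= (NL x. en (norm (ind (cball y r) x *. f x)))"
  by (intro nn_integral_mono) (auto simp: ind_def)
 ultimately show ?thesis by (rule le_less_trans[rotated])
qed

lemma L2_mult_integrable: "f : L2 ==> g : L2 ==> integrable lebesgue (%x. f x*g x)"
proof -
 assume f: "f : L2" and g: "g : L2"
 note m = L2_measurable[OF f] L2_measurable[OF g]
 have "integrable lebesgue (%x. f x*g x) <-> itg (%x. bor f x*bor g x)"
  using m bor[OF m(1)] bor[OF m(2)] by (intro lebesgue_lborel_integral(2)) (auto elim!: eventually_elim2)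
 thus ?thesis using f g by (simp add: L2_iff sqi_mult_integrable)
qed

locale setting =
 fixes V::"'a::euclidean_space => real" and T::"real => ('a => real) => 'a => real" and s::real
 assumes dim3: "3 <= DIM('a)" and V: "nonzero_density V" and s_ge: "real DIM('a)/2 <= s"
  and RHV: "reverse_Hoelder s V" and semigroup: "schroedinger_semigroup V T"
begin

text \<open>A Borel version of \<open>V\<close>; the maximum with 0 makes it nonnegative everywhere
  rather than almost everywhere.\<close>

definition W::"'a => real" where "W=(%x. max 0 (bor V x))"

definition TT::"real => 'a l2 => 'a l2" where "TT t u = elt (T t (rep u))"

lemma V_measurable: "V : borel_measurable lebesgue"
 using V by (intro locally_integrable_measurable) (simp add: nonzero_density_def)

lemma W_meas [measurable]: "W : BM"
 unfolding W_def using bor(1)[OF V_measurable] by measurable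

lemma V_W: "AL x. V x = W x"
 using bor(2)[OF V_measurable] by eventually_elim (metis V W_def max.absorb2 nonzero_density_def)

lemma W_lebesgue:
 assumes [measurable]: "A : sets borel" "h : BM"
 shows "(NL x:A. en (h (V x))) = (NN x:A. en (h (W x)))"
 using V_W by (intro nn_integral_lborel_lebesgue) (measurable, auto elim!: eventually_mono)

lemma W_fin: "(NN y:ball x r. en (W y)) < oo"
 using W_lebesgue[of "ball x r" "%x. x"] locally_integrable_nn_ball[of V x r] V
 by (simp add: nonzero_density_def)

lemma RH_exponent_gt_1: "1 < s"
proof -
 have "(3::real) <= real DIM('a)" using dim3 by simp
 thus ?thesis using s_ge by linarith
qed

lemma W_RH:
 obtains K where "0 < K" "!!x r. (NN y:ball x r. en (W y powr s)) < oo"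
  "!!x r. 0 < r ==> enn2real (NN y:ball x r. en (W y powr s))
  <= K*measure lborel (ball x r)*(enn2real (NN y:ball x r. en (W y))/measure lborel (ball x r)) powr s"
proof -
 obtain C where C: "0 < C" "!!x r. 0 < r ==>
  epowr (eaverage (ball x r) (%y. en (V y powr s))) (1/s)
  <= en C*eaverage (ball x r) (%y. en (V y))"
  using RHV unfolding reverse_Hoelder_def by blast
 note s1 = RH_exponent_gt_1
 have main: "(NN y:ball x r. en (W y powr s)) < oo &
  enn2real (NN y:ball x r. en (W y powr s))
  <= C powr s*measure lborel (ball x r)*(enn2real (NN y:ball x r. en (W y))/measure lborel (ball x r)) powr s"
  if r: "0 < r" for x r
 proof -
  define b where "b=measure lborel (ball x r)"
  have b: "0 < b" using r by (simp add: b_def content_ball_pos)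
  have eb: "emeasure lebesgue (ball x r) = en b"
  unfolding b_def by (subst emeasure_completion) (auto intro!: emeasure_eq_ennreal_measure[OF less_imp_neq[OF emeasure_ball_less_top]])
  define I where "I=(NN y:ball x r. en (W y powr s))"
  define J where "J=enn2real (NN y:ball x r. en (W y))"
  have J: "0 <= J" "(NN y:ball x r. en (W y)) = en J" using W_fin[of x r] by (auto simp: J_def less_top)
  have le: "epowr (I/en b) (1/s) <= en C*(en J/en b)"
  using C(2)[OF r, of x] W_lebesgue[of "ball x r" "%v. v powr s"] W_lebesgue[of "ball x r" "%v. v"]
  by (simp add: eaverage_def eb I_def J(2))
  also have "... = en (C*(J/b))" using C J b by (simp add: divide_ennreal ennreal_mult[symmetric])
  finally have le: "epowr (I/en b) (1/s) <= en (C*(J/b))" .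
  \<comment> \<open>Local integrability of the power \<open>s\<close> is a consequence: an infinite
    left-hand side contradicts the finite right-hand side.\<close>
  have "I ~= oo"
  proof
  assume "I = oo"
  hence "I/en b = oo" using b by (simp add: ennreal_top_divide)
  thus False using le s1 by (simp add: epowr_def top_unique)
  qed
  then obtain i where i: "0 <= i" "I = en i" by (cases I) auto
  have "(i/b) powr (1/s) <= C*(J/b)"
  using le s1 i b C J by (simp add: epowr_def divide_ennreal ennreal_le_iff)
  hence "((i/b) powr (1/s)) powr s <= (C*(J/b)) powr s" using s1 by (intro powr_mono2) auto
  also have "(C*(J/b)) powr s = C powr s*(J/b) powr s" by (rule powr_mult)
  also have "((i/b) powr (1/s)) powr s = i/b" using s1 i b by (simp add: powr_powr)
  finally have "i <= C powr s*b*(J/b) powr s" using b by (simp add: divide_le_eq mult_ac)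
  thus ?thesis using i by (simp add: I_def[symmetric] J_def[symmetric] b_def[symmetric])
 qed
 show ?thesis
 proof (rule that[of "C powr s"])
  show "(NN y:ball x r. en (W y powr s)) < oo" for x r
  using main[of r x] by (cases "0 < r") (auto simp: ball_empty not_less)
 qed (use C main in auto)
qed

definition KW::real where
 "KW = (SOME K. 0 < K & (!x r. 0 < r --> enn2real (NN y:ball x r. en (W y powr s))
  <= K*measure lborel (ball x r)*(enn2real (NN y:ball x r. en (W y))/measure lborel (ball x r)) powr s))"

lemma KW: "0 < KW & (!x r. 0 < r --> enn2real (NN y:ball x r. en (W y powr s))
  <= KW*measure lborel (ball x r)*(enn2real (NN y:ball x r. en (W y))/measure lborel (ball x r)) powr s)"
 unfolding KW_def by (rule someI_ex, rule W_RH) blast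

sublocale potential W s KW
proof
 show "W : BM" by (rule W_meas)
 show "0 <= W x" for x by (simp add: W_def)
 show "(NN y:ball x r. en (W y powr s)) < oo" for x r by (rule W_RH) blast
 show "~ (AL x. W x = 0)"
 proof
  assume "AL x. W x = 0"
  hence "AL x. V x = 0" using V_W by eventually_elim simp
  hence "AE x in lebesgue. V x = 0" by (rule AE_completion)
  thus False using V by (simp add: nonzero_density_def)
 qed
qed (use W_fin RH_exponent_gt_1 s_ge dim3 KW in auto)

lemma critical_radius_eq: "critical_radius V = rho"
proof
 fix x
 have "(LINT y:ball x r|lebesgue. V y) = v x r" for r
 proof -
  have "(LINT y:ball x r|lebesgue. V y) = enn2real (NL y. en (ind (ball x r) y *. V y))"
  unfolding set_lebesgue_integral_def using V
  by (intro integral_eq_nn_integral borel_measurable_scaleR borel_measurable_indicator V_measurable)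
  (auto simp: nonzero_density_def ind_def)
  also have "(NL y. en (ind (ball x r) y *. V y)) = (NL y:ball x r. en (V y))"
  by (intro nn_integral_cong) (auto simp: ind_def)
  finally show ?thesis using W_lebesgue[of "ball x r" "%v. v"] by (simp add: v_eq)
 qed
 thus "critical_radius V x = rho x" by (simp add: critical_radius_def rho_def)
qed

lemmas C0 = semigroup[unfolded schroedinger_semigroup_def C0_semigroup_def, THEN conjunct1]

lemmas C0_0 = C0[THEN conjunct2, THEN conjunct2, THEN conjunct2, THEN conjunct1, rule_format]
lemmas C0_add = C0[THEN conjunct2, THEN conjunct2, THEN conjunct2, THEN conjunct2, THEN conjunct1, rule_format]
lemmas C0_lim = C0[THEN conjunct2, THEN conjunct2, THEN conjunct2, THEN conjunct2, THEN conjunct2, rule_format]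

lemma T_L2: "0 <= t ==> f : L2 ==> T t f : L2" using C0 by blast

lemma T_lin: "0 <= t ==> f : L2 ==> g : L2 ==> elt (T t (%y. a1*f y + b1*g y)) = a1 *. elt (T t f) + b1 *. elt (T t g)"
proof -
 assume t: "0 <= t" "f : L2" "g : L2"
 have "AE x in lebesgue. T t (%y. a1*f y + b1*g y) x = a1*T t f x + b1*T t g x" using C0 t by blast
 hence "AL x. T t (%y. a1*f y + b1*g y) x = a1*T t f x + b1*T t g x" by (simp add: AE_completion_iff)
 moreover have "AL x. rep (a1 *. elt (T t f) + b1 *. elt (T t g)) x = a1*T t f x + b1*T t g x"
  using rep_elt[of "%x. a1*T t f x + b1*T t g x"] lin_L2[of "T t f" "T t g" a1 b1] T_L2 t by simp
 ultimately show ?thesis by (intro elt_eqI T_L2 lin_L2 t) (auto elim!: eventually_elim2)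
qed

lemma T_norm: "0 <= t ==> ? M. !f:L2. norm (elt (T t f)) <= M*norm (elt f)"
 using C0 T_L2 by (simp add: norm_elt)

text \<open>\<open>T t\<close> acts on functions rather than classes; linearity and boundedness make
  it respect equality almost everywhere.\<close>

lemma T_cong: "0 <= t ==> f : L2 ==> elt (T t f) = TT t (elt f)"
proof -
 assume t: "0 <= t" "f : L2"
 let ?g = "rep (elt f)"
 obtain M where M: "!f:L2. norm (elt (T t f)) <= M*norm (elt f)" using T_norm[OF t(1)] by blast
 have "norm (elt (T t (%y. 1*f y + (- 1)*?g y))) <= M*norm (elt (%y. 1*f y + (- 1)*?g y))"
  using M lin_L2(1)[OF t(2) rep_L2] by blast
 hence "norm (elt (T t f) - elt (T t ?g)) <= M*norm (elt f - elt ?g)"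
  unfolding T_lin[OF t rep_L2] lin_L2(2)[OF t(2) rep_L2] by simp
 thus ?thesis by (simp add: TT_def)
qed

sublocale c0_semigroup TT
proof (rule c0_semigroup.intro)
 fix t::real assume t: "0 <= t"
 have sc: "TT t (a1 *. x + b1 *. y) = a1 *. TT t x + b1 *. TT t y" for a1 b1 x y
  using T_cong[OF t lin_L2(1)[of "rep x" "rep y" a1 b1]] T_lin[OF t rep_L2 rep_L2, of a1 x b1 y]
  lin_L2(2)[of "rep x" "rep y" a1 b1] by (simp add: TT_def)
 obtain M where M: "!f:L2. norm (elt (T t f)) <= M*norm (elt f)" using T_norm[OF t] by blast
 show "bounded_linear (TT t)"
 proof (rule bounded_linear_intro[where K=M])
  show "TT t (x + y) = TT t x + TT t y" for x y using sc[of 1 x 1 y] by simp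
  show "TT t (a *. x) = a *. TT t x" for a x using sc[of a x 0 x] by simp
  show "norm (TT t x) <= norm x*M" for x using M[rule_format, OF rep_L2, of x] by (simp add: TT_def mult.commute)
 qed
next
 fix x::"'a l2"
 have "AE y in lebesgue. T 0 (rep x) y = rep x y" by (rule C0_0[OF rep_L2])
 hence "AL y. T 0 (rep x) y = rep x y" by (simp add: AE_completion_iff)
 thus "TT 0 x = x" unfolding TT_def by (intro elt_eqI T_L2) (auto elim!: eventually_mono)
next
 fix r t::real and x::"'a l2" assume t: "0 <= r" "0 <= t"
 have m: "T t (rep x) : L2" using T_L2[OF t(2)] by simp
 have "AE y in lebesgue. T (r + t) (rep x) y = T r (T t (rep x)) y" by (rule C0_add[OF t rep_L2])
 hence ae: "AL y. T (r + t) (rep x) y = T r (T t (rep x)) y" by (simp add: AE_completion_iff)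
 have "TT (r + t) x = elt (T r (T t (rep x)))"
  unfolding TT_def using ae rep_elt[OF T_L2[OF t(1) m]] t by (intro elt_eqI T_L2) (auto elim!: eventually_elim2)
 also have "... = TT r (TT t x)" using T_cong[OF t(1) m] by (simp add: TT_def)
 finally show "TT (r + t) x = TT r (TT t x)" .
next
 fix x::"'a l2"
 have "((%t. L2_norm (%y. T t (rep x) y - rep x y)) ---> 0) (at_right 0)" by (rule C0_lim[OF rep_L2])
 moreover have "eventually (%t. L2_norm (%y. T t (rep x) y - rep x y) = norm (TT t x - x)) (at_right 0)"
  unfolding eventually_at_filter
 proof (intro always_eventually allI impI)
  fix t::real assume "t : {0<..}"
  hence m: "T t (rep x) : L2" using T_L2[of t "rep x"] by simp
  show "L2_norm (%y. T t (rep x) y - rep x y) = norm (TT t x - x)"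
  using lin_L2[OF m rep_L2, of 1 "-1" x] norm_elt[of "%y. T t (rep x) y - rep x y"] by (simp add: TT_def)
 qed
 ultimately have "((%t. norm (TT t x - x)) ---> 0) (at_right 0)" by (rule Lim_transform_eventually)
 thus "((%t. TT t x) ---> x) (at_right 0)" by (simp add: Lim_null[of _ x] tendsto_norm_zero_iff)
qed

lemma gen_generator: "gen u h ==> generator T (rep u) (rep h)"
proof -
 assume "gen u h"
 hence "((%t. norm ((TT t u - u) /\<^sub>R t - h)) ---> 0) (at_right 0)"
  unfolding gen_def using Lim_null tendsto_norm_zero by blast
 moreover have "eventually (%t. norm ((TT t u - u) /\<^sub>R t - h) = L2_norm (%x. (T t (rep u) x - rep u x)/t - rep h x)) (at_right 0)"
  unfolding eventually_at_filter
 proof (intro always_eventually allI impI)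
  fix t::real assume "t : {0<..}"
  hence m: "T t (rep u) : L2" using T_L2[of t "rep u"] by simp
  note l1 = lin_L2[OF m rep_L2, of "1/t" "- (1/t)" u]
  have eq: "(%x. (T t (rep u) x - rep u x)/t - rep h x)
  = (%x. 1*(1/t*T t (rep u) x + (- (1/t))*rep u x) + (- 1)*rep h x)"
  by (auto simp: fun_eq_iff diff_divide_distrib)
  have "norm (elt (%x. (T t (rep u) x - rep u x)/t - rep h x)) = norm ((TT t u - u) /\<^sub>R t - h)"
  unfolding eq lin_L2(2)[OF l1(1) rep_L2] l1(2) by (simp add: TT_def scaleR_diff_right inverse_eq_divide)
  moreover have "(%x. (T t (rep u) x - rep u x)/t - rep h x) : L2"
  unfolding eq by (rule lin_L2(1)[OF l1(1) rep_L2])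
  ultimately show "norm ((TT t u - u) /\<^sub>R t - h) = L2_norm (%x. (T t (rep u) x - rep u x)/t - rep h x)"
  by (simp add: norm_elt)
 qed
 ultimately have "((%t. L2_norm (%x. (T t (rep u) x - rep u x)/t - rep h x)) ---> 0) (at_right 0)"
  by (rule Lim_transform_eventually)
 thus ?thesis by (simp add: generator_def)
qed

lemma V_W_integral:
 assumes [measurable]: "g : BM"
 shows "(\<integral>x. V x*g x \<partial>lebesgue) = (LI x. W x*g x)" "integrable lebesgue (%x. V x*g x) <-> itg (%x. W x*g x)"
proof -
 have g: "g : borel_measurable lebesgue" using assms by (intro measurable_completion) simp
 have "(%x. V x*g x) : borel_measurable lebesgue" using V_measurable g by simp
 moreover have "AL x. V x*g x = W x*g x" using V_W by eventually_elim simp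
 ultimately show "(\<integral>x. V x*g x \<partial>lebesgue) = (LI x. W x*g x)" "integrable lebesgue (%x. V x*g x) <-> itg (%x. W x*g x)"
  by (auto intro!: lebesgue_lborel_integral simp: lebesgue_lborel_integral(2))
qed

text \<open>The components of the weak gradient of \<open>rep u\<close> serve as its gradient in the
  Hilbert space. Conversely, the components \<open>k e\<close> are assembled into a vector field,
  which puts every admissible test element into \<open>form_domain\<close>.\<close>

sublocale schr TT W s KW
proof unfold_locales
 show "W : BM" by (rule W_meas)
 show "0 <= W x" for x by (rule W_nonneg)
 show "itg (%y. W y*(gauss t (y - x))^2)" if "0 < t" for t x using that by (rule integrable_W_gauss_sq)
 fix u h assume "gen u h"
 hence "schroedinger_operator V (rep u) (%x. - rep h x)"
  using gen_generator semigroup by (auto simp: schroedinger_semigroup_def)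
 then obtain g where fd: "form_domain V (rep u) g"
  and eq: "!!v k. form_domain V v k ==> (LINT x|lebesgue. g x .* k x) + (LINT x|lebesgue. V x*rep u x* v x)
  = (LINT x|lebesgue. - rep h x* v x)"
  unfolding schroedinger_operator_def by blast
 have g: "g : borel_measurable lebesgue" "integrable lebesgue (%x. (norm (g x))^2)" "weak_gradient (rep u) g"
  using fd by (auto simp: form_domain_def)
 have gL: "(%x. g x .* e) : L2" for e
 proof -
  \<comment> \<open>The conclusion wanted does not mention the test function, so the zero function
    serves.\<close>
  have "C1c (%_::'a. 0) (%_. 0)" unfolding C1c_def by (auto intro: exI[of _ "{}"] GDERIV_const)
  from weak_gradient_inner(1)[OF g(3) rep_L2 g(1,2) this] show ?thesis .
 qed
 show "? g. hasgrad u g & itg (%x. W x*(rep u x)^2) &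
  (!v k. hasgrad v k --> itg (%x. W x*(rep v x)^2) -->
  (\<Sum>e\<in>Basis. inner (g e) (k e)) + (LI x. W x*(rep u x*rep v x)) = - inner h v)"
 proof (intro exI[of _ "%e. elt (%x. g x .* e)"] conjI allI impI)
  show "hasgrad u (%e. elt (%x. g x .* e))"
  unfolding hasgrad_def using weak_gradient_inner(2)[OF g(3) rep_L2 g(1,2)] by simp
  show "itg (%x. W x*(rep u x)^2)"
  using fd V_W_integral(2)[of "%x. (rep u x)^2"] by (simp add: form_domain_def)
  fix v k assume hv: "hasgrad v k" and iv: "itg (%x. W x*(rep v x)^2)"
  define kf where "kf x = (\<Sum>e\<in>Basis. rep (k e) x *. e)" for x
  have kfe: "kf x .* e = rep (k e) x" if "e : Basis" for x e using that by (simp add: kf_def)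
  have ip: "x .* kf y = (\<Sum>e\<in>Basis. (x .* e)*rep (k e) y)" for x y
  by (subst euclidean_inner) (auto simp: kfe intro: sum.cong)
  have "form_domain V (rep v) kf"
  unfolding form_domain_def
  proof (intro conjI)
  show "kf : borel_measurable lebesgue"
  unfolding kf_def by (intro measurable_completion) simp
  have "(%x. (norm (kf x))^2) = (%x. \<Sum>e\<in>Basis. rep (k e) x*rep (k e) x)"
  by (simp only: power2_norm_eq_inner ip) (auto simp: kfe)
  thus "integrable lebesgue (%x. (norm (kf x))^2)" by (simp only:) (intro Bochner_Integration.integrable_sum L2_mult_integrable rep_L2)
  show "weak_gradient (rep v) kf"
  unfolding kf_def using hv by (intro weak_gradientI) (auto simp: hasgrad_def)
  show "integrable lebesgue (%x. V x*(rep v x)^2)"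
  using iv V_W_integral(2)[of "%x. (rep v x)^2"] by simp
  qed simp
  from eq[OF this] have "(LINT x|lebesgue. g x .* kf x) + (LINT x|lebesgue. V x*(rep u x*rep v x))
  = (LINT x|lebesgue. - (rep h x*rep v x))" by (simp add: mult.assoc)
  moreover have "(LINT x|lebesgue. g x .* kf x) = (\<Sum>e\<in>Basis. inner (elt (%x. g x .* e)) (k e))"
  proof -
  have "(LINT x|lebesgue. g x .* kf x) = (\<Sum>e\<in>Basis. (LINT x|lebesgue. (g x .* e)*rep (k e) x))"
  unfolding ip by (intro Bochner_Integration.integral_sum L2_mult_integrable gL) simp
  thus ?thesis using inner_elt[OF gL rep_L2] by simp
  qed
  moreover have "(LINT x|lebesgue. V x*(rep u x*rep v x)) = (LI x. W x*(rep u x*rep v x))"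
  by (rule V_W_integral) simp
  moreover have "(LINT x|lebesgue. - (rep h x*rep v x)) = - inner h v"
  using inner_elt[OF rep_L2 rep_L2, of h v] by simp
  ultimately show "(\<Sum>e\<in>Basis. inner (elt (%x. g x .* e)) (k e)) + (LI x. W x*(rep u x*rep v x)) = - inner h v"
  by simp
 qed
qed

end

section \<open>Combining decay in the distance, in time and in the radius\<close>

lemma sqrt_prod_bound:
 fixes u::real
 assumes "0 <= u" "u <= a" "u <= b" "a*b <= c*X^2" "0 <= c" "0 <= X"
 shows "u <= sqrt c*X"
proof (rule power2_le_imp_le)
 have "u^2 <= a*b" unfolding power2_eq_square using assms by (intro mult_mono) auto
 thus "u^2 <= (sqrt c*X)^2" using assms by (simp add: power_mult_distrib)
qed (use assms in simp)

context schr
begin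

text \<open>\<open>l = 1\<close> is the central ball, where no gap to the support is asked.
  Otherwise the support stays outside half the radius, and passing from \<open>x0\<close> to
  \<open>x\<close> changes distances by at most \<open>sqrt t\<close>.\<close>

lemma gauss_annulus:
 fixes g::"'a l2"
 assumes t: "0 < t" and l: "1 <= l" and g: "nn_l2 g" and m: "mass g <= en m" "0 <= m"
  and inner: "l = 1 | (AL x. x : ball x0 (l/2* sqrt t) --> rep g x = 0)" and x: "x : ball x0 (sqrt t)"
 shows "inner g (gk t x) <= fact M*exp 2/gconst TYPE('a)*4 ^ M*(t ^-hd('a)*m)*(1/l) ^ M"
proof -
 define c where "c=fact M*exp 2/gconst TYPE('a)*t ^-hd('a)*(4 ^ M*(1/l) ^ M)"
 have c: "0 <= c" using l by (simp add: c_def)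
 have st: "0 < sqrt t" using t by simp
 have "en (inner g (gk t x)) <= (NN y. en c*en (rep g y))"
  unfolding ennreal_inner_gk[OF t g]
 proof (rule nn_integral_mono_AE)
  have "AL y. l = 1 | (y : ball x0 (l/2* sqrt t) --> rep g y = 0)" using inner by auto
  thus "AL y. en (rep g y)*en (gauss t (y - x)) <= en c*en (rep g y)"
  proof eventually_elim
  case (elim y)
  have "gauss t (y - x) <= c" if y: "l = 1 | y ~: ball x0 (l/2* sqrt t)"
  proof -
  have "pk M (norm (y - x)/sqrt t) <= 2 ^ M*pk M (l/2 - 1/2)"
  proof (rule pk_half)
  show "l/2 - 1/2 <= norm (y - x)/sqrt t + 1"
  proof (cases "l = 1")
  case True thus ?thesis using st by simp
  next
  case False
  hence "l/2* sqrt t <= dist x0 y" using y by simp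
  also have "... <= sqrt t + norm (y - x)" using x dist_triangle[of x0 y x] by (simp add: dist_norm norm_minus_commute)
  finally have "l/2 - 1 <= norm (y - x)/sqrt t" using st by (simp add: le_divide_eq algebra_simps)
  thus ?thesis by simp
  qed
  qed (use l st in auto)
  also have "pk M (l/2 - 1/2) <= 2 ^ M*(1/l) ^ M"
  proof -
  have "1/(1 + (l/2 - 1/2)) ^ M <= 1/(l/2) ^ M" using l by (intro divide_left_mono power_mono mult_pos_pos zero_less_power) auto
  thus ?thesis by (simp add: pk_def power_divide)
  qed
  finally have "pk M (norm (y - x)/sqrt t) <= 2 ^ M*(2 ^ M*(1/l) ^ M)" by simp
  also have "... = 4 ^ M*(1/l) ^ M" by (simp add: mult.assoc[symmetric] power_mult_distrib[symmetric])
  finally have "fact M*exp 2/gconst TYPE('a)*t ^-hd('a)*pk M (norm (y - x)/sqrt t) <= c"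
  unfolding c_def by (intro mono_l) auto
  thus ?thesis using gauss_le_pk[OF t, of "y - x" M] by linarith
  qed
  hence "rep g y = 0 | gauss t (y - x) <= c" using elim by auto
  thus ?case
  proof
  assume "gauss t (y - x) <= c"
  thus ?case by (auto simp: mult.commute[of "en c"] intro!: mono_l ennreal_leI)
  qed simp
  qed
 qed
 also have "... = en c*mass g" by (simp add: mass_def nn_integral_cmult)
 also have "... <= en c*en m" using m by (intro mono_l) auto
 finally have "en (inner g (gk t x)) <= en (c*m)" using c m by (simp add: ennreal_mult)
 moreover have "0 <= c*m" using c m by simp
 ultimately have "inner g (gk t x) <= c*m" by (simp only: ennreal_le_iff)
 thus ?thesis by (simp add: c_def mult_ac)
qed

text \<open>On an annulus at distance \<open>l * sqrt t\<close>, the Gaussian bound supplies decay in \<open>l\<close>, the loss of mass supplies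
 decay in \<open>t\<close>, and the regularity estimate supplies smallness in \<open>r\<close>; geometric means combine the three.\<close>

definition Y::"'a => real => real" where "Y x0 t = 1 + sqrt t/rho x0"

lemma Y: "0 < t ==> 1 <= Y x0 t" unfolding Y_def using rho_pos[of x0] by simp

text \<open>Upper bound and oscillation in one predicate, both linear in \<open>m\<close>, so that
  they add up over the pieces into which \<open>g\<close> is cut.\<close>

definition annular::"real => nat => nat => real => 'a => real => 'a l2 => real => bool" where
 "annular C N1 k t x0 r g m <->
  (AL x. x : ball x0 r --> rep (S t g) x <= C*(t ^-hd('a)*m*(1/Y x0 t) ^ N1)) &
  (AL x. AL z. x : ball x0 r --> z : ball x0 r -->
  <|rep (S t g) x - rep (S t g) z|> <= C*(r/sqrt t) powr (dl/4)*(t ^-hd('a)*m*(1/Y x0 t) ^ N1))"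

text \<open>Two geometric means. The Gaussian bound of order \<open>?M\<close> and the decay bound
  of order \<open>?N\<close> give \<open>X\<close>, where the growth \<open>l ^ ?N\<close> of the
  latter is compensated. Then \<open>X\<close> and the regularity bound give the oscillation, with
  half the Hoelder exponent.\<close>

lemma annular_bound:
 obtains C where "0 <= C"
  "!!t l r x0 g m. 0 < t ==> 0 < r ==> r <= sqrt t ==> 1 <= l ==> nn_l2 g ==> mass g <= en m ==> 0 <= m ==>
  AL x. x ~: ball x0 (l* sqrt t) --> rep g x = 0 ==>
  l = 1 | (AL x. x : ball x0 (l/2* sqrt t) --> rep g x = 0) ==> annular C N1 k t x0 r g ((1/l) ^ k*m)"
proof -
 \<comment> \<open>Chosen so that \<open>Z ^ (2*n)\<close> cancels \<open>y ^ nd\<close> from the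
   regularity bound and still leaves \<open>(1/y) ^ N1\<close> after the square root.\<close>
 obtain n::nat where n: "(nd + 2*N1)/(2*kk) <= real n" using real_arch_simple by blast
 have nk: "real (nd + 2*N1) <= 2*real n*kk" using n kk by (simp add: divide_le_eq mult_ac)
 let ?N = "4*n" and ?M = "4*n + 4*k"
 obtain Cb where Cb: "0 <= Cb" "!!t L x0 f m. 0 < t ==> sqrt t <= L ==> nn_l2 f ==> AL x. x ~: ball x0 L --> rep f x = 0 ==>
  mass f <= en m ==> 0 <= m ==>
  le_l2 (S t f) (Cb*t ^-hd('a)*(L/sqrt t*(1 + sqrt t/rho x0) powr (- kk)) ^ ?N*m)"
  using decay[of ?N] by blast
 obtain Cc where Cc: "0 <= Cc" "!!t r x0 f m. 0 < t ==> 0 < r ==> r <= sqrt t ==> nn_l2 f ==> mass f <= en m ==> 0 <= m ==>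
  AL x. AL z. x : ball x0 r --> z : ball x0 r -->
  <|rep (S t f) x - rep (S t f) z|> <= Cc*t ^-hd('a)*(r/sqrt t) powr (dl/2)*(1 + sqrt t/rho x0) ^ nd*m"
  using regularity_mass by blast
 define Ca where "Ca=fact ?M*exp 2/gconst TYPE('a)*4 ^ ?M"
 have Ca: "0 <= Ca" by (simp add: Ca_def)
 define C1 where "C1=sqrt (Ca*Cb)"
 define C where "C=C1 + sqrt (C1*Cc)"
 have C1: "0 <= C1" using Ca Cb by (simp add: C1_def)
 have C: "C1 <= C" "sqrt (C1*Cc) <= C" using C1 Cc by (simp_all add: C_def)
 show ?thesis
 proof (rule that[of C])
  show "0 <= C" using C C1 by linarith
  fix t l r m::real and x0::'a and g::"'a l2"
  assume t: "0 < t" and r: "0 < r" "r <= sqrt t" and l: "1 <= l" and g: "nn_l2 g" and m: "mass g <= en m" "0 <= m"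
  and supp: "AL x. x ~: ball x0 (l* sqrt t) --> rep g x = 0"
  and inner: "l = 1 | (AL x. x : ball x0 (l/2* sqrt t) --> rep g x = 0)"
  define ta where "ta=t ^-hd('a)*m"
  have ta: "0 <= ta" using m by (simp add: ta_def)
  define y where "y=Y x0 t"
  have y: "1 <= y" using Y[OF t] by (simp add: y_def)
  define Z where "Z=y powr (- kk)"
  have Z: "0 <= Z" by (simp add: Z_def)
  have st: "0 < sqrt t" using t by simp
  have Zy: "Z ^ (2*n) <= (1/y) ^ (nd + 2*N1)"
  proof -
  have "Z ^ (2*n) = (y powr (- kk)) powr real (2*n)" using y unfolding Z_def by (intro powr_realpow[symmetric]) simp
  also have "... = y powr (- kk*real (2*n))" by (rule powr_powr)
  also have "... <= y powr (- real (nd + 2*N1))" using y nk by (intro powr_mono) (auto simp: mult_ac)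
  also have "... = 1/y ^ (nd + 2*N1)" using y powr_realpow[of y "nd + 2*N1"] by (simp only: powr_minus_divide)
  finally show ?thesis by (simp only: power_one_over)
  qed
  define X where "X=ta*(Z ^ (2*n)*(1/l) ^ (2*k))"
  have X: "0 <= X" using ta Z l by (simp add: X_def)
  have nn: "AL x. 0 <= rep (S t g) x" using nn_S[OF g] t unfolding nn_l2_def by simp
  have "AL x. rep (S t g) x <= Cb*t ^-hd('a)*((l* sqrt t)/sqrt t*(1 + sqrt t/rho x0) powr (- kk)) ^ ?N*m"
  using Cb(2)[OF t _ g supp m] l st unfolding le_l2_def by simp
  hence bb: "AL x. rep (S t g) x <= Cb*(ta*(l*Z) ^ ?N)"
  using st by (simp add: ta_def Z_def y_def Y_def mult_ac)
  have eq: "(1/l) ^ ?M*(l*Z) ^ ?N = (Z ^ (2*n)*(1/l) ^ (2*k))^2"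
  proof -
  have "(1/l) ^ ?M*(l*Z) ^ ?N = (1/l*l) ^ ?N*(Z ^ ?N*(1/l) ^ (4*k))" by (simp only: power_add power_mult_distrib mult_ac)
  also have "... = (Z ^ (2*n)*(1/l) ^ (2*k))^2" using l by (simp add: power_mult_distrib power_mult[symmetric] mult.commute)
  finally show ?thesis .
  qed
  have p: "AL x. x : ball x0 (sqrt t) --> rep (S t g) x <= C1*X"
  using bb nn domination[OF g t]
  proof (rule eventually_mono[OF eventually_conj[OF eventually_conj]], clarify)
  fix x assume x: "x : ball x0 (sqrt t)" and u: "rep (S t g) x <= Cb*(ta*(l*Z) ^ ?N)" "0 <= rep (S t g) x" "rep (S t g) x <= inner g (gk t x)"
  show "rep (S t g) x <= C1*X"
  unfolding C1_def
  proof (rule sqrt_prod_bound[OF u(2) order_trans[OF u(3) gauss_annulus[OF t l g m inner x, of ?M, folded Ca_def ta_def]] u(1)])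
  have "Ca*ta*(1/l) ^ ?M*(Cb*(ta*(l*Z) ^ ?N)) = Ca*Cb*(ta^2*((1/l) ^ ?M*(l*Z) ^ ?N))"
  by (simp only: power2_eq_square mult_ac)
  also have "... = Ca*Cb*X^2" unfolding eq X_def by (simp only: power_mult_distrib)
  finally show "Ca*ta*(1/l) ^ ?M*(Cb*(ta*(l*Z) ^ ?N)) <= Ca*Cb*X^2" by (rule eq_refl)
  qed (use X Ca Cb in auto)
  qed
  define q where "q=ta*(1/l) ^ k*(1/y) ^ N1"
  have q: "0 <= q" using ta l y by (simp add: q_def)
  have Xq: "X <= q"
  proof -
  have "Z ^ (2*n) <= (1/y) ^ N1" by (rule order_trans[OF Zy]) (use y in "intro power_decreasing; simp")
  moreover have "(1/l) ^ (2*k) <= (1/l) ^ k" using l by (intro power_decreasing) auto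
  ultimately have "Z ^ (2*n)*(1/l) ^ (2*k) <= (1/y) ^ N1*(1/l) ^ k" using l y by (intro mult_mono) auto
  from mono_l[OF this ta] show ?thesis by (simp add: X_def q_def mult_ac)
  qed
  have sub: "ball x0 r \<subseteq> ball x0 (sqrt t)" using r by (simp add: subset_ball)
  have tq: "t ^-hd('a)*((1/l) ^ k*m)*(1/Y x0 t) ^ N1 = q" by (simp add: q_def ta_def y_def mult_ac)
  show "annular C N1 k t x0 r g ((1/l) ^ k*m)"
  unfolding annular_def tq
  proof
  have "C1*X <= C*q" using C C1 X Xq by (intro mult_mono) auto
  thus "AL x. x : ball x0 r --> rep (S t g) x <= C*q"
  using p sub by (auto elim!: eventually_mono)
  note p' = p[THEN AE_conjI, OF nn]
  show "AL x. AL z. x : ball x0 r --> z : ball x0 r -->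
  <|rep (S t g) x - rep (S t g) z|> <= C*(r/sqrt t) powr (dl/4)*q"
  using p' Cc(2)[OF t r g m, of x0]
  proof eventually_elim
  case (elim x)
  note x = elim(1)
  show ?case using p' elim(2)
  proof eventually_elim
  case (elim z)
  show ?case
  proof (intro impI)
  assume xz: "x : ball x0 r" "z : ball x0 r"
  define d where "d=<|rep (S t g) x - rep (S t g) z|>"
  have d1: "d <= C1*X" using x elim(1) xz sub by (auto simp: d_def abs_le_iff)
  define R where "R=(r/sqrt t) powr (dl/4)"
  have R2: "(r/sqrt t) powr (dl/2) = R^2" by (simp add: R_def power2_eq_square powr_add[symmetric])
  have d2: "d <= Cc*(ta*(R^2*y ^ nd))"
  using elim(2) xz by (simp add: d_def ta_def R2[symmetric] y_def Y_def mult_ac)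
  have "d <= sqrt (C1*Cc)*(R*q)"
  proof (rule sqrt_prod_bound[OF _ d1 d2])
  have "Z ^ (2*n)*y ^ nd <= (1/y) ^ (nd + 2*N1)*y ^ nd" using y by (intro mono_r Zy) auto
  also have "... = (1/y*y) ^ nd*((1/y) ^ N1)^2" by (simp only: power_add power_mult_distrib mult_ac power_mult[symmetric])
  also have "... = ((1/y) ^ N1)^2" using y by simp
  finally have Zn: "Z ^ (2*n)*y ^ nd <= ((1/y) ^ N1)^2" .
  have "C1*X*(Cc*(ta*(R^2*y ^ nd))) = C1*Cc*(ta^2* R^2*((1/l) ^ k)^2)*(Z ^ (2*n)*y ^ nd)"
  unfolding X_def power2_eq_square mult_2[of k] power_add[of "1/l" k k] by (simp only: mult_ac)
  also have "... <= C1*Cc*(ta^2* R^2*((1/l) ^ k)^2)*((1/y) ^ N1)^2"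
  using C1 Cc by (intro mono_l Zn) auto
  also have "... = C1*Cc*(R*q)^2" by (simp only: q_def power_mult_distrib mult_ac)
  finally show "C1*X*(Cc*(ta*(R^2*y ^ nd))) <= C1*Cc*(R*q)^2" .
  qed (use C1 Cc q in "auto simp: d_def R_def")
  also have "... <= C*(R*q)" using C q by (intro mono_r) (auto simp: R_def)
  finally show "<|rep (S t g) x - rep (S t g) z|> <= C*(r/sqrt t) powr (dl/4)*q"
  by (simp add: d_def R_def mult_ac)
  qed
  qed
  qed
  qed
 qed
qed

definition Ph::"nat => real => 'a => 'a l2" where "Ph k t x0 = cls (%y. pk k (norm (y - x0)/sqrt t))"

lemma annular_add:
 assumes t: "0 <= t" and 1: "annular C N1 k t x0 r g m" and 2: "annular C N1 k t x0 r g' m'"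
 shows "annular C N1 k t x0 r (g + g') (m + m')"
proof -
 have e: "AL x. rep (S t (g + g')) x = rep (S t g) x + rep (S t g') x"
  using rep_plus[of "S t g" "S t g'"] linear_simps(1)[OF lin[OF t], of g g'] by simp
 show ?thesis
  unfolding annular_def
 proof
  show "AL x. x : ball x0 r --> rep (S t (g + g')) x <= C*(t ^-hd('a)*(m + m')*(1/Y x0 t) ^ N1)"
  using e conjunct1[OF 1[unfolded annular_def]] conjunct1[OF 2[unfolded annular_def]]
  by eventually_elim (auto simp: distrib_left distrib_right intro: add_mono)
  show "AL x. AL z. x : ball x0 r --> z : ball x0 r -->
  <|rep (S t (g + g')) x - rep (S t (g + g')) z|> <= C*(r/sqrt t) powr (dl/4)*(t ^-hd('a)*(m + m')*(1/Y x0 t) ^ N1)"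
  using e conjunct2[OF 1[unfolded annular_def]] conjunct2[OF 2[unfolded annular_def]]
  proof eventually_elim
  case (elim x)
  note ex = elim(1)
  show ?case using e elim(2,3)
  proof eventually_elim
  case (elim z)
  show ?case
  proof (intro impI)
  assume "x : ball x0 r" "z : ball x0 r"
  with elim(2,3) have "<|(rep (S t g) x - rep (S t g) z) + (rep (S t g') x - rep (S t g') z)|>
  <= C*(r/sqrt t) powr (dl/4)*(t ^-hd('a)*m*(1/Y x0 t) ^ N1)
  + C*(r/sqrt t) powr (dl/4)*(t ^-hd('a)*m'*(1/Y x0 t) ^ N1)"
  by (intro order_trans[OF abs_triangle_ineq] add_mono) auto
  thus "<|rep (S t (g + g')) x - rep (S t (g + g')) z|> <= C*(r/sqrt t) powr (dl/4)*(t ^-hd('a)*(m + m')*(1/Y x0 t) ^ N1)"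
  by (simp add: ex elim(1) distrib_left distrib_right algebra_simps)
  qed
  qed
  qed
 qed
qed

text \<open>Induction on the number of dyadic annuli covering the support: the outermost one is
  split off. An annulus of size \<open>l\<close> contributes its integral against the weight, since
  \<open>pk k\<close> is at least \<open>(1/(2*l)) ^ k\<close> there.\<close>

lemma weighted_bound:
 assumes k: "DIM('a) < k"
 obtains C where "0 <= C"
  "!!t r x0 g R. 0 < t ==> 0 < r ==> r <= sqrt t ==> nn_l2 g ==> AL x. x ~: ball x0 R --> rep g x = 0 ==>
  annular C N1 k t x0 r g (inner g (Ph k t x0))"
proof -
 obtain C1 where C1: "0 <= C1"
  "!!t l r x0 g m. 0 < t ==> 0 < r ==> r <= sqrt t ==> 1 <= l ==> nn_l2 g ==> mass g <= en m ==> 0 <= m ==>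
  AL x. x ~: ball x0 (l* sqrt t) --> rep g x = 0 ==>
  l = 1 | (AL x. x : ball x0 (l/2* sqrt t) --> rep g x = 0) ==> annular C1 N1 k t x0 r g ((1/l) ^ k*m)"
  using annular_bound[of N1 k] by blast
 show ?thesis
 proof (rule that[of "C1*2 ^ k"])
  show "0 <= C1*2 ^ k" using C1 by simp
  fix t r R::real and x0::'a and g::"'a l2"
  assume t: "0 < t" and r: "0 < r" "r <= sqrt t" and g: "nn_l2 g" and supp: "AL x. x ~: ball x0 R --> rep g x = 0"
  have st: "0 < sqrt t" using t by simp
  have sq: "sqi (%y. pk k (norm (y - x0)/sqrt t))" using sqi_pk[OF st k, of 1 x0] by simp
  have base: "annular (C1*2 ^ k) N1 k t x0 r h (inner h (Ph k t x0))"
  if h: "nn_l2 h" and l: "1 <= l" and s1: "AL x. x ~: ball x0 (l* sqrt t) --> rep h x = 0"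
  and s2: "l = 1 | (AL x. x : ball x0 (l/2* sqrt t) --> rep h x = 0)" for h l
  proof -
  define m where "m=(2*l) ^ k*inner h (Ph k t x0)"
  have "0 <= inner h (Ph k t x0)" unfolding Ph_def using st by (intro nn_l2_inner h nn_l2_abs sq pk_nonneg) auto
  hence m0: "0 <= m" using l by (simp add: m_def)
  have "mass h <= en m"
  proof -
  have i: "itg (%x. (2*l) ^ k*(rep h x*pk k (norm (x - x0)/sqrt t)))"
  by (intro integrable_mult_right sqi_mult_integrable sqi_rep sq)
  have "mass h <= (NN x. en ((2*l) ^ k*(rep h x*pk k (norm (x - x0)/sqrt t))))"
  unfolding mass_def
  proof (rule nn_integral_mono_AE)
  show "AL x. en (rep h x) <= en ((2*l) ^ k*(rep h x*pk k (norm (x - x0)/sqrt t)))"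
  using s1 h[unfolded nn_l2_def]
  proof eventually_elim
  case (elim x)
  show ?case
  proof (cases "x : ball x0 (l* sqrt t)")
  case True
  hence "norm (x - x0)/sqrt t <= l" using st by (simp add: divide_le_eq dist_norm norm_minus_commute)
  hence "(1 + norm (x - x0)/sqrt t) ^ k <= (2*l) ^ k" using l st by (intro power_mono) auto
  moreover have "0 < (1 + norm (x - x0)/sqrt t) ^ k" using st by (intro zero_less_power add_pos_nonneg) auto
  ultimately have "1 <= (2*l) ^ k*pk k (norm (x - x0)/sqrt t)" by (simp add: pk_def le_divide_eq)
  from mono_l[OF this elim(2)] show ?thesis by (intro ennreal_leI) (simp add: mult_ac)
  qed (use elim in simp)
  qed
  qed
  also have "... = en (LI x. (2*l) ^ k*(rep h x*pk k (norm (x - x0)/sqrt t)))"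
  using i h l st unfolding nn_l2_def by (intro nn_integral_eq_integral) (auto intro!: mult_nonneg_nonneg pk_nonneg elim!: eventually_mono)
  also have "... = en m" unfolding m_def Ph_def inner_cls[OF sq] by simp
  finally show ?thesis .
  qed
  from C1(2)[OF t r l h this m0 s1 s2] have "annular C1 N1 k t x0 r h ((1/l) ^ k*m)" .
  moreover have "(1/l) ^ k*m = 2 ^ k*inner h (Ph k t x0)"
  using l by (simp add: m_def power_mult_distrib power_one_over mult.assoc[symmetric])
  ultimately have "annular C1 N1 k t x0 r h (2 ^ k*inner h (Ph k t x0))" by simp
  thus ?thesis by (simp add: annular_def mult_ac)
  qed
  have ind: "annular (C1*2 ^ k) N1 k t x0 r h (inner h (Ph k t x0))"
  if h: "nn_l2 h" "AL x. x ~: ball x0 (2 ^ J* sqrt t) --> rep h x = 0" for h and J::nat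
  using h
  proof (induction J arbitrary: h)
  case 0
  thus ?case by (intro base[of _ 1]) auto
  next
  case (Suc J)
  let ?A = "ball x0 (2 ^ J* sqrt t)"
  have "annular (C1*2 ^ k) N1 k t x0 r (rst ?A h) (inner (rst ?A h) (Ph k t x0))"
  using rep_rst[of ?A h] by (intro Suc.IH nn_rst Suc.prems) (auto simp: ind_def elim!: eventually_mono)
  moreover have "annular (C1*2 ^ k) N1 k t x0 r (rst (- ?A) h) (inner (rst (- ?A) h) (Ph k t x0))"
  proof (rule base[of _ "2 ^ Suc J"])
  show "AL x. x ~: ball x0 (2 ^ Suc J* sqrt t) --> rep (rst (- ?A) h) x = 0"
  using Suc.prems(2) rep_rst[of "- ?A" h] by (auto simp: ind_def elim!: eventually_elim2)
  show "2 ^ Suc J = (1::real) | (AL x. x : ball x0 (2 ^ Suc J/2* sqrt t) --> rep (rst (- ?A) h) x = 0)"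
  using rep_rst[of "- ?A" h] by (intro disjI2) (auto simp: ind_def elim!: eventually_mono)
  show "(1::real) <= 2 ^ Suc J" by (rule one_le_power) simp
  qed (auto intro!: nn_rst Suc.prems)
  ultimately show ?case
  using annular_add[OF less_imp_le[OF t]] rst_split[of ?A h] inner_add_left[of "rst ?A h" "rst (- ?A) h" "Ph k t x0"] by fastforce
  qed
  obtain J where "R/sqrt t < 2 ^ J" using real_arch_pow[of 2 "R/sqrt t"] by auto
  hence "ball x0 R \<subseteq> ball x0 (2 ^ J* sqrt t)" using st by (intro subset_ball) (simp add: divide_less_eq)
  thus "annular (C1*2 ^ k) N1 k t x0 r g (inner g (Ph k t x0))"
  using supp by (intro ind[of g J] g) (auto elim!: eventually_mono)
 qed
qed

end

section \<open>A jointly Borel, nonnegative version of the kernel\<close>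

lemma dominated_nonneg:
 fixes k::"'a::euclidean_space => real"
 assumes [measurable]: "k : BM" "!!m::nat. A m : sets borel" "E : sets borel"
  and i: "itg (%y. k y*ind U y)"
  and lim: "AL y. (%m. ind (A m) y::real) ----> ind E y"
  and U: "!!m. A m \<subseteq> U" and nn: "!!m. 0 <= (LI y. k y*ind (A m) y)"
 shows "0 <= (LI y. k y*ind E y)"
proof (rule LIMSEQ_le_const)
 show "(%m. LI y. k y*ind (A m) y) ----> (LI y. k y*ind E y)"
 proof (rule integral_dominated_convergence[where w="%y. <|k y*ind U y|>"])
  show "AL y. (%m. k y*ind (A m) y) ----> k y*ind E y"
  using lim by eventually_elim (intro tendsto_intros)
  show "AL y. norm (k y*ind (A m) y) <= <|k y*ind U y|>" for m
  using U[of m] by (auto simp: ind_def)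
 qed (use i in auto)
qed (use nn in auto)

lemma indicator_eventually_LIMSEQ:
 assumes "!!y. eventually (%m. y : A m <-> y : E) sequentially"
 shows "AE y in M. (%m. ind (A m) y::real) ----> ind E y"
proof (rule AE_I2, rule tendsto_eventually)
 fix y
 show "eventually (%m. ind (A m) y = (ind E y::real)) sequentially"
  using assms[of y] by eventually_elim (simp add: ind_def)
qed

text \<open>Countably many test sets decide the sign: finite unions of basis sets exhaust open sets,
  and outer regularity reaches the Borel set where \<open>k\<close> is negative.\<close>

lemma nonneg_test:
 fixes k::"'a::euclidean_space => real"
 assumes B: "topological_basis B" "countable B"
  and k[measurable]: "k : BM" and i: "!!n::nat. itg (%y. k y*ind (ball 0 n) y)"
  and test: "!!n::nat. !!F. F \<subseteq> B ==> finite F ==> 0 <= (LI y. k y*ind (\<Union>F \<inter> ball 0 n) y)"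
 shows "AL y. 0 <= k y"
proof -
 have op: "open S" if "S : B" for S using B(1) that by (rule topological_basis_open)
 have 1: "0 <= (LI y. k y*ind (O' \<inter> ball 0 n) y)" if O: "open O'" for O' and n::nat
 proof (cases "O' = {}")
  case False
  obtain B' where B': "B' \<subseteq> B" "\<Union>B' = O'" using B(1) O unfolding topological_basis_def by blast
  with False have ne: "B' ~= {}" by auto
  have c: "countable B'" using B' B(2) countable_subset by blast
  define b where "b=from_nat_into B'"
  have b: "range b = B'" unfolding b_def using ne c by (rule range_from_nat_into)
  show ?thesis
  proof (rule dominated_nonneg[OF k _ _ i, of "%m. \<Union>(b ` {..m}) \<inter> ball 0 n"])
  show "AL y. (%m. ind (\<Union>(b ` {..m}) \<inter> ball 0 n) y::real) ----> ind (O' \<inter> ball 0 n) y"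
  proof (rule indicator_eventually_LIMSEQ)
  fix y
  show "eventually (%m. y : \<Union>(b ` {..m}) \<inter> ball 0 n <-> y : O' \<inter> ball 0 n) sequentially"
  proof (cases "y : O'")
  case True
  then obtain N where "y : b N" using B' b by blast
  thus ?thesis using True unfolding eventually_sequentially by (intro exI[of _ N]) auto
  qed (use B' b in auto)
  qed
  show "0 <= (LI y. k y*ind (\<Union>(b ` {..m}) \<inter> ball 0 n) y)" for m
  using B' b by (intro test) auto
  show "\<Union>(b ` {..m}) \<inter> ball 0 n : sets borel" for m
  using op B' b by (intro borel_open open_Int open_UN ballI) auto
  qed (use O in auto)
 qed simp
 have "AL y. y : ball 0 (real n) --> 0 <= k y" for n::nat
 proof -
  define N where "N={y. k y < 0} \<inter> ball 0 (real n)"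
  have N[measurable]: "N : sets borel" unfolding N_def by measurable
  have "? O'. open O' & N \<subseteq> O' & emeasure lebesgue (O' - N) < en (1/Suc m)" for m
  by (rule sets_lebesgue_outer_open[of N "1/Suc m"]) auto
  then obtain Q where Q: "!!m. open (Q m)" "!!m. N \<subseteq> Q m" "!!m. emeasure lebesgue (Q m - N) < en (1/Suc m)" by metis
  have [measurable]: "Q m : sets borel" for m using Q(1) by simp
  define Z where "Z=(\<Inter>m. Q m)"
  have Z[measurable]: "Z : sets borel" unfolding Z_def by measurable
  have "emeasure lborel (Z - N) <= en e" if "0 < e" for e
  proof -
  obtain m where "1/real (Suc m) < e" using nat_approx_posE[OF `0 < e`] by metis
  have "emeasure lborel (Z - N) <= emeasure lborel (Q m - N)" by (intro emeasure_mono) (auto simp: Z_def)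
  also have "... <= en (1/Suc m)" using Q(3)[of m] by (simp add: emeasure_completion)
  also have "... <= en e" using `1/real (Suc m) < e` by (intro ennreal_leI less_imp_le)
  finally show ?thesis .
  qed
  hence "emeasure lborel (Z - N) <= 0 + en e" if "0 < e" for e using that by (simp only: add_0)
  hence "emeasure lborel (Z - N) <= 0" by (rule ennreal_le_epsilon)
  hence "emeasure lborel (Z - N) = 0" by simp
  hence ZN: "AL y. y ~: Z - N" by (intro AE_not_in) (auto simp: null_sets_def)
  have "0 <= (LI y. k y*ind N y)"
  proof (rule dominated_nonneg[OF k _ N i[of n], of "%m. (\<Inter>j\<le>m. Q j) \<inter> ball 0 n"])
  show "AL y. (%m. ind ((\<Inter>j\<le>m. Q j) \<inter> ball 0 n) y::real) ----> ind N y"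
  using ZN
  proof eventually_elim
  case (elim y)
  have "eventually (%m. y : (\<Inter>j\<le>m. Q j) \<inter> ball 0 n <-> y : N) sequentially"
  proof (cases "y : N")
  case True
  hence "y : ball 0 (real n)" by (simp add: N_def)
  thus ?thesis using True Q(2) by (intro always_eventually) blast
  next
  case False
  hence "y ~: Z" using elim by simp
  then obtain M where "y ~: Q M" by (auto simp: Z_def)
  thus ?thesis using False unfolding eventually_sequentially by (intro exI[of _ M]) auto
  qed
  thus ?case by (intro tendsto_eventually) (auto simp: ind_def elim!: eventually_mono)
  qed
  show "0 <= (LI y. k y*ind ((\<Inter>j\<le>m. Q j) \<inter> ball 0 n) y)" for m
  using Q(1) by (intro 1 open_INT) auto
  qed auto
  moreover have iN: "itg (%y. - (k y*ind N y))"
  by (rule Bochner_Integration.integrable_bound[OF i[of n]]) (auto simp: N_def ind_def)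
  ultimately have "(LI y. - (k y*ind N y)) <= 0" by simp
  moreover have nn: "0 <= - (k y*ind N y)" for y by (simp add: N_def ind_def)
  ultimately have "(LI y. - (k y*ind N y)) = 0" using Bochner_Integration.integral_nonneg[of lborel "%y. - (k y*ind N y)"] by simp
  hence "AL y. - (k y*ind N y) = 0" using integral_nonneg_eq_0_iff_AE[OF iN] nn by simp
  thus ?thesis by eventually_elim (auto simp: N_def ind_def not_less split: if_splits)
 qed
 hence "AL y. !n::nat. y : ball 0 (real n) --> 0 <= k y" unfolding AE_all_countable by blast
 thus ?thesis by eventually_elim (use reals_Archimedean2 in auto)
qed

locale kernel_setting = setting V T s for V::"'a::euclidean_space => real" and T s +
 fixes heat::"real => 'a => 'a => real"
 assumes kernel: "semigroup_kernel T heat"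
begin

text \<open>The kernel is measurable for the completed measure in \<open>(t, x, y)\<close> only. Its
  Borel version agrees with it almost everywhere in the product, so it represents the semigroup for
  almost every \<open>t\<close>; \<open>good\<close> singles out these times.\<close>

definition P0::"real \<times> 'a \<times> 'a => real" where "P0=bor (%(t, x, y). if 0 < t then heat t x y else 0)"

lemma P0: "P0 : BM" "AL p. 0 < fst p --> heat (fst p) (fst (snd p)) (snd (snd p)) = P0 p"
proof -
 have "(%(t, x, y). heat t x y) : borel_measurable (lebesgue_on ({0<..} \<times> UNIV))" using kernel by (simp add: semigroup_kernel_def)
 moreover have "({0<..} \<times> UNIV::(real \<times> 'a \<times> 'a) set) : sets lebesgue" by (intro sets_completionI_sets) (auto intro!: borel_open open_Times)
 ultimately have "(%p. if p : {0<..} \<times> UNIV then (%(t, x, y). heat t x y) p else 0) : borel_measurable lebesgue"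
  by (simp only: borel_measurable_if)
 hence m: "(%(t, x, y). if 0 < t then heat t x y else 0) : borel_measurable lebesgue"
  by (rule measurable_cong[THEN iffD1, rotated]) (auto split: if_splits)
 show "P0 : BM" unfolding P0_def by (rule bor(1)[OF m])
 show "AL p. 0 < fst p --> heat (fst p) (fst (snd p)) (snd (snd p)) = P0 p"
  using bor(2)[OF m] unfolding P0_def[symmetric] by eventually_elim (auto split: prod.splits)
qed

lemmas [measurable] = P0(1)

definition good::"real => bool" where
 "good t <-> (!u. AL x. itg (%y. P0 (t, x, y)*rep u y) &
  rep (TT t u) x = (LI y. P0 (t, x, y)*rep u y))"

lemma AE_good: "AL t. 0 < t --> good t"
proof -
 have "AE p in lb2. 0 < fst p --> heat (fst p) (fst (snd p)) (snd (snd p)) = P0 p"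
  unfolding lborel_prod by (rule P0(2))
 from lborel_pair.AE_pair[OF this]
 have "AL t. AE z in (lborel::('a \<times> 'a) measure). 0 < t --> heat t (fst z) (snd z) = P0 (t, z)" by simp
 thus ?thesis
 proof eventually_elim
  case (elim t)
  show ?case
  proof
  assume t: "0 < t"
  have "AE z in lb2. heat t (fst z) (snd z) = P0 (t, z)" unfolding lborel_prod using elim t by simp
  from lborel_pair.AE_pair[OF this] have ae: "AL x. AL y. heat t x y = P0 (t, x, y)" by simp
  show "good t"
  unfolding good_def
  proof
  fix u::"'a l2"
  have "AE x in lebesgue. integrable lebesgue (%y. heat t x y*rep u y) & T t (rep u) x = (LINT y|lebesgue. heat t x y*rep u y)"
  using kernel t rep_L2 unfolding semigroup_kernel_def by blast
  hence "AL x. integrable lebesgue (%y. heat t x y*rep u y) & T t (rep u) x = (LINT y|lebesgue. heat t x y*rep u y)"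
  by (simp add: AE_completion_iff)
  moreover have "AL x. rep (TT t u) x = T t (rep u) x"
  unfolding TT_def using t by (intro rep_elt T_L2) auto
  ultimately show "AL x. itg (%y. P0 (t, x, y)*rep u y) & rep (TT t u) x = (LI y. P0 (t, x, y)*rep u y)"
  using ae
  proof eventually_elim
  case (elim x)
  have m: "(%y. heat t x y*rep u y) : borel_measurable lebesgue" using elim(1) by (auto intro: borel_measurable_integrable)
  have e: "AL y. heat t x y*rep u y = P0 (t, x, y)*rep u y" using elim(3) by eventually_elim simp
  show ?case using lebesgue_lborel_integral[OF m _ e] elim by simp
  qed
  qed
  qed
 qed
qed

text \<open>Positivity of the semigroup makes the integral over each test set nonnegative for almost
  every \<open>x\<close>. The exceptional set depends on the test set, so only a countable family
  may be used.\<close>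

lemma good_nonneg:
 assumes t: "0 < t" "good t"
 shows "AL x. AL y. 0 <= P0 (t, x, y)"
proof -
 obtain B::"'a set set" where B: "countable B" "topological_basis B" using ex_countable_basis by blast
 define \<F> where "\<F>={F. F \<subseteq> B & finite F} \<times> (UNIV::nat set)"
 have c: "countable \<F>" unfolding \<F>_def using countable_Collect_finite_subset[OF B(1)] by (intro countable_SIGMA) (auto simp: conj_commute)
 have one: "AL x. itg (%y. P0 (t, x, y)*ind A y) & 0 <= (LI y. P0 (t, x, y)*ind A y)"
  if A[measurable]: "A : sets borel" "A \<subseteq> ball 0 (real n)" for A and n::nat
 proof -
  have "emeasure lborel A < oo" by (rule le_less_trans[OF emeasure_mono[OF A(2)]]) auto
  hence sq: "sqi (ind A)" using A(1) by (simp add: sqi_indicator)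
  define u::"'a l2" where "u=cls (ind A)"
  have nn: "nn_l2 (TT t u)" unfolding u_def using t by (intro nn_S nn_l2_abs sq) auto
  show ?thesis using t(2)[unfolded good_def, rule_format, of u] nn[unfolded nn_l2_def]
  proof eventually_elim
  case (elim x)
  have e: "AL y. P0 (t, x, y)*rep u y = P0 (t, x, y)*ind A y"
  unfolding u_def using rep_abs[OF sq] by eventually_elim simp
  have "(LI y. P0 (t, x, y)*rep u y) = (LI y. P0 (t, x, y)*ind A y)" by (rule integral_cong_AE[OF _ _ e]) measurable
  moreover have "itg (%y. P0 (t, x, y)*rep u y) <-> itg (%y. P0 (t, x, y)*ind A y)"
  by (rule integrable_cong_AE[OF _ _ e]) measurable
  ultimately show ?case using elim by simp
  qed
 qed
 have mF: "\<Union>F \<inter> ball 0 (real n) : sets borel" if "F \<subseteq> B" for F n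
  using that topological_basis_open[OF B(2)] by (intro borel_open open_Int open_Union) auto
 have "AL x. \<forall>(F, n)\<in>\<F>. 0 <= (LI y. P0 (t, x, y)*ind (\<Union>F \<inter> ball 0 (real n)) y)"
  unfolding AE_ball_countable[OF c]
 proof (clarsimp simp: \<F>_def)
  fix F and n::nat assume F: "F \<subseteq> B" "finite F"
  show "AL x. 0 <= (LI y. P0 (t, x, y)*ind (\<Union>F \<inter> ball 0 (real n)) y)"
  using one[OF mF[OF F(1)], of n n] by (auto elim!: eventually_mono)
 qed
 moreover have "AL x. !n::nat. itg (%y. P0 (t, x, y)*ind (ball 0 (real n)) y)"
  unfolding AE_all_countable
 proof
  fix n::nat
  show "AL x. itg (%y. P0 (t, x, y)*ind (ball 0 (real n)) y)"
  using one[of "ball 0 (real n)" n] by (auto elim!: eventually_mono)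
 qed
 ultimately show ?thesis
 proof eventually_elim
  case (elim x)
  show ?case by (rule nonneg_test[OF B(2,1)]) (use elim in "auto simp: \<F>_def")
 qed
qed

definition P::"real => 'a => 'a => real" where "P t x y = max 0 (P0 (t, x, y))"

lemma P_measurable [measurable (raw)]:
 assumes [measurable]: "f : borel_measurable M" "g : borel_measurable M" "h : borel_measurable M"
 shows "(%z. P (f z) (g z) (h z)) : borel_measurable M"
 unfolding P_def by measurable

lemma P_nonneg: "0 <= P t x y" by (simp add: P_def)

lemma heat_P: "AL p. 0 < fst p --> heat (fst p) (fst (snd p)) (snd (snd p)) = P (fst p) (fst (snd p)) (snd (snd p))"
proof -
 have "AE p in lb2. 0 < fst p --> 0 <= P0 p"
 proof (rule lborel_pair.AE_pair_measure)
  show "AL t. AE z in (lborel::('a \<times> 'a) measure). 0 < fst (t, z) --> 0 <= P0 (t, z)"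
  using AE_good
  proof eventually_elim
  case (elim t)
  show ?case
  proof (cases "0 < t")
  case True
  have "AE z in lb2. 0 <= P0 (t, z)"
  proof (rule lborel_pair.AE_pair_measure)
  show "{z \<in> space lb2. 0 <= P0 (t, z)} : sets lb2" unfolding lborel_prod by measurable
  qed (use good_nonneg[OF True] elim True in auto)
  thus ?thesis unfolding lborel_prod by simp
  qed simp
  qed
  have "{p \<in> space lb2. 0 < fst p --> 0 <= P0 p} = - ({0<..} \<times> UNIV) \<union> {p. 0 <= P0 p}"
  by (auto simp: space_pair_measure)
  moreover have "- ({0<..} \<times> UNIV) \<union> {p. 0 <= P0 p} : sets borel"
  proof (rule sets.Un[OF borel_comp[OF borel_open[OF open_Times]]])
  show "{p. 0 <= P0 p} : sets borel" by measurable
  qed auto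
  ultimately show "{p \<in> space lb2. 0 < fst p --> 0 <= P0 p} : sets lb2"
  unfolding lborel_prod by simp
 qed
 hence "AL p. 0 < fst p --> 0 <= P0 p" unfolding lborel_prod .
 thus ?thesis using P0(2) by eventually_elim (auto simp: P_def max_def)
qed

text \<open>Truncations lie in \<open>L\<^sup>2\<close>, and the kernel acts on a nonnegative function by monotone convergence.\<close>

definition trunc::"('a => real) => nat => 'a => real" where
 "trunc g n y = min (g y) (real n)*ind (ball 0 (real n)) y"

lemma trunc:
 assumes [measurable]: "g : BM" and g: "!!y. 0 <= g y"
 shows "sqi (trunc g n)" "0 <= trunc g n y" "trunc g n y <= g y" "incseq (%n. trunc g n y)" "(%n. trunc g n y) ----> g y"
proof -
 show "sqi (trunc g n)"
  by (rule sqi_bounded_support[where B="real n" and R = "real n"]) (use g in "auto simp: trunc_def[abs_def] ind_def min_def")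
 show "0 <= trunc g n y" "trunc g n y <= g y" using g by (auto simp: trunc_def ind_def)
 show "incseq (%n. trunc g n y)" using g[of y] by (intro incseq_SucI) (auto simp: trunc_def ind_def)
 obtain N where N: "max (g y) (norm y) < real N" using reals_Archimedean2 by blast
 show "(%n. trunc g n y) ----> g y"
  by (rule tendsto_eventually, unfold eventually_sequentially, rule exI[of _ N]) (use N in "auto simp: trunc_def")
qed

text \<open>The semigroup extended to nonnegative Borel functions that need not be square
  integrable.\<close>

definition G::"('a => real) => real => 'a => ennreal" where
 "G g t x = (NN y. en (P t x y)*en (g y))"

lemma G_trunc:
 assumes [measurable]: "g : BM" and g: "!!y. 0 <= g y" and t: "0 < t" "good t"
 shows "AL x. (%n. en (rep (TT t (cls (trunc g n))) x)) ----> G g t x & (!n. en (rep (TT t (cls (trunc g n))) x) <= G g t x)"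
proof -
 have tm [measurable]: "trunc g n : BM" for n using trunc(1)[of g n] g by (simp add: sqi_def)
 have "AL x. !n. itg (%y. P0 (t, x, y)*rep (cls (trunc g n)) y) &
  rep (TT t (cls (trunc g n))) x = (LI y. P0 (t, x, y)*rep (cls (trunc g n)) y)"
  unfolding AE_all_countable using t(2) by (simp add: good_def)
 thus ?thesis using good_nonneg[OF t]
 proof eventually_elim
  case (elim x)
  have eq: "en (rep (TT t (cls (trunc g n))) x) = (NN y. en (P t x y)*en (trunc g n y))" for n
  proof -
  have e: "AL y. P0 (t, x, y)*rep (cls (trunc g n)) y = P t x y*trunc g n y"
  using rep_abs[OF trunc(1)[OF assms(1) g, of n]] elim(2) by eventually_elim (simp add: P_def)
  have "itg (%y. P t x y*trunc g n y)"
  using elim(1) by (intro integrable_cong_AE[OF _ _ e, THEN iffD1]) auto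
  moreover have "rep (TT t (cls (trunc g n))) x = (LI y. P t x y*trunc g n y)"
  using elim(1) integral_cong_AE[OF _ _ e] by simp
  ultimately show ?thesis
  using trunc(2)[OF assms(1) g] by (simp add: nn_integral_eq_integral[symmetric] P_nonneg ennreal_mult)
  qed
  have "(%n. NN y. en (P t x y)*en (trunc g n y)) ----> G g t x"
  unfolding G_def
  proof (rule nn_integral_LIMSEQ)
  show "incseq (%n y. en (P t x y)*en (trunc g n y))"
  using incseqD[OF trunc(4)[OF assms(1) g]] by (intro incseq_SucI le_funI mono_l ennreal_leI) auto
  show "(%n. en (P t x y)*en (trunc g n y)) ----> en (P t x y)*en (g y)" for y
  using trunc(5)[OF assms(1) g] by (intro ennreal_tendsto_cmult tendsto_ennrealI) auto
  qed measurable
  moreover have "(NN y. en (P t x y)*en (trunc g n y)) <= G g t x" for n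
  unfolding G_def using trunc(3)[OF assms(1) g] by (intro nn_integral_mono mono_l ennreal_leI) auto
  ultimately show ?case by (simp add: eq)
 qed
qed

end

section \<open>Time integrals for functions of controlled growth\<close>

locale frac = kernel_setting V T s heat for V::"'a::euclidean_space => real" and T s heat +
 fixes al::real
 assumes al: "0 < al" "al < real DIM('a)"
begin

text \<open>The growth of the L1 norm on balls that the weight and Morrey conditions imply. With the
  exponent \<open>d - al\<close>, the semigroup at time \<open>t\<close> has size
  \<open>t powr (- (al/2))\<close>, critical for the time integral.\<close>

definition gr::"nat => 'a => real => real" where
 "gr N x r = r powr (real DIM('a) - al)*(1 + r/rho x) ^ N"

lemma gr_nonneg: "0 <= r ==> 0 <= gr N x r" using rho_pos[of x] by (simp add: gr_def)

definition growth_le::"nat => real => ('a => real) => bool" where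
 "growth_le N A g <-> g : BM & (!y. 0 <= g y) & 0 <= A &
  (!x r. 0 < r --> (NN y:ball x r. en (g y)) <= en (A*gr N x r))"

lemma growth_pk:
 assumes g: "growth_le N A g" and R: "0 < R" and k: "DIM('a) + N < k"
 shows "(NN y. en (g y)*en (pk k (norm (y - x)/R))) <= en (2 ^ (k + 1)*(A*gr N x R))"
proof -
 have A: "0 <= A" and [measurable]: "g : BM" using g by (auto simp: growth_le_def)
 have "(NN y. en (g y)*en (pk k (norm (y - x)/R))) <= en (2 ^ (k + 1))*en (A*gr N x R)"
 proof (rule nn_dyadic[OF _ R _ k])
  fix j::nat
  have p: "1 <= (2::real) ^ j" by simp
  have "(2 ^ j* R) powr (real DIM('a) - al) <= (2 ^ j) ^ DIM('a)* R powr (real DIM('a) - al)"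
  proof -
  have "((2::real) ^ j) powr (real DIM('a) - al) <= (2 ^ j) powr real DIM('a)" using p al by (intro powr_mono) auto
  thus ?thesis unfolding powr_mult by (intro mono_r) (auto simp: powr_realpow)
  qed
  moreover have "(1 + 2 ^ j* R/rho x) ^ N <= (2 ^ j*(1 + R/rho x)) ^ N"
  using p R rho_pos[of x] by (intro power_mono) (auto simp: distrib_left)
  ultimately have "gr N x (2 ^ j* R) <= ((2 ^ j) ^ DIM('a)* R powr (real DIM('a) - al))*(2 ^ j*(1 + R/rho x)) ^ N"
  unfolding gr_def using R rho_pos[of x] by (intro mult_mono) auto
  also have "... = gr N x R*2 ^ ((DIM('a) + N)*j)"
  unfolding gr_def power_mult_distrib by (simp add: power_mult[symmetric] power_add distrib_left mult_ac)
  finally have "A*gr N x (2 ^ j* R) <= (A*gr N x R)*2 ^ ((DIM('a) + N)*j)" using A by (simp add: mult.assoc mono_l)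
  hence "en (A*gr N x (2 ^ j* R)) <= en (A*gr N x R)*en (2 ^ ((DIM('a) + N)*j))"
  by (simp add: ennreal_mult''[symmetric] ennreal_leI)
  moreover have "(NN y:ball x (2 ^ j* R). en (g y)) <= en (A*gr N x (2 ^ j* R))"
  using g R by (simp add: growth_le_def)
  ultimately show "(NN y:ball x (2 ^ j* R). en (g y)) <= en (A*gr N x R)*en (2 ^ ((DIM('a) + N)*j))"
  by (rule order_trans[rotated])
 qed simp
 thus ?thesis using A gr_nonneg[of R N x] R by (simp add: ennreal_mult'[symmetric])
qed

text \<open>The annular bounds are used with \<open>N + 1\<close> powers of \<open>Y\<close>:
  \<open>N\<close> of them cancel the growth of \<open>g\<close>, the last one is kept for
  convergence at large times. Truncations carry the bounds over to \<open>g\<close>.\<close>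

lemma G_bounds:
 obtains C where "0 <= C"
  "!!t r x0 g A. 0 < t ==> good t ==> 0 < r ==> r <= sqrt t ==> growth_le N A g ==>
  (AL x. x : ball x0 r --> G g t x <= en (C*A*(t powr (- (al/2))/Y x0 t))) &
  (AL x. AL z. x : ball x0 r --> z : ball x0 r -->
  G g t x <= G g t z + en (C*A*((r/sqrt t) powr (dl/4)*t powr (- (al/2)))) &
  G g t z <= G g t x + en (C*A*((r/sqrt t) powr (dl/4)*t powr (- (al/2)))))"
proof -
 \<comment> \<open>Above the total growth exponent of \<open>g\<close>, so that the dyadic sums
   converge.\<close>
 define k where "k=DIM('a) + N + 1"
 have k: "DIM('a) < k" "DIM('a) + N < k" by (simp_all add: k_def)
 obtain C1 where C1: "0 <= C1"
  "!!t r x0 g R. 0 < t ==> 0 < r ==> r <= sqrt t ==> nn_l2 g ==> AL x. x ~: ball x0 R --> rep g x = 0 ==>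
  annular C1 (N + 1) k t x0 r g (inner g (Ph k t x0))"
  using weighted_bound[OF k(1), of "N + 1"] by blast
 show ?thesis
 proof (rule that[of "C1*2 ^ (k + 1)"])
  show "0 <= C1*2 ^ (k + 1)" using C1 by simp
  fix t r A::real and x0::'a and g::"'a => real"
  assume t: "0 < t" "good t" and r: "0 < r" "r <= sqrt t" and gr: "growth_le N A g"
  have [measurable]: "g : BM" and g0: "!!y. 0 <= g y" and A: "0 <= A" using gr by (auto simp: growth_le_def)
  note tr = trunc[OF `g : BM` g0]
  have st: "0 < sqrt t" using t by simp
  have y1: "1 <= Y x0 t" by (rule Y[OF t(1)])
  define u where "u n = TT t (cls (trunc g n))" for n
  have nn: "nn_l2 (cls (trunc g n))" for n using tr by (intro nn_l2_abs)
  define a where "a=C1*2 ^ (k + 1)*A*(t powr (- (al/2))/Y x0 t)"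
  define d where "d=C1*2 ^ (k + 1)*A*((r/sqrt t) powr (dl/4)*t powr (- (al/2)))"
  have ad: "0 <= a" "0 <= d" using C1 A y1 by (simp_all add: a_def d_def)
  have bd: "C1*th*(t ^-hd('a)*inner (cls (trunc g n)) (Ph k t x0)*(1/Y x0 t) ^ (N + 1))
  <= C1*2 ^ (k + 1)*A*(th*(t powr (- (al/2))/Y x0 t))" if "0 <= th" for n th
  proof -
  have sq: "sqi (%y. pk k (norm (y - x0)/sqrt t))" using sqi_pk[OF st k(1), of 1 x0] by simp
  have "en (inner (cls (trunc g n)) (Ph k t x0)) = (NN y. en (trunc g n y*pk k (norm (y - x0)/sqrt t)))"
  unfolding Ph_def inner_abs_cls[OF tr(1) sq] using st tr(2)
  by (intro nn_integral_eq_integral[symmetric] sqi_mult_integrable tr sq) (auto intro!: pk_nonneg mult_nonneg_nonneg)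
  also have "... <= (NN y. en (g y)*en (pk k (norm (y - x0)/sqrt t)))"
  using tr(3) st g0 by (intro nn_integral_mono) (auto simp: ennreal_mult[symmetric] pk_nonneg intro!: ennreal_leI mono_r)
  also have "... <= en (2 ^ (k + 1)*(A*gr N x0 (sqrt t)))" by (rule growth_pk[OF gr st k(2)])
  finally have i: "inner (cls (trunc g n)) (Ph k t x0) <= 2 ^ (k + 1)*(A*gr N x0 (sqrt t))"
  using A gr_nonneg[of "sqrt t" N x0] st by (subst (asm) ennreal_le_iff) auto
  have "C1*th*(t ^-hd('a)*inner (cls (trunc g n)) (Ph k t x0)*(1/Y x0 t) ^ (N + 1))
  <= C1*th*(t ^-hd('a)*(2 ^ (k + 1)*(A*gr N x0 (sqrt t)))*(1/Y x0 t) ^ (N + 1))"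
  using C1 that y1 by (intro mono_l mono_r i) auto
  also have "... = C1*2 ^ (k + 1)*A*(th*(t ^-hd('a)* sqrt t powr (real DIM('a) - al)*((Y x0 t) ^ N*(1/Y x0 t) ^ (N + 1))))"
  by (simp add: gr_def Y_def mult_ac)
  also have "(Y x0 t) ^ N*(1/Y x0 t) ^ (N + 1) = 1/Y x0 t" using y1 by (simp add: power_one_over)
  also have "t ^-hd('a)* sqrt t powr (real DIM('a) - al) = t powr (- (al/2))"
  unfolding sqrt_powr[OF t(1)] by (simp add: powr_add[symmetric] diff_divide_distrib)
  finally show ?thesis by (simp add: mult_ac)
  qed
  have an: "annular C1 (N + 1) k t x0 r (cls (trunc g n)) (inner (cls (trunc g n)) (Ph k t x0))" for n
  proof (rule C1(2)[OF t(1) r nn, where R="real n + norm x0"])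
  show "AL x. x ~: ball x0 (real n + norm x0) --> rep (cls (trunc g n)) x = 0"
  using rep_abs[OF tr(1), of n]
  proof eventually_elim
  case (elim x)
  show ?case using elim norm_triangle_ineq4[of x0 x] by (auto simp: trunc_def dist_norm ind_def)
  qed
  qed
  have 1: "AL x. !n. x : ball x0 r --> rep (u n) x <= a"
  unfolding AE_all_countable
  proof
  fix n show "AL x. x : ball x0 r --> rep (u n) x <= a"
  using conjunct1[OF an[of n, unfolded annular_def]] bd[of 1 n] by (auto simp: u_def a_def elim!: eventually_mono)
  qed
  have 2: "AL x. !n. AL z. x : ball x0 r --> z : ball x0 r --> <|rep (u n) x - rep (u n) z|> <= d"
  unfolding AE_all_countable
  proof
  fix n
  have "C1*2 ^ (k + 1)*A*((r/sqrt t) powr (dl/4)*(t powr (- (al/2))/Y x0 t)) <= d"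
  unfolding d_def using C1 A y1 mono_l[OF y1, of "t powr (- (al/2))"]
  by (intro mono_l) (auto simp: divide_le_eq)
  with bd[of "(r/sqrt t) powr (dl/4)" n]
  have "C1*(r/sqrt t) powr (dl/4)*(t ^-hd('a)*inner (cls (trunc g n)) (Ph k t x0)*(1/Y x0 t) ^ (N + 1)) <= d"
  by simp
  thus "AL x. AL z. x : ball x0 r --> z : ball x0 r --> <|rep (u n) x - rep (u n) z|> <= d"
  using conjunct2[OF an[of n, unfolded annular_def]] unfolding u_def
  by (elim eventually_mono) (auto elim!: eventually_mono)
  qed
  have lim: "AL x. (%n. en (rep (u n) x)) ----> G g t x"
  using G_trunc[OF `g : BM` g0 t] by (auto simp: u_def elim!: eventually_mono)
  show "(AL x. x : ball x0 r --> G g t x <= en (C1*2 ^ (k + 1)*A*(t powr (- (al/2))/Y x0 t))) &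
  (AL x. AL z. x : ball x0 r --> z : ball x0 r -->
  G g t x <= G g t z + en (C1*2 ^ (k + 1)*A*((r/sqrt t) powr (dl/4)*t powr (- (al/2)))) &
  G g t z <= G g t x + en (C1*2 ^ (k + 1)*A*((r/sqrt t) powr (dl/4)*t powr (- (al/2)))))"
  unfolding a_def[symmetric] d_def[symmetric]
  proof
  show "AL x. x : ball x0 r --> G g t x <= en a"
  using 1 lim by eventually_elim (auto intro!: LIMSEQ_le_const2 ennreal_leI)
  show "AL x. AL z. x : ball x0 r --> z : ball x0 r --> G g t x <= G g t z + en d & G g t z <= G g t x + en d"
  using 2 lim
  proof eventually_elim
  case (elim x)
  note limx = elim(2)
  have "AL z. !n. x : ball x0 r --> z : ball x0 r --> <|rep (u n) x - rep (u n) z|> <= d"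
  using elim(1) unfolding AE_all_countable .
  thus ?case using lim
  proof eventually_elim
  case (elim z)
  show ?case
  proof (intro impI)
  assume xz: "x : ball x0 r" "z : ball x0 r"
  have st: "en a' <= en b' + en d" if "<|a' - b'|> <= d" for a' b'
  proof -
  have "a' <= max 0 b' + d" using that by linarith
  hence "en a' <= en (max 0 b') + en d"
  using ad by (simp add: ennreal_plus[symmetric] ennreal_leI del: ennreal_plus)
  thus ?thesis by (cases "b' <= 0") (auto simp: max_def ennreal_neg)
  qed
  have uu: "<|rep (u n) x - rep (u n) z|> <= d" for n using elim(1) xz by blast
  show "G g t x <= G g t z + en d & G g t z <= G g t x + en d"
  proof
  show "G g t x <= G g t z + en d"
  using st[OF uu] by (intro LIMSEQ_le[OF limx tendsto_add[OF elim(2) tendsto_const]]) auto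
  show "G g t z <= G g t x + en d"
  using st uu by (intro LIMSEQ_le[OF elim(2) tendsto_add[OF limx tendsto_const]]) (auto simp: abs_minus_commute)
  qed
  qed
  qed
  qed
  qed
 qed
qed

text \<open>Near the ball the total mass 1 suffices, because the weight is bounded below there;
  farther away the tail bound applies at distance \<open>(s - 1)*r\<close>.\<close>

lemma gauss_ball:
 fixes x0 y::'a
 assumes t: "0 < t" and r: "sqrt t <= r"
 shows "(NN x:ball x0 r. en (gauss t (x - y))) <= en (3 ^ k*(1 + gT TYPE('a) k)*pk k (norm (y - x0)/r))"
proof -
 have st: "0 < sqrt t" using t by simp
 with r have r0: "0 < r" by linarith
 have gT: "0 <= gT TYPE('a) k" by (rule gT)
 define s where "s=norm (y - x0)/r"
 have s: "0 <= s" using r0 by (simp add: s_def)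
 have pp: "(1/(1 + s)) ^ k = pk k s" by (simp add: pk_def power_one_over)
 show ?thesis
 proof (cases "s < 2")
  case True
  have "(1/3) ^ k <= (1/(1 + s)) ^ k" using True s by (intro power_mono divide_left_mono) auto
  hence "3 ^ k*(1/3) ^ k <= 3 ^ k*pk k s" unfolding pp by (intro mono_l) auto
  also have "3 ^ k*(1/3) ^ k = (1::real)" by (simp add: power_mult_distrib[symmetric])
  also have "3 ^ k*pk k s <= 3 ^ k*(1 + gT TYPE('a) k)*pk k s"
  using gT s by (intro mono_r) (auto simp: pk_nonneg)
  finally have e: "1 <= 3 ^ k*(1 + gT TYPE('a) k)*pk k s" .
  have "(NN x:ball x0 r. en (gauss t (x - y))) <= (NN x. en (gauss t (x - y)))"
  by (intro nn_integral_mono) (auto simp: ind_def)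
  also have "... = en 1" using nn_integral_gauss[OF t, of y] by simp
  also note ennreal_leI[OF e]
  finally show ?thesis unfolding s_def .
 next
  case False
  define L where "L=(s - 1)*r"
  have L: "0 < L" using False r0 by (simp add: L_def)
  have "(NN x:ball x0 r. en (gauss t (x - y))) <= en (gT TYPE('a) k*(sqrt t/L) ^ k)"
  proof (rule gauss_tail[OF t L])
  fix x assume "x : ball x0 r"
  hence "norm (x - x0) < r" by (simp add: dist_norm norm_minus_commute)
  moreover have "norm (y - x0) <= norm (x - y) + norm (x - x0)" using norm_triangle_ineq4[of "x - x0" "x - y"] by simp
  ultimately show "L <= norm (x - y)" using r0 by (simp add: L_def s_def left_diff_distrib)
  qed simp
  also have "... <= en (3 ^ k*(1 + gT TYPE('a) k)*pk k s)"
  proof (rule ennreal_leI)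
  have "sqrt t/L <= r/L" using r L by (intro divide_right_mono) auto
  also have "... = 1/(s - 1)" using r0 by (simp add: L_def)
  also have "... <= 3/(1 + s)"
  proof -
  have "0 < s - 1" "0 < 1 + s" "1 + s <= 3*(s - 1)" using False by simp_all
  thus ?thesis by (simp add: pos_divide_le_eq pos_le_divide_eq mult.commute)
  qed
  finally have "(sqrt t/L) ^ k <= (3/(1 + s)) ^ k" using st L by (intro power_mono) auto
  also have "... = 3 ^ k*pk k s" by (simp add: pk_def power_divide)
  finally have "gT TYPE('a) k*(sqrt t/L) ^ k <= gT TYPE('a) k*(3 ^ k*pk k s)" using gT by (rule mono_l)
  also have "... <= (1 + gT TYPE('a) k)*(3 ^ k*pk k s)" using s by (intro mono_r) (auto simp: pk_nonneg)
  finally show "gT TYPE('a) k*(sqrt t/L) ^ k <= 3 ^ k*(1 + gT TYPE('a) k)*pk k s" by (simp add: mult_ac)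
  qed
  finally show ?thesis by (simp add: s_def)
 qed
qed

definition CS::"nat => real" where
 "CS N = 3 ^ (DIM('a) + N + 1)*(1 + gT TYPE('a) (DIM('a) + N + 1))*2 ^ (DIM('a) + N + 2)"

lemma CS: "0 <= CS N" using gT[where 'a='a, of "DIM('a) + N + 1"] by (simp add: CS_def)

text \<open>Domination replaces the semigroup by the free flow. After an exchange of integrals, the
  Gaussian mass of the ball is bounded by a polynomial weight against which \<open>g\<close> is
  summable.\<close>

lemma G_small:
 assumes t: "0 < t" "good t" and r: "sqrt t <= r" and g: "growth_le N A g"
 shows "(NN x:ball x0 r. G g t x) <= en (CS N*(A*gr N x0 r))"
proof -
 define k where "k=DIM('a) + N + 1"
 have st: "0 < sqrt t" using t by simp
 with r have r0: "0 < r" by linarith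
 have [measurable]: "g : BM" and g0: "!!y. 0 <= g y" and A: "0 <= A" using g by (auto simp: growth_le_def)
 note tr = trunc[OF `g : BM` g0]
 define c where "c=3 ^ k*(1 + gT TYPE('a) k)"
 have c: "0 <= c" using gT[where 'a='a, of k] by (simp add: c_def)
 have dom: "AL x. G g t x <= (NN y. en (g y)*en (gauss t (x - y)))"
 proof -
  have "AL x. !n. en (rep (TT t (cls (trunc g n))) x) <= (NN y. en (g y)*en (gauss t (x - y)))"
  unfolding AE_all_countable
  proof
  fix n
  have nn: "nn_l2 (cls (trunc g n))" using tr by (intro nn_l2_abs)
  have "en (inner (cls (trunc g n)) (gk t x)) <= (NN y. en (g y)*en (gauss t (x - y)))" for x
  unfolding ennreal_inner_gk[OF t(1) nn] gauss_symm[of t x]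
  using rep_abs[OF tr(1), of n] by (intro nn_integral_mono_AE) (auto intro!: mono_r ennreal_leI tr(3) elim!: eventually_mono)
  thus "AL x. en (rep (TT t (cls (trunc g n))) x) <= (NN y. en (g y)*en (gauss t (x - y)))"
  using domination[OF nn t(1)] by (auto elim!: eventually_mono intro: order_trans[OF ennreal_leI])
  qed
  thus ?thesis using G_trunc[OF `g : BM` g0 t] by eventually_elim (auto intro: LIMSEQ_le_const2)
 qed
 have "(NN x:ball x0 r. G g t x) <= (NN x. (NN y. en (g y)*(en (gauss t (x - y))*ind (ball x0 r) x)))"
  using dom by (intro nn_integral_mono_AE) (auto simp: ind_def elim!: eventually_mono)
 also have "... = (NN y. (NN x. en (g y)*(en (gauss t (x - y))*ind (ball x0 r) x)))"
  by (rule lborel_pair.Fubini') measurable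
 also have "... <= (NN y. en c*(en (g y)*en (pk k (norm (y - x0)/r))))"
 proof (rule nn_integral_mono)
  fix y
  have "(NN x. en (g y)*(en (gauss t (x - y))*ind (ball x0 r) x)) = en (g y)*(NN x:ball x0 r. en (gauss t (x - y)))"
  by (rule nn_integral_cmult) measurable
  also have "... <= en (g y)*en (c*pk k (norm (y - x0)/r))"
  unfolding c_def by (intro mono_l gauss_ball t r) auto
  finally show "(NN x. en (g y)*(en (gauss t (x - y))*ind (ball x0 r) x)) <= en c*(en (g y)*en (pk k (norm (y - x0)/r)))"
  using c r0 by (simp add: ennreal_mult pk_nonneg mult_ac)
 qed
 also have "... = en c*(NN y. en (g y)*en (pk k (norm (y - x0)/r)))" by (rule nn_integral_cmult) measurable
 also have "... <= en c*en (2 ^ (k + 1)*(A*gr N x0 r))"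
  by (intro mono_l growth_pk[OF g r0]) (auto simp: k_def)
 also have "... = en (CS N*(A*gr N x0 r))"
  using c A gr_nonneg[of r N x0] r0 by (subst ennreal_mult[symmetric]) (auto simp: CS_def c_def k_def)
 finally show ?thesis .
qed

end

context frac
begin

lemma G_measurable [measurable (raw)]:
 assumes [measurable]: "g : BM" "f : borel_measurable M" "h : borel_measurable M"
 shows "(%z. G g (f z) (h z)) : borel_measurable M"
 unfolding G_def by measurable

definition FI::"real set => ('a => real) => 'a => ennreal" where
 "FI J g x = (NN t:J. en (t powr (al/2 - 1))*G g t x)"

lemma FI_measurable [measurable]:
 assumes [measurable]: "J : sets borel" "g : BM" shows "FI J g : BM"
 unfolding FI_def[abs_def] by measurable

lemma FI_split: "0 < r ==> g : BM ==> FI {0<..} g x = FI {0<..<r^2} g x + FI {r^2..} g x"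
proof -
 assume r: "0 < r" and [measurable]: "g : BM"
 have "ind {0<..} t = (ind {0<..<r^2} t + ind {r^2..} t::ennreal)" for t
  using less_le_trans[OF zero_less_power[OF r], of 2 t] by (auto simp: ind_def)
 thus ?thesis unfolding FI_def by (simp add: distrib_left nn_integral_add)
qed

text \<open>For \<open>t < r^2\<close> the integral over the ball has a bound independent of
  \<open>t\<close>, so \<open>t powr (al/2 - 1)\<close> is integrated as it stands and yields
  \<open>r powr al\<close>.\<close>

lemma FI_small:
 assumes r: "0 < r" and g: "growth_le N A g"
 shows "(NN x:ball x0 r. FI {0<..<r^2} g x) <= en (2/al*CS N*A*(r powr al*gr N x0 r))"
proof -
 have [measurable]: "g : BM" and A: "0 <= A" using g by (auto simp: growth_le_def)
 define c where "c=CS N*(A*gr N x0 r)"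
 have c: "0 <= c" using CS[of N] A gr_nonneg[of r N x0] r by (simp add: c_def)
 have "(NN x:ball x0 r. FI {0<..<r^2} g x)
  = (NN x. (NN t. en (t powr (al/2 - 1))*ind {0<..<r^2} t*(G g t x*ind (ball x0 r) x)))"
  unfolding FI_def by (intro nn_integral_cong, subst nn_integral_multc[symmetric]) (auto simp: mult_ac)
 also have "... = (NN t. (NN x. en (t powr (al/2 - 1))*ind {0<..<r^2} t*(G g t x*ind (ball x0 r) x)))"
  by (rule lborel_pair.Fubini') measurable
 also have "... <= (NN t. en c*(en (t powr (al/2 - 1))*ind {0..r^2} t))"
 proof (rule nn_integral_mono_AE)
  show "AL t. (NN x. en (t powr (al/2 - 1))*ind {0<..<r^2} t*(G g t x*ind (ball x0 r) x))
  <= en c*(en (t powr (al/2 - 1))*ind {0..r^2} t)"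
  using AE_good
  proof eventually_elim
  case (elim t)
  have e: "(NN x. en (t powr (al/2 - 1))*ind {0<..<r^2} t*(G g t x*ind (ball x0 r) x))
  = en (t powr (al/2 - 1))*ind {0<..<r^2} t*(NN x:ball x0 r. G g t x)" by (rule nn_integral_cmult) measurable
  show ?case
  proof (cases "t : {0<..<r^2}")
  case True
  hence "sqrt t <= r" using r real_sqrt_le_mono[of t "r^2"] by simp
  hence "(NN x:ball x0 r. G g t x) <= en c" unfolding c_def using elim True by (intro G_small g) auto
  from mono_l[OF this, of "en (t powr (al/2 - 1))"] show ?thesis unfolding e using True by (simp add: mult.commute)
  qed (simp add: e)
  qed
 qed
 also have "... = en c*(NN t. en (t powr (al/2 - 1))*ind {0..r^2} t)" by (rule nn_integral_cmult) measurable
 also have "(NN t. en (t powr (al/2 - 1))*ind {0..r^2} t) = en ((r^2) powr (al/2 - 1 + 1)/(al/2 - 1 + 1))"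
  using al by (intro nn_integral_has_integral_lebesgue' has_integral_powr_from_0) auto
 also have "(r^2) powr (al/2 - 1 + 1) = r powr al" using r powr_powr[of r 2 "al/2"] by simp
 also have "en c*en (r powr al/(al/2 - 1 + 1)) = en (2/al*CS N*A*(r powr al*gr N x0 r))"
  using c al by (subst ennreal_mult[symmetric]) (auto simp: c_def mult_ac)
 finally show ?thesis .
qed

lemma nn_integral_powr_tail:
 assumes "e < -1" "0 < a" "0 <= c"
 shows "(NN t:{a..}. en (c*t powr e)) = en (c*(- (a powr (e + 1))/(e + 1)))"
 using assms has_integral_mult_right[OF has_integral_powr_to_inf[OF assms(1,2)], of c]
 by (intro nn_integral_has_integral_lebesgue') auto

text \<open>The size bound leaves \<open>1/t\<close> times \<open>1/Y\<close>, at most a multiple of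
  \<open>t powr (- 3/2)\<close>: finiteness, with a constant that depends on \<open>rho x0\<close>.
  The oscillation leaves \<open>t powr (- 1 - dl/8)\<close>, whose integral from \<open>r^2\<close>
  cancels \<open>r powr (dl/4)\<close>; hence a constant uniform in ball and
  \<open>g\<close>.\<close>

lemma FI_large:
 obtains C where "0 <= C"
  "!!r x0 g A. 0 < r ==> growth_le N A g ==> (AL x. x : ball x0 r --> FI {r^2..} g x < oo) &
  (AL x. AL z. x : ball x0 r --> z : ball x0 r -->
  FI {r^2..} g x <= FI {r^2..} g z + en (C*A) & FI {r^2..} g z <= FI {r^2..} g x + en (C*A))"
proof -
 obtain C where C: "0 <= C"
  "!!t r x0 g A. 0 < t ==> good t ==> 0 < r ==> r <= sqrt t ==> growth_le N A g ==>
  (AL x. x : ball x0 r --> G g t x <= en (C*A*(t powr (- (al/2))/Y x0 t))) &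
  (AL x. AL z. x : ball x0 r --> z : ball x0 r -->
  G g t x <= G g t z + en (C*A*((r/sqrt t) powr (dl/4)*t powr (- (al/2)))) &
  G g t z <= G g t x + en (C*A*((r/sqrt t) powr (dl/4)*t powr (- (al/2)))))"
  using G_bounds[of N] by blast
 show ?thesis
 proof (rule that[of "C*(8/dl)"])
  show "0 <= C*(8/dl)" using C dl by simp
  fix r A::real and x0::'a and g::"'a => real"
  assume r: "0 < r" and g: "growth_le N A g"
  have [measurable]: "g : BM" and A: "0 <= A" using g by (auto simp: growth_le_def)
  have CA: "0 <= C*A" using C A by simp
  have r2: "0 < r^2" using r by simp
  let ?B = "ball x0 r"
  have rt: "0 < t" "r <= sqrt t" if "r^2 <= t" for t
  using less_le_trans[OF r2 that] r real_sqrt_le_mono[OF that] by simp_all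
  define a where "a t = C*A*(t powr (- (al/2))/Y x0 t)" for t
  define d where "d t = C*A*((r/sqrt t) powr (dl/4)*t powr (- (al/2)))" for t
  have [measurable]: "a : BM" "d : BM" unfolding a_def d_def Y_def by measurable
  have "AL t. AL x. r^2 <= t --> x : ?B --> G g t x <= en (a t)"
  using AE_good
  proof eventually_elim
  case (elim t)
  thus ?case using C(2)[OF rt(1) _ r rt(2) g, of t x0] rt unfolding a_def by (cases "r^2 <= t") auto
  qed
  hence fin: "AL x. AL t. r^2 <= t --> x : ?B --> G g t x <= en (a t)"
  by (rule lborel_pair.AE_commute[THEN iffD1, rotated]) measurable
  \<comment> \<open>Null sets of pairs arise for each good \<open>t\<close> separately;
    measurability on the product allows the quantifier over \<open>t\<close> to move inside those
    over \<open>x\<close> and \<open>z\<close>.\<close>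
  interpret Q: pair_sigma_finite lborel "lb2::('a \<times> 'a) measure"
  unfolding lborel_prod by unfold_locales
  have "AL t. AE w in lb2. r^2 <= t --> fst w : ?B --> snd w : ?B -->
  G g t (fst w) <= G g t (snd w) + en (d t) & G g t (snd w) <= G g t (fst w) + en (d t)"
  using AE_good
  proof eventually_elim
  case (elim t)
  show ?case
  proof (rule lborel_pair.AE_pair_measure)
  show "AL x. AL z. r^2 <= t --> fst (x, z) : ?B --> snd (x, z) : ?B -->
  G g t (fst (x, z)) <= G g t (snd (x, z)) + en (d t) & G g t (snd (x, z)) <= G g t (fst (x, z)) + en (d t)"
  using elim C(2)[OF rt(1) _ r rt(2) g, of t x0] rt unfolding d_def by (cases "r^2 <= t") auto
  qed measurable
  qed
  hence "AE w in lb2. AL t. r^2 <= t --> fst w : ?B --> snd w : ?B -->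
  G g t (fst w) <= G g t (snd w) + en (d t) & G g t (snd w) <= G g t (fst w) + en (d t)"
  by (rule Q.AE_commute[THEN iffD1, rotated]) measurable
  from lborel_pair.AE_pair[OF this]
  have osc: "AL x. AL z. AL t. r^2 <= t --> x : ?B --> z : ?B -->
  G g t x <= G g t z + en (d t) & G g t z <= G g t x + en (d t)" by simp
  have pd: "t powr (al/2 - 1)*d t = C*A*r powr (dl/4)*t powr (- 1 - dl/8)" if t: "0 < t" for t
  proof -
  have "d t = C*A*(r powr (dl/4)*t powr (- (dl/4/2))*t powr (- (al/2)))"
  unfolding d_def div_sqrt_powr[OF t less_imp_le[OF r]] ..
  hence "t powr (al/2 - 1)*d t = C*A*r powr (dl/4)*(t powr (al/2 - 1)*(t powr (- (dl/4/2))*t powr (- (al/2))))" by (simp only: mult_ac)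
  also have "t powr (al/2 - 1)*(t powr (- (dl/4/2))*t powr (- (al/2))) = t powr (- 1 - dl/8)" by (simp add: powr_add[symmetric])
  finally show ?thesis .
  qed
  have pa: "t powr (al/2 - 1)*a t <= C*A*rho x0*t powr (- 3/2)" if t: "0 < t" for t
  proof -
  have "1/Y x0 t <= 1/(sqrt t/rho x0)" unfolding Y_def
  using add_pos_pos[OF zero_less_one divide_pos_pos[OF real_sqrt_gt_zero[OF t] rho_pos[of x0]]] divide_pos_pos[OF real_sqrt_gt_zero[OF t] rho_pos[of x0]]
  by (intro divide_left_mono mult_pos_pos) auto
  also have "... = rho x0*t powr (- (1/2))" using t by (simp add: powr_minus_divide powr_half_sqrt)
  finally have "C*A*t powr (al/2 - 1)*t powr (- (al/2))*(1/Y x0 t) <= C*A*t powr (al/2 - 1)*t powr (- (al/2))*(rho x0*t powr (- (1/2)))"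
  using CA by (intro mono_l) auto
  also have "... = C*A*rho x0*(t powr (al/2 - 1)*t powr (- (al/2))*t powr (- (1/2)))" by (simp only: mult_ac)
  also have "t powr (al/2 - 1)*t powr (- (al/2))*t powr (- (1/2)) = t powr (- 3/2)" by (simp only: powr_add[symmetric]) simp
  finally show ?thesis by (simp add: a_def mult_ac)
  qed
  have e1: "(NN t:{r^2..}. en (t powr (al/2 - 1)*d t)) = en (C*(8/dl)*A)"
  proof -
  have "(NN t:{r^2..}. en (t powr (al/2 - 1)*d t)) = (NN t:{r^2..}. en (C*A*r powr (dl/4)*t powr (- 1 - dl/8)))"
  using pd rt by (intro nn_integral_cong) (auto simp: ind_def)
  also have "... = en (C*A*r powr (dl/4)*(- ((r^2) powr (- 1 - dl/8 + 1))/(- 1 - dl/8 + 1)))"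
  using CA dl r2 by (intro nn_integral_powr_tail) auto
  also have "(r^2) powr (- 1 - dl/8 + 1) = r powr (- (dl/4))" using r powr_powr[of r 2 "- (dl/8)"] by simp
  also have "C*A*r powr (dl/4)*(- (r powr (- (dl/4)))/(- 1 - dl/8 + 1)) = C*A*(r powr (dl/4)*r powr (- (dl/4)))*(8/dl)" by simp
  also have "r powr (dl/4)*r powr (- (dl/4)) = 1" using r by (simp add: powr_add[symmetric])
  finally show ?thesis by (simp add: mult_ac)
  qed
  have add: "FI {r^2..} g x <= FI {r^2..} g z + en (C*(8/dl)*A)"
  if "AL t. r^2 <= t --> G g t x <= G g t z + en (d t)" for x z
  proof -
  have "FI {r^2..} g x <= (NN t. en (t powr (al/2 - 1))*G g t z*ind {r^2..} t + en (t powr (al/2 - 1)*d t)*ind {r^2..} t)"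
  unfolding FI_def
  proof (rule nn_integral_mono_AE)
  show "AL t. en (t powr (al/2 - 1))*G g t x*ind {r^2..} t
  <= en (t powr (al/2 - 1))*G g t z*ind {r^2..} t + en (t powr (al/2 - 1)*d t)*ind {r^2..} t"
  using that
  proof eventually_elim
  case (elim t)
  show ?case using mono_l[of "G g t x" "G g t z + en (d t)" "en (t powr (al/2 - 1))"] elim
  by (auto simp: ind_def distrib_left ennreal_mult')
  qed
  qed
  also have "... = FI {r^2..} g z + en (C*(8/dl)*A)" unfolding FI_def e1[symmetric] by (rule nn_integral_add) measurable
  finally show ?thesis .
  qed
  show "(AL x. x : ?B --> FI {r^2..} g x < oo) & (AL x. AL z. x : ?B --> z : ?B -->
  FI {r^2..} g x <= FI {r^2..} g z + en (C*(8/dl)*A) & FI {r^2..} g z <= FI {r^2..} g x + en (C*(8/dl)*A))"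
  proof
  show "AL x. x : ?B --> FI {r^2..} g x < oo"
  using fin
  proof eventually_elim
  case (elim x)
  show ?case
  proof
  assume x: "x : ?B"
  have "FI {r^2..} g x <= (NN t:{r^2..}. en (C*A*rho x0*t powr (- 3/2)))"
  unfolding FI_def
  proof (rule nn_integral_mono_AE)
  show "AL t. en (t powr (al/2 - 1))*G g t x*ind {r^2..} t <= en (C*A*rho x0*t powr (- 3/2))*ind {r^2..} t"
  using elim
  proof eventually_elim
  case (elim t)
  show ?case
  proof (cases "r^2 <= t")
  case True
  have "en (t powr (al/2 - 1))*G g t x <= en (t powr (al/2 - 1))*en (a t)" using elim True x by (intro mono_l) auto
  also have "... = en (t powr (al/2 - 1)*a t)" by (simp add: ennreal_mult')
  also have "... <= en (C*A*rho x0*t powr (- 3/2))" using pa rt[OF True] by (intro ennreal_leI) auto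
  finally show ?thesis using True by simp
  qed simp
  qed
  qed
  also have "... < oo" using CA rho_pos[of x0] r2 by (subst nn_integral_powr_tail) auto
  finally show "FI {r^2..} g x < oo" .
  qed
  qed
  show "AL x. AL z. x : ?B --> z : ?B -->
  FI {r^2..} g x <= FI {r^2..} g z + en (C*(8/dl)*A) & FI {r^2..} g z <= FI {r^2..} g x + en (C*(8/dl)*A)"
  using osc
  proof (elim eventually_mono, intro impI conjI add)
  fix x z assume "AL t. r^2 <= t --> x : ?B --> z : ?B --> G g t x <= G g t z + en (d t) & G g t z <= G g t x + en (d t)" "x : ?B" "z : ?B"
  thus "AL t. r^2 <= t --> G g t x <= G g t z + en (d t)" "AL t. r^2 <= t --> G g t z <= G g t x + en (d t)"
  by (auto elim!: eventually_mono)
  qed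
  qed
 qed
qed

text \<open>The constant \<open>c\<close> is the large-time part at one admissible point of the
  ball. The small-time part is integrated, and the large-time part differs from \<open>c\<close> by
  at most a constant.\<close>

lemma FI_oscillation:
 obtains C where "0 <= C"
  "!!r x0 g A. 0 < r ==> growth_le N A g ==> (AL x. x : ball x0 r --> FI {0<..} g x < oo) &
  (? c::real. (NN x:ball x0 r. en <|enn2real (FI {0<..} g x) - c|>) <= en (C*A*(r ^ DIM('a)*(1 + r/rho x0) ^ N)))"
proof -
 obtain C where C: "0 <= C"
  "!!r x0 g A. 0 < r ==> growth_le N A g ==> (AL x. x : ball x0 r --> FI {r^2..} g x < oo) &
  (AL x. AL z. x : ball x0 r --> z : ball x0 r -->
  FI {r^2..} g x <= FI {r^2..} g z + en (C*A) & FI {r^2..} g z <= FI {r^2..} g x + en (C*A))"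
  using FI_large[of N] by blast
 define C' where "C'=2/al*CS N + C*unit_ball_vol DIM('a)"
 have cs: "0 <= 2/al*CS N" using CS[of N] al by simp
 show ?thesis
 proof (rule that[of C'])
  show "0 <= C'" using cs C by (simp add: C'_def)
  fix r A::real and x0::'a and g::"'a => real"
  assume r: "0 < r" and g: "growth_le N A g"
  have [measurable]: "g : BM" and A: "0 <= A" using g by (auto simp: growth_le_def)
  let ?B = "ball x0 r" and ?S = "FI {0<..<r^2} g" and ?L = "FI {r^2..} g"
  define P where "P=r ^ DIM('a)*(1 + r/rho x0) ^ N"
  have P: "r ^ DIM('a) <= P" unfolding P_def using r rho_pos[of x0] by (simp add: mult_le_cancel_left1)
  have "r powr al*gr N x0 r = (r powr al*r powr (real DIM('a) - al))*(1 + r/rho x0) ^ N" by (simp add: gr_def)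
  also have "r powr al*r powr (real DIM('a) - al) = r ^ DIM('a)" using r by (simp add: powr_add[symmetric] powr_realpow)
  finally have small: "(NN x:?B. ?S x) <= en (2/al*CS N*A*P)"
  using FI_small[OF r g, of x0] by (simp add: P_def)
  have "AL x. ?S x*ind ?B x ~= oo"
  by (rule nn_integral_PInf_AE) (use small in "auto simp: top_unique")
  hence Sfin: "AL x. x : ?B --> ?S x < oo" by (auto simp: less_top elim!: eventually_mono)
  have Lfin: "AL x. x : ?B --> ?L x < oo" using C(2)[OF r g] by blast
  note sp = FI_split[OF r `g : BM`]
  have fin: "AL x. x : ?B --> FI {0<..} g x < oo" using Sfin Lfin by eventually_elim (auto simp: sp)
  have ae: "AL z. z : ?B --> ?L z < oo & (AL x. x : ?B --> ?L x <= ?L z + en (C*A) & ?L z <= ?L x + en (C*A))"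
  using Lfin C(2)[OF r g, of x0, THEN conjunct2] by eventually_elim (auto elim!: eventually_mono)
  have "? z. ?L z < oo & (AL x. x : ?B --> ?L x <= ?L z + en (C*A) & ?L z <= ?L x + en (C*A))"
  proof (rule ccontr)
  assume no: "~ ?thesis"
  have "AL z. z ~: ?B" using ae by eventually_elim (use no in blast)
  hence "emeasure lborel ?B = 0" using AE_iff_null_sets[of ?B lborel] by (auto simp: null_sets_def)
  thus False using content_ball_pos[OF r, of x0] by (simp add: measure_def)
  qed
  then obtain z where z: "?L z < oo" "AL x. x : ?B --> ?L x <= ?L z + en (C*A) & ?L z <= ?L x + en (C*A)"
  by blast
  define c where "c=enn2real (?L z)"
  have "(NN x:?B. en <|enn2real (FI {0<..} g x) - c|>) <= (NN x. ?S x*ind ?B x + en (C*A)*ind ?B x)"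
  proof (rule nn_integral_mono_AE)
  show "AL x. en <|enn2real (FI {0<..} g x) - c|>*ind ?B x <= ?S x*ind ?B x + en (C*A)*ind ?B x"
  using Sfin Lfin z(2)
  proof eventually_elim
  case (elim x)
  show ?case
  proof (cases "x : ?B")
  case True
  obtain s' l' z' where n: "?S x = en s'" "0 <= s'" "?L x = en l'" "0 <= l'" "?L z = en z'" "0 <= z'"
  using elim True z(1) by (metis ennreal_cases less_irrefl infinity_ennreal_def)
  have ca: "0 <= C*A" using C A by simp
  have "l' <= z' + C*A" "z' <= l' + C*A" using elim True n ca by (auto simp: ennreal_plus[symmetric] simp del: ennreal_plus)
  hence "<|s' + l' - z'|> <= s' + C*A" using n by linarith
  hence "en <|s' + l' - z'|> <= en s' + en (C*A)" using n ca by (simp add: ennreal_plus[symmetric] ennreal_leI del: ennreal_plus)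
  moreover have "enn2real (FI {0<..} g x) = s' + l'" using n by (simp add: sp ennreal_plus[symmetric] del: ennreal_plus)
  ultimately show ?thesis using True n by (simp add: c_def)
  qed simp
  qed
  qed
  also have "... = (NN x:?B. ?S x) + en (C*A)*emeasure lborel ?B" by (simp add: nn_integral_add nn_integral_cmult_indicator)
  also have "emeasure lborel ?B = en (unit_ball_vol DIM('a)*r ^ DIM('a))" using r by (simp add: emeasure_ball)
  also have "(NN x:?B. ?S x) + en (C*A)*en (unit_ball_vol DIM('a)*r ^ DIM('a)) <= en (2/al*CS N*A*P) + en (C*A*(unit_ball_vol DIM('a)*P))"
  proof (intro add_mono small)
  have "0 <= C*A" "0 <= unit_ball_vol (real DIM('a))*r ^ DIM('a)" using C A r by simp_all
  thus "en (C*A)*en (unit_ball_vol DIM('a)*r ^ DIM('a)) <= en (C*A*(unit_ball_vol DIM('a)*P))"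
  unfolding ennreal_mult[OF `0 <= C*A` `0 <= unit_ball_vol (real DIM('a))*r ^ DIM('a)`, symmetric]
  by (intro ennreal_leI mono_l P) auto
  qed
  also have "... = en (C'*A*P)"
  proof -
  have P0: "0 <= P" using P r by (meson order_trans zero_le_power less_imp_le)
  have "0 <= 2/al*CS N*A*P" "0 <= C*A*(unit_ball_vol DIM('a)*P)"
  using mult_nonneg_nonneg[OF mult_nonneg_nonneg[OF cs A] P0] C A P0 by simp_all
  thus ?thesis by (subst ennreal_plus[symmetric]) (auto simp: C'_def algebra_simps)
  qed
  finally show "(AL x. x : ?B --> FI {0<..} g x < oo) &
  (? c::real. (NN x:?B. en <|enn2real (FI {0<..} g x) - c|>) <= en (C'*A*(r ^ DIM('a)*(1 + r/rho x0) ^ N)))"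
  using fin unfolding P_def by blast
 qed
qed

end

section \<open>The fractional integral and its BMO norm\<close>

lemma AE_eq_borel_integral:
 fixes f g::"'a::euclidean_space => real"
 assumes g: "g : BM" and eq: "AL x. f x = g x"
 shows "f : borel_measurable lebesgue" "(\<integral>x. f x \<partial>lebesgue) = (LI x. g x)" "integrable lebesgue f <-> itg g"
proof -
 show f: "f : borel_measurable lebesgue"
 proof (rule measurableI)
  fix A::"real set" assume A: "A : sets borel"
  have [measurable]: "g : borel_measurable lebesgue" using g by (intro measurable_completion) simp
  have N: "{x. f x ~= g x & f x : A} : sets lebesgue" "{x. f x ~= g x} : sets lebesgue"
  proof -
  have "AL x. ~ (f x ~= g x & f x : A)" "AL x. ~ f x ~= g x" using eq by (auto elim!: eventually_mono)
  thus "{x. f x ~= g x & f x : A} : sets lebesgue" "{x. f x ~= g x} : sets lebesgue"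
  using sets_completion_AE[of "%x. f x ~= g x & f x : A" lborel] sets_completion_AE[of "%x. f x ~= g x" lborel]
  by (simp_all add: pred_def)
  qed
  have "f -` A \<inter> space lebesgue = {x. f x ~= g x & f x : A} \<union> (g -` A - {x. f x ~= g x})" by auto
  also have "... : sets lebesgue" using N measurable_sets[OF `g : borel_measurable lebesgue` A] by auto
  finally show "f -` A \<inter> space lebesgue : sets lebesgue" .
 qed simp
 show "(\<integral>x. f x \<partial>lebesgue) = (LI x. g x)" "integrable lebesgue f <-> itg g"
  by (rule lebesgue_lborel_integral[OF f g eq])+
qed

text \<open>Replacing the average by an arbitrary constant costs a factor 2. The exponent
  \<open>N + 1\<close> is positive even for \<open>N = 0\<close>, as the parameter of a BMO space
  has to be.\<close>

lemma bmo_bound: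
 fixes b::"'a::euclidean_space => real"
 assumes b: "b : borel_measurable lebesgue" and \<rho>: "!!x. 0 < \<rho> x" and M: "0 <= M"
  and osc: "!!x r. 0 < r ==> ? c::real. (NL y:ball x r. en <|b y - c|>) <= en (M*(r ^ DIM('a)*(1 + r/\<rho> x) ^ N))"
 shows "locally_integrable b" "bmo_norm \<rho> (real (N + 1)) b <= en (2*M/unit_ball_vol DIM('a))"
proof -
 have eB: "emeasure lebesgue (ball x r) = en (unit_ball_vol DIM('a)*r ^ DIM('a))" if "0 < r" for x::'a and r
  using that by (subst emeasure_completion) (auto simp: emeasure_ball)
 have iB: "set_integrable lebesgue (ball x r) (%y. b y - c)" "set_integrable lebesgue (ball x r) b" "set_integrable lebesgue (ball x r) (%_. c)"
  if r: "0 < r" and le: "(NL y:ball x r. en <|b y - c|>) <= en Q" for x r Q and c::real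
 proof -
  have "(NL y. en (norm (ind (ball x r) y *. (b y - c)))) = (NL y:ball x r. en <|b y - c|>)"
  by (intro nn_integral_cong) (auto simp: ind_def)
  also have "... < oo" using le by (auto simp: less_top[symmetric] top_unique)
  finally show 1: "set_integrable lebesgue (ball x r) (%y. b y - c)"
  unfolding set_integrable_def integrable_iff_bounded
  by (intro conjI borel_measurable_scaleR borel_measurable_indicator borel_measurable_diff b) auto
  show 2: "set_integrable lebesgue (ball x r) (%_. c)" unfolding set_integrable_def using eB[OF r, of x] by (simp add: integrable_indicator_iff)
  show "set_integrable lebesgue (ball x r) b" using set_integral_add(1)[OF 1 2] by simp
 qed
 show "locally_integrable b"
  unfolding locally_integrable_def
 proof (intro allI impI)
  fix Q::"'a set" assume Q: "compact Q"
  then obtain r where r: "0 < r" "Q \<subseteq> ball 0 r" using bounded_subset_ballD[OF compact_imp_bounded, of Q 0] by auto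
  obtain c where "(NL y:ball 0 r. en <|b y - c|>) <= en (M*(r ^ DIM('a)*(1 + r/\<rho> 0) ^ N))" using osc[OF r(1)] by blast
  from set_integrable_subset[OF iB(2)[OF r(1) this] _ r(2)] show "b absolutely_integrable_on Q" using borel_compact[OF Q] by simp
 qed
 show "bmo_norm \<rho> (real (N + 1)) b <= en (2*M/unit_ball_vol DIM('a))"
  unfolding bmo_norm_def
 proof (intro SUP_least)
  fix x::'a and r assume "r : {0::real<..}"
  hence r: "0 < r" by simp
  let ?B = "ball x r"
  define be where "be=unit_ball_vol DIM('a)*r ^ DIM('a)"
  have be: "0 < be" using r by (simp add: be_def unit_ball_vol_pos)
  note ebe = eB[OF r, of x, folded be_def]
  have mbe: "measure lebesgue ?B = be" using ebe be by (simp add: measure_def)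
  define y where "y=1 + r/\<rho> x"
  have y: "1 <= y" using r \<rho>[of x] by (simp add: y_def)
  define Q where "Q=M*(r ^ DIM('a)*y ^ N)"
  have Q: "0 <= Q" using M r y by (simp add: Q_def)
  obtain c where c: "(NL y:?B. en <|b y - c|>) <= en Q" using osc[OF r, of x] unfolding Q_def y_def by blast
  note i = iB[OF r c]
  define a where "a=average ?B b"
  have "be*(a - c) = (LINT y:?B|lebesgue. b y) - (LINT y:?B|lebesgue. c)"
  using be r by (simp add: a_def average_def mbe right_diff_distrib set_lebesgue_integral_def)
  also have "... = (LINT y:?B|lebesgue. b y - c)" by (rule set_integral_diff(2)[OF i(2,3), symmetric])
  finally have "<|be*(a - c)|> = norm (LINT y:?B|lebesgue. b y - c)" by simp
  hence "en (be*<|a - c|>) = en (norm (LINT y:?B|lebesgue. b y - c))" using be by (simp add: abs_mult)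
  also have "... <= (NL y. en (norm (ind ?B y *. (b y - c))))"
  unfolding set_lebesgue_integral_def by (rule integral_norm_bound_ennreal) (use i(1) in "simp add: set_integrable_def")
  also have "... = (NL y:?B. en <|b y - c|>)" by (intro nn_integral_cong) (auto simp: ind_def)
  also note c
  finally have ac: "be*<|a - c|> <= Q" using Q by simp
  have "(NL y:?B. en <|b y - a|>) <= (NL y. en <|b y - c|>*ind ?B y + en <|a - c|>*ind ?B y)"
  by (intro nn_integral_mono) (auto simp: ind_def ennreal_plus[symmetric] simp del: ennreal_plus intro!: ennreal_leI)
  also have "... = (NL y:?B. en <|b y - c|>) + en <|a - c|>*emeasure lebesgue ?B"
  proof -
  have [measurable]: "?B : sets lebesgue" "b : borel_measurable lebesgue" using b by auto
  show ?thesis by (subst nn_integral_add) (measurable, simp add: nn_integral_cmult_indicator)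
  qed
  also have "... <= en Q + en Q"
  using ac be by (intro add_mono c) (auto simp: ebe ennreal_mult[symmetric] mult.commute intro!: ennreal_leI)
  also have "... = en (2*Q)" using Q by (simp add: ennreal_plus[symmetric] del: ennreal_plus)
  finally have "eaverage ?B (%y. en <|b y - a|>) <= en (2*Q)/en be"
  unfolding eaverage_def ebe by (rule divide_right_mono_ennreal)
  also have "... = en (2*Q/be)" using Q be by (simp add: divide_ennreal)
  finally have "en (y powr (- real (N + 1)))*eaverage ?B (%y. en <|b y - a|>) <= en (y powr (- real (N + 1)))*en (2*Q/be)"
  by (intro mono_l) auto
  also have "... = en (y powr (- real (N + 1))*(2*Q/be))" by (rule ennreal_mult[symmetric]) (use Q be in auto)
  also have "... <= en (2*M/unit_ball_vol DIM('a))"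
  proof (rule ennreal_leI)
  have "y ^ N = y powr real N" using y by (simp add: powr_realpow)
  hence "y powr (- real (N + 1))*y ^ N = y powr (- 1)" by (simp only: powr_add[symmetric]) simp
  also have "... <= y powr 0" using y by (intro powr_mono) auto
  finally have le: "y powr (- real (N + 1))*y ^ N <= 1" using y by simp
  have "y powr (- real (N + 1))*(2*Q/be) = 2*M/unit_ball_vol DIM('a)*(y powr (- real (N + 1))*y ^ N)"
  using r by (simp add: Q_def be_def)
  also have "... <= 2*M/unit_ball_vol DIM('a)*1" using M by (intro mono_l le) (simp add: unit_ball_vol_nonneg)
  finally show "y powr (- real (N + 1))*(2*Q/be) <= 2*M/unit_ball_vol DIM('a)" by simp
  qed
  finally show "en ((1 + r/\<rho> x) powr (- real (N + 1)))*eaverage ?B (%y. en <|b y - average ?B b|>) <= en (2*M/unit_ball_vol DIM('a))"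
  by (simp only: y_def a_def)
 qed
qed

context frac
begin

text \<open>One Borel null set containing all exceptional triples is sectioned at \<open>x\<close>,
  so that the iterated forms and the joint form hold for the same \<open>x\<close>.\<close>

lemma heat_P_sections: "AL x. (AL t. AL y. 0 < t --> heat t x y = P t x y) &
 (AL y. AL t. 0 < t --> heat t x y = P t x y) & (AE q in lb2. 0 < fst q --> heat (fst q) x (snd q) = P (fst q) x (snd q))"
proof -
 let ?E = "%t x y. 0 < t --> heat t x y = P t x y"
 from heat_P obtain N where N: "{p \<in> space lborel. ~ ?E (fst p) (fst (snd p)) (snd (snd p))} \<subseteq> N" "emeasure lborel N = 0" "N : sets lborel"
  by (rule AE_E)
 interpret Q: pair_sigma_finite lborel "lb2::('a \<times> 'a) measure"
  unfolding lborel_prod by unfold_locales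
 have Nm [measurable]: "N : sets (lborel \<Otimes>\<^sub>M lb2)" unfolding lborel_prod by (rule N(3))
 have E: "?E t x y" if "(t, x, y) ~: N" for t x y using N(1) that by force
 have "AE p in lborel \<Otimes>\<^sub>M lb2. p ~: N"
  unfolding lborel_prod using N by (intro AE_not_in) (auto simp: null_sets_def)
 from Q.AE_pair[OF this] have "AL t. AE w in lb2. (t, w) ~: N" .
 hence "AE w in lb2. AL t. (t, w) ~: N"
  by (rule Q.AE_commute[THEN iffD1, rotated]) measurable
 from lborel_pair.AE_pair[OF this] show ?thesis
 proof eventually_elim
  case (elim x)
  have m: "{z \<in> space lb2. (fst z, x, snd z) ~: N} : sets lb2"
  "{z \<in> space lb2. (snd z, x, fst z) ~: N} : sets lb2" by measurable
  have ty: "AL t. AL y. (t, x, y) ~: N"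
  by (rule lborel_pair.AE_commute[THEN iffD1, OF m(2) elim])
  have tyq: "AE q in lb2. (fst q, x, snd q) ~: N"
  by (rule lborel_pair.AE_pair_measure) (use m ty in auto)
  show ?case
  by (intro conjI; rule eventually_mono[OF ty] eventually_mono[OF elim] eventually_mono[OF tyq]; (erule eventually_mono)?; erule E)
 qed
qed

definition dens::"('a => real) => 'a => real \<times> 'a => real" where
 "dens g x q = ind {0<..} (fst q)*P (fst q) x (snd q)*g (snd q)*fst q powr (al/2 - 1)"

lemma dens:
 assumes [measurable]: "g : BM"
 shows "dens g x : borel_measurable lb2"
  "(!!y. 0 <= g y) ==> FI {0<..} g x < oo ==> integrable lb2 (dens g x)"
  "(!!y. 0 <= g y) ==> FI {0<..} g x < oo ==> integral\<^sup>L lb2 (dens g x) = enn2real (FI {0<..} g x)"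
proof -
 show m: "dens g x : borel_measurable lb2" unfolding dens_def[abs_def] by measurable
 assume g: "!!y. 0 <= g y" and fin: "FI {0<..} g x < oo"
 have "(\<integral>\<^sup>+q. en (dens g x q) \<partial>lb2) = (NN t. (NN y. en (dens g x (t, y))))"
  by (rule lborel.nn_integral_fst[symmetric]) (use m in measurable)
 also have "... = FI {0<..} g x"
  unfolding FI_def G_def
 proof (rule nn_integral_cong)
  fix t::real
  have "(NN y. en (dens g x (t, y))) = (NN y. (en (t powr (al/2 - 1))*ind {0<..} t)*(en (P t x y)*en (g y)))"
  using g P_nonneg by (intro nn_integral_cong) (auto simp: dens_def ind_def ennreal_mult'' ennreal_mult mult_ac)
  also have "... = (en (t powr (al/2 - 1))*ind {0<..} t)*(NN y. en (P t x y)*en (g y))"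
  by (rule nn_integral_cmult) measurable
  finally show "(NN y. en (dens g x (t, y))) = en (t powr (al/2 - 1))*(NN y. en (P t x y)*en (g y))*ind {0<..} t"
  by (simp add: mult_ac)
 qed
 finally have eq: "(\<integral>\<^sup>+q. en (dens g x q) \<partial>lb2) = FI {0<..} g x" .
 have nn: "0 <= dens g x q" for q using g P_nonneg by (simp add: dens_def)
 show "integrable lb2 (dens g x)" using m nn eq fin by (intro integrableI_nonneg) auto
 show "integral\<^sup>L lb2 (dens g x) = enn2real (FI {0<..} g x)"
  using m nn eq by (subst integral_eq_nn_integral) auto
qed

lemma growth_mono: "growth_le N A g ==> h : BM ==> (!!y. 0 <= h y) ==> (!!y. h y <= g y) ==> growth_le N A h"
 unfolding growth_le_def
proof (safe)
 fix x r assume h: "!!y. h y <= g y" and g: "!x r. 0 < r --> (NN y:ball x r. en (g y)) <= en (A*gr N x r)" and r: "0 < (r::real)"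
 have "(NN y:ball x r. en (h y)) <= (NN y:ball x r. en (g y))"
  by (intro nn_integral_mono mono_r ennreal_leI h) auto
 also have "... <= en (A*gr N x r)" using g r by blast
 finally show "(NN y:ball x r. en (h y)) <= en (A*gr N x r)" .
qed

text \<open>Positive and negative part of \<open>f\<close> are treated separately, because the time
  integral is controlled for nonnegative functions. Finiteness of both gives absolute convergence,
  and Fubini's theorem then identifies the iterated integral.\<close>

lemma fractional_integral_bmo:
 obtains C where "0 <= C"
  "!!f A. f : borel_measurable lebesgue ==> growth_le N A (%y. <|bor f y|>) ==> fractional_integral_exists heat al f &
  locally_integrable (fractional_integral heat al f) & bmo_norm rho (real (N + 1)) (fractional_integral heat al f) <= en (C*A)"
proof -
 obtain C where C: "0 <= C"
  "!!r x0 g A. 0 < r ==> growth_le N A g ==> (AL x. x : ball x0 r --> FI {0<..} g x < oo) &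
  (? c::real. (NN x:ball x0 r. en <|enn2real (FI {0<..} g x) - c|>) <= en (C*A*(r ^ DIM('a)*(1 + r/rho x0) ^ N)))"
  using FI_oscillation[of N] by blast
 show ?thesis
 proof (rule that[of "4*C/unit_ball_vol DIM('a)"])
  show "0 <= 4*C/unit_ball_vol DIM('a)" using C by (simp add: unit_ball_vol_nonneg)
  fix f::"'a => real" and A::real
  assume f: "f : borel_measurable lebesgue" and g: "growth_le N A (%y. <|bor f y|>)"
  have A: "0 <= A" using g by (simp add: growth_le_def)
  note fh = bor[OF f]
  note [measurable] = fh(1)
  define hp where "hp y = max 0 (bor f y)" for y
  define hn where "hn y = max 0 (- bor f y)" for y
  have [measurable]: "hp : BM" "hn : BM" unfolding hp_def hn_def by measurable
  have hpn: "0 <= hp y" "0 <= hn y" "hp y - hn y = bor f y" for y by (auto simp: hp_def hn_def)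
  have gp: "growth_le N A hp" and gn: "growth_le N A hn"
  by (rule growth_mono[OF g]; simp add: hp_def hn_def)+
  have fin: "AL x. FI {0<..} g' x < oo" if "growth_le N A g'" for g'
  proof -
  have "AL x. !n::nat. x : ball 0 (real (Suc n)) --> FI {0<..} g' x < oo"
  unfolding AE_all_countable using C(2)[OF _ that] by (metis of_nat_0_less_iff zero_less_Suc)
  thus ?thesis
  proof eventually_elim
  case (elim x)
  obtain n where "norm x < real n" using reals_Archimedean2 by blast
  thus ?case using elim[rule_format, of n] by simp
  qed
  qed
  define b0 where "b0 x = enn2real (FI {0<..} hp x) - enn2real (FI {0<..} hn x)" for x
  have [measurable]: "b0 : BM" unfolding b0_def by measurable
  have main: "AL x. integrable (lebesgue_on ({0<..} \<times> UNIV)) (%(t, y). heat t x y*f y*t powr (al/2 - 1)) & fractional_integral heat al f x = b0 x"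
  using heat_P_sections fin[OF gp] fin[OF gn]
  proof eventually_elim
  case (elim x)
  define ps where "ps q = dens hp x q - dens hn x q" for q
  have ip: "integrable lb2 (dens hp x)" "integrable lb2 (dens hn x)"
  by (rule dens(2); use hpn elim in simp)+
  have ips: "integrable lb2 ps" unfolding ps_def using ip by simp
  have psb0: "integral\<^sup>L lb2 ps = b0 x"
  unfolding ps_def b0_def using ip elim hpn by (simp add: dens(3))
  have pseq: "ps (t, y) = ind {0<..} t*P t x y*t powr (al/2 - 1)*bor f y" for t y
  unfolding ps_def dens_def hpn(3)[symmetric] by (simp add: algebra_simps)
  have psm [measurable]: "ps : BM" using borel_measurable_integrable[OF ips] unfolding lborel_prod by simp
  have fy: "AE q in (lborel::(real \<times> 'a) measure). f (snd q) = bor f (snd q)"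
  proof -
  obtain N where N: "{y \<in> space lborel. f y ~= bor f y} \<subseteq> N" "emeasure lborel N = 0" "N : sets lborel" using fh(2) by (rule AE_E)
  have "AE q in (lb2::(real \<times> 'a) measure). snd q ~: N"
  proof (rule lborel_pair.AE_pair_measure)
  have [measurable]: "N : sets borel" using N by simp
  show "{q \<in> space (lb2::(real \<times> 'a) measure). snd q ~: N} : sets lb2" by measurable
  show "AE t in (lborel::real measure). AL y. snd (t, y) ~: N" using N by (auto intro!: AE_not_in simp: null_sets_def)
  qed
  thus ?thesis unfolding lborel_prod using N(1) by (auto elim!: eventually_mono)
  qed
  have S: "({0<..} \<times> UNIV::(real \<times> 'a) set) : sets lebesgue" by (intro sets_completionI_sets) (auto intro!: borel_open open_Times)
  have "AL q. ind ({0<..} \<times> UNIV) q *. (%(t, y). heat t x y*f y*t powr (al/2 - 1)) q = ps q"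
  using conjunct2[OF conjunct2[OF elim(1)], unfolded lborel_prod] fy
  proof eventually_elim
  case (elim q)
  thus ?case by (cases q) (auto simp: pseq ind_def)
  qed
  from AE_eq_borel_integral(3)[OF psm this]
  have 1: "integrable (lebesgue_on ({0<..} \<times> UNIV)) (%(t, y). heat t x y*f y*t powr (al/2 - 1))"
  using S ips unfolding lborel_prod by (subst integrable_restrict_space) auto
  \<comment> \<open>Where this integral diverges it is 0 by convention; the constant factor
    \<open>bor f y\<close> can be moved through it in either case.\<close>
  define ka where "ka y = (LI t. ind {0<..} t*P t x y*t powr (al/2 - 1))" for y
  have [measurable]: "ka : BM" unfolding ka_def by measurable
  have "AL y. fractional_kernel heat al x y*f y = ka y*bor f y"
  using conjunct1[OF conjunct2[OF elim(1)]] fh(2)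
  proof eventually_elim
  case (elim y)
  have "AL t. ind {0<..} t *. (heat t x y*t powr (al/2 - 1)) = ind {0<..} t*P t x y*t powr (al/2 - 1)"
  using elim(1) by eventually_elim (auto simp: ind_def)
  from AE_eq_borel_integral(2)[OF _ this] have "fractional_kernel heat al x y = ka y"
  unfolding fractional_kernel_def set_lebesgue_integral_def ka_def by simp
  thus ?case using elim(2) by simp
  qed
  from AE_eq_borel_integral(2)[OF _ this] have "fractional_integral heat al f x = (LI y. ka y*bor f y)"
  unfolding fractional_integral_def by simp
  also have "... = (LI y. (LI t. ps (t, y)))" unfolding ka_def pseq by simp
  also have "... = b0 x" using lborel_pair.integral_snd[of "%t y. ps (t, y)"] ips psb0 by simp
  finally show ?case using 1 by simp
  qed
  have ex: "fractional_integral_exists heat al f"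
  unfolding fractional_integral_exists_def using main by (intro AE_completion) (auto elim!: eventually_mono)
  have ae: "AL x. fractional_integral heat al f x = b0 x" using main by (auto elim!: eventually_mono)
  have osc: "? c::real. (NL y:ball x r. en <|fractional_integral heat al f y - c|>) <= en ((2*C*A)*(r ^ DIM('a)*(1 + r/rho x) ^ N))"
  if r: "0 < r" for x r
  proof -
  define Q where "Q=C*A*(r ^ DIM('a)*(1 + r/rho x) ^ N)"
  have Q: "0 <= Q" using C A r rho_pos[of x] by (simp add: Q_def)
  obtain c1 c2 where c: "(NN x:ball x r. en <|enn2real (FI {0<..} hp x) - c1|>) <= en Q"
  "(NN x:ball x r. en <|enn2real (FI {0<..} hn x) - c2|>) <= en Q"
  using C(2)[OF r gp, of x] C(2)[OF r gn, of x] unfolding Q_def by blast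
  have "(NL y:ball x r. en <|fractional_integral heat al f y - (c1 - c2)|>) = (NN y:ball x r. en <|b0 y - (c1 - c2)|>)"
  using ae by (intro nn_integral_lborel_lebesgue) (measurable, auto elim!: eventually_mono)
  also have "... <= (NN y. en <|enn2real (FI {0<..} hp y) - c1|>*ind (ball x r) y + en <|enn2real (FI {0<..} hn y) - c2|>*ind (ball x r) y)"
  by (intro nn_integral_mono) (auto simp: b0_def ind_def ennreal_plus[symmetric] simp del: ennreal_plus intro!: ennreal_leI)
  also have "... = (NN x:ball x r. en <|enn2real (FI {0<..} hp x) - c1|>) + (NN x:ball x r. en <|enn2real (FI {0<..} hn x) - c2|>)"
  by (rule nn_integral_add) measurable
  also have "... <= en Q + en Q" by (intro add_mono c)
  also have "... = en ((2*C*A)*(r ^ DIM('a)*(1 + r/rho x) ^ N))" using Q by (simp add: ennreal_plus[symmetric] Q_def mult_ac del: ennreal_plus)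
  finally show ?thesis by blast
  qed
  \<comment> \<open>The fractional integral is measurable as an almost-everywhere copy of the Borel
    function \<open>b0\<close>, by completeness of Lebesgue measure.\<close>
  have "b0 : BM" by measurable
  from bmo_bound[OF AE_eq_borel_integral(1)[OF this ae] rho_pos _ osc] ex C A
  show "fractional_integral_exists heat al f & locally_integrable (fractional_integral heat al f) &
  bmo_norm rho (real (N + 1)) (fractional_integral heat al f) <= en (4*C/unit_ball_vol DIM('a)*A)" by (simp add: mult_ac)
 qed
qed

end

section \<open>Local L1 bounds from the weight and Morrey conditions\<close>

lemma epowr_pos: "0 < e ==> epowr z e = 0 <-> z = 0" "0 < e ==> epowr z e = top <-> z = top"
 "0 < e ==> 0 <= r ==> epowr (en r) e = en (r powr e)" "0 < e ==> epowr top e = top"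
 by (auto simp: epowr_def enn2real_eq_0_iff)

text \<open>Hoelder's inequality in the form of Young's inequality with optimally scaled factors; where the weight
 vanishes, its negative power is infinite and there is nothing to prove.\<close>

lemma weighted_young:
 fixes u z::real
 assumes p: "1 < p" and p': "p' = p/(p - 1)" and pos: "0 < Ph" "0 < Ps" and z: "0 <= z"
 shows "en <|u|> <= en (Ph*Ps/(p*Ph powr p))*en (<|u|> powr p*z powr p) + en (Ph*Ps/(p'*Ps powr p'))*inverse (en (z powr p'))"
proof (cases "z = 0")
 case True
 have "0 < Ph*Ps/(p'*Ps powr p')" using p p' pos by simp
 thus ?thesis using True p p' pos by (auto simp: ennreal_mult_top)
next
 case False
 have z0: "0 < z" using False z by simp
 have pp: "1 < p'" "1/p + 1/p' = 1" using p by (simp_all add: p' field_simps)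
 have "<|u|> = Ph*Ps*((<|u|>*z/Ph)*(1/(z*Ps)))" using z0 pos by simp
 also have "... <= Ph*Ps*((<|u|>*z/Ph) powr p/p + (1/(z*Ps)) powr p'/p')"
  using p pp z0 pos by (intro mono_l Youngs_inequality) auto
 also have "(<|u|>*z/Ph) powr p = <|u|> powr p*z powr p/Ph powr p" by (simp only: powr_divide powr_mult)
 also have "(1/(z*Ps)) powr p' = 1/(z powr p'*Ps powr p')" by (simp only: powr_divide powr_mult powr_one_eq_one)
 also have "Ph*Ps*(<|u|> powr p*z powr p/Ph powr p/p + 1/(z powr p'*Ps powr p')/p')
  = Ph*Ps/(p*Ph powr p)*(<|u|> powr p*z powr p) + Ph*Ps/(p'*Ps powr p')*inverse (z powr p')"
  by (simp add: distrib_left inverse_eq_divide mult_ac)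
 finally show ?thesis
  using p pp pos z0 by (simp add: ennreal_mult[symmetric] inverse_ennreal ennreal_plus[symmetric] ennreal_leI del: ennreal_plus)
qed

text \<open>Hoelder's inequality with the factors \<open>f * w\<close> and \<open>1/w\<close>. The
  Morrey condition bounds the first by the integral of \<open>w^q\<close> to the power
  \<open>1/q\<close>, exactly the power in the weight condition, because the Morrey exponent is
  \<open>p/q\<close>. The volume left over has the exponent
  \<open>1/q + 1/p' = 1 - \<alpha>/d\<close>.\<close>

lemma weight_L1_bound:
 fixes w::"'a::euclidean_space => real"
 assumes \<rho>: "!!x. 0 < \<rho> x" and p: "1 < p" "p < real DIM('a)/\<alpha>" and \<alpha>: "0 < \<alpha>"
  and q: "1/q = 1/p - \<alpha>/real DIM('a)" and w: "w : A_weight \<rho> p q \<theta>0"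
 obtains C where "0 <= C"
  "!!f M \<theta> x r. f : borel_measurable lebesgue ==> morrey_norm \<rho> p (p/q) \<theta> (%x. w x powr p) (%x. w x powr q) f <= en M ==> 0 < M ==> 0 < r ==>
  (NL y:ball x r. en <|f y|>) <= en (C*M*(r powr (real DIM('a) - \<alpha>)*(1 + r/\<rho> x) powr (\<theta> + \<theta>0)))"
proof -
 define p' where "p'=p/(p - 1)"
 have pp: "1 < p'" "1/p + 1/p' = 1" using p by (simp_all add: p'_def field_simps)
 have "\<alpha>/real DIM('a) < 1/p" using p \<alpha> by (simp add: field_simps)
 hence "0 < 1/q" using q by simp
 hence q0: "0 < q" by simp
 note e0 = `0 < 1/q` divide_pos_pos[OF zero_less_one less_trans[OF zero_less_one pp(1)]] divide_pos_pos[OF less_trans[OF zero_less_one p(1)] q0]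
  divide_pos_pos[OF zero_less_one less_trans[OF zero_less_one p(1)]]
 have wn: "nonzero_density w" using w by (simp add: A_weight_def)
 hence w0: "!!x. 0 <= w x" and wm [measurable]: "w : borel_measurable lebesgue"
  by (auto simp: nonzero_density_def intro: locally_integrable_measurable)
 define be where "be r = unit_ball_vol DIM('a)*r ^ DIM('a)" for r
 have be: "0 < be r" "emeasure lebesgue (ball (x::'a) r) = en (be r)" if "0 < r" for x r
  using that by (simp add: be_def unit_ball_vol_pos) (subst emeasure_completion, use that in "auto simp: emeasure_ball be_def")
 define a where "a x r = (NL y:ball x r. en (w y powr q))" for x r
 define b where "b x r = (NL y:ball x r. inverse (en (w y powr p')))" for x r
 obtain C where C: "0 < C" "!!x r. 0 < r ==> epowr (a x r/en (be r)) (1/q)*epowr (b x r/en (be r)) (1/p') <= en (C*(1 + r/\<rho> x) powr \<theta>0)"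
  using w be(2) unfolding A_weight_def Let_def p'_def[symmetric] eaverage_def a_def b_def by auto
 have fin: "epowr (a x r/en (be r)) (1/q)*epowr (b x r/en (be r)) (1/p') ~= oo" if "0 < r" for x r
  using C(2)[OF that, of x] by (auto simp: top_unique)
 have bm: "ball x r : sets lebesgue" for x::'a and r by simp
 note [measurable] = bm
 have b0: "b x r ~= 0" if r: "0 < r" for x r
 proof
  assume "b x r = 0"
  hence "AE y in lebesgue. inverse (en (w y powr p'))*ind (ball x r) y = 0" unfolding b_def
  by (rule nn_integral_0_iff_AE[THEN iffD1, rotated]) measurable
  hence "AE y in lebesgue. y ~: ball x r" by (auto simp: ind_def elim!: eventually_mono split: if_splits)
  hence "emeasure lebesgue (ball x r) = 0" using AE_iff_null_sets[OF bm] by (auto simp: null_sets_def)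
  thus False using be[OF r] by simp
 qed
 have az: "AE y in lebesgue. y : ball x r --> w y = 0" if "a x r = 0" for x r
 proof -
  have "AE y in lebesgue. en (w y powr q)*ind (ball x r) y = 0"
  using that unfolding a_def by (rule nn_integral_0_iff_AE[THEN iffD1, rotated]) measurable
  thus ?thesis by (auto simp: ind_def ennreal_eq_0_iff elim!: eventually_mono)
 qed
 \<comment> \<open>If \<open>w\<close> vanished on one ball, the second factor of the weight
   condition would be infinite on every larger concentric ball, which forces \<open>w = 0\<close>
   there too and hence almost everywhere.\<close>
 have a0: "a x r ~= 0" if r: "0 < r" for x r
 proof
  assume z: "a x r = 0"
  have "b x r = (NL y:ball x r. oo)"
  unfolding b_def using az[OF z] pp by (intro nn_integral_cong_AE) (auto simp: ind_def elim!: eventually_mono)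
  also have "... = oo*emeasure lebesgue (ball x r)" by (rule nn_integral_cmult_indicator) simp
  also have "... = oo" unfolding be(2)[OF r] using be(1)[OF r] by (simp add: ennreal_top_mult)
  finally have bi: "b x r = oo" .
  have "a x (r + real n) = 0" for n
  proof -
  have rn: "0 < r + real n" using r by simp
  have "b x r <= b x (r + real n)" unfolding b_def by (intro nn_integral_mono mono_l) (auto simp: ind_def)
  hence "b x (r + real n) = oo" using bi by (simp add: top_unique)
  hence "epowr (b x (r + real n)/en (be (r + real n))) (1/p') = oo" using e0 be(1)[OF rn] by (simp add: epowr_pos ennreal_top_divide)
  hence "epowr (a x (r + real n)/en (be (r + real n))) (1/q) = 0"
  using fin[OF rn, of x] by (metis ennreal_mult_top infinity_ennreal_def)
  thus ?thesis using e0 by (simp add: epowr_pos ennreal_divide_eq_0_iff)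
  qed
  hence "AE y in lebesgue. !n. y : ball x (r + real n) --> w y = 0" unfolding AE_all_countable using az by blast
  hence "AE y in lebesgue. w y = 0"
  proof eventually_elim
  case (elim y)
  obtain n where "dist x y < real n" using reals_Archimedean2 by blast
  thus ?case using elim[rule_format, of n] r by simp
  qed
  thus False using wn by (simp add: nonzero_density_def)
 qed
 define C' where "C'=C*unit_ball_vol DIM('a) powr (1 - \<alpha>/real DIM('a))"
 show ?thesis
 proof (rule that[of C'])
  show "0 <= C'" using C by (simp add: C'_def)
  fix f::"'a => real" and M \<theta> r::real and x::'a
  assume f[measurable]: "f : borel_measurable lebesgue" and M: "morrey_norm \<rho> p (p/q) \<theta> (%x. w x powr p) (%x. w x powr q) f <= en M" "0 < M" and r: "0 < r"
  note be = be[OF r]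
  define Y where "Y=1 + r/\<rho> x"
  have Y: "0 < Y" using r \<rho>[of x] by (simp add: Y_def add_pos_nonneg)
  have "a x r ~= oo"
  proof
  assume "a x r = oo"
  thus False using fin[OF r, of x] b0[OF r, of x] e0 be(1) by (simp add: epowr_pos ennreal_top_divide ennreal_top_mult ennreal_divide_eq_0_iff)
  qed
  then obtain a' where a': "a x r = en a'" "0 < a'" using a0[OF r, of x] by (cases "a x r") (auto simp: less_le)
  have "b x r ~= oo"
  proof
  assume "b x r = oo"
  thus False using fin[OF r, of x] a0[OF r, of x] e0 be(1) by (simp add: epowr_pos ennreal_top_divide ennreal_mult_top ennreal_divide_eq_0_iff)
  qed
  then obtain b' where b': "b x r = en b'" "0 < b'" using b0[OF r, of x] by (cases "b x r") (auto simp: less_le)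
  have AB: "a' powr (1/q)*b' powr (1/p') <= C*Y powr \<theta>0*be r powr (1 - \<alpha>/real DIM('a))"
  proof -
  have "en ((a'/be r) powr (1/q)*(b'/be r) powr (1/p')) <= en (C*Y powr \<theta>0)"
  using C(2)[OF r, of x] a' b' be(1) e0 by (simp add: divide_ennreal epowr_pos ennreal_mult[symmetric] Y_def)
  hence le: "(a'/be r) powr (1/q)*(b'/be r) powr (1/p') <= C*Y powr \<theta>0" using C(1) by (simp add: ennreal_le_iff)
  have ex: "1/q + 1/p' = 1 - \<alpha>/real DIM('a)" using q pp(2) by simp
  have "a' powr (1/q)*b' powr (1/p') = (a'/be r) powr (1/q)*(b'/be r) powr (1/p')*be r powr (1/q + 1/p')"
  using be(1) by (simp add: powr_divide powr_add)
  also have "... <= C*Y powr \<theta>0*be r powr (1/q + 1/p')" by (intro mono_r le) auto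
  finally show ?thesis by (simp only: ex)
  qed
  define F where "F=(NL y:ball x r. en (<|f y|> powr p*w y powr p))"
  \<comment> \<open>\<open>Ph\<close> bounds the norm of \<open>f * w\<close> with exponent
    \<open>p\<close> on the ball and \<open>Ps\<close> is the norm of \<open>1/w\<close> with
    exponent \<open>p'\<close>; scaled by them, Young's inequality returns the product
    \<open>Ph*Ps\<close>.\<close>
  define Ph where "Ph=a' powr (1/q)*(M*Y powr \<theta>)"
  define Ps where "Ps=b' powr (1/p')"
  have pos: "0 < Ph" "0 < Ps" using a' b' M Y by (simp_all add: Ph_def Ps_def)
  have "F <= en (Ph powr p)"
  proof -
  have "en (Y powr (- \<theta>))*epowr (F/epowr (a x r) (p/q)) (1/p) <= en M"
  by (rule order_trans[OF _ M(1)], unfold morrey_norm_def F_def a_def Y_def, rule SUP_upper2[of x], simp, rule SUP_upper2[of r]) (use r in auto)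
  hence 1: "en (Y powr (- \<theta>))*epowr (F/en (a' powr (p/q))) (1/p) <= en M" using a' e0 by (simp add: epowr_pos)
  have "F ~= oo"
  proof
  assume "F = oo"
  thus False using 1 e0 Y a' by (simp add: epowr_pos ennreal_top_divide ennreal_mult_top top_unique)
  qed
  then obtain F' where F': "F = en F'" "0 <= F'" by (cases F) auto
  have "Y powr (- \<theta>)*(F'/a' powr (p/q)) powr (1/p) <= M"
  using 1 F' a' e0 M by (simp add: divide_ennreal epowr_pos ennreal_mult[symmetric] ennreal_le_iff)
  hence "Y powr \<theta>*(Y powr (- \<theta>)*(F'/a' powr (p/q)) powr (1/p)) <= Y powr \<theta>*M" by (intro mono_l) auto
  also have "Y powr \<theta>*(Y powr (- \<theta>)*(F'/a' powr (p/q)) powr (1/p)) = (F'/a' powr (p/q)) powr (1/p)"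
  using Y by (simp add: mult.assoc[symmetric] powr_add[symmetric])
  finally have "((F'/a' powr (p/q)) powr (1/p)) powr p <= (Y powr \<theta>*M) powr p" using p by (intro powr_mono2) auto
  moreover have "((F'/a' powr (p/q)) powr (1/p)) powr p = F'/a' powr (p/q)" using p F' by (simp add: powr_powr)
  ultimately have "F' <= (Y powr \<theta>*M) powr p*a' powr (p/q)" using a' by (simp add: divide_le_eq)
  also have "a' powr (p/q) = (a' powr (1/q)) powr p" by (simp add: powr_powr)
  also have "(Y powr \<theta>*M) powr p*(a' powr (1/q)) powr p = Ph powr p"
  unfolding Ph_def powr_mult by (simp only: mult_ac)
  finally show ?thesis using F' by (simp add: ennreal_leI)
  qed
  have Psp: "Ps powr p' = b'" using b' pp by (simp add: Ps_def powr_powr)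
  let ?c1 = "en (Ph*Ps/(p*Ph powr p))" and ?c2 = "en (Ph*Ps/(p'*Ps powr p'))"
  have "(NL y:ball x r. en <|f y|>) <= (NL y. ?c1*(en (<|f y|> powr p*w y powr p)*ind (ball x r) y) + ?c2*(inverse (en (w y powr p'))*ind (ball x r) y))"
  using weighted_young[OF p(1) p'_def pos w0] by (intro nn_integral_mono) (simp add: ind_def)
  also have "... = ?c1*F + ?c2*b x r" unfolding F_def b_def by (subst nn_integral_add) (auto simp: nn_integral_cmult)
  also have "... <= ?c1*en (Ph powr p) + ?c2*en (Ps powr p')"
  using `F <= en (Ph powr p)` by (intro add_mono mono_l) (auto simp: b' Psp)
  also have "... = en (Ph*Ps/(p*Ph powr p)*Ph powr p + Ph*Ps/(p'*Ps powr p')*Ps powr p')"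
  using pos p pp by (simp add: ennreal_mult[symmetric] ennreal_plus[symmetric] del: ennreal_plus)
  also have "Ph*Ps/(p*Ph powr p)*Ph powr p + Ph*Ps/(p'*Ps powr p')*Ps powr p' = Ph*Ps*(1/p + 1/p')"
  using pos by (simp add: distrib_left)
  also have "... = M*Y powr \<theta>*(a' powr (1/q)*b' powr (1/p'))" unfolding pp(2) by (simp add: Ph_def Ps_def mult_ac)
  also have "en ... <= en (M*Y powr \<theta>*(C*Y powr \<theta>0*be r powr (1 - \<alpha>/real DIM('a))))"
  using M AB by (intro ennreal_leI mono_l) auto
  also have "be r powr (1 - \<alpha>/real DIM('a)) = unit_ball_vol DIM('a) powr (1 - \<alpha>/real DIM('a))*r powr (real DIM('a) - \<alpha>)"
  proof -
  have "(r ^ DIM('a)) powr (1 - \<alpha>/real DIM('a)) = (r powr real DIM('a)) powr (1 - \<alpha>/real DIM('a))" using r by (simp add: powr_realpow)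
  also have "... = r powr (real DIM('a) - \<alpha>)" by (simp add: powr_powr right_diff_distrib)
  finally show ?thesis by (simp add: be_def powr_mult)
  qed
  also have "M*Y powr \<theta>*(C*Y powr \<theta>0*(unit_ball_vol DIM('a) powr (1 - \<alpha>/real DIM('a))*r powr (real DIM('a) - \<alpha>)))
  = C'*M*(r powr (real DIM('a) - \<alpha>)*Y powr (\<theta> + \<theta>0))" unfolding powr_add C'_def by (simp only: mult_ac)
  finally show "(NL y:ball x r. en <|f y|>) <= en (C'*M*(r powr (real DIM('a) - \<alpha>)*(1 + r/\<rho> x) powr (\<theta> + \<theta>0)))" by (simp only: Y_def)
 qed
qed

theorem theorem2p6:
  fixes V w :: "'a::euclidean_space \<Rightarrow> real"
    and T :: "real \<Rightarrow> ('a \<Rightarrow> real) \<Rightarrow> ('a \<Rightarrow> real)"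
    and heat :: "real \<Rightarrow> 'a \<Rightarrow> 'a \<Rightarrow> real"
    and \<rho> :: "'a \<Rightarrow> real"
    and s \<alpha> p q \<kappa> :: real
  assumes dim: "3 \<le> DIM('a)"
    and V: "nonzero_density V"
    and rho: "\<rho> = critical_radius V"
    and s: "real DIM('a) / 2 \<le> s"
    and RH: "reverse_Hoelder s V"
    and semigroup: "schroedinger_semigroup V T"
    and kernel: "semigroup_kernel T heat"
    and alpha: "0 < \<alpha>" "\<alpha> < real DIM('a)"
    and p: "1 < p" "p < real DIM('a) / \<alpha>"
    and q: "1 / q = 1 / p - \<alpha> / real DIM('a)"
    and w: "w \<in> A_weight_inf \<rho> p q"
    and kappa: "\<kappa> = p / q"
  shows "\<forall>\<theta>>0. \<exists>\<theta>'>0. \<exists>C>0.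
           \<forall>f \<in> morrey_space \<rho> p \<kappa> \<theta> (\<lambda>x. w x powr p) (\<lambda>x. w x powr q).
             fractional_integral_exists heat \<alpha> f \<and>
             fractional_integral heat \<alpha> f \<in> BMO \<rho> \<theta>' \<and>
             bmo_norm \<rho> \<theta>' (fractional_integral heat \<alpha> f)
               \<le> ennreal C * morrey_norm \<rho> p \<kappa> \<theta> (\<lambda>x. w x powr p) (\<lambda>x. w x powr q) f"
proof (intro allI impI)
 fix \<theta>::real assume \<theta>: "0 < \<theta>"
 interpret frac V T s heat \<alpha>
  using dim V s RH semigroup kernel alpha by unfold_locales
 have \<rho>: "\<rho> = rho" using rho critical_radius_eq by simp
 have rp: "0 < \<rho> x" for x using rho_pos \<rho> by simp
 obtain \<theta>0 where \<theta>0: "0 < \<theta>0" "w : A_weight \<rho> p q \<theta>0" using w by (auto simp: A_weight_inf_def)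
 obtain C1 where C1: "0 <= C1"
  "!!f M \<theta> x r. f : borel_measurable lebesgue ==> morrey_norm \<rho> p (p/q) \<theta> (%x. w x powr p) (%x. w x powr q) f <= en M ==> 0 < M ==> 0 < r ==>
  (NL y:ball x r. en <|f y|>) <= en (C1*M*(r powr (real DIM('a) - \<alpha>)*(1 + r/\<rho> x) powr (\<theta> + \<theta>0)))"
  using weight_L1_bound[OF rp p alpha(1) q \<theta>0(2)] by blast
 \<comment> \<open>Rounded up, because growth and decay orders are natural numbers
   throughout.\<close>
 define N where "N=nat \<lceil>\<theta> + \<theta>0\<rceil>"
 have N: "\<theta> + \<theta>0 <= real N" by (simp add: N_def real_nat_ceiling_ge)
 obtain C2 where C2: "0 <= C2"
  "!!f A. f : borel_measurable lebesgue ==> growth_le N A (%y. <|bor f y|>) ==> fractional_integral_exists heat \<alpha> f &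
  locally_integrable (fractional_integral heat \<alpha> f) & bmo_norm rho (real (N + 1)) (fractional_integral heat \<alpha> f) <= en (C2*A)"
  using fractional_integral_bmo[of N] by blast
 \<comment> \<open>The added 1 keeps \<open>C\<close> positive, so that it may also divide the error
   below.\<close>
 define C where "C=C1*C2 + 1"
 have C: "0 < C" "C2*C1 <= C" using C1 C2 by (simp_all add: C_def add_nonneg_pos)
 show "EX \<theta>'>0. EX C>0. !f : morrey_space \<rho> p \<kappa> \<theta> (%x. w x powr p) (%x. w x powr q).
  fractional_integral_exists heat \<alpha> f & fractional_integral heat \<alpha> f : BMO \<rho> \<theta>' &
  bmo_norm \<rho> \<theta>' (fractional_integral heat \<alpha> f) <= en C*morrey_norm \<rho> p \<kappa> \<theta> (%x. w x powr p) (%x. w x powr q) f"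
 proof (rule exI[of _ "real (N + 1)"], intro conjI, simp, rule exI[of _ C], intro conjI ballI)
  fix f assume fm: "f : morrey_space \<rho> p \<kappa> \<theta> (%x. w x powr p) (%x. w x powr q)"
  let ?M = "morrey_norm \<rho> p \<kappa> \<theta> (%x. w x powr p) (%x. w x powr q) f"
  have f: "f : borel_measurable lebesgue" "?M < oo" using fm by (auto simp: morrey_space_def)
  then obtain M where M: "?M = en M" "0 <= M" by (cases ?M) auto
  \<comment> \<open>Young's inequality divides by the norm bound, which must be positive; any
    \<open>M' > M\<close> serves, also for \<open>M = 0\<close>, and the excess is removed in the
    limit.\<close>
  have gl: "growth_le N (C1*M') (%y. <|bor f y|>)" if M': "M < M'" for M'
  unfolding growth_le_def
  proof (intro conjI allI impI)
  show "(%y. <|bor f y|>) : BM" using bor(1)[OF f(1)] by measurable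
  show "0 <= C1*M'" using C1 M M' by simp
  fix x r assume r: "0 < (r::real)"
  have "(NN y:ball x r. en <|bor f y|>) = (NL y:ball x r. en <|f y|>)"
  using bor[OF f(1)] by (intro nn_integral_lborel_lebesgue[symmetric]) (measurable, auto elim!: eventually_mono)
  also have "... <= en (C1*M'*(r powr (real DIM('a) - \<alpha>)*(1 + r/\<rho> x) powr (\<theta> + \<theta>0)))"
  using M M' r by (intro C1(2) f) (auto simp: kappa[symmetric] ennreal_leI)
  also have "... <= en (C1*M'*gr N x r)"
  proof (intro ennreal_leI mono_l)
  have y: "1 <= 1 + r/rho x" using r rho_pos[of x] by simp
  hence "(1 + r/rho x) powr (\<theta> + \<theta>0) <= (1 + r/rho x) powr real N" using N by (intro powr_mono) auto
  also have "... = (1 + r/rho x) ^ N" using y by (simp add: powr_realpow)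
  finally show "r powr (real DIM('a) - \<alpha>)*(1 + r/\<rho> x) powr (\<theta> + \<theta>0) <= gr N x r"
  unfolding gr_def \<rho> by (intro mono_l) auto
  qed (use C1 M M' in auto)
  finally show "(NN y:ball x r. en <|bor f y|>) <= en (C1*M'*gr N x r)" .
  qed simp
  have F: "fractional_integral_exists heat \<alpha> f" "locally_integrable (fractional_integral heat \<alpha> f)"
  using C2(2)[OF f(1) gl[of "M + 1"]] by auto
  have "bmo_norm \<rho> (real (N + 1)) (fractional_integral heat \<alpha> f) <= en (C*M)"
  proof (rule ennreal_le_epsilon)
  fix e::real assume e: "0 < e"
  have "bmo_norm \<rho> (real (N + 1)) (fractional_integral heat \<alpha> f) <= en (C2*(C1*(M + e/C)))"
  using C2(2)[OF f(1) gl[of "M + e/C"]] C e unfolding \<rho> by simp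
  also have "C2*(C1*(M + e/C)) <= C*(M + e/C)" using C M e by (simp add: mult.assoc[symmetric] mono_r)
  also have "C*(M + e/C) = C*M + e" using C by (simp add: distrib_left)
  finally show "bmo_norm \<rho> (real (N + 1)) (fractional_integral heat \<alpha> f) <= en (C*M) + en e"
  using C M e by (simp add: ennreal_plus[symmetric] ennreal_leI del: ennreal_plus)
  qed
  thus le: "bmo_norm \<rho> (real (N + 1)) (fractional_integral heat \<alpha> f) <= en C*?M"
  using C M by (simp add: ennreal_mult)
  have "en C*?M < oo" using M by (simp add: ennreal_mult_less_top)
  with le have "bmo_norm \<rho> (real (N + 1)) (fractional_integral heat \<alpha> f) < oo" by (rule le_less_trans)
  thus "fractional_integral heat \<alpha> f : BMO \<rho> (real (N + 1))" using F by (simp add: BMO_def)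
  show "fractional_integral_exists heat \<alpha> f" by (rule F(1))
 qed (use C in auto)
qed

end
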